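(* Assume the Riemann hypothesis, let $b\ge1$ and $\ell>0$. Then, as $T\to\infty$, \[ \mathcal{C}^-_{\blacktriangle}(\ell)+o(1)\le\int_b^{b+\ell}F(\alpha,T)\,\mathrm{d}\alpha\le\mathcal{C}^+_{\blacktriangle}(\ell)+o(1), \] where, writing $\{\ell\}$ for the fractional part and $x_+=\max\{x,0\}$, \[ \mathcal{C}^+_{\blacktriangle}(\ell)=\tfrac43(\ell+1)+\tfrac{\{\ell\}^3}{12}-\tfrac{\{\ell\}}{3}-\tfrac14\big(1-\{\ell\}-\{\ell\}^2\big)_+\quad(\ell\ge1), \] \[ \mathcal{C}^+_{\blacktriangle}(\ell)=\min\Big\{\tfrac43(\ell+1)+\tfrac{\ell^3}{12}-\tfrac{\ell}{3}-\tfrac14(1-\ell-\ell^2)_+\,;\,(1+c)\Big(1+\tfrac{\ell^2(1+c)^2}{12c^2}\Big)\Big\},\ c=\max\Big\{6^{-1/3}\ell^{2/3},\tfrac{\ell}{2-\ell}\Big\}\quad(0<\ell\le1), \] and \[ \mathcal{C}^-_{\blacktriangle}(\ell)=\tfrac23(\ell-1)-\tfrac{2\{\ell\}}{3}+\Big(\tfrac{1+\{\ell\}}{2}\Big)\Big(\{\ell\}-\tfrac{(1+\{\ell\})^2}{12}\Big)_+\quad(\ell\ge2),\qquad \mathcal{C}^-_{\blacktriangle}(\ell)=\Big(\ell-1-\tfrac{\ell^2}{12}\Big)_+\quad(0<\ell\le2). \]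
   Context: $F(\alpha,T)=\frac{2\pi}{T\log T}\sum_{0<\gamma,\gamma'\le T}T^{i\alpha(\gamma-\gamma')}w(\gamma-\gamma')$, $w(u)=4/(4+u^2)$, the sum over ordinates of non-trivial zeros of the Riemann zeta-function counted with multiplicity. "$A+o(1)\le X(T)\le B+o(1)$ as $T\to\infty$" means $\liminf X(T)\ge A$ and $\limsup X(T)\le B$. *)

theory Defs
  imports "HOL-Complex_Analysis.Complex_Analysis"
begin

section \<open>The Riemann zeta function\<close>

text \<open>The analytic continuation of the Dirichlet series to the whole plane without the pole;
  the irrelevant value at the pole is set to 0, so that the function is uniquely determined.\<close>

definition zeta_continuation :: "(complex \<Rightarrow> complex) \<Rightarrow> bool" where
  "zeta_continuation f \<longleftrightarrow>
     f holomorphic_on - {1} \<and> f 1 = 0 \<and>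
     (\<forall>s. Re s > 1 \<longrightarrow> (\<lambda>n. 1 / of_nat (Suc n) powr s) sums f s)"

definition riemann_zeta :: "complex \<Rightarrow> complex" where
  "riemann_zeta = (THE f. zeta_continuation f)"


subsection \<open>Existence and uniqueness of the continuation\<close>

lemma holomorphic_series:
  fixes f :: "nat \<Rightarrow> complex \<Rightarrow> complex" and r :: real
  assumes hol: "\<And>n. f n holomorphic_on UNIV"
    and bound: "\<And>R. \<exists>C\<ge>0. \<forall>n s. norm s \<le> R \<longrightarrow> norm (f n s) \<le> C * real (Suc n) powr (- Re s - r)"
  shows "(\<lambda>s. \<Sum>n. f n s) holomorphic_on {s. Re s > 1 - r}"
    and "\<And>s. Re s > 1 - r \<Longrightarrow> summable (\<lambda>n. f n s)"
proof -
  have summ: "summable (\<lambda>n. C * real (Suc n) powr e)" if "e < -1" for C e :: real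
    using that summable_real_powr_iff[of e] summable_Suc_iff[of "\<lambda>n. real n powr e"]
    by (intro summable_mult) simp
  show "summable (\<lambda>n. f n s)" if s: "Re s > 1 - r" for s
  proof -
    obtain C where C: "\<And>n. norm (f n s) \<le> C * real (Suc n) powr (- Re s - r)"
      using bound[of "norm s"] by auto
    show ?thesis
      by (rule summable_comparison_test'[OF summ[of "- Re s - r" C], of 0]) (use s C in auto)
  qed
  show "(\<lambda>s. \<Sum>n. f n s) holomorphic_on {s. Re s > 1 - r}"
  proof (rule holomorphic_uniform_sequence[where f = "\<lambda>N s. \<Sum>n<N. f n s"])
    show "open {s. Re s > 1 - r}" by (simp add: open_halfspace_Re_gt)
    show "(\<lambda>s. \<Sum>n<N. f n s) holomorphic_on {s. Re s > 1 - r}" for N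
      by (intro holomorphic_intros holomorphic_on_subset[OF hol]) auto
    fix x assume x: "x \<in> {s. Re s > 1 - r}"
    define d where "d = (Re x - (1 - r)) / 2"
    have d: "d > 0" using x by (simp add: d_def)
    obtain C where C: "C \<ge> 0"
      "\<And>n s. norm s \<le> norm x + d \<Longrightarrow> norm (f n s) \<le> C * real (Suc n) powr (- Re s - r)"
      using bound[of "norm x + d"] by auto
    have re: "Re s \<ge> Re x - d" "norm s \<le> norm x + d" if "s \<in> cball x d" for s
    proof -
      have "norm (x - s) \<le> d" using that by (simp add: dist_norm)
      then show "Re s \<ge> Re x - d" using complex_Re_le_cmod[of "x - s"] by simp
      show "norm s \<le> norm x + d"
        using \<open>norm (x - s) \<le> d\<close> norm_triangle_ineq2[of s x] by (simp add: norm_minus_commute)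
    qed
    have "uniform_limit (cball x d) (\<lambda>N s. \<Sum>n<N. f n s) (\<lambda>s. \<Sum>n. f n s) sequentially"
    proof (rule Weierstrass_m_test)
      show "summable (\<lambda>n. C * real (Suc n) powr (- (Re x - d) - r))"
        using d by (intro summ) (simp add: d_def field_simps)
      fix n s assume s: "s \<in> cball x d"
      have "norm (f n s) \<le> C * real (Suc n) powr (- Re s - r)"
        using C(2) re(2)[OF s] by blast
      also have "\<dots> \<le> C * real (Suc n) powr (- (Re x - d) - r)"
        using C(1) re(1)[OF s] by (intro mult_left_mono powr_mono) auto
      finally show "norm (f n s) \<le> C * real (Suc n) powr (- (Re x - d) - r)" .
    qed
    moreover have "cball x d \<subseteq> {s. Re s > 1 - r}"
    proof
      fix s assume "s \<in> cball x d"
      then show "s \<in> {s. Re s > 1 - r}" using re(1)[of s] d by (simp add: d_def field_simps)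
    qed
    ultimately show "\<exists>d>0. cball x d \<subseteq> {s. Re s > 1 - r} \<and>
        uniform_limit (cball x d) (\<lambda>N s. \<Sum>n<N. f n s) (\<lambda>s. \<Sum>n. f n s) sequentially"
      using d by blast
  qed
qed

lemma holomorphic_on_gchoose [holomorphic_intros]:
  fixes f :: "complex \<Rightarrow> complex"
  assumes "f holomorphic_on A"
  shows "(\<lambda>s. f s gchoose k) holomorphic_on A"
  unfolding gbinomial_prod_rev using assms by (intro holomorphic_intros) auto

lemma norm_of_nat_Suc_powr: "norm (of_nat (Suc n) powr s) = real (Suc n) powr Re s"
  by (subst norm_powr_real_powr) auto

definition zeta_series :: "complex \<Rightarrow> complex" where
  "zeta_series s = (\<Sum>n. 1 / of_nat (Suc n) powr s)"

lemma zeta_series_bound: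
  "\<exists>C\<ge>0. \<forall>n s. norm s \<le> R \<longrightarrow>
     norm (1 / of_nat (Suc n) powr s) \<le> C * real (Suc n) powr (- Re s - 0)"
  by (rule exI[of _ 1])
     (auto simp del: of_nat_Suc simp: norm_divide norm_of_nat_Suc_powr powr_minus field_simps)

lemma zeta_series_holomorphic: "zeta_series holomorphic_on {s. Re s > 1}"
  and summable_zeta_series: "Re s > 1 \<Longrightarrow> summable (\<lambda>n. 1 / of_nat (Suc n) powr s :: complex)"
proof -
  have hol: "(\<lambda>s. 1 / of_nat (Suc n) powr s :: complex) holomorphic_on UNIV" for n
    by (intro holomorphic_intros) (auto simp del: of_nat_Suc)
  note * = holomorphic_series[of "\<lambda>n s. 1 / of_nat (Suc n) powr s" 0, OF hol zeta_series_bound]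
  show "zeta_series holomorphic_on {s. Re s > 1}"
    using *(1) by (simp add: zeta_series_def[abs_def])
  show "Re s > 1 \<Longrightarrow> summable (\<lambda>n. 1 / of_nat (Suc n) powr s :: complex)"
    using *(2) by simp
qed

definition zeta_rem :: "nat \<Rightarrow> nat \<Rightarrow> complex \<Rightarrow> complex" where
  "zeta_rem K n s = of_nat (Suc (Suc n)) powr (1 - s) -
     (\<Sum>k\<le>Suc K. (1 - s gchoose k) * of_nat (Suc n) powr (1 - s - of_nat k))"

lemma zeta_rem_bound_single:
  "norm (zeta_rem K n s) \<le>
     norm (fact (K + 2) * (1 - s gchoose (K + 2))) * 2 powr (norm s + real K + 1) *
     real (Suc n) powr (- Re s - real (Suc K))"
proof -
  define a where "a = 1 - s"
  define m where "m = real (Suc n)"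
  have m: "m \<ge> 1" by (simp add: m_def)
  define S where "S = closed_segment (complex_of_real m) (complex_of_real (m + 1))"
  have S: "\<exists>y. x = of_real y \<and> m \<le> y \<and> y \<le> m + 1" if "x \<in> S" for x
    using that unfolding S_def closed_segment_of_real closed_segment_eq_real_ivl by (auto split: if_splits)
  define f where "f i x = fact i * (a gchoose i) * x powr (a - of_nat i)" for i and x :: complex
  define e where "e = - Re s - real (Suc K)"
  define B where "B = norm (fact (K + 2) * (a gchoose (K + 2))) * (2 powr (norm s + real K + 1) * m powr e)"
  have "norm (f 0 (of_real (m + 1)) - (\<Sum>i\<le>Suc K. f i (of_real m) * (of_real (m + 1) - of_real m) ^ i / fact i))
        \<le> B * norm (complex_of_real (m + 1) - of_real m) ^ Suc (Suc K) / fact (Suc K)"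
  proof (rule complex_Taylor)
    show "convex S" by (simp add: S_def)
    show "complex_of_real m \<in> S" "complex_of_real (m + 1) \<in> S" by (simp_all add: S_def)
  next
    fix i x assume "x \<in> S" "i \<le> Suc K"
    then obtain y where y: "x = of_real y" "m \<le> y" using S by blast
    have x: "x \<notin> \<real>\<^sub>\<le>\<^sub>0" using y m by auto
    have g: "of_nat (Suc i) * (a gchoose Suc i) = (a - of_nat i) * (a gchoose i)"
      using gbinomial_mult_1[of a i] by (simp add: algebra_simps)
    have "f (Suc i) x = fact i * (of_nat (Suc i) * (a gchoose Suc i)) * x powr (a - of_nat (Suc i))"
      by (simp add: f_def algebra_simps)
    also have "\<dots> = fact i * (a gchoose i) * ((a - of_nat i) * x powr (a - of_nat i - 1))"
      by (subst g) (simp add: algebra_simps)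
    finally have "f (Suc i) x = fact i * (a gchoose i) * ((a - of_nat i) * x powr (a - of_nat i - 1))" .
    moreover have "(f i has_field_derivative fact i * (a gchoose i) * ((a - of_nat i) * x powr (a - of_nat i - 1)))
        (at x within S)"
      unfolding f_def
      by (intro DERIV_cmult has_field_derivative_at_within[OF has_field_derivative_powr[OF x]])
    ultimately show "(f i has_field_derivative f (Suc i) x) (at x within S)" by simp
  next
    fix x assume "x \<in> S"
    then obtain y where y: "x = of_real y" "m \<le> y" "y \<le> m + 1" using S by blast
    have "norm (x powr (a - of_nat (K + 2))) = y powr e"
    proof -
      have "Re (a - of_nat (K + 2)) = e" by (simp add: a_def e_def)
      then show ?thesis using y m by (subst norm_powr_real_powr) auto
    qed
    also have "\<dots> = (y / m) powr e * m powr e"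
      using m y by (simp add: powr_divide)
    also have "\<dots> \<le> 2 powr (norm s + real K + 1) * m powr e"
    proof (rule mult_right_mono)
      have "(y / m) powr e \<le> (y / m) powr (norm s + real K + 1)"
        using m y abs_Re_le_cmod[of s] by (intro powr_mono) (auto simp: e_def)
      also have "\<dots> \<le> 2 powr (norm s + real K + 1)"
        using m y by (intro powr_mono2) (auto simp: field_simps)
      finally show "(y / m) powr e \<le> 2 powr (norm s + real K + 1)" .
    qed simp
    finally have "norm (x powr (a - of_nat (K + 2))) \<le> 2 powr (norm s + real K + 1) * m powr e" .
    then show "norm (f (Suc (Suc K)) x) \<le> B"
      unfolding f_def B_def by (simp add: norm_mult mult_left_mono)
  qed
  also have "B * norm (complex_of_real (m + 1) - of_real m) ^ Suc (Suc K) / fact (Suc K) = B / fact (Suc K)"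
    by simp
  also have "\<dots> \<le> B / 1"
    by (intro divide_left_mono) (auto simp: B_def fact_ge_1 simp del: fact_Suc)
  also have "f 0 (of_real (m + 1)) - (\<Sum>i\<le>Suc K. f i (of_real m) * (of_real (m + 1) - of_real m) ^ i / fact i)
             = zeta_rem K n s"
    by (simp add: zeta_rem_def f_def a_def m_def del: sum.atMost_Suc)
  finally show ?thesis
    by (simp add: B_def a_def m_def e_def mult.assoc)
qed

lemma zeta_rem_bound:
  "\<exists>C\<ge>0. \<forall>n s. norm s \<le> R \<longrightarrow> norm (zeta_rem K n s) \<le> C * real (Suc n) powr (- Re s - real (Suc K))"
proof -
  define h :: "complex \<Rightarrow> real" where
    "h s = norm (fact (K + 2) * (1 - s gchoose (K + 2))) * 2 powr (norm s + real K + 1)" for s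
  have hol: "(\<lambda>s. fact (K + 2) * (1 - s gchoose (K + 2)) :: complex) holomorphic_on cball 0 R"
    by (intro holomorphic_intros)
  have "continuous_on (cball 0 R) h"
    unfolding h_def
    by (intro continuous_intros continuous_on_powr continuous_on_norm
          holomorphic_on_imp_continuous_on[OF hol]) auto
  then have "compact (h ` cball 0 R)" by (intro compact_continuous_image) auto
  then have "bounded (h ` cball 0 R)" by (rule compact_imp_bounded)
  then obtain C where C: "C > 0" "\<And>s. norm s \<le> R \<Longrightarrow> h s \<le> C"
    by (force simp: bounded_pos dest: spec)
  show ?thesis
  proof (intro exI[of _ C] conjI allI impI)
    show "0 \<le> C" using C by simp
    fix n and s :: complex assume s: "norm s \<le> R"
    have "norm (zeta_rem K n s) \<le> h s * real (Suc n) powr (- Re s - real (Suc K))"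
      using zeta_rem_bound_single[of K n s] by (simp add: h_def)
    also have "\<dots> \<le> C * real (Suc n) powr (- Re s - real (Suc K))"
      using C(2)[OF s] by (intro mult_right_mono) auto
    finally show "norm (zeta_rem K n s) \<le> C * real (Suc n) powr (- Re s - real (Suc K))" .
  qed
qed

lemma zeta_rem_sum_holomorphic:
  "(\<lambda>s. \<Sum>n. zeta_rem K n s) holomorphic_on {s. Re s > - real K}"
  and summable_zeta_rem: "Re s > - real K \<Longrightarrow> summable (\<lambda>n. zeta_rem K n s)"
proof -
  have hol: "zeta_rem K n holomorphic_on UNIV" for n
    unfolding zeta_rem_def[abs_def]
    by (intro holomorphic_intros) (auto simp del: of_nat_Suc)
  note * = holomorphic_series[of "zeta_rem K" "real (Suc K)", OF hol zeta_rem_bound]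
  show "(\<lambda>s. \<Sum>n. zeta_rem K n s) holomorphic_on {s. Re s > - real K}"
    using *(1) by simp
  show "Re s > - real K \<Longrightarrow> summable (\<lambda>n. zeta_rem K n s)"
    using *(2) by simp
qed

text \<open>Expanding the terms of the telescoping sum of $n^{1-s} - (n+1)^{1-s}$ binomially expresses
  $(s-1)\zeta(s)$ through the values $\zeta(s+1), \dots, \zeta(s+K)$ and a remainder that is
  holomorphic for $\Re s > -K$.\<close>

lemma zeta_series_recurrence:
  assumes s: "Re s > 1"
  shows "(s - 1) * zeta_series s =
    1 - (\<Sum>k\<in>{2..Suc K}. (1 - s gchoose (k - 1)) / of_nat k *
          ((s + of_nat k - 2) * zeta_series (s + of_nat k - 1))) + (\<Sum>n. zeta_rem K n s)"
proof -
  define u :: "nat \<Rightarrow> complex" where "u n = of_nat (Suc n) powr (1 - s)" for n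
  have norm_u: "norm (u n) = real (Suc n) powr (1 - Re s)" for n
    unfolding u_def by (subst norm_of_nat_Suc_powr) simp
  have "(\<lambda>n. real (Suc n) powr (1 - Re s)) \<longlonglongrightarrow> 0"
    using s by (intro tendsto_neg_powr filterlim_compose[OF filterlim_real_sequentially filterlim_Suc]) auto
  then have "u \<longlonglongrightarrow> 0"
    by (subst tendsto_norm_zero_iff[symmetric]) (simp only: norm_u)
  then have tele: "(\<lambda>n. u (Suc n) - u n) sums (0 - u 0)"
    by (rule telescope_sums)
  have ser: "(\<lambda>n. of_nat (Suc n) powr (1 - s - of_nat k)) sums zeta_series (s + of_nat k - 1)"
    if "k \<ge> 1" for k
  proof -
    have "Re (s + of_nat k - 1) > 1" using s that by simp
    from summable_sums[OF summable_zeta_series[OF this]]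
    have "(\<lambda>n. 1 / of_nat (Suc n) powr (s + of_nat k - 1)) sums zeta_series (s + of_nat k - 1)"
      by (simp add: zeta_series_def)
    also have "(\<lambda>n. 1 / of_nat (Suc n) powr (s + of_nat k - 1) :: complex)
               = (\<lambda>n. of_nat (Suc n) powr (1 - s - of_nat k))"
      by (rule ext, subst powr_minus_divide[symmetric]) (simp add: algebra_simps)
    finally show ?thesis .
  qed
  have "(\<lambda>n. zeta_rem K n s + (\<Sum>k=1..Suc K. (1 - s gchoose k) * of_nat (Suc n) powr (1 - s - of_nat k)))
        sums ((\<Sum>n. zeta_rem K n s) + (\<Sum>k=1..Suc K. (1 - s gchoose k) * zeta_series (s + of_nat k - 1)))"
    using s by (intro sums_add sums_sum sums_mult ser summable_sums summable_zeta_rem) auto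
  also have "(\<lambda>n. zeta_rem K n s + (\<Sum>k=1..Suc K. (1 - s gchoose k) * of_nat (Suc n) powr (1 - s - of_nat k)))
             = (\<lambda>n. u (Suc n) - u n)"
  proof
    fix n
    have "{..Suc K} = insert 0 {1..Suc K}" by auto
    then have "(\<Sum>k\<le>Suc K. (1 - s gchoose k) * of_nat (Suc n) powr (1 - s - of_nat k)) =
      u n + (\<Sum>k=1..Suc K. (1 - s gchoose k) * of_nat (Suc n) powr (1 - s - of_nat k))"
      by (simp add: u_def del: of_nat_Suc)
    then show "zeta_rem K n s + (\<Sum>k=1..Suc K. (1 - s gchoose k) * of_nat (Suc n) powr (1 - s - of_nat k))
               = u (Suc n) - u n"
      unfolding zeta_rem_def by (simp add: u_def del: of_nat_Suc)
  qed
  finally have "(\<Sum>n. zeta_rem K n s) + (\<Sum>k=1..Suc K. (1 - s gchoose k) * zeta_series (s + of_nat k - 1)) = 0 - u 0"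
    using tele sums_unique2 by blast
  moreover have "u 0 = 1" by (simp add: u_def)
  moreover have "(\<Sum>k=1..Suc K. (1 - s gchoose k) * zeta_series (s + of_nat k - 1)) =
    (1 - s) * zeta_series s + (\<Sum>k=2..Suc K. (1 - s gchoose k) * zeta_series (s + of_nat k - 1))"
  proof -
    have "{1..Suc K} = insert 1 {2..Suc K}" by auto
    then show ?thesis by simp
  qed
  moreover have "(\<Sum>k=2..Suc K. (1 - s gchoose k) * zeta_series (s + of_nat k - 1)) =
    - (\<Sum>k\<in>{2..Suc K}. (1 - s gchoose (k - 1)) / of_nat k *
          ((s + of_nat k - 2) * zeta_series (s + of_nat k - 1)))"
    unfolding sum_negf[symmetric]
  proof (rule sum.cong[OF refl])
    fix k assume "k \<in> {2..Suc K}"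
    then obtain j where k: "k = Suc j" by (cases k) auto
    have "of_nat (Suc j) * (1 - s gchoose Suc j) = - (s + of_nat j - 1) * (1 - s gchoose j)"
      using gbinomial_mult_1[of "1 - s" j] by (simp add: algebra_simps)
    then have "(1 - s gchoose Suc j) = - (s + of_nat j - 1) * (1 - s gchoose j) / of_nat (Suc j)"
      by (metis nonzero_mult_div_cancel_left of_nat_neq_0)
    moreover have "s + of_nat (Suc j) - 2 = s + of_nat j - 1" by simp
    moreover have "(- A * Y / Z) * W = - (Y / Z * (A * W))" for A W Y Z :: complex
      by (simp add: mult_ac)
    ultimately show "(1 - s gchoose k) * zeta_series (s + of_nat k - 1) =
      - ((1 - s gchoose (k - 1)) / of_nat k * ((s + of_nat k - 2) * zeta_series (s + of_nat k - 1)))"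
      unfolding k by (simp only: diff_Suc_1)
  qed
  moreover have "(s - 1) * Z = 1 - X + R"
    if "R + A = 0 - u0" "u0 = 1" "A = (1 - s) * Z + B" "B = - X" for R A B X Z u0
    using that by (simp add: algebra_simps)
  ultimately show ?thesis by blast
qed

lemma zeta_extension:
  "\<exists>g. g holomorphic_on {s. Re s > 1 - real K} \<and> (\<forall>s. Re s > 1 \<longrightarrow> g s = (s - 1) * zeta_series s)"
proof (induction K)
  case 0
  show ?case
    by (rule exI[of _ "\<lambda>s. (s - 1) * zeta_series s"])
       (auto intro!: holomorphic_intros zeta_series_holomorphic)
next
  case (Suc K)
  then obtain g where g: "g holomorphic_on {s. Re s > 1 - real K}"
    "\<And>s. Re s > 1 \<Longrightarrow> g s = (s - 1) * zeta_series s" by blast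
  define G where "G s = 1 - (\<Sum>k\<in>{2..Suc K}. (1 - s gchoose (k - 1)) / of_nat k *
          g (s + of_nat k - 1)) + (\<Sum>n. zeta_rem K n s)" for s
  have shift: "(\<lambda>s. g (s + of_nat k - 1)) holomorphic_on {s. Re s > - real K}" if "k \<in> {2..Suc K}" for k
  proof -
    have "(g \<circ> (\<lambda>s. s + of_nat k - 1)) holomorphic_on {s. Re s > - real K}"
      by (rule holomorphic_on_compose_gen[OF _ g(1)]) (use that in \<open>auto intro!: holomorphic_intros\<close>)
    then show ?thesis by (simp add: o_def)
  qed
  have "G holomorphic_on {s. Re s > - real K}"
    unfolding G_def by (intro holomorphic_intros shift zeta_rem_sum_holomorphic) auto
  moreover have "G s = (s - 1) * zeta_series s" if s: "Re s > 1" for s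
  proof -
    have "(\<Sum>k\<in>{2..Suc K}. (1 - s gchoose (k - 1)) / of_nat k * g (s + of_nat k - 1)) =
      (\<Sum>k\<in>{2..Suc K}. (1 - s gchoose (k - 1)) / of_nat k *
          ((s + of_nat k - 2) * zeta_series (s + of_nat k - 1)))"
      by (intro sum.cong refl) (use s in \<open>auto simp: g(2) algebra_simps\<close>)
    then show ?thesis unfolding G_def by (subst zeta_series_recurrence[OF s, of K]) simp
  qed
  ultimately show ?case by (intro exI[of _ G]) auto
qed

lemma zeta_entire:
  "\<exists>h. h holomorphic_on UNIV \<and> (\<forall>s. Re s > 1 \<longrightarrow> h s = (s - 1) * zeta_series s)"
proof -
  obtain g where g: "\<And>K. g K holomorphic_on {s. Re s > 1 - real K}"
    "\<And>K s. Re s > 1 \<Longrightarrow> g K s = (s - 1) * zeta_series s"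
    using zeta_extension by metis
  have agree: "g K s = g L s" if "Re s > 1 - real K" "K \<le> L" for K L s
  proof (rule analytic_continuation_open[of "{s. Re s > 1}" "{s. Re s > 1 - real K}" "g K" "g L" s])
    show "g L holomorphic_on {s. Re s > 1 - real K}"
      by (rule holomorphic_on_subset[OF g(1)]) (use that in auto)
    show "{s. Re s > 1} \<noteq> {}" by (auto intro: exI[of _ 2])
    show "connected {s. Re s > 1 - real K}"
      by (intro convex_connected convex_halfspace_Re_gt)
  qed (use that in \<open>auto simp: g open_halfspace_Re_gt\<close>)
  define h where "h s = g (nat \<lceil>2 - Re s\<rceil>) s" for s
  have h_eq: "h s = g K s" if "Re s > 1 - real K" for s K
  proof -
    have "Re s > 1 - real (nat \<lceil>2 - Re s\<rceil>)" by linarith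
    then show ?thesis
      unfolding h_def using agree[of _ s] that by (metis nat_le_linear)
  qed
  have "h holomorphic_on UNIV"
  proof -
    have "h holomorphic_on (\<Union>K. {s. Re s > 1 - real K})"
    proof (rule holomorphic_on_UN_open)
      show "h holomorphic_on {s. Re s > 1 - real K}" for K
        by (rule holomorphic_transform[OF g(1)]) (simp add: h_eq)
    qed (simp add: open_halfspace_Re_gt)
    moreover have "(\<Union>K. {s. Re s > 1 - real K}) = (UNIV :: complex set)"
    proof -
      have "\<exists>K. Re s > 1 - real K" for s
        using reals_Archimedean2[of "1 - Re s"] by (auto simp: algebra_simps)
      then show ?thesis by auto
    qed
    ultimately show ?thesis by simp
  qed
  moreover have "h s = (s - 1) * zeta_series s" if "Re s > 1" for s
    using h_eq[of 0 s] that by (simp add: g(2))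
  ultimately show ?thesis by blast
qed

lemma zeta_continuation_if_entire:
  assumes "h holomorphic_on UNIV" and h: "\<And>s. Re s > 1 \<Longrightarrow> h s = (s - 1) * zeta_series s"
  shows "zeta_continuation (\<lambda>s. h s / (s - 1))"
proof -
  have "(\<lambda>s. h s / (s - 1)) holomorphic_on - {1}"
    using assms(1) by (intro holomorphic_intros) (auto intro: holomorphic_on_subset)
  moreover have "(\<lambda>n. 1 / of_nat (Suc n) powr s) sums (h s / (s - 1))" if "Re s > 1" for s
  proof -
    have "s \<noteq> 1" using that by auto
    then have "h s / (s - 1) = zeta_series s"
      using that by (simp add: h)
    then show ?thesis
      using summable_sums[OF summable_zeta_series[OF that]] by (simp add: zeta_series_def)
  qed
  ultimately show ?thesis
    unfolding zeta_continuation_def by auto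
qed

lemma connected_minus_one: "connected (- {1 :: complex})"
  by (rule connected_punctured_universe) simp

lemma zeta_continuation_unique:
  assumes "zeta_continuation f" "zeta_continuation g"
  shows "f = g"
proof
  fix s
  show "f s = g s"
  proof (cases "s = 1")
    case False
    show ?thesis
    proof (rule analytic_continuation_open[of "{s. Re s > 1}" "- {1}" f g s])
      show "{s. Re s > 1} \<noteq> {}" by (auto intro: exI[of _ 2])
      show "f z = g z" if "z \<in> {s. Re s > 1}" for z
        using assms that sums_unique2 unfolding zeta_continuation_def by blast
    qed (use assms False connected_minus_one in
          \<open>auto simp: zeta_continuation_def open_halfspace_Re_gt\<close>)
  qed (use assms in \<open>auto simp: zeta_continuation_def\<close>)
qed

lemma zeta_continuation_riemann_zeta: "zeta_continuation riemann_zeta"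
  unfolding riemann_zeta_def
  using zeta_entire zeta_continuation_if_entire zeta_continuation_unique by (metis theI)


section \<open>Non-trivial zeros and the Riemann hypothesis\<close>

definition nontrivial_zeros :: "complex set" where
  "nontrivial_zeros = {\<rho>. riemann_zeta \<rho> = 0 \<and> 0 < Re \<rho> \<and> Re \<rho> < 1}"

definition riemann_hypothesis :: bool where
  "riemann_hypothesis \<longleftrightarrow> (\<forall>\<rho>\<in>nontrivial_zeros. Re \<rho> = 1 / 2)"

definition zeros_upto :: "real \<Rightarrow> complex set" where
  "zeros_upto T = {\<rho>\<in>nontrivial_zeros. 0 < Im \<rho> \<and> Im \<rho> \<le> T}"

definition zero_mult :: "complex \<Rightarrow> nat" where
  "zero_mult \<rho> = nat (zorder riemann_zeta \<rho>)"

lemma riemann_zeta_not_constant: "\<not> riemann_zeta constant_on - {1}"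
proof
  assume "riemann_zeta constant_on - {1}"
  then obtain c where c: "\<And>s. s \<noteq> 1 \<Longrightarrow> riemann_zeta s = c"
    by (auto simp: constant_on_def)
  have ser: "(\<lambda>n. 1 / of_nat (Suc n) powr of_nat k) sums c" if "k \<ge> 2" for k
  proof -
    have "Re (of_nat k) > 1" using that by simp
    moreover have "(of_nat k :: complex) \<noteq> 1" using that by auto
    ultimately show ?thesis
      using zeta_continuation_riemann_zeta c[of "of_nat k"] unfolding zeta_continuation_def by metis
  qed
  have "(\<lambda>n. Re (1 / of_nat (Suc n) powr of_nat 2 - 1 / of_nat (Suc n) powr of_nat 3)) sums Re (c - c)"
    by (intro sums_Re sums_diff ser) auto
  moreover have "Re (1 / of_nat (Suc n) powr of_nat 2 - 1 / of_nat (Suc n) powr of_nat 3)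
     = 1 / real (Suc n) ^ 2 - 1 / real (Suc n) ^ 3" for n
  proof -
    have "of_nat (Suc n) powr of_nat k = complex_of_real (real (Suc n) ^ k)" for k
      by (subst powr_nat') (auto simp del: of_nat_Suc)
    then show ?thesis by (simp del: of_nat_Suc flip: of_real_divide of_real_power)
  qed
  ultimately have sums0: "(\<lambda>n. 1 / real (Suc n) ^ 2 - 1 / real (Suc n) ^ 3) sums 0" by simp
  have nonneg: "1 / real (Suc n) ^ 2 - 1 / real (Suc n) ^ 3 \<ge> 0" for n
    by (simp add: divide_left_mono power_increasing del: of_nat_Suc)
  have "1 / real (Suc 1) ^ 2 - 1 / real (Suc 1) ^ 3 = 0"
    using suminf_eq_zero_iff[OF sums_summable[OF sums0] nonneg] sums_unique[OF sums0] by metis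
  then show False by simp
qed

lemma finite_zeros_upto: "finite (zeros_upto T)"
proof -
  obtain h where h: "h holomorphic_on UNIV" "\<And>s. Re s > 1 \<Longrightarrow> h s = (s - 1) * zeta_series s"
    using zeta_entire by blast
  have zeta_eq: "riemann_zeta s = h s / (s - 1)" for s
    using zeta_continuation_unique[OF zeta_continuation_riemann_zeta zeta_continuation_if_entire[OF h]]
    by metis
  define K where "K = cbox (Complex 0 0) (Complex 1 T)"
  have sub: "zeros_upto T \<subseteq> {z\<in>K. h z = 0}"
    by (auto simp: zeros_upto_def nontrivial_zeros_def zeta_eq K_def in_cbox_complex_iff)
  show ?thesis
  proof (cases "h constant_on UNIV")
    case False
    have "finite {z\<in>K. h z = 0}"
      by (rule holomorphic_compact_finite_zeros[OF h(1)]) (use False in \<open>auto simp: K_def\<close>)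
    then show ?thesis using sub finite_subset by blast
  next
    case True
    then obtain c where c: "\<And>s. h s = c" by (auto simp: constant_on_def)
    show ?thesis
    proof (cases "c = 0")
      case True
      then have "riemann_zeta constant_on - {1}" by (auto simp: zeta_eq c constant_on_def)
      then show ?thesis using riemann_zeta_not_constant by blast
    next
      case False
      then have "zeros_upto T = {}" using sub c by auto
      then show ?thesis by simp
    qed
  qed
qed


section \<open>The form factor\<close>

definition pair_weight :: "real \<Rightarrow> real" where
  "pair_weight u = 4 / (4 + u\<^sup>2)"

definition form_factor_complex :: "real \<Rightarrow> real \<Rightarrow> complex" where
  "form_factor_complex \<alpha> T =
     of_real (2 * pi / (T * ln T)) *
     (\<Sum>\<rho>\<in>zeros_upto T. \<Sum>\<rho>'\<in>zeros_upto T.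
        of_nat (zero_mult \<rho> * zero_mult \<rho>') *
        of_real T powr (\<i> * of_real (\<alpha> * (Im \<rho> - Im \<rho>'))) *
        of_real (pair_weight (Im \<rho> - Im \<rho>')))"

text \<open>The double sum is real by symmetry, see the lemma below.\<close>

definition form_factor :: "real \<Rightarrow> real \<Rightarrow> real" where
  "form_factor \<alpha> T = Re (form_factor_complex \<alpha> T)"

lemma of_real_form_factor:
  assumes "T > 0"
  shows "of_real (form_factor \<alpha> T) = form_factor_complex \<alpha> T"
proof -
  have cnj_powr: "cnj (of_real T powr (\<i> * of_real x)) = of_real T powr (\<i> * of_real (- x))" for x
    using assms by (simp add: powr_def exp_cnj Ln_of_real)
  have w: "pair_weight (x - y) = pair_weight (y - x)" for x y
    by (simp add: pair_weight_def power2_commute[of x y])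
  have "cnj (form_factor_complex \<alpha> T) = form_factor_complex \<alpha> T"
    unfolding form_factor_complex_def complex_cnj_mult complex_cnj_complex_of_real cnj_sum
    by (subst sum.swap)
       (intro arg_cong2[of _ _ _ _ "(*)"] refl sum.cong,
        simp_all only: cnj_powr complex_cnj_of_nat mult.commute minus_mult_right minus_diff_eq,
        simp_all add: w)
  then show ?thesis
    by (simp add: form_factor_def complex_eq_iff)
qed


section \<open>The bounds\<close>

definition pos_part :: "real \<Rightarrow> real" where
  "pos_part x = max x 0"

definition C_plus :: "real \<Rightarrow> real" where
  "C_plus l =
     (if l \<ge> 1 then
        4 / 3 * (l + 1) + frac l ^ 3 / 12 - frac l / 3 - 1 / 4 * pos_part (1 - frac l - (frac l)\<^sup>2)
      else
        (let c = max (6 powr (- 1 / 3) * l powr (2 / 3)) (l / (2 - l)) in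
         min (4 / 3 * (l + 1) + l ^ 3 / 12 - l / 3 - 1 / 4 * pos_part (1 - l - l\<^sup>2))
             ((1 + c) * (1 + l\<^sup>2 * (1 + c)\<^sup>2 / (12 * c\<^sup>2)))))"

definition C_minus :: "real \<Rightarrow> real" where
  "C_minus l =
     (if l \<ge> 2 then
        2 / 3 * (l - 1) - 2 * frac l / 3 +
        (1 + frac l) / 2 * pos_part (frac l - (1 + frac l)\<^sup>2 / 12)
      else pos_part (l - 1 - l\<^sup>2 / 12))"

text \<open>The two formulas agree where their ranges of validity overlap.\<close>

lemma C_plus_le_1:
  assumes "0 < l" "l \<le> 1" "c = max (6 powr (- 1 / 3) * l powr (2 / 3)) (l / (2 - l))"
  shows "C_plus l = min (4 / 3 * (l + 1) + l ^ 3 / 12 - l / 3 - 1 / 4 * pos_part (1 - l - l\<^sup>2))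
                        ((1 + c) * (1 + l\<^sup>2 * (1 + c)\<^sup>2 / (12 * c\<^sup>2)))"
proof (cases "l = 1")
  case True
  have "6 powr (- 1 / 3) \<le> (1 :: real)"
    using powr_mono[of "- 1 / 3" 0 "6 :: real"] by simp
  then have "c = 1" using True assms(3) by simp
  then show ?thesis using True by (simp add: C_plus_def pos_part_def)
qed (use assms in \<open>auto simp: C_plus_def Let_def\<close>)

lemma C_minus_le_2:
  assumes "0 < l" "l \<le> 2"
  shows "C_minus l = pos_part (l - 1 - l\<^sup>2 / 12)"
proof (cases "l = 2")
  case True
  have fr: "frac (2 :: real) = 0" by (simp add: frac_def)
  show ?thesis unfolding C_minus_def pos_part_def True fr by simp
qed (use assms in \<open>auto simp: C_minus_def\<close>)

end

theory Submission
  imports Defs "HOL-Number_Theory.Prime_Powers" "HOL-Real_Asymp.Real_Asymp"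
begin

text \<open>
  Write $S(y) = \sum_{0<\gamma\le T} e^{iy\gamma}$ and average $F(\cdot, T)$ against the triangle
  $(h-|\alpha-\beta|)_+$, whose Fourier transform, a Fejer kernel, is nonnegative. Since
  $0 \le w \le 1 = w(0)$, every off-diagonal term of the resulting double sum is at most its value for
  $\beta = 0$ and $w = 1$ in modulus, so
  \[ \frac{2\pi}{T\log T}\Bigl(2h^2 N(T) - M\Bigr) \le \int (h-|\alpha-\beta|)_+ F(\alpha,T)\,d\alpha \le \frac{2\pi}{T\log T} M,
     \qquad M = \int_{-h}^{h} (h-|\alpha|)\,|S(\alpha\log T)|^2\,d\alpha, \]
  where $N(T) \ge (1+o(1))\frac{T\log T}{2\pi}$. For $h<1$ the mean square $M$ is bounded by means of a
  Landau--Gonek type formula: integrating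
  $\zeta'/\zeta(s)\,e^{y(s-1/2)}$ around a rectangle, the right edge contributes only the prime power
  nearest to $e^y$ and the left edge, by the functional equation, only the logarithmic derivative of
  $\chi$. Bessel's inequality turns both into a mean value, and Mertens' theorem gives
  $M \le (1+o(1))\frac{T\log T}{2\pi}(h + h^3/3)$. Hence all triangular averages of $F$ with $h \le 1$ lie
  asymptotically between $h(2h-1-h^2/3)$ and $h+h^3/3$, and the theorem follows by bounding the indicator
  function of an interval above and below by sums of triangles.
\<close>


section \<open>Triangular averages\<close>

text \<open>An upper bound for M serves both sides of the theorem, because the diagonal is bounded
  from below by the zero count. The two terms of h + h^3/3 have separate origins. The term h is the
  peak of S near y = 0, where chi'/chi is close to -log T and the Fourier integral of a constant
  over [0, T] concentrates. The term h^3/3 comes from the prime powers, whose weights accumulate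
  like the integral of y (1 - y/Y). The obstacle is h = 1. On a vertical line Re s = c > 1 the
  formula for S(y) has an error of size e^(y(c - 1/2)) up to logarithms; its mean square up to y = h
  log T is about T^(h(2c - 1)), which is below T only if c is chosen close to 1 depending on h < 1.
  The value h = 1, which the unit triangles require, is recovered by comparing a unit triangle with
  slightly smaller ones, uniformly in their position. The Riemann hypothesis enters by turning the
  residues e^(y(rho - 1/2)) into the phases e^(iy gamma). The positive parts in the final constants
  record which of two competing configurations of triangles is better.\<close>

definition tri :: "real \<Rightarrow> real \<Rightarrow> real" where
  "tri h u = max 0 (h - \<bar>u\<bar>)"

definition tri_avg :: "real \<Rightarrow> real \<Rightarrow> (real \<Rightarrow> real) \<Rightarrow> real" where
  "tri_avg h \<beta> G = integral {\<beta> - h..\<beta> + h} (\<lambda>\<alpha>. tri h (\<alpha> - \<beta>) * G \<alpha>)"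

lemma continuous_on_tri [continuous_intros]:
  "continuous_on A f \<Longrightarrow> continuous_on A (\<lambda>x. tri h (f x))"
  unfolding tri_def by (intro continuous_intros)

lemma has_integral_tri:
  assumes "continuous_on UNIV G"
  shows "((\<lambda>\<alpha>. tri h (\<alpha> - \<beta>) * G \<alpha>) has_integral tri_avg h \<beta> G) UNIV"
proof (rule has_integral_on_superset)
  show "((\<lambda>\<alpha>. tri h (\<alpha> - \<beta>) * G \<alpha>) has_integral tri_avg h \<beta> G) {\<beta> - h..\<beta> + h}"
    unfolding tri_avg_def
    by (intro integrable_integral integrable_continuous_interval continuous_intros
          continuous_on_subset[OF assms]) auto
qed (auto simp: tri_def)

lemma has_integral_tri_sum:
  fixes n :: nat
  assumes "continuous_on UNIV G"
  shows "((\<lambda>\<alpha>. (\<Sum>j<n. tri 1 (\<alpha> - \<beta> j)) * G \<alpha>) has_integral (\<Sum>j<n. tri_avg 1 (\<beta> j) G)) UNIV"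
  unfolding sum_distrib_right by (intro has_integral_sum has_integral_tri assms finite_lessThan)

lemma has_integral_indicator_interval:
  fixes G :: "real \<Rightarrow> real"
  assumes "continuous_on UNIV G"
  shows "((\<lambda>\<alpha>. indicator {a..b} \<alpha> * G \<alpha>) has_integral integral {a..b} G) UNIV"
proof -
  have "(G has_integral integral {a..b} G) {a..b}"
    by (intro integrable_integral integrable_continuous_interval continuous_on_subset[OF assms]) auto
  then show ?thesis
    by (subst (asm) has_integral_restrict_UNIV[symmetric])
       (rule has_integral_eq[rotated], assumption, auto)
qed

text \<open>Unit hats at consecutive integers form a partition of unity, so the sum is the trapezoid
  that rises on [-1, 0], equals 1 on [0, n] and falls on [n, n + 1]. The closed form presupposes at
  least one hat, hence \<open>Suc n\<close>. It reduces the pointwise inequalities below to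
  piecewise linear arithmetic.\<close>

lemma sum_unit_tri:
  "(\<Sum>j<Suc n. tri 1 (u - real j)) = max 0 (min 1 (min (u + 1) (real (Suc n) - u)))"
proof (induction n)
  case (Suc n)
  have "(\<Sum>j<Suc (Suc n). tri 1 (u - real j)) =
      max 0 (min 1 (min (u + 1) (real (Suc n) - u))) + tri 1 (u - real (Suc n))"
    using Suc by simp
  also have "\<dots> = max 0 (min 1 (min (u + 1) (real (Suc (Suc n)) - u)))"
    by (auto simp: tri_def max_def min_def abs_if)
  finally show ?case .
qed (auto simp: tri_def max_def min_def abs_if)

text \<open>Isolates what the final optimisation uses of the form factor. With g(h) = h + h^3/3 the
  two bounds are g(h) and 2 h^2 - g(h), the latter with h factored out. Uniformity in \<beta> lets
  one threshold for T serve all translates of a triangle.\<close>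

locale triangle_averages =
  fixes F :: "real \<Rightarrow> real \<Rightarrow> real"
  assumes cont: "\<And>T. continuous_on UNIV (F T)"
    and nonneg: "\<And>T \<alpha>. T > 1 \<Longrightarrow> F T \<alpha> \<ge> 0"
    and upper: "\<And>h \<epsilon>. 0 < h \<Longrightarrow> h \<le> 1 \<Longrightarrow> \<epsilon> > 0 \<Longrightarrow>
          eventually (\<lambda>T. \<forall>\<beta>. tri_avg h \<beta> (F T) \<le> h + h ^ 3 / 3 + \<epsilon>) at_top"
    and lower: "\<And>h \<epsilon>. 0 < h \<Longrightarrow> h \<le> 1 \<Longrightarrow> \<epsilon> > 0 \<Longrightarrow>
          eventually (\<lambda>T. \<forall>\<beta>. h * (2 * h - 1 - h\<^sup>2 / 3) - \<epsilon> \<le> tri_avg h \<beta> (F T)) at_top"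
begin

section \<open>Majorants and minorants of an interval built from triangles\<close>

lemma upper': "0 \<le> h \<Longrightarrow> h \<le> 1 \<Longrightarrow> \<epsilon> > 0 \<Longrightarrow>
    eventually (\<lambda>T. \<forall>\<beta>. tri_avg h \<beta> (F T) \<le> h + h ^ 3 / 3 + \<epsilon>) at_top"
  using upper[of h \<epsilon>] by (cases "h = 0") (auto simp: tri_avg_def)

text \<open>The trapezoid of the n unit triangles equals 1 up to distance h from each end of the
  interval and then loses slope one; the triangles of height h centred at the two endpoints supply
  exactly what is lost, so the sum is 1 throughout the interval. For n = 0 two triangles at distance
  2h - 1 still add up to 1 between their centres. Each unit triangle costs 1 + 1/3.\<close>

lemma majorant:
  assumes h: "0 \<le> h" "h \<le> 1" and l: "2 * h + real n - 1 = l" "l > 0" and \<epsilon>: "\<epsilon> > 0"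
  shows "eventually (\<lambda>T. integral {b..b + l} (F T) \<le> 4 / 3 * real n + 2 * (h + h ^ 3 / 3) + \<epsilon>) at_top"
proof -
  define \<delta> where "\<delta> = \<epsilon> / (real n + 2)"
  have \<delta>: "\<delta> > 0" "(real n + 2) * \<delta> = \<epsilon>" using \<epsilon> by (auto simp: \<delta>_def)
  have 1: "eventually (\<lambda>T. \<forall>\<beta>. tri_avg 1 \<beta> (F T) \<le> 4 / 3 + \<delta>) at_top"
    using upper[of 1 \<delta>] \<delta> by simp
  show ?thesis using 1 upper'[OF h \<delta>(1)] eventually_gt_at_top[of 1]
  proof eventually_elim
    case (elim T)
    have pt: "indicator {b..b + l} \<alpha> \<le>
        (\<Sum>j<n. tri 1 (\<alpha> - (b + h + real j))) + tri h (\<alpha> - b) + tri h (\<alpha> - (b + l))" for \<alpha>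
    proof (cases n)
      case 0
      then show ?thesis using h l by (auto simp: indicator_def tri_def max_def abs_if)
    next
      case (Suc k)
      have "(\<Sum>j<n. tri 1 (\<alpha> - (b + h + real j))) = (\<Sum>j<Suc k. tri 1 (\<alpha> - (b + h) - real j))"
        unfolding Suc by (intro sum.cong refl) (simp add: algebra_simps)
      then show ?thesis unfolding sum_unit_tri using h l Suc
        by (auto simp: indicator_def tri_def max_def min_def abs_if)
    qed
    have "integral {b..b + l} (F T) \<le> (\<Sum>j<n. tri_avg 1 (b + h + real j) (F T))
        + tri_avg h b (F T) + tri_avg h (b + l) (F T)"
    proof (rule has_integral_le[OF has_integral_indicator_interval[OF cont[of T]]])
      show "((\<lambda>\<alpha>. ((\<Sum>j<n. tri 1 (\<alpha> - (b + h + real j))) + tri h (\<alpha> - b) + tri h (\<alpha> - (b + l))) * F T \<alpha>)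
        has_integral (\<Sum>j<n. tri_avg 1 (b + h + real j) (F T)) + tri_avg h b (F T) + tri_avg h (b + l) (F T)) UNIV"
        unfolding distrib_right by (intro has_integral_add has_integral_tri_sum has_integral_tri cont)
    qed (use pt nonneg elim in \<open>auto intro!: mult_right_mono\<close>)
    also have "\<dots> \<le> (\<Sum>j<n. 4 / 3 + \<delta>) + (h + h ^ 3 / 3 + \<delta>) + (h + h ^ 3 / 3 + \<delta>)"
      using elim by (intro add_mono sum_mono) auto
    also have "\<dots> = 4 / 3 * real n + 2 * (h + h ^ 3 / 3) + \<epsilon>"
      using \<delta>(2) by (simp add: algebra_simps)
    finally show ?case .
  qed
qed

text \<open>One triangle over the midpoint, stretched vertically by s until its value s (h - l/2) at
  the endpoints reaches 1. For short intervals this can be cheaper than a sum of triangles that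
  equals 1 on the whole interval.\<close>

lemma single_majorant:
  assumes h: "0 < h" "h \<le> 1" and l: "0 < l" and s: "s \<ge> 0" "s * (h - l / 2) \<ge> 1" and \<epsilon>: "\<epsilon> > 0"
  shows "eventually (\<lambda>T. integral {b..b + l} (F T) \<le> s * (h + h ^ 3 / 3) + \<epsilon>) at_top"
proof -
  define \<delta> where "\<delta> = \<epsilon> / (s + 1)"
  have \<delta>: "\<delta> > 0" "(s + 1) * \<delta> = \<epsilon>" using \<epsilon> s(1) by (auto simp: \<delta>_def)
  show ?thesis using upper[OF h \<delta>(1)] eventually_gt_at_top[of 1]
  proof eventually_elim
    case (elim T)
    have pt: "indicator {b..b + l} \<alpha> \<le> s * tri h (\<alpha> - (b + l / 2))" for \<alpha>
    proof (cases "\<alpha> \<in> {b..b + l}")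
      case True
      then have "h - l / 2 \<le> tri h (\<alpha> - (b + l / 2))" by (auto simp: tri_def max_def abs_if field_simps)
      then have "s * (h - l / 2) \<le> s * tri h (\<alpha> - (b + l / 2))" using s by (intro mult_left_mono)
      then show ?thesis using True s by simp
    qed (use s in \<open>auto simp: tri_def\<close>)
    have "integral {b..b + l} (F T) \<le> s * tri_avg h (b + l / 2) (F T)"
    proof (rule has_integral_le[OF has_integral_indicator_interval[OF cont[of T]]])
      show "((\<lambda>\<alpha>. s * (tri h (\<alpha> - (b + l / 2)) * F T \<alpha>)) has_integral s * tri_avg h (b + l / 2) (F T)) UNIV"
        by (intro has_integral_mult_right has_integral_tri cont)
      show "indicator {b..b + l} \<alpha> * F T \<alpha> \<le> s * (tri h (\<alpha> - (b + l / 2)) * F T \<alpha>)" for \<alpha>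
        using pt[of \<alpha>] nonneg[of T \<alpha>] elim mult_right_mono[of _ _ "F T \<alpha>"] by (simp add: mult.assoc[symmetric])
    qed
    also have "\<dots> \<le> s * (h + h ^ 3 / 3 + \<delta>)" using elim s by (intro mult_left_mono) auto
    also have "\<dots> \<le> s * (h + h ^ 3 / 3) + \<epsilon>" using \<delta> by (simp add: algebra_simps)
    finally show ?case .
  qed
qed

text \<open>The inscribed triangle normalised to height 1, hence the lower bound for triangles
  divided by h.\<close>

lemma single_minorant:
  assumes h: "0 < h" "h \<le> 1" and l: "l = 2 * h" and \<epsilon>: "\<epsilon> > 0"
  shows "eventually (\<lambda>T. 2 * h - 1 - h\<^sup>2 / 3 - \<epsilon> \<le> integral {b..b + l} (F T)) at_top"
proof -
  have \<delta>: "h * \<epsilon> > 0" using \<epsilon> h by auto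
  show ?thesis using lower[OF h \<delta>] eventually_gt_at_top[of 1]
  proof eventually_elim
    case (elim T)
    have pt: "(1 / h) * tri h (\<alpha> - (b + h)) \<le> indicator {b..b + l} \<alpha>" for \<alpha>
      using h l by (auto simp: tri_def max_def abs_if field_simps indicator_def)
    have "(1 / h) * (h * (2 * h - 1 - h\<^sup>2 / 3) - h * \<epsilon>) \<le> (1 / h) * tri_avg h (b + h) (F T)"
      using elim h by (intro mult_left_mono) auto
    also have "\<dots> \<le> integral {b..b + l} (F T)"
    proof (rule has_integral_le[OF _ has_integral_indicator_interval[OF cont[of T]]])
      show "((\<lambda>\<alpha>. (1 / h) * (tri h (\<alpha> - (b + h)) * F T \<alpha>)) has_integral (1 / h) * tri_avg h (b + h) (F T)) UNIV"
        by (intro has_integral_mult_right has_integral_tri cont)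
      show "(1 / h) * (tri h (\<alpha> - (b + h)) * F T \<alpha>) \<le> indicator {b..b + l} \<alpha> * F T \<alpha>" for \<alpha>
        using mult_right_mono[OF pt[of \<alpha>] nonneg[of T \<alpha>]] elim by (simp add: mult.assoc)
    qed
    also have "(1 / h) * (h * (2 * h - 1 - h\<^sup>2 / 3) - h * \<epsilon>) = 2 * h - 1 - h\<^sup>2 / 3 - \<epsilon>"
      using h by (simp add: field_simps)
    finally show ?case .
  qed
qed

text \<open>Unit triangles centred at b + 1, ..., b + n fill the interval from the left; the last
  triangle has support [b + n, b + l] and meets only the falling edge of the last unit triangle,
  where the two add up to at most 1. The condition h >= 1/2 keeps the unit triangles inside the
  interval. The choice q = 0 discards the last triangle when its lower bound is negative.\<close>

lemma minorant:
  assumes h: "1 / 2 \<le> h" "h < 1" and l: "l = real n + 2 * h" and n: "n \<ge> 1" and \<epsilon>: "\<epsilon> > 0"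
    and q: "q \<in> {0, 1}"
  shows "eventually (\<lambda>T. 2 / 3 * real n + q * (h * (2 * h - 1 - h\<^sup>2 / 3)) - \<epsilon> \<le> integral {b..b + l} (F T)) at_top"
proof -
  define \<delta> where "\<delta> = \<epsilon> / (real n + 1)"
  have \<delta>: "\<delta> > 0" "(real n + 1) * \<delta> = \<epsilon>" using \<epsilon> by (auto simp: \<delta>_def)
  have 1: "eventually (\<lambda>T. \<forall>\<beta>. 2 / 3 - \<delta> \<le> tri_avg 1 \<beta> (F T)) at_top"
    using lower[of 1 \<delta>] \<delta> by simp
  have h': "0 < h" "h \<le> 1" using h by auto
  show ?thesis using 1 lower[OF h' \<delta>(1)] eventually_gt_at_top[of 1]
  proof eventually_elim
    case (elim T)
    obtain k where k: "n = Suc k" using n by (cases n) auto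
    have pt: "(\<Sum>j<n. tri 1 (\<alpha> - (b + 1 + real j))) + q * tri h (\<alpha> - (b + real n + h))
        \<le> indicator {b..b + l} \<alpha>" for \<alpha>
    proof -
      have "(\<Sum>j<n. tri 1 (\<alpha> - (b + 1 + real j))) = (\<Sum>j<Suc k. tri 1 (\<alpha> - (b + 1) - real j))"
        unfolding k by (intro sum.cong refl) (simp add: algebra_simps)
      then show ?thesis unfolding sum_unit_tri using h l k q
        by (auto simp: indicator_def tri_def max_def min_def abs_if)
    qed
    have "2 / 3 * real n + q * (h * (2 * h - 1 - h\<^sup>2 / 3)) - \<epsilon> =
        (\<Sum>j<n. 2 / 3 - \<delta>) + (q * (h * (2 * h - 1 - h\<^sup>2 / 3)) - \<delta>)"
      using \<delta>(2) by (simp add: algebra_simps)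
    also have "\<dots> \<le> (\<Sum>j<n. tri_avg 1 (b + 1 + real j) (F T)) + q * tri_avg h (b + real n + h) (F T)"
      using elim q \<delta> by (intro add_mono sum_mono) (auto simp: algebra_simps)
    also have "\<dots> \<le> integral {b..b + l} (F T)"
    proof (rule has_integral_le[OF _ has_integral_indicator_interval[OF cont[of T]]])
      show "((\<lambda>\<alpha>. (\<Sum>j<n. tri 1 (\<alpha> - (b + 1 + real j))) * F T \<alpha> + q * (tri h (\<alpha> - (b + real n + h)) * F T \<alpha>))
        has_integral (\<Sum>j<n. tri_avg 1 (b + 1 + real j) (F T)) + q * tri_avg h (b + real n + h) (F T)) UNIV"
        by (intro has_integral_add has_integral_mult_right has_integral_tri_sum has_integral_tri cont)
      show "(\<Sum>j<n. tri 1 (\<alpha> - (b + 1 + real j))) * F T \<alpha> + q * (tri h (\<alpha> - (b + real n + h)) * F T \<alpha>)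
          \<le> indicator {b..b + l} \<alpha> * F T \<alpha>" for \<alpha>
        using mult_right_mono[OF pt[of \<alpha>] nonneg[of T \<alpha>]] elim by (simp add: algebra_simps)
    qed
    finally show ?case .
  qed
qed

lemma eventually_upper:
  assumes l: "l > 0" and \<epsilon>: "\<epsilon> > 0"
  shows "eventually (\<lambda>T. integral {b..b + l} (F T) \<le> C_plus l + \<epsilon>) at_top"
proof -
  define \<theta> where "\<theta> = frac l"
  define k where "k = nat \<lfloor>l\<rfloor>"
  have k: "l = real k + \<theta>" "0 \<le> \<theta>" "\<theta> < 1"
    using l by (auto simp: \<theta>_def k_def frac_def frac_lt_1) (simp add: frac_def[symmetric] frac_lt_1)
  \<comment> \<open>Q is the cheaper of two coverings by \<open>majorant\<close>: k unit triangles
    with h = (1 + \<theta>)/2, or k + 1 of them with h = \<theta>/2. The second costs (1 - \<theta>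
    - \<theta>^2)/4 more than the first, which explains the positive part.\<close>
  define Q where "Q = 4 / 3 * (l + 1) + \<theta> ^ 3 / 12 - \<theta> / 3 - 1 / 4 * pos_part (1 - \<theta> - \<theta>\<^sup>2)"
  have Q: "eventually (\<lambda>T. integral {b..b + l} (F T) \<le> Q + \<epsilon>) at_top"
  proof (cases "1 - \<theta> - \<theta>\<^sup>2 \<ge> 0")
    case True
    have "Q = 4 / 3 * real k + 2 * ((1 + \<theta>) / 2 + ((1 + \<theta>) / 2) ^ 3 / 3)"
      using True k(1) by (simp add: Q_def pos_part_def power3_eq_cube power2_eq_square field_simps)
    moreover have "eventually (\<lambda>T. integral {b..b + l} (F T) \<le> 4 / 3 * real k + 2 * ((1 + \<theta>) / 2 + ((1 + \<theta>) / 2) ^ 3 / 3) + \<epsilon>) at_top"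
      by (rule majorant) (use k l \<epsilon> in \<open>auto simp: field_simps\<close>)
    ultimately show ?thesis by simp
  next
    case False
    have "Q = 4 / 3 * real (Suc k) + 2 * (\<theta> / 2 + (\<theta> / 2) ^ 3 / 3)"
      using False k(1) by (simp add: Q_def pos_part_def power3_eq_cube power2_eq_square field_simps)
    moreover have "eventually (\<lambda>T. integral {b..b + l} (F T) \<le> 4 / 3 * real (Suc k) + 2 * (\<theta> / 2 + (\<theta> / 2) ^ 3 / 3) + \<epsilon>) at_top"
      by (rule majorant) (use k l \<epsilon> in \<open>auto simp: field_simps\<close>)
    ultimately show ?thesis by simp
  qed
  show ?thesis
  proof (cases "l \<ge> 1")
    case True
    then have "C_plus l = Q" by (simp add: C_plus_def Q_def \<theta>_def)
    then show ?thesis using Q by simp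
  next
    case False
    then have \<theta>: "\<theta> = l" using l by (simp add: \<theta>_def frac_eq)
    \<comment> \<open>The cost of a single triangle is (h + h^3/3)/(h - l/2), parametrised here by c
      through h = l (1 + c)/(2c). For small l the minimum lies near h^3 = 3l/4, that is c = 6^(-1/3)
      l^(2/3); the other entry of the maximum enforces h <= 1.\<close>
    define c where "c = max (6 powr (- 1 / 3) * l powr (2 / 3)) (l / (2 - l))"
    have c: "c > 0" "l / (2 - l) \<le> c" using l False by (auto simp: c_def less_max_iff_disj)
    define h where "h = l * (1 + c) / (2 * c)"
    have h: "0 < h" "h \<le> 1"
      using c l False by (auto simp: h_def field_simps intro!: add_pos_pos)
    have "eventually (\<lambda>T. integral {b..b + l} (F T) \<le> (1 + c) / h * (h + h ^ 3 / 3) + \<epsilon>) at_top"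
    proof (rule single_majorant[OF h l])
      have "(1 + c) / h = 2 * c / l" using c l by (simp add: h_def)
      moreover have "h - l / 2 = l / (2 * c)" using c by (simp add: h_def field_simps)
      ultimately show "(1 + c) / h * (h - l / 2) \<ge> 1" using c l by simp
    qed (use c h \<epsilon> in auto)
    moreover have "(1 + c) / h * (h + h ^ 3 / 3) = (1 + c) * (1 + h\<^sup>2 / 3)"
      using h by (simp add: field_simps power3_eq_cube power2_eq_square)
    moreover have "h\<^sup>2 / 3 = l\<^sup>2 * (1 + c)\<^sup>2 / (12 * c\<^sup>2)"
      by (simp add: h_def power_divide power_mult_distrib)
    moreover have "C_plus l = min Q ((1 + c) * (1 + l\<^sup>2 * (1 + c)\<^sup>2 / (12 * c\<^sup>2)))"
      using False by (simp add: C_plus_def Q_def \<theta> c_def Let_def)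
    ultimately show ?thesis using Q by (auto simp: min_def)
  qed
qed

lemma eventually_lower:
  assumes l: "l > 0" and \<epsilon>: "\<epsilon> > 0"
  shows "eventually (\<lambda>T. C_minus l - \<epsilon> \<le> integral {b..b + l} (F T)) at_top"
proof (cases "l \<ge> 2")
  case True
  define \<theta> where "\<theta> = frac l"
  \<comment> \<open>One unit of length is held back, so that the remainder 1 + \<theta> = 2h gives h
    in [1/2, 1) as \<open>minorant\<close> requires.\<close>
  define n where "n = nat (\<lfloor>l\<rfloor> - 1)"
  have k: "l = real n + 1 + \<theta>" "0 \<le> \<theta>" "\<theta> < 1" "n \<ge> 1"
  proof -
    have "\<lfloor>l\<rfloor> \<ge> 2" using True by (simp add: le_floor_iff)
    then have "n \<ge> 1" "real n = real_of_int \<lfloor>l\<rfloor> - 1" unfolding n_def by linarith+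
    then show "l = real n + 1 + \<theta>" "n \<ge> 1" by (auto simp: \<theta>_def frac_def)
  qed (auto simp: \<theta>_def frac_lt_1)
  define h where "h = (1 + \<theta>) / 2"
  define q :: real where "q = (if \<theta> - (1 + \<theta>)\<^sup>2 / 12 \<ge> 0 then 1 else 0)"
  have "eventually (\<lambda>T. 2 / 3 * real n + q * (h * (2 * h - 1 - h\<^sup>2 / 3)) - \<epsilon> \<le> integral {b..b + l} (F T)) at_top"
    by (rule minorant) (use k \<epsilon> in \<open>auto simp: h_def q_def\<close>)
  moreover have "2 * h - 1 - h\<^sup>2 / 3 = \<theta> - (1 + \<theta>)\<^sup>2 / 12"
    by (simp add: h_def field_simps power2_eq_square)
  moreover have "C_minus l = 2 / 3 * real n + h * pos_part (\<theta> - (1 + \<theta>)\<^sup>2 / 12)"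
    unfolding C_minus_def \<theta>_def[symmetric] h_def using True k(1) by (simp add: field_simps)
  moreover have "h * pos_part (\<theta> - (1 + \<theta>)\<^sup>2 / 12) = q * (h * (\<theta> - (1 + \<theta>)\<^sup>2 / 12))"
    by (simp add: q_def pos_part_def)
  ultimately show ?thesis by (simp only:)
next
  case False
  then have C: "C_minus l = pos_part (l - 1 - l\<^sup>2 / 12)" by (simp add: C_minus_def)
  have 1: "eventually (\<lambda>T. 2 * (l / 2) - 1 - (l / 2)\<^sup>2 / 3 - \<epsilon> \<le> integral {b..b + l} (F T)) at_top"
    by (rule single_minorant) (use False l \<epsilon> in auto)
  show ?thesis using 1 eventually_gt_at_top[of 1]
  proof eventually_elim
    case (elim T)
    \<comment> \<open>Where the triangle gives a negative bound, positivity of F accounts for the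
      positive part.\<close>
    have "0 \<le> integral {b..b + l} (F T)"
      using elim nonneg by (intro Henstock_Kurzweil_Integration.integral_nonneg integrable_continuous_interval continuous_on_subset[OF cont]) auto
    then show ?case using elim \<epsilon> by (auto simp: C pos_part_def max_def power_divide)
  qed
qed

lemma Liminf_Limsup_bounds:
  assumes l: "l > 0"
  shows "ereal (C_minus l) \<le> Liminf at_top (\<lambda>T. ereal (integral {b..b + l} (F T)))"
    and "Limsup at_top (\<lambda>T. ereal (integral {b..b + l} (F T))) \<le> ereal (C_plus l)"
proof -
  show "Limsup at_top (\<lambda>T. ereal (integral {b..b + l} (F T))) \<le> ereal (C_plus l)"
  proof (rule ereal_le_epsilon2)
    fix e :: real assume "e > 0"
    from eventually_upper[OF l this, of b]
    show "Limsup at_top (\<lambda>T. ereal (integral {b..b + l} (F T))) \<le> ereal (C_plus l) + ereal e"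
      by (intro Limsup_bounded) (auto elim: eventually_mono)
  qed
  show "ereal (C_minus l) \<le> Liminf at_top (\<lambda>T. ereal (integral {b..b + l} (F T)))"
  proof (rule ereal_le_epsilon2)
    fix e :: real assume e: "e > 0"
    have "ereal (C_minus l - e) \<le> Liminf at_top (\<lambda>T. ereal (integral {b..b + l} (F T)))"
      using eventually_lower[OF l e, of b]
      by (intro Liminf_bounded) (auto elim: eventually_mono)
    then show "ereal (C_minus l) \<le> Liminf at_top (\<lambda>T. ereal (integral {b..b + l} (F T))) + ereal e"
      by (cases "Liminf at_top (\<lambda>T. ereal (integral {b..b + l} (F T)))") auto
  qed
qed

end

section \<open>Bessel's inequality for Fourier integrals\<close>

text \<open>On each half line the integrand is the exponential of a linear function, with
  coefficient -z or \<open>cnj z\<close> for z = \<epsilon> - iv, so truncation costs an explicit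
  exponential tail. A finite N keeps the later interchanges of integrals on compact boxes. For
  \<epsilon> = 2 the limit is exactly \<open>pair_weight v\<close>.\<close>

lemma poisson_kernel_truncated:
  fixes \<epsilon> N v :: real
  assumes "\<epsilon> > 0" "N \<ge> 0"
  shows "norm (integral {-N..N} (\<lambda>y. of_real (exp (- \<epsilon> * \<bar>y\<bar>)) * cis (y * v)) - of_real (2 * \<epsilon> / (\<epsilon>\<^sup>2 + v\<^sup>2)))
         \<le> 2 * exp (- \<epsilon> * N) / \<epsilon>"
proof -
  define z where "z = Complex \<epsilon> (- v)"
  have z: "z \<noteq> 0" "cnj z \<noteq> 0" using assms by (auto simp: z_def complex_eq_iff)
  have e1: "of_real (exp (- \<epsilon> * \<bar>y\<bar>)) * cis (y * v) = exp (- z * of_real y)" if "y \<ge> 0" for y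
    using that by (auto simp: z_def complex_eq_iff Re_exp Im_exp mult.commute)
  have e2: "of_real (exp (- \<epsilon> * \<bar>y\<bar>)) * cis (y * v) = exp (cnj z * of_real y)" if "y \<le> 0" for y
    using that by (auto simp: z_def complex_eq_iff Re_exp Im_exp mult.commute)
  have 1: "((\<lambda>y. of_real (exp (- \<epsilon> * \<bar>y\<bar>)) * cis (y * v)) has_integral
      (- exp (- z * of_real N) / z - - exp (- z * of_real 0) / z)) {0..N}"
  proof (rule has_integral_eq[rotated])
    show "((\<lambda>y. exp (- z * of_real y)) has_integral (- exp (- z * of_real N) / z - - exp (- z * of_real 0) / z)) {0..N}"
      using assms z
      by (intro fundamental_theorem_of_calculus has_vector_derivative_real_field)
         (auto intro!: derivative_eq_intros)
  qed (use e1 in auto)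
  have 2: "((\<lambda>y. of_real (exp (- \<epsilon> * \<bar>y\<bar>)) * cis (y * v)) has_integral
      (exp (cnj z * of_real 0) / cnj z - exp (cnj z * of_real (-N)) / cnj z)) {-N..0}"
  proof (rule has_integral_eq[rotated])
    show "((\<lambda>y. exp (cnj z * of_real y)) has_integral (exp (cnj z * of_real 0) / cnj z - exp (cnj z * of_real (-N)) / cnj z)) {-N..0}"
      using assms z
      by (intro fundamental_theorem_of_calculus has_vector_derivative_real_field)
         (auto intro!: derivative_eq_intros)
  qed (use e2 in auto)
  have "((\<lambda>y. of_real (exp (- \<epsilon> * \<bar>y\<bar>)) * cis (y * v)) has_integral
     ((exp (cnj z * of_real 0) / cnj z - exp (cnj z * of_real (-N)) / cnj z) +
      (- exp (- z * of_real N) / z - - exp (- z * of_real 0) / z))) {-N..N}"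
    using assms by (intro has_integral_combine[OF _ _ 2 1]) auto
  then have "integral {-N..N} (\<lambda>y. of_real (exp (- \<epsilon> * \<bar>y\<bar>)) * cis (y * v)) =
     (1 / cnj z + 1 / z) - (exp (- (cnj z * of_real N)) / cnj z + exp (- (z * of_real N)) / z)"
    by (simp add: integral_unique)
  moreover have "1 / cnj z + 1 / z = of_real (2 * \<epsilon> / (\<epsilon>\<^sup>2 + v\<^sup>2))"
    by (simp add: z_def complex_eq_iff Re_divide Im_divide power2_eq_square add_divide_distrib)
  moreover have "norm (exp (- (cnj z * of_real N)) / cnj z + exp (- (z * of_real N)) / z) \<le>
      exp (- \<epsilon> * N) / \<epsilon> + exp (- \<epsilon> * N) / \<epsilon>"
  proof (rule norm_triangle_mono)
    have nz: "norm z \<ge> \<epsilon>" using abs_Re_le_cmod[of z] assms by (simp add: z_def)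
    show "norm (exp (- (cnj z * of_real N)) / cnj z) \<le> exp (- \<epsilon> * N) / \<epsilon>"
      unfolding norm_divide norm_exp_eq_Re complex_mod_cnj using nz assms
      by (simp add: z_def frac_le)
    show "norm (exp (- (z * of_real N)) / z) \<le> exp (- \<epsilon> * N) / \<epsilon>"
      unfolding norm_divide norm_exp_eq_Re using nz assms
      by (simp add: z_def frac_le)
  qed
  moreover have "norm (K - X) \<le> 2 * c" if "K = Y - E" "Y = X" "norm E \<le> c + c" for K X Y E :: complex and c
    using that by simp
  ultimately show ?thesis by (metis times_divide_eq_right)
qed

lemma integral_poisson_kernel_le:
  fixes \<epsilon> a b t :: real
  assumes "\<epsilon> > 0" "a \<le> b"
  shows "integral {a..b} (\<lambda>u. 2 * \<epsilon> / (\<epsilon>\<^sup>2 + (t - u)\<^sup>2)) \<le> 2 * pi"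
proof -
  have "((\<lambda>u. 2 * \<epsilon> / (\<epsilon>\<^sup>2 + (t - u)\<^sup>2)) has_integral
      (2 * arctan ((b - t) / \<epsilon>) - 2 * arctan ((a - t) / \<epsilon>))) {a..b}"
  proof (rule fundamental_theorem_of_calculus[OF assms(2)])
    fix u assume "u \<in> {a..b}"
    have "((\<lambda>u. 2 * arctan ((u - t) / \<epsilon>)) has_real_derivative 2 * (inverse (1 + ((u - t) / \<epsilon>)\<^sup>2) * (1 / \<epsilon>))) (at u within {a..b})"
      using assms by (auto intro!: derivative_eq_intros)
    also have "2 * (inverse (1 + ((u - t) / \<epsilon>)\<^sup>2) * (1 / \<epsilon>)) = 2 * \<epsilon> / (\<epsilon>\<^sup>2 + (t - u)\<^sup>2)"
    proof -
      have "1 + ((u - t) / \<epsilon>)\<^sup>2 = (\<epsilon>\<^sup>2 + (t - u)\<^sup>2) / \<epsilon>\<^sup>2"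
        using assms by (simp add: power_divide power2_commute[of u t] add_divide_distrib)
      then show ?thesis using assms by (simp add: power2_eq_square)
    qed
    finally show "((\<lambda>u. 2 * arctan ((u - t) / \<epsilon>)) has_vector_derivative 2 * \<epsilon> / (\<epsilon>\<^sup>2 + (t - u)\<^sup>2)) (at u within {a..b})"
      by (simp add: has_real_derivative_iff_has_vector_derivative)
  qed
  then show ?thesis
    using arctan_bounded[of "(b - t) / \<epsilon>"] arctan_bounded[of "(a - t) / \<epsilon>"]
    by (simp add: integral_unique)
qed

lemma integral_add_add_const:
  fixes f g :: "real \<Rightarrow> real"
  assumes "a \<le> b" "f integrable_on {a..b}" "g integrable_on {a..b}"
  shows "integral {a..b} (\<lambda>u. f u + g u + c) = integral {a..b} f + (integral {a..b} g + (b - a) * c)"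
proof -
  have "((\<lambda>u. f u + g u + c) has_integral (integral {a..b} f + integral {a..b} g + (b - a) * c)) {a..b}"
    using assms has_integral_const_real[of c a b]
    by (intro has_integral_add integrable_integral) auto
  then show ?thesis by (simp add: integral_unique add.assoc)
qed

text \<open>Schur's test. Opening the square and integrating over y first leaves the kernel K(t -
  u), which up to the tail R is the Poisson kernel: positive, even and of mass at most 2 pi.
  Together with |f(t) f(u)| <= (|f(t)|^2 + |f(u)|^2)/2 this yields the factor 2 pi; the last term
  collects the tail.\<close>

lemma bessel_damped:
  fixes f :: "real \<Rightarrow> complex"
  assumes ab: "a \<le> b" and cont: "continuous_on {a..b} f" and \<epsilon>: "\<epsilon> > 0" and N: "N \<ge> 0"
    and m: "\<And>t. t \<in> {a..b} \<Longrightarrow> norm (f t) \<le> m"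
  shows "integral {-N..N} (\<lambda>y. exp (- \<epsilon> * \<bar>y\<bar>) * (norm (integral {a..b} (\<lambda>t. f t * cis (y * t))))\<^sup>2)
         \<le> 2 * pi * integral {a..b} (\<lambda>t. (norm (f t))\<^sup>2) + (b - a)\<^sup>2 * m\<^sup>2 * (2 * exp (- \<epsilon> * N) / \<epsilon>)"
proof -
  define H where "H y = integral {a..b} (\<lambda>t. f t * cis (y * t))" for y
  define \<Phi> where "\<Phi> y t u = of_real (exp (- \<epsilon> * \<bar>y\<bar>)) * (f t * cnj (f u) * cis (y * (t - u)))" for y t u
  define K where "K v = integral {-N..N} (\<lambda>y. of_real (exp (- \<epsilon> * \<bar>y\<bar>)) * cis (y * v))" for v
  define P where "P v = 2 * \<epsilon> / (\<epsilon>\<^sup>2 + v\<^sup>2)" for v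
  define R where "R = 2 * exp (- \<epsilon> * N) / \<epsilon>"
  have P0: "P v \<ge> 0" for v using \<epsilon> by (simp add: P_def)
  have den: "\<epsilon>\<^sup>2 + v\<^sup>2 \<noteq> 0" for v using \<epsilon> by (simp add: add_nonneg_eq_0_iff)
  have contP: "continuous_on A (\<lambda>x. P (q x))" if "continuous_on A q" for A :: "'b::topological_space set" and q
    unfolding P_def using that den by (intro continuous_intros) auto
  have fc: "continuous_on A (\<lambda>x. f (q x))" if "continuous_on A q" "q ` A \<subseteq> {a..b}" for A :: "'b::topological_space set" and q
    using continuous_on_compose2[OF cont that] .
  have cisc: "continuous_on A (\<lambda>x. cis (q x))" if "continuous_on A q" for A :: "'b::topological_space set" and q
    unfolding cis_conv_exp using that by (intro continuous_intros)
  have int_ft: "(\<lambda>t. f t * cis (y * t)) integrable_on {a..b}" for y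
    by (intro integrable_continuous_interval continuous_intros fc cisc) auto
  have HH: "of_real ((norm (H y))\<^sup>2) = integral {a..b} (\<lambda>t. integral {a..b} (\<lambda>u. f t * cnj (f u) * cis (y * (t - u))))" for y
  proof -
    have "cnj (H y) = integral {a..b} (\<lambda>u. cnj (f u * cis (y * u)))"
      unfolding H_def by (rule integral_cnj)
    then have "of_real ((norm (H y))\<^sup>2) = integral {a..b} (\<lambda>t. f t * cis (y * t)) * integral {a..b} (\<lambda>u. cnj (f u * cis (y * u)))"
      by (simp only: complex_norm_square H_def)
    also have "\<dots> = integral {a..b} (\<lambda>t. f t * cis (y * t) * integral {a..b} (\<lambda>u. cnj (f u * cis (y * u))))"
      by (rule integral_mult_left[symmetric])
    also have "\<dots> = integral {a..b} (\<lambda>t. integral {a..b} (\<lambda>u. f t * cis (y * t) * cnj (f u * cis (y * u))))"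
      by (simp only: integral_mult_right)
    also have "(\<lambda>t. integral {a..b} (\<lambda>u. f t * cis (y * t) * cnj (f u * cis (y * u)))) =
       (\<lambda>t. integral {a..b} (\<lambda>u. f t * cnj (f u) * cis (y * (t - u))))"
    proof -
      have "f t * cis (y * t) * cnj (f u * cis (y * u)) = f t * cnj (f u) * cis (y * (t - u))" for t u
      proof -
        have "cis (y * t) * cis (- (y * u)) = cis (y * (t - u))"
          by (simp add: cis_mult right_diff_distrib)
        then show ?thesis by (simp add: cis_cnj mult_ac)
      qed
      then show ?thesis by (simp only:)
    qed
    finally show ?thesis .
  qed
  have c3: "continuous_on (({-N..N} \<times> {a..b}) \<times> {a..b}) (\<lambda>(p, u). \<Phi> (fst p) (snd p) u)"
    unfolding \<Phi>_def case_prod_unfold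
    by (intro continuous_intros fc cisc) auto
  have "of_real (integral {-N..N} (\<lambda>y. exp (- \<epsilon> * \<bar>y\<bar>) * (norm (H y))\<^sup>2)) =
      integral {-N..N} (\<lambda>y. of_real (exp (- \<epsilon> * \<bar>y\<bar>) * (norm (H y))\<^sup>2))"
  proof -
    have "continuous_on {-N..N} H"
      unfolding H_def interval_cbox
      by (rule integral_continuous_on_param) (auto simp: case_prod_unfold intro!: continuous_intros fc cisc)
    then have "(\<lambda>y. exp (- \<epsilon> * \<bar>y\<bar>) * (norm (H y))\<^sup>2) integrable_on {-N..N}"
      by (intro integrable_continuous_interval continuous_intros)
    from integral_linear[OF this bounded_linear_of_real, symmetric] show ?thesis by (simp only: o_def)
  qed
  also have "\<dots> = integral {-N..N} (\<lambda>y. integral {a..b} (\<lambda>t. integral {a..b} (\<lambda>u. \<Phi> y t u)))"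
  proof (rule Henstock_Kurzweil_Integration.integral_cong)
    fix y
    have "of_real (exp (- \<epsilon> * \<bar>y\<bar>) * (norm (H y))\<^sup>2) = of_real (exp (- \<epsilon> * \<bar>y\<bar>)) *
        integral {a..b} (\<lambda>t. integral {a..b} (\<lambda>u. f t * cnj (f u) * cis (y * (t - u))))"
      by (simp only: of_real_mult HH)
    also have "\<dots> = integral {a..b} (\<lambda>t. of_real (exp (- \<epsilon> * \<bar>y\<bar>)) * integral {a..b} (\<lambda>u. f t * cnj (f u) * cis (y * (t - u))))"
      by (rule integral_mult_right[symmetric])
    also have "\<dots> = integral {a..b} (\<lambda>t. integral {a..b} (\<lambda>u. \<Phi> y t u))"
      unfolding \<Phi>_def by (intro Henstock_Kurzweil_Integration.integral_cong integral_mult_right[symmetric])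
    finally show "of_real (exp (- \<epsilon> * \<bar>y\<bar>) * (norm (H y))\<^sup>2) = integral {a..b} (\<lambda>t. integral {a..b} (\<lambda>u. \<Phi> y t u))" .
  qed
  also have "\<dots> = integral {a..b} (\<lambda>t. integral {-N..N} (\<lambda>y. integral {a..b} (\<lambda>u. \<Phi> y t u)))"
  proof -
    have "continuous_on ({-N..N} \<times> {a..b}) (\<lambda>p. integral {a..b} (\<Phi> (fst p) (snd p)))"
      unfolding interval_cbox[of a b] by (rule integral_continuous_on_param) (use c3 in \<open>simp\<close>)
    then show ?thesis
      using integral_swap_continuous[of "-N" a N b "\<lambda>y t. integral {a..b} (\<Phi> y t)"]
      by (simp add: case_prod_unfold cbox_Pair_eq)
  qed
  also have "\<dots> = integral {a..b} (\<lambda>t. integral {a..b} (\<lambda>u. integral {-N..N} (\<lambda>y. \<Phi> y t u)))"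
  proof (rule Henstock_Kurzweil_Integration.integral_cong)
    fix t assume t: "t \<in> {a..b}"
    have "continuous_on ({-N..N} \<times> {a..b}) (\<lambda>(y, u). \<Phi> y t u)"
      unfolding \<Phi>_def case_prod_unfold using t
      by (intro continuous_intros fc cisc) auto
    then show "integral {-N..N} (\<lambda>y. integral {a..b} (\<lambda>u. \<Phi> y t u)) = integral {a..b} (\<lambda>u. integral {-N..N} (\<lambda>y. \<Phi> y t u))"
      using integral_swap_continuous[of "-N" a N b "\<lambda>y u. \<Phi> y t u"]
      by (simp add: cbox_Pair_eq)
  qed
  also have "\<dots> = integral {a..b} (\<lambda>t. integral {a..b} (\<lambda>u. f t * cnj (f u) * K (t - u)))"
  proof (intro Henstock_Kurzweil_Integration.integral_cong)
    fix t u
    have "integral {-N..N} (\<lambda>y. \<Phi> y t u) = integral {-N..N} (\<lambda>y. f t * cnj (f u) * (of_real (exp (- \<epsilon> * \<bar>y\<bar>)) * cis (y * (t - u))))"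
      unfolding \<Phi>_def by (intro Henstock_Kurzweil_Integration.integral_cong) (rule mult.left_commute)
    then show "integral {-N..N} (\<lambda>y. \<Phi> y t u) = f t * cnj (f u) * K (t - u)"
      unfolding K_def by (simp only: integral_mult_right)
  qed
  finally have eq: "of_real (integral {-N..N} (\<lambda>y. exp (- \<epsilon> * \<bar>y\<bar>) * (norm (H y))\<^sup>2)) =
      integral {a..b} (\<lambda>t. integral {a..b} (\<lambda>u. f t * cnj (f u) * K (t - u)))" .
  \<comment> \<open>The two halves stay separate because each is integrated first over the variable
    its value of f does not depend on, where only the mass of P enters.\<close>
  define B where "B t u = (norm (f t))\<^sup>2 / 2 * P (t - u) + (norm (f u))\<^sup>2 / 2 * P (t - u) + m\<^sup>2 * R" for t u
  have Kc: "continuous_on A (\<lambda>x. K (q x))" if "continuous_on A q" for A :: "'b::topological_space set" and q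
    unfolding K_def interval_cbox
    by (rule integral_continuous_on_param)
       (auto simp: case_prod_unfold intro!: continuous_intros cisc continuous_on_compose2[OF that])
  have ptB: "norm (f t * cnj (f u) * K (t - u)) \<le> B t u" if tu: "t \<in> {a..b}" "u \<in> {a..b}" for t u
  proof -
    have "norm (K (t - u)) \<le> P (t - u) + R"
    proof -
      have "norm (K (t - u) - of_real (P (t - u))) \<le> R"
        unfolding K_def P_def R_def by (rule poisson_kernel_truncated[OF \<epsilon> N])
      then show ?thesis
        using norm_triangle_ineq[of "K (t - u) - of_real (P (t - u))" "of_real (P (t - u))"] P0 by simp
    qed
    then have "norm (f t * cnj (f u) * K (t - u)) \<le> norm (f t) * norm (f u) * (P (t - u) + R)"
      unfolding norm_mult complex_mod_cnj by (intro mult_left_mono) auto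
    also have "\<dots> = norm (f t) * norm (f u) * P (t - u) + norm (f t) * norm (f u) * R"
      by (simp add: distrib_left)
    also have "\<dots> \<le> ((norm (f t))\<^sup>2 / 2 + (norm (f u))\<^sup>2 / 2) * P (t - u) + m\<^sup>2 * R"
    proof (intro add_mono mult_right_mono P0)
      show "norm (f t) * norm (f u) \<le> (norm (f t))\<^sup>2 / 2 + (norm (f u))\<^sup>2 / 2"
        using sum_squares_bound[of "norm (f t)" "norm (f u)"] by simp
      show "norm (f t) * norm (f u) \<le> m\<^sup>2"
        unfolding power2_eq_square using m tu order_trans[OF norm_ge_zero m[OF tu(1)]] by (intro mult_mono) auto
      show "R \<ge> 0" using \<epsilon> by (simp add: R_def)
    qed
    finally show ?thesis by (simp add: B_def algebra_simps)
  qed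
  have Bc2: "continuous_on ({a..b} \<times> {a..b}) (\<lambda>(t, u). B t u)"
    unfolding B_def case_prod_unfold by (intro continuous_intros fc contP) auto
  have Bc: "continuous_on {a..b} (B t)" if "t \<in> {a..b}" for t
    unfolding B_def using that by (intro continuous_intros fc contP) auto
  have inner: "norm (integral {a..b} (\<lambda>u. f t * cnj (f u) * K (t - u))) \<le> integral {a..b} (B t)" if t: "t \<in> {a..b}" for t
    by (rule integral_norm_bound_integral)
       (use ptB t Bc in \<open>auto intro!: integrable_continuous_interval continuous_intros fc Kc\<close>)
  have out_c: "continuous_on {a..b} (\<lambda>t. integral {a..b} (\<lambda>u. f t * cnj (f u) * K (t - u)))"
    unfolding interval_cbox
    by (rule integral_continuous_on_param)
       (auto simp: case_prod_unfold intro!: continuous_intros fc Kc)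
  have outB: "continuous_on {a..b} (\<lambda>t. integral {a..b} (B t))"
    unfolding interval_cbox[of a b] by (rule integral_continuous_on_param) (use Bc2 in \<open>simp\<close>)
  have "integral {-N..N} (\<lambda>y. exp (- \<epsilon> * \<bar>y\<bar>) * (norm (H y))\<^sup>2) \<le> norm (complex_of_real (integral {-N..N} (\<lambda>y. exp (- \<epsilon> * \<bar>y\<bar>) * (norm (H y))\<^sup>2)))"
    by simp
  also have "\<dots> \<le> integral {a..b} (\<lambda>t. integral {a..b} (B t))"
    unfolding eq
    by (rule integral_norm_bound_integral) (use inner in \<open>auto intro!: integrable_continuous_interval out_c outB\<close>)
  also have "\<dots> = integral {a..b} (\<lambda>t. integral {a..b} (\<lambda>u. (norm (f t))\<^sup>2 / 2 * P (t - u)) +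
      (integral {a..b} (\<lambda>u. (norm (f u))\<^sup>2 / 2 * P (t - u)) + (b - a) * (m\<^sup>2 * R)))"
  proof (rule Henstock_Kurzweil_Integration.integral_cong)
    fix t assume t: "t \<in> {a..b}"
    have i1: "(\<lambda>u. (norm (f t))\<^sup>2 / 2 * P (t - u)) integrable_on {a..b}"
      by (intro integrable_continuous_interval continuous_intros contP)
    have i2: "(\<lambda>u. (norm (f u))\<^sup>2 / 2 * P (t - u)) integrable_on {a..b}"
      by (intro integrable_continuous_interval continuous_intros contP cont)  auto
    show "integral {a..b} (B t) = integral {a..b} (\<lambda>u. (norm (f t))\<^sup>2 / 2 * P (t - u)) +
      (integral {a..b} (\<lambda>u. (norm (f u))\<^sup>2 / 2 * P (t - u)) + (b - a) * (m\<^sup>2 * R))"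
      unfolding B_def by (rule integral_add_add_const[OF ab i1 i2])
  qed
  also have "\<dots> = integral {a..b} (\<lambda>t. integral {a..b} (\<lambda>u. (norm (f t))\<^sup>2 / 2 * P (t - u))) +
      (integral {a..b} (\<lambda>t. integral {a..b} (\<lambda>u. (norm (f u))\<^sup>2 / 2 * P (t - u))) + (b - a) * ((b - a) * (m\<^sup>2 * R)))"
  proof -
    have j1: "(\<lambda>t. integral {a..b} (\<lambda>u. (norm (f t))\<^sup>2 / 2 * P (t - u))) integrable_on {a..b}"
      unfolding interval_cbox[of a b]
      by (intro integrable_continuous integral_continuous_on_param)
         (auto simp: case_prod_unfold intro!: continuous_intros fc contP)
    have j2: "(\<lambda>t. integral {a..b} (\<lambda>u. (norm (f u))\<^sup>2 / 2 * P (t - u))) integrable_on {a..b}"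
      unfolding interval_cbox[of a b]
      by (intro integrable_continuous integral_continuous_on_param)
         (auto simp: case_prod_unfold intro!: continuous_intros fc contP)
    show ?thesis
      by (rule integral_add_add_const[OF ab j1 j2, unfolded add.assoc])
  qed
  also have "integral {a..b} (\<lambda>t. integral {a..b} (\<lambda>u. (norm (f u))\<^sup>2 / 2 * P (t - u))) =
      integral {a..b} (\<lambda>u. integral {a..b} (\<lambda>t. (norm (f u))\<^sup>2 / 2 * P (t - u)))"
  proof -
    have "continuous_on ({a..b} \<times> {a..b}) (\<lambda>(t, u). (norm (f u))\<^sup>2 / 2 * P (t - u))"
      unfolding case_prod_unfold by (intro continuous_intros fc contP) auto
    then show ?thesis
      using integral_swap_continuous[of a a b b "\<lambda>t u. (norm (f u))\<^sup>2 / 2 * P (t - u)"]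
      by (simp add: cbox_Pair_eq)
  qed
  also have "(\<lambda>u. integral {a..b} (\<lambda>t. (norm (f u))\<^sup>2 / 2 * P (t - u))) =
      (\<lambda>t. integral {a..b} (\<lambda>u. (norm (f t))\<^sup>2 / 2 * P (t - u)))"
    by (simp add: P_def power2_commute)
  also have "integral {a..b} (\<lambda>t. integral {a..b} (\<lambda>u. (norm (f t))\<^sup>2 / 2 * P (t - u))) \<le>
      integral {a..b} (\<lambda>t. pi * (norm (f t))\<^sup>2)"
  proof (rule integral_le)
    show "(\<lambda>t. integral {a..b} (\<lambda>u. (norm (f t))\<^sup>2 / 2 * P (t - u))) integrable_on {a..b}"
      unfolding interval_cbox[of a b]
      by (intro integrable_continuous integral_continuous_on_param)
         (auto simp: case_prod_unfold intro!: continuous_intros fc contP)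
    show "(\<lambda>t. pi * (norm (f t))\<^sup>2) integrable_on {a..b}"
      by (intro integrable_continuous_interval continuous_intros cont)
    fix t assume "t \<in> {a..b}"
    have "integral {a..b} (\<lambda>u. (norm (f t))\<^sup>2 / 2 * P (t - u)) = (norm (f t))\<^sup>2 / 2 * integral {a..b} (\<lambda>u. P (t - u))"
      by (rule integral_mult_right)
    also have "\<dots> \<le> (norm (f t))\<^sup>2 / 2 * (2 * pi)"
      unfolding P_def by (intro mult_left_mono integral_poisson_kernel_le \<epsilon> ab) auto
    finally show "integral {a..b} (\<lambda>u. (norm (f t))\<^sup>2 / 2 * P (t - u)) \<le> pi * (norm (f t))\<^sup>2" by (simp add: mult_ac)
  qed
  also have "integral {a..b} (\<lambda>t. pi * (norm (f t))\<^sup>2) = pi * integral {a..b} (\<lambda>t. (norm (f t))\<^sup>2)"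
    by (rule integral_mult_right)
  finally show ?thesis
    by (simp add: H_def R_def power2_eq_square mult_ac)
qed

text \<open>The inequality half of Plancherel's theorem, with the sharp constant 2 pi on which the
  leading term of the mean square depends. For fixed \<epsilon> the tail vanishes as N tends to
  infinity; afterwards \<epsilon> tends to 0, with M fixed throughout.\<close>

lemma bessel_inequality:
  fixes f :: "real \<Rightarrow> complex"
  assumes ab: "a \<le> b" and cont: "continuous_on {a..b} f"
  shows "integral {-M..M} (\<lambda>y. (norm (integral {a..b} (\<lambda>t. f t * cis (y * t))))\<^sup>2)
         \<le> 2 * pi * integral {a..b} (\<lambda>t. (norm (f t))\<^sup>2)"
proof (cases "M \<ge> 0")
  case M: True
  define H where "H y = integral {a..b} (\<lambda>t. f t * cis (y * t))" for y
  define I where "I = integral {-M..M} (\<lambda>y. (norm (H y))\<^sup>2)"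
  define Q where "Q = 2 * pi * integral {a..b} (\<lambda>t. (norm (f t))\<^sup>2)"
  have contH: "continuous_on A H" for A
    unfolding H_def interval_cbox cis_conv_exp
    by (rule integral_continuous_on_param)
       (auto simp: case_prod_unfold intro!: continuous_intros continuous_on_compose2[OF cont])
  have "bounded (f ` {a..b})" by (intro compact_imp_bounded compact_continuous_image cont) auto
  then obtain m where m: "\<And>t. t \<in> {a..b} \<Longrightarrow> norm (f t) \<le> m" unfolding bounded_iff by blast
  have step: "exp (- \<epsilon> * M) * I \<le> Q" if \<epsilon>: "\<epsilon> > 0" for \<epsilon>
  proof (rule tendsto_lowerbound)
    have "((\<lambda>N. Q + (b - a)\<^sup>2 * m\<^sup>2 * (2 * exp (- \<epsilon> * N) / \<epsilon>)) \<longlongrightarrow> Q + (b - a)\<^sup>2 * m\<^sup>2 * (2 * 0 / \<epsilon>)) at_top"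
    proof (intro tendsto_intros)
      have "filterlim (\<lambda>N. - \<epsilon> * N) at_bot at_top"
        using \<epsilon> by (intro filterlim_tendsto_neg_mult_at_bot[OF tendsto_const _ filterlim_ident]) auto
      then show "((\<lambda>N. exp (- \<epsilon> * N)) \<longlongrightarrow> 0) at_top"
        by (rule filterlim_compose[OF exp_at_bot])
    qed (use \<epsilon> in auto)
    then show "((\<lambda>N. Q + (b - a)\<^sup>2 * m\<^sup>2 * (2 * exp (- \<epsilon> * N) / \<epsilon>)) \<longlongrightarrow> Q) at_top" by simp
    show "eventually (\<lambda>N. exp (- \<epsilon> * M) * I \<le> Q + (b - a)\<^sup>2 * m\<^sup>2 * (2 * exp (- \<epsilon> * N) / \<epsilon>)) at_top"
      using eventually_ge_at_top[of M]
    proof eventually_elim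
      case (elim N)
      have "exp (- \<epsilon> * M) * I = integral {-M..M} (\<lambda>y. exp (- \<epsilon> * M) * (norm (H y))\<^sup>2)"
        unfolding I_def by (rule integral_mult_right[symmetric])
      also have "\<dots> \<le> integral {-M..M} (\<lambda>y. exp (- \<epsilon> * \<bar>y\<bar>) * (norm (H y))\<^sup>2)"
      proof (rule integral_le)
        fix y assume "y \<in> {-M..M}"
        then have "\<epsilon> * \<bar>y\<bar> \<le> \<epsilon> * M" using \<epsilon> by (intro mult_left_mono) auto
        then show "exp (- \<epsilon> * M) * (norm (H y))\<^sup>2 \<le> exp (- \<epsilon> * \<bar>y\<bar>) * (norm (H y))\<^sup>2"
          by (intro mult_right_mono) auto
      qed (intro integrable_continuous_interval continuous_intros contH)+
      also have "\<dots> \<le> integral {-N..N} (\<lambda>y. exp (- \<epsilon> * \<bar>y\<bar>) * (norm (H y))\<^sup>2)"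
        using elim by (intro integral_subset_le integrable_continuous_interval continuous_intros contH) auto
      also have "\<dots> \<le> Q + (b - a)\<^sup>2 * m\<^sup>2 * (2 * exp (- \<epsilon> * N) / \<epsilon>)"
        unfolding Q_def H_def by (rule bessel_damped) (use ab cont \<epsilon> M m elim in auto)
      finally show ?case .
    qed
  qed simp
  have "I \<le> Q"
  proof (rule tendsto_upperbound)
    have "((\<lambda>\<epsilon>. exp (- \<epsilon> * M) * I) \<longlongrightarrow> exp (- 0 * M) * I) (at_right 0)"
      by (intro tendsto_intros)
    then show "((\<lambda>\<epsilon>. exp (- \<epsilon> * M) * I) \<longlongrightarrow> I) (at_right 0)" by simp
    show "eventually (\<lambda>\<epsilon>. exp (- \<epsilon> * M) * I \<le> Q) (at_right 0)"
      using step by (auto simp: eventually_at_right_less eventually_at intro!: exI[of _ 1])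
  qed simp
  then show ?thesis by (simp add: I_def Q_def H_def)
next
  case False
  have "integral {a..b} (\<lambda>t. (norm (f t))\<^sup>2) \<ge> 0"
    by (intro Henstock_Kurzweil_Integration.integral_nonneg integrable_continuous_interval continuous_intros cont) auto
  then show ?thesis using False by simp
qed

section \<open>Fejer kernels and averages of double sums\<close>

definition fejer :: "real \<Rightarrow> real \<Rightarrow> real" where
  "fejer h v = (if v = 0 then h\<^sup>2 else 2 * (1 - cos (h * v)) / v\<^sup>2)"

lemma fejer_nonneg: "fejer h v \<ge> 0"
  by (auto simp: fejer_def)

text \<open>\<open>fejer h v\<close> is (2 sin(hv/2)/v)^2, completed by its limit h^2 at v = 0. R
  and L are the antiderivatives, found by integration by parts, on the two sides of the apex.
  Shifting the triangle to \<beta> only produces the factor cos(\<beta> v), since the odd part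
  cancels.\<close>

lemma tri_cos_integral:
  assumes h: "h \<ge> 0"
  shows "((\<lambda>\<alpha>. tri h (\<alpha> - \<beta>) * cos (\<alpha> * v)) has_integral cos (\<beta> * v) * fejer h v) {\<beta> - h..\<beta> + h}"
proof -
  define R where "R \<alpha> = (if v = 0 then h * (\<alpha> - \<beta>) - (\<alpha> - \<beta>)\<^sup>2 / 2
     else (h - (\<alpha> - \<beta>)) * sin (\<alpha> * v) / v - cos (\<alpha> * v) / v\<^sup>2)" for \<alpha>
  define L where "L \<alpha> = (if v = 0 then h * (\<alpha> - \<beta>) + (\<alpha> - \<beta>)\<^sup>2 / 2
     else (h + (\<alpha> - \<beta>)) * sin (\<alpha> * v) / v + cos (\<alpha> * v) / v\<^sup>2)" for \<alpha>
  have "((\<lambda>\<alpha>. (h - (\<alpha> - \<beta>)) * cos (\<alpha> * v)) has_integral (R (\<beta> + h) - R \<beta>)) {\<beta>..\<beta> + h}"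
  proof (rule fundamental_theorem_of_calculus)
    fix \<alpha> assume "\<alpha> \<in> {\<beta>..\<beta> + h}"
    show "(R has_vector_derivative (h - (\<alpha> - \<beta>)) * cos (\<alpha> * v)) (at \<alpha> within {\<beta>..\<beta> + h})"
      unfolding R_def[abs_def] has_real_derivative_iff_has_vector_derivative[symmetric]
      by (cases "v = 0") (auto intro!: derivative_eq_intros simp: field_simps power2_eq_square)
  qed (use h in auto)
  then have 1: "((\<lambda>\<alpha>. tri h (\<alpha> - \<beta>) * cos (\<alpha> * v)) has_integral (R (\<beta> + h) - R \<beta>)) {\<beta>..\<beta> + h}"
    by (rule has_integral_eq[rotated]) (auto simp: tri_def max_def abs_if)
  have "((\<lambda>\<alpha>. (h + (\<alpha> - \<beta>)) * cos (\<alpha> * v)) has_integral (L \<beta> - L (\<beta> - h))) {\<beta> - h..\<beta>}"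
  proof (rule fundamental_theorem_of_calculus)
    fix \<alpha> assume "\<alpha> \<in> {\<beta> - h..\<beta>}"
    show "(L has_vector_derivative (h + (\<alpha> - \<beta>)) * cos (\<alpha> * v)) (at \<alpha> within {\<beta> - h..\<beta>})"
      unfolding L_def[abs_def] has_real_derivative_iff_has_vector_derivative[symmetric]
      by (cases "v = 0") (auto intro!: derivative_eq_intros simp: field_simps power2_eq_square)
  qed (use h in auto)
  then have 2: "((\<lambda>\<alpha>. tri h (\<alpha> - \<beta>) * cos (\<alpha> * v)) has_integral (L \<beta> - L (\<beta> - h))) {\<beta> - h..\<beta>}"
    by (rule has_integral_eq[rotated]) (auto simp: tri_def max_def abs_if)
  have "((\<lambda>\<alpha>. tri h (\<alpha> - \<beta>) * cos (\<alpha> * v)) has_integral (L \<beta> - L (\<beta> - h)) + (R (\<beta> + h) - R \<beta>)) {\<beta> - h..\<beta> + h}"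
    using h by (intro has_integral_combine[OF _ _ 2 1]) auto
  also have "(L \<beta> - L (\<beta> - h)) + (R (\<beta> + h) - R \<beta>) = cos (\<beta> * v) * fejer h v"
  proof (cases "v = 0")
    case False
    have "cos ((\<beta> + h) * v) + cos ((\<beta> - h) * v) = 2 * cos (\<beta> * v) * cos (h * v)"
      by (simp add: distrib_right left_diff_distrib cos_add cos_diff)
    then have "2 * cos (\<beta> * v) - cos ((\<beta> + h) * v) - cos ((\<beta> - h) * v) = 2 * cos (\<beta> * v) * (1 - cos (h * v))"
      by (simp add: algebra_simps)
    moreover have "(L \<beta> - L (\<beta> - h)) + (R (\<beta> + h) - R \<beta>) =
       (2 * cos (\<beta> * v) - cos ((\<beta> + h) * v) - cos ((\<beta> - h) * v)) / v\<^sup>2"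
      using False by (simp add: L_def R_def diff_divide_distrib add_divide_distrib)
    ultimately show ?thesis using False by (simp add: fejer_def)
  qed (simp add: L_def R_def fejer_def power2_eq_square)
  finally show ?thesis .
qed

lemma tri_avg_cos_sum:
  fixes g :: "'a \<Rightarrow> real" and A :: "'a \<Rightarrow> 'a \<Rightarrow> real"
  assumes "finite Z" "h \<ge> 0"
  shows "tri_avg h \<beta> (\<lambda>\<alpha>. \<Sum>p\<in>Z. \<Sum>q\<in>Z. A p q * cos (\<alpha> * (g p - g q))) =
     (\<Sum>p\<in>Z. \<Sum>q\<in>Z. A p q * (cos (\<beta> * (g p - g q)) * fejer h (g p - g q)))"
proof -
  have "((\<lambda>\<alpha>. \<Sum>p\<in>Z. \<Sum>q\<in>Z. A p q * (tri h (\<alpha> - \<beta>) * cos (\<alpha> * (g p - g q)))) has_integral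
     (\<Sum>p\<in>Z. \<Sum>q\<in>Z. A p q * (cos (\<beta> * (g p - g q)) * fejer h (g p - g q)))) {\<beta> - h..\<beta> + h}"
    by (intro has_integral_sum has_integral_mult_right tri_cos_integral assms)
  then show ?thesis
    unfolding tri_avg_def by (simp add: integral_unique sum_distrib_left mult_ac)
qed

lemma norm_cis_sum_squared:
  fixes g m :: "'a \<Rightarrow> real"
  shows "(norm (\<Sum>p\<in>Z. of_real (m p) * cis (\<alpha> * g p)))\<^sup>2 = (\<Sum>p\<in>Z. \<Sum>q\<in>Z. m p * m q * cos (\<alpha> * (g p - g q)))"
proof -
  have "(norm (\<Sum>p\<in>Z. of_real (m p) * cis (\<alpha> * g p)))\<^sup>2 =
     (\<Sum>p\<in>Z. m p * cos (\<alpha> * g p))\<^sup>2 + (\<Sum>p\<in>Z. m p * sin (\<alpha> * g p))\<^sup>2"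
    by (simp add: cmod_power2 Re_sum Im_sum)
  also have "\<dots> = (\<Sum>p\<in>Z. \<Sum>q\<in>Z. m p * cos (\<alpha> * g p) * (m q * cos (\<alpha> * g q)) + m p * sin (\<alpha> * g p) * (m q * sin (\<alpha> * g q)))"
    by (simp add: power2_eq_square sum_product sum.distrib)
  also have "\<dots> = (\<Sum>p\<in>Z. \<Sum>q\<in>Z. m p * m q * cos (\<alpha> * (g p - g q)))"
    by (intro sum.cong refl) (simp add: right_diff_distrib cos_diff algebra_simps)
  finally show ?thesis .
qed

lemma tri_avg_bounds:
  fixes g m :: "'a \<Rightarrow> real" and W :: "'a \<Rightarrow> 'a \<Rightarrow> real"
  assumes Z: "finite Z" and h: "h \<ge> 0" and m: "\<And>p. p \<in> Z \<Longrightarrow> m p \<ge> 0"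
    and W: "\<And>p q. 0 \<le> W p q" "\<And>p q. W p q \<le> 1" "\<And>p. W p p = 1"
  defines "G \<equiv> \<lambda>\<alpha>. \<Sum>p\<in>Z. \<Sum>q\<in>Z. m p * m q * W p q * cos (\<alpha> * (g p - g q))"
    and "S \<equiv> \<lambda>\<alpha>. \<Sum>p\<in>Z. of_real (m p) * cis (\<alpha> * g p)"
  shows "tri_avg h \<beta> G \<le> tri_avg h 0 (\<lambda>\<alpha>. (norm (S \<alpha>))\<^sup>2)"
    and "2 * h\<^sup>2 * (\<Sum>p\<in>Z. (m p)\<^sup>2) - tri_avg h 0 (\<lambda>\<alpha>. (norm (S \<alpha>))\<^sup>2) \<le> tri_avg h \<beta> G"
proof -
  have G: "tri_avg h \<beta> G = (\<Sum>p\<in>Z. \<Sum>q\<in>Z. m p * m q * W p q * (cos (\<beta> * (g p - g q)) * fejer h (g p - g q)))"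
    unfolding G_def by (rule tri_avg_cos_sum[OF Z h])
  have S: "tri_avg h 0 (\<lambda>\<alpha>. (norm (S \<alpha>))\<^sup>2) = (\<Sum>p\<in>Z. \<Sum>q\<in>Z. m p * m q * fejer h (g p - g q))"
    unfolding S_def norm_cis_sum_squared by (subst tri_avg_cos_sum[OF Z h]) simp
  have t: "\<bar>W p q * cos (\<beta> * (g p - g q))\<bar> \<le> 1" for p q
    unfolding abs_mult using W(1,2)[of p q] mult_mono[of "\<bar>W p q\<bar>" 1 "\<bar>cos (\<beta> * (g p - g q))\<bar>" 1] by simp
  have pos: "0 \<le> m p * m q * fejer h (g p - g q)" if "p \<in> Z" "q \<in> Z" for p q
    using m that fejer_nonneg by simp
  have eq: "m p * m q * W p q * (cos (\<beta> * (g p - g q)) * fejer h (g p - g q)) =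
      (W p q * cos (\<beta> * (g p - g q))) * (m p * m q * fejer h (g p - g q))" for p q
    by (simp add: mult_ac)
  show "tri_avg h \<beta> G \<le> tri_avg h 0 (\<lambda>\<alpha>. (norm (S \<alpha>))\<^sup>2)"
    unfolding G S eq
  proof (intro sum_mono)
    fix p q assume "p \<in> Z" "q \<in> Z"
    then show "(W p q * cos (\<beta> * (g p - g q))) * (m p * m q * fejer h (g p - g q)) \<le> m p * m q * fejer h (g p - g q)"
      using mult_right_mono[OF order_trans[OF abs_ge_self t] pos] by simp
  qed
  have "2 * h\<^sup>2 * (\<Sum>p\<in>Z. (m p)\<^sup>2) = (\<Sum>p\<in>Z. \<Sum>q\<in>Z. if p = q then 2 * (m p * m q * fejer h (g p - g q)) else 0)"
    using Z by (simp add: sum_distrib_left fejer_def power2_eq_square mult_ac)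
  also have "\<dots> \<le> (\<Sum>p\<in>Z. \<Sum>q\<in>Z. m p * m q * W p q * (cos (\<beta> * (g p - g q)) * fejer h (g p - g q)) +
       m p * m q * fejer h (g p - g q))"
  \<comment> \<open>In the sum of the two double sums each term carries the factor W cos + 1 >= 0,
    which is 2 on the diagonal; dropping all other terms gives the lower bound.\<close>
  proof (intro sum_mono)
    fix p q assume pq: "p \<in> Z" "q \<in> Z"
    have "0 \<le> (W p q * cos (\<beta> * (g p - g q)) + 1) * (m p * m q * fejer h (g p - g q))"
      by (rule mult_nonneg_nonneg[OF _ pos[OF pq]]) (use t[of p q] in \<open>auto simp: abs_le_iff\<close>)
    then show "(if p = q then 2 * (m p * m q * fejer h (g p - g q)) else 0) \<le>
       m p * m q * W p q * (cos (\<beta> * (g p - g q)) * fejer h (g p - g q)) + m p * m q * fejer h (g p - g q)"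
      unfolding eq by (auto simp: W distrib_right)
  qed
  finally show "2 * h\<^sup>2 * (\<Sum>p\<in>Z. (m p)\<^sup>2) - tri_avg h 0 (\<lambda>\<alpha>. (norm (S \<alpha>))\<^sup>2) \<le> tri_avg h \<beta> G"
    unfolding G S sum.distrib by simp
qed

section \<open>The form factor as a weighted cosine sum, and its positivity\<close>

lemma Re_complex_of_real_mult: "Re (of_real a * z) = a * Re z"
  by simp

lemma form_factor_eq_cos_sum:
  assumes "T > 0"
  shows "form_factor \<alpha> T = 2 * pi / (T * ln T) * (\<Sum>p\<in>zeros_upto T. \<Sum>q\<in>zeros_upto T.
     real (zero_mult p) * real (zero_mult q) * pair_weight (Im p - Im q) * cos (\<alpha> * (ln T * Im p - ln T * Im q)))"
proof -
  have "Re (of_nat (zero_mult p * zero_mult q) * of_real T powr (\<i> * of_real (\<alpha> * (Im p - Im q))) *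
        of_real (pair_weight (Im p - Im q))) =
      real (zero_mult p) * real (zero_mult q) * pair_weight (Im p - Im q) * cos (\<alpha> * (ln T * Im p - ln T * Im q))" for p q
  proof -
    have "of_real T powr (\<i> * of_real (\<alpha> * (Im p - Im q))) = cis (\<alpha> * (ln T * Im p - ln T * Im q))"
      using assms by (simp add: powr_def Ln_of_real cis_conv_exp algebra_simps)
    then show ?thesis by (simp add: mult_ac)
  qed
  then show ?thesis
    unfolding form_factor_def form_factor_complex_def Re_complex_of_real_mult Re_sum by (simp only:)
qed

text \<open>\<open>pair_weight\<close> is the Fourier transform of e^(-2|y|), so the double sum is
  the integral over the real line of e^(-2|y|) times the squared modulus of the sum of m_p e^(i(a_p
  + y \<gamma>_p)). \<open>K N\<close> is the transform truncated to [-N, N], where positivity is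
  immediate and from where it passes to the limit.\<close>

lemma weighted_cos_sum_nonneg:
  fixes m a \<gamma> :: "'a \<Rightarrow> real"
  shows "0 \<le> (\<Sum>p\<in>Z. \<Sum>q\<in>Z. m p * m q * pair_weight (\<gamma> p - \<gamma> q) * cos (a p - a q))"
proof -
  define K where "K N v = integral {-N..N} (\<lambda>y. of_real (exp (- 2 * \<bar>y\<bar>)) * cis (y * v))" for N v
  have lim: "((\<lambda>N. K N v) \<longlongrightarrow> of_real (pair_weight v)) at_top" for v
  proof -
    have "((\<lambda>N. K N v - of_real (pair_weight v)) \<longlongrightarrow> 0) at_top"
    proof (rule Lim_null_comparison)
      show "eventually (\<lambda>N. norm (K N v - of_real (pair_weight v)) \<le> 2 * exp (- 2 * N) / 2) at_top"
        using eventually_ge_at_top[of 0]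
      proof eventually_elim
        case (elim N)
        show ?case using poisson_kernel_truncated[of 2 N v] elim by (simp add: K_def pair_weight_def)
      qed
      have "filterlim (\<lambda>N. - 2 * N :: real) at_bot at_top"
        by (intro filterlim_tendsto_neg_mult_at_bot[OF tendsto_const _ filterlim_ident]) auto
      then have "((\<lambda>N. exp (- 2 * N :: real)) \<longlongrightarrow> 0) at_top"
        by (rule filterlim_compose[OF exp_at_bot])
      then show "((\<lambda>N. 2 * exp (- 2 * N) / 2 :: real) \<longlongrightarrow> 0) at_top" by simp
    qed
    then show ?thesis by (simp add: LIM_zero_iff)
  qed
  have contc: "continuous_on A (\<lambda>y. cis (y * v))" for A v
    unfolding cis_conv_exp by (intro continuous_intros)
  have pos: "0 \<le> Re (\<Sum>p\<in>Z. \<Sum>q\<in>Z. of_real (m p * m q) * cis (a p - a q) * K N (\<gamma> p - \<gamma> q))" for N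
  proof (cases "finite Z")
    case True
    define S where "S y = (\<Sum>p\<in>Z. of_real (m p) * cis (a p + y * \<gamma> p))" for y
    have S: "of_real ((norm (S y))\<^sup>2) = (\<Sum>p\<in>Z. \<Sum>q\<in>Z. of_real (m p * m q) * cis (a p - a q) * cis (y * (\<gamma> p - \<gamma> q)))" for y
    proof -
      have "of_real ((norm (S y))\<^sup>2) = (\<Sum>p\<in>Z. of_real (m p) * cis (a p + y * \<gamma> p)) * (\<Sum>q\<in>Z. of_real (m q) * cis (- (a q + y * \<gamma> q)))"
        unfolding complex_norm_square S_def by (simp add: cis_cnj)
      also have "\<dots> = (\<Sum>p\<in>Z. \<Sum>q\<in>Z. of_real (m p * m q) * (cis (a p + y * \<gamma> p) * cis (- (a q + y * \<gamma> q))))"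
        by (simp add: sum_product mult_ac)
      also have "\<dots> = (\<Sum>p\<in>Z. \<Sum>q\<in>Z. of_real (m p * m q) * cis (a p - a q) * cis (y * (\<gamma> p - \<gamma> q)))"
        by (intro sum.cong refl) (simp only: mult.assoc cis_mult, simp add: algebra_simps)
      finally show ?thesis .
    qed
    have "((\<lambda>y. \<Sum>p\<in>Z. \<Sum>q\<in>Z. of_real (m p * m q) * cis (a p - a q) * (of_real (exp (- 2 * \<bar>y\<bar>)) * cis (y * (\<gamma> p - \<gamma> q)))) has_integral
      (\<Sum>p\<in>Z. \<Sum>q\<in>Z. of_real (m p * m q) * cis (a p - a q) * K N (\<gamma> p - \<gamma> q))) {-N..N}"
      unfolding K_def
      by (intro has_integral_sum has_integral_mult_right integrable_integral integrable_continuous_interval continuous_intros contc True)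
    from has_integral_Re[OF this]
    show ?thesis
    proof (rule has_integral_nonneg)
      fix y
      have "(\<Sum>p\<in>Z. \<Sum>q\<in>Z. of_real (m p * m q) * cis (a p - a q) * (of_real (exp (- 2 * \<bar>y\<bar>)) * cis (y * (\<gamma> p - \<gamma> q)))) =
         of_real (exp (- 2 * \<bar>y\<bar>) * (norm (S y))\<^sup>2)"
        unfolding of_real_mult[of "exp _"] S by (simp add: sum_distrib_left mult_ac)
      then show "0 \<le> Re (\<Sum>p\<in>Z. \<Sum>q\<in>Z. of_real (m p * m q) * cis (a p - a q) * (of_real (exp (- 2 * \<bar>y\<bar>)) * cis (y * (\<gamma> p - \<gamma> q))))"
        by (simp only: Re_complex_of_real) simp
    qed
  qed simp
  have "((\<lambda>N. Re (\<Sum>p\<in>Z. \<Sum>q\<in>Z. of_real (m p * m q) * cis (a p - a q) * K N (\<gamma> p - \<gamma> q))) \<longlongrightarrow>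
      Re (\<Sum>p\<in>Z. \<Sum>q\<in>Z. of_real (m p * m q) * cis (a p - a q) * of_real (pair_weight (\<gamma> p - \<gamma> q)))) at_top"
    by (intro tendsto_intros lim)
  then have "0 \<le> Re (\<Sum>p\<in>Z. \<Sum>q\<in>Z. of_real (m p * m q) * cis (a p - a q) * of_real (pair_weight (\<gamma> p - \<gamma> q)))"
    by (rule tendsto_lowerbound) (use pos in auto)
  also have "\<dots> = (\<Sum>p\<in>Z. \<Sum>q\<in>Z. m p * m q * pair_weight (\<gamma> p - \<gamma> q) * cos (a p - a q))"
    by (simp add: Re_sum mult_ac)
  finally show ?thesis .
qed

lemma form_factor_nonneg:
  assumes "T > 1"
  shows "form_factor \<alpha> T \<ge> 0"
  using weighted_cos_sum_nonneg[of "\<lambda>p. real (zero_mult p)" "Im" "\<lambda>p. \<alpha> * (ln T * Im p)" "zeros_upto T"] assms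
  by (subst form_factor_eq_cos_sum) (auto simp: right_diff_distrib intro!: mult_nonneg_nonneg)

lemma continuous_on_form_factor: "continuous_on A (\<lambda>\<alpha>. form_factor \<alpha> T)"
proof -
  have "continuous_on A (\<lambda>\<alpha>. of_real T powr (\<i> * of_real (\<alpha> * c)) :: complex)" for c
    unfolding powr_def by (cases "T = 0") (auto intro!: continuous_intros)
  then show ?thesis
    unfolding form_factor_def form_factor_complex_def
    by (intro continuous_on_Re continuous_on_mult continuous_on_sum continuous_on_const)
qed

section \<open>Sums over prime powers\<close>

text \<open>Legendre's formula: ln n is the sum of the von Mangoldt function over the divisors of n,
  and d divides N div d of the numbers up to N.\<close>

lemma sum_mangoldt_floor:
  fixes N :: nat
  shows "(\<Sum>d=1..N. mangoldt d * real (N div d)) = ln (fact N)"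
proof -
  have card: "card {n\<in>{1..N}. d dvd n} = N div d" if "d \<in> {1..N}" for d
  proof -
    have "{n\<in>{1..N}. d dvd n} = (\<lambda>k. d * k) ` {1..N div d}"
    proof (intro equalityI subsetI)
      fix n assume n: "n \<in> {n\<in>{1..N}. d dvd n}"
      then obtain k where k: "n = d * k" by auto
      with n that have "k \<in> {1..N div d}"
        by (auto simp: less_eq_div_iff_mult_less_eq mult.commute Suc_le_eq intro!: Nat.gr0I)
      then show "n \<in> (\<lambda>k. d * k) ` {1..N div d}" using k by auto
    next
      fix n assume "n \<in> (\<lambda>k. d * k) ` {1..N div d}"
      then show "n \<in> {n\<in>{1..N}. d dvd n}"
        using that by (auto simp: less_eq_div_iff_mult_less_eq mult.commute Suc_le_eq)
    qed
    moreover have "inj_on (\<lambda>k. d * k) {1..N div d}" using that by (auto simp: inj_on_def)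
    ultimately show ?thesis by (simp add: card_image)
  qed
  have "ln (fact N :: real) = (\<Sum>n=1..N. ln (real n))"
    unfolding fact_prod of_nat_prod by (subst ln_prod) auto
  also have "\<dots> = (\<Sum>n=1..N. \<Sum>d | d dvd n. mangoldt d)"
    by (intro sum.cong refl) (subst mangoldt_sum, auto)
  also have "\<dots> = (\<Sum>n=1..N. \<Sum>d | d \<in> {1..N} \<and> d dvd n. mangoldt d)"
  proof (intro sum.cong refl Collect_cong)
    fix n d assume n: "n \<in> {1..N}"
    have "d \<le> n" "d \<noteq> 0" if "d dvd n" using that n by (auto dest: dvd_imp_le)
    then show "d dvd n \<longleftrightarrow> d \<in> {1..N} \<and> d dvd n" using n by auto
  qed
  also have "\<dots> = (\<Sum>d=1..N. \<Sum>n | n \<in> {1..N} \<and> d dvd n. mangoldt d)"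
    by (rule sum.swap_restrict) auto
  also have "\<dots> = (\<Sum>d=1..N. mangoldt d * real (N div d))"
    using card by (intro sum.cong refl) (simp add: mult.commute)
  finally show ?thesis ..
qed

text \<open>Chebyshev's argument. The central binomial coefficient is at most 4^m, and by Legendre's
  formula its logarithm counts each d in (m, 2m] once and no d negatively. Strong induction then
  halves N; an odd N costs one further term, at most ln N, and 4m + 2m + N <= 4N closes the
  induction.\<close>

lemma sum_mangoldt_le: "(\<Sum>d=1..N. mangoldt d) \<le> 4 * real N"
proof (induction N rule: less_induct)
  case (less N)
  show ?case
  proof (cases "N = 0")
    case False
    define m where "m = N div 2"
    have "(\<Sum>d=1..2*m. mangoldt d * real (2 * m div d)) - 2 * (\<Sum>d=1..m. mangoldt d * real (m div d))
        = ln (fact (2 * m)) - 2 * ln (fact m)"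
      by (simp only: sum_mangoldt_floor)
    also have "\<dots> = ln (real (2 * m choose m))"
    proof -
      have "real (2 * m choose m) = fact (2 * m) / (fact m * fact m)"
        using binomial_fact[of m "2 * m", where 'a = real] by (simp add: mult_2)
      then show ?thesis by (simp only: ln_div ln_mult) (simp del: fact_Suc)
    qed
    also have "\<dots> \<le> ln (2 ^ (2 * m))"
    proof -
      have "real (2 * m choose m) \<le> real (2 ^ (2 * m))"
        using binomial_le_pow2[of "2 * m" m] by (simp only: of_nat_le_iff)
      moreover have "0 < real (2 * m choose m)" by (simp add: zero_less_binomial_iff)
      ultimately show ?thesis by (subst ln_le_cancel_iff) simp_all
    qed
    also have "\<dots> = 2 * real m * ln 2" by (subst ln_realpow) auto
    finally have 1: "(\<Sum>d=1..2*m. mangoldt d * real (2 * m div d)) - 2 * (\<Sum>d=1..m. mangoldt d * real (m div d))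
      \<le> 2 * real m * ln 2" .
    have 2: "(\<Sum>d=1..m. mangoldt d * real (m div d)) = (\<Sum>d=1..2*m. mangoldt d * real (m div d))"
      by (rule sum.mono_neutral_left) auto
    have "(\<Sum>d=Suc m..2*m. mangoldt d) \<le> (\<Sum>d=Suc m..2*m. mangoldt d * (real (2 * m div d) - 2 * real (m div d)))"
    proof (intro sum_mono)
      fix d assume d: "d \<in> {Suc m..2*m}"
      then have "m div d = 0" "2 * m div d \<ge> 1" by (auto simp: less_eq_div_iff_mult_less_eq)
      then show "mangoldt d \<le> (mangoldt d * (real (2 * m div d) - 2 * real (m div d)) :: real)"
        using mangoldt_nonneg[of d] by (simp add: mult_le_cancel_left1)
    qed
    also have "\<dots> \<le> (\<Sum>d=1..2*m. mangoldt d * (real (2 * m div d) - 2 * real (m div d)))"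
    proof (intro sum_mono2)
      fix d assume "d \<in> {1..2 * m} - {Suc m..2 * m}"
      have "2 * (m div d) \<le> 2 * m div d"
        using \<open>d \<in> {1..2 * m} - {Suc m..2 * m}\<close>
        by (subst less_eq_div_iff_mult_less_eq) (auto simp: mult.assoc)
      then have "2 * real (m div d) \<le> real (2 * m div d)"
        by (metis of_nat_le_iff of_nat_mult of_nat_numeral)
      then show "0 \<le> mangoldt d * (real (2 * m div d) - 2 * real (m div d))"
        using mangoldt_nonneg[of d] by simp
    qed auto
    also have "\<dots> \<le> 2 * real m * ln 2"
      using 1 unfolding 2 by (simp add: algebra_simps sum_subtractf sum_distrib_left)
    finally have 3: "(\<Sum>d=Suc m..2*m. mangoldt d) \<le> 2 * real m * ln 2" .
    have 4: "(\<Sum>d=1..m. mangoldt d) \<le> 4 * real m"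
      using False by (intro less.IH) (auto simp: m_def)
    have N: "N = 2 * m \<or> N = Suc (2 * m)" unfolding m_def by linarith
    have "(\<Sum>d=1..N. mangoldt d) \<le> (\<Sum>d=1..2*m. mangoldt d) + ln (real N)"
    proof -
      have "mangoldt (Suc (2*m)) \<le> ln (real (Suc (2 * m)))" by (rule mangoldt_le) simp
      moreover have "ln (real N) \<ge> 0" using False by simp
      ultimately show ?thesis using N by auto
    qed
    also have "{1..2*m} = {1..m} \<union> {Suc m..2*m}" by auto
    also have "(\<Sum>d\<in>{1..m} \<union> {Suc m..2*m}. mangoldt d :: real) = (\<Sum>d=1..m. mangoldt d) + (\<Sum>d=Suc m..2*m. mangoldt d)"
      by (rule sum.union_disjoint) auto
    also have "\<dots> + ln (real N) \<le> 4 * real m + 2 * real m * ln 2 + (real N - 1)"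
      using 3 4 ln_le_minus_one[of "real N"] False by simp
    also have "\<dots> \<le> 4 * real m + 2 * real m * 1 + real N"
      using ln_2_less_1 by (intro add_mono mult_left_mono) auto
    also have "\<dots> \<le> 4 * real N" using N by auto
    finally show ?thesis by simp
  qed simp
qed

section \<open>Mertens' theorem for the von Mangoldt function\<close>

lemma ln_fact_ge: "N \<ge> 1 \<Longrightarrow> real N * ln (real N) - real N \<le> ln (fact N)"
proof (induction N rule: nat_induct_at_least)
  case (Suc n)
  have "real n * (ln (real (Suc n)) - ln (real n)) \<le> 1"
  proof -
    have "ln (real (Suc n)) - ln (real n) = ln (1 + 1 / real n)"
      using Suc.hyps by (subst ln_divide_pos[symmetric]) (auto simp: field_simps)
    also have "\<dots> \<le> 1 / real n" using ln_add_one_self_le_self[of "1 / real n"] by simp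
    finally show ?thesis using Suc by (simp add: field_simps)
  qed
  moreover have "ln (fact (Suc n) :: real) = ln (real (Suc n)) + ln (fact n)"
    by (simp add: ln_mult)
  ultimately show ?case using Suc.IH by (simp add: algebra_simps)
qed simp

lemma ln_fact_le:
  assumes "N \<ge> 1" shows "ln (fact N) \<le> real N * ln (real N)"
proof -
  have "ln (fact N :: real) \<le> ln (real N ^ N)"
    using assms fact_le_power[of N, where 'a = real] by (subst ln_le_cancel_iff) auto
  then show ?thesis using assms by (simp add: ln_realpow)
qed

lemma ln_le_iff_le_exp: "0 < x \<Longrightarrow> ln x \<le> v \<longleftrightarrow> x \<le> exp (v::real)"
  by (metis exp_le_cancel_iff exp_ln)

text \<open>Both bounds compare N times the sum with ln N! through Legendre's formula. Rounding N/d
  down loses less than 1 per term, hence at most 4N in total by Chebyshev's bound: this is the 4.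
  The 1 is the linear term in ln N! >= N ln N - N.\<close>

lemma mertens_sum_mangoldt:
  assumes "N \<ge> 1"
  shows "(\<Sum>d=1..N. mangoldt d / real d) \<le> ln (real N) + 4"
    and "ln (real N) - 1 \<le> (\<Sum>d=1..N. mangoldt d / real d)"
proof -
  have "real N * (\<Sum>d=1..N. mangoldt d / real d) - (\<Sum>d=1..N. mangoldt d)
      = (\<Sum>d=1..N. mangoldt d * (real N / real d - 1))"
    by (simp add: algebra_simps sum_subtractf sum_distrib_left)
  also have "\<dots> \<le> (\<Sum>d=1..N. mangoldt d * real (N div d))"
  proof (intro sum_mono mult_left_mono mangoldt_nonneg)
    fix d assume d: "d \<in> {1..N}"
    have "real N / real d < real (N div d) + 1"
      using d floor_divide_of_nat_eq[of N d, where 'a = real] floor_correct[of "real N / real d"] by simp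
    then show "real N / real d - 1 \<le> real (N div d)" by simp
  qed
  also have "\<dots> \<le> real N * ln (real N)"
    unfolding sum_mangoldt_floor using assms by (rule ln_fact_le)
  finally have "real N * (\<Sum>d=1..N. mangoldt d / real d) \<le> real N * (ln (real N) + 4)"
    using sum_mangoldt_le[of N] by (simp add: algebra_simps)
  then show "(\<Sum>d=1..N. mangoldt d / real d) \<le> ln (real N) + 4"
    using assms by simp
  have "real N * (ln (real N) - 1) \<le> ln (fact N)"
    using ln_fact_ge[OF assms] by (simp add: algebra_simps)
  also have "\<dots> = (\<Sum>d=1..N. mangoldt d * real (N div d))"
    by (simp only: sum_mangoldt_floor)
  also have "\<dots> \<le> (\<Sum>d=1..N. mangoldt d * (real N / real d))"
    by (intro sum_mono mult_left_mono mangoldt_nonneg of_nat_div_le_of_nat)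
  also have "\<dots> = real N * (\<Sum>d=1..N. mangoldt d / real d)"
    by (simp add: sum_distrib_left mult_ac)
  finally show "ln (real N) - 1 \<le> (\<Sum>d=1..N. mangoldt d / real d)"
    using assms by simp
qed

lemma sum_mangoldt_exp_bound:
  assumes "v \<ge> 0"
  shows "\<bar>(\<Sum>n | 1 \<le> n \<and> ln (real n) \<le> v. mangoldt n / real n) - v\<bar> \<le> 4"
proof -
  define N where "N = nat \<lfloor>exp v\<rfloor>"
  have ev: "exp v \<ge> 1" using assms by simp
  have N: "real N \<le> exp v" "exp v < real N + 1" "N \<ge> 1"
    unfolding N_def using ev by linarith+
  have eq: "{n. 1 \<le> n \<and> ln (real n) \<le> v} = {1..N}"
  proof -
    have "ln (real n) \<le> v \<longleftrightarrow> n \<le> N" if "n \<ge> 1" for n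
    proof -
      have "ln (real n) \<le> v \<longleftrightarrow> real n \<le> exp v"
        using that by (intro ln_le_iff_le_exp) auto
      also have "\<dots> \<longleftrightarrow> n \<le> N" using N by linarith
      finally show ?thesis .
    qed
    then show ?thesis by auto
  qed
  have "ln (real N) \<le> v" using N by (subst ln_le_iff_le_exp) auto
  moreover have "v - 1 \<le> ln (real N)"
  proof -
    have "exp v \<le> exp 1 * real N"
    proof -
      have "2 * real N \<le> exp 1 * real N" using exp_ge_add_one_self[of 1] by (intro mult_right_mono) auto
      then show ?thesis using N by linarith
    qed
    then have "v \<le> ln (exp 1 * real N)"
      using N by (subst ln_ge_iff) auto
    then show ?thesis using N by (subst (asm) ln_mult) auto
  qed
  moreover note mertens_sum_mangoldt[OF N(3)]
  ultimately show ?thesis unfolding eq by linarith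
qed

lemma finite_ln_le: "finite {n::nat. 1 \<le> n \<and> ln (real n) \<le> v}"
proof (rule finite_subset)
  show "{n::nat. 1 \<le> n \<and> ln (real n) \<le> v} \<subseteq> {..nat \<lceil>exp v\<rceil>}"
  proof
    fix n :: nat assume "n \<in> {n. 1 \<le> n \<and> ln (real n) \<le> v}"
    then have n: "n \<ge> 1" "ln (real n) \<le> v" by auto
    then have "real n \<le> exp v"
      by (subst (asm) ln_le_iff_le_exp) auto
    then show "n \<in> {..nat \<lceil>exp v\<rceil>}" by (simp add: le_nat_iff nat_le_iff) linarith
  qed
qed simp

text \<open>Abel summation, carried out as an exchange of sum and integral: \<phi>(ln n) is the
  integral of -\<phi>' from ln n to V because \<phi>(V) = 0, so the sum equals the integral of (2v/V
  - 1) M(v) over [0, V]. Mertens' theorem gives M(v) = v up to 4; the weight is at most 1 in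
  modulus, so the error is at most 4V, and the main term integrates to V^2/6.\<close>

lemma sum_mangoldt_triangle:
  assumes V: "V > 0"
  shows "(\<Sum>n | 1 \<le> n \<and> ln (real n) \<le> V. mangoldt n * ln (real n) / real n * (1 - ln (real n) / V))
         \<le> V\<^sup>2 / 6 + 4 * V"
proof -
  define A where "A = {n::nat. 1 \<le> n \<and> ln (real n) \<le> V}"
  have fin: "finite A" unfolding A_def by (rule finite_ln_le)
  define \<phi> where "\<phi> v = v * (1 - v / V)" for v
  have piece: "((\<lambda>v. (2 * v / V - 1) * (if ln (real n) \<le> v then mangoldt n / real n else 0))
      has_integral mangoldt n / real n * \<phi> (ln (real n))) {0..V}" if "n \<in> A" for n
  proof -
    have n: "0 \<le> ln (real n)" "ln (real n) \<le> V" using that by (auto simp: A_def)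
    have "((\<lambda>v. 2 * v / V - 1) has_integral (- \<phi> V - (- \<phi> (ln (real n))))) {ln (real n)..V}"
      using n V unfolding \<phi>_def
      by (intro fundamental_theorem_of_calculus)
         (auto intro!: derivative_eq_intros simp: has_real_derivative_iff_has_vector_derivative[symmetric] field_simps)
    then have "((\<lambda>v. (2 * v / V - 1) * (mangoldt n / real n)) has_integral (\<phi> (ln (real n)) * (mangoldt n / real n))) {ln (real n)..V}"
      using V by (intro has_integral_mult_left) (simp add: \<phi>_def)
    then have "((\<lambda>v. if v \<in> {ln (real n)..V} then (2 * v / V - 1) * (mangoldt n / real n) else 0) has_integral (\<phi> (ln (real n)) * (mangoldt n / real n))) {0..V}"
      using n by (subst has_integral_restrict) auto
    then show ?thesis
      by (rule has_integral_eq_rhs[OF has_integral_eq, rotated]) (auto simp: mult.commute)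
  qed
  have tot: "((\<lambda>v. \<Sum>n\<in>A. (2 * v / V - 1) * (if ln (real n) \<le> v then mangoldt n / real n else 0))
      has_integral (\<Sum>n\<in>A. mangoldt n / real n * \<phi> (ln (real n)))) {0..V}"
    by (intro has_integral_sum fin piece)
  have bnd: "((\<lambda>v. (2 * v / V - 1) * v + 4) has_integral
      ((2 * V^3 / (3 * V) - V\<^sup>2 / 2 + 4 * V) - (2 * 0^3 / (3 * V) - 0\<^sup>2 / 2 + 4 * 0))) {0..V}"
    using V by (intro fundamental_theorem_of_calculus)
       (auto intro!: derivative_eq_intros simp: has_real_derivative_iff_has_vector_derivative[symmetric] field_simps power2_eq_square)
  have "(\<Sum>n\<in>A. mangoldt n / real n * \<phi> (ln (real n))) \<le>
      ((2 * V^3 / (3 * V) - V\<^sup>2 / 2 + 4 * V) - (2 * 0^3 / (3 * V) - 0\<^sup>2 / 2 + 4 * 0))"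
  proof (rule has_integral_le[OF tot bnd])
    fix v assume v: "v \<in> {0..V}"
    define M where "M = (\<Sum>n | 1 \<le> n \<and> ln (real n) \<le> v. mangoldt n / real n)"
    have "(\<Sum>n\<in>A. (2 * v / V - 1) * (if ln (real n) \<le> v then mangoldt n / real n else 0))
        = (2 * v / V - 1) * (\<Sum>n\<in>A. if ln (real n) \<le> v then mangoldt n / real n else 0)"
      by (simp add: sum_distrib_left)
    also have "(\<Sum>n\<in>A. if ln (real n) \<le> v then mangoldt n / real n else 0) = M"
      unfolding M_def using v by (subst sum.inter_filter[OF fin, symmetric]) (auto simp: A_def intro!: sum.cong)
    also have "(2 * v / V - 1) * M \<le> (2 * v / V - 1) * v + 4"
    proof -
      have a: "\<bar>2 * v / V - 1\<bar> \<le> 1" using v V by (auto simp: abs_le_iff field_simps)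
      have "\<bar>(2 * v / V - 1) * (M - v)\<bar> \<le> 1 * 4"
        unfolding abs_mult M_def using a sum_mangoldt_exp_bound[of v] v by (intro mult_mono) auto
      moreover have "(2 * v / V - 1) * M = (2 * v / V - 1) * v + (2 * v / V - 1) * (M - v)"
        by (simp add: right_diff_distrib)
      ultimately show ?thesis by (simp only: abs_le_iff) linarith
    qed
    finally show "(\<Sum>n\<in>A. (2 * v / V - 1) * (if ln (real n) \<le> v then mangoldt n / real n else 0)) \<le> (2 * v / V - 1) * v + 4" .
  qed
  also have "\<dots> = V\<^sup>2 / 6 + 4 * V" using V by (simp add: field_simps power3_eq_cube power2_eq_square)
  finally show ?thesis by (simp add: A_def \<phi>_def mult_ac)
qed

section \<open>Digamma and logarithmic derivatives\<close>

text \<open>Taylor expansion of Ln along a horizontal unit segment. The second derivative -1/w^2 is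
  controlled by the distance of the segment from 0, which is at least |Im z|, and is attained at the
  left end if the segment lies in the closed right half-plane.\<close>

lemma Ln_diff_minus_inverse_bound:
  assumes "Im z \<noteq> 0"
  shows "norm (Ln (z + of_real x + 1) - Ln (z + of_real x) - inverse (z + of_real x)) \<le>
     1 / ((Im z)\<^sup>2) "
    and "x + Re z \<ge> 0 \<Longrightarrow> norm (Ln (z + of_real x + 1) - Ln (z + of_real x) - inverse (z + of_real x)) \<le>
     1 / ((Im z)\<^sup>2 + (x + Re z)\<^sup>2)"
proof -
  define S where "S = closed_segment (z + of_real x) (z + of_real x + 1)"
  have S: "\<exists>y. w = z + of_real y \<and> x \<le> y \<and> y \<le> x + 1" if w: "w \<in> S" for w
  proof -
    from w obtain u where u: "w = (1 - u) *\<^sub>R (z + of_real x) + u *\<^sub>R (z + of_real x + 1)" "0 \<le> u" "u \<le> 1"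
      unfolding S_def closed_segment_def by blast
    then have "w = z + of_real (x + u)" by (auto simp: scaleR_conv_of_real algebra_simps)
    then show ?thesis using u by (intro exI[of _ "x + u"]) auto
  qed
  define f where "f i w = (if i = 0 then Ln w else if i = (1::nat) then inverse w else - inverse (w\<^sup>2))" for i w
  have gen: "norm (f 0 (z + of_real x + 1) - (\<Sum>i\<le>1. f i (z + of_real x) * ((z + of_real x + 1) - (z + of_real x)) ^ i / fact i)) \<le>
      B * norm ((z + of_real x + 1) - (z + of_real x)) ^ Suc 1 / fact 1"
    if B: "\<And>y. x \<le> y \<Longrightarrow> norm (inverse ((z + of_real y)\<^sup>2)) \<le> B" for B
  proof (rule complex_Taylor[where S = S])
    fix i w assume w: "w \<in> S" "i \<le> (1::nat)"
    then obtain y where y: "w = z + of_real y" using S by blast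
    have "w \<notin> \<real>\<^sub>\<le>\<^sub>0" "w \<noteq> 0" using assms y by (auto simp: complex_nonpos_Reals_iff complex_eq_iff)
    then show "(f i has_field_derivative f (Suc i) w) (at w within S)"
      using w unfolding f_def
      by (cases "i = 0") (auto intro!: derivative_eq_intros simp: power2_eq_square field_simps)
  next
    fix w assume "w \<in> S"
    then obtain y where "w = z + of_real y" "x \<le> y" using S by blast
    then show "norm (f (Suc 1) w) \<le> B" using B[of y] by (simp add: f_def)
  qed (auto simp: S_def)
  have nrm: "norm (inverse ((z + of_real y)\<^sup>2)) = 1 / ((Im z)\<^sup>2 + (y + Re z)\<^sup>2)" for y
    by (simp add: norm_inverse norm_power cmod_power2 add.commute divide_inverse)
  have pos: "(Im z)\<^sup>2 > 0" using assms by simp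
  show "norm (Ln (z + of_real x + 1) - Ln (z + of_real x) - inverse (z + of_real x)) \<le> 1 / ((Im z)\<^sup>2)"
    using gen[of "1 / ((Im z)\<^sup>2)"] pos
    by (simp add: f_def nrm divide_left_mono add_pos_nonneg diff_diff_eq)
  show "norm (Ln (z + of_real x + 1) - Ln (z + of_real x) - inverse (z + of_real x)) \<le>
     1 / ((Im z)\<^sup>2 + (x + Re z)\<^sup>2)" if "x + Re z \<ge> 0"
  proof -
    have "norm (inverse ((z + of_real y)\<^sup>2)) \<le> 1 / ((Im z)\<^sup>2 + (x + Re z)\<^sup>2)" if "x \<le> y" for y
      unfolding nrm using pos that \<open>x + Re z \<ge> 0\<close>
      by (intro divide_left_mono add_left_mono power_mono mult_pos_pos add_pos_nonneg) auto
    from gen[OF this] show ?thesis by (simp add: f_def diff_diff_eq)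
  qed
qed

text \<open>Inserting the telescoping differences of Ln into the limit formula for Digamma leaves Ln
  z plus the Taylor remainders e n. These are summable uniformly in z: the distance from the real
  axis handles the first four, and since Re z >= -2 the decay in n handles the others. Passing from
  Ln z to ln |z| costs the imaginary part, at most pi.\<close>

lemma Digamma_bound:
  "\<exists>C. \<forall>z. \<bar>Re z\<bar> \<le> 2 \<and> \<bar>Im z\<bar> \<ge> 1 / 2 \<longrightarrow> norm (Digamma z - of_real (ln (norm z))) \<le> C"
proof -
  define u where "u n = (if n < 4 then 4 else 1 / (real n - 2)\<^sup>2)" for n :: nat
  have "summable (\<lambda>n. 1 / real (Suc n) ^ 2)" 
    using inverse_squares_sums sums_summable by (simp add: add.commute)
  then have "summable (\<lambda>n. 1 / (real (n + 3) - 2)\<^sup>2)"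
    by (simp add: add.commute)
  then have summ3: "summable (\<lambda>n. 1 / (real n - 2)\<^sup>2)"
    by (subst (asm) summable_iff_shift)
  have "summable u"
    by (rule summable_cong[THEN iffD1, OF _ summ3]) (auto simp: u_def eventually_sequentially intro!: exI[of _ 4])
  define U where "U = suminf u"
  have u0: "u n \<ge> 0" for n by (simp add: u_def)
  show ?thesis
  proof (intro exI[of _ "U + pi"] allI impI)
    fix z :: complex assume z: "\<bar>Re z\<bar> \<le> 2 \<and> \<bar>Im z\<bar> \<ge> 1 / 2"
    then have im: "Im z \<noteq> 0" by auto
    define e where "e n = Ln (z + of_nat n + 1) - Ln (z + of_nat n) - inverse (z + of_nat n)" for n
    have im2: "(Im z)\<^sup>2 \<ge> 1 / 4"
      using z power_mono[of "1/2" "\<bar>Im z\<bar>" 2] by (simp add: power2_eq_square)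
    have e: "norm (e n) \<le> u n" for n
    proof (cases "n < 4")
      case True
      have "norm (e n) \<le> 1 / (Im z)\<^sup>2"
        using Ln_diff_minus_inverse_bound(1)[OF im, of "real n"] by (simp add: e_def)
      also have "\<dots> \<le> 1 / (1 / 4)" using im2 by (intro divide_left_mono) auto
      finally show ?thesis using True by (simp add: u_def)
    next
      case False
      have "norm (e n) \<le> 1 / ((Im z)\<^sup>2 + (real n + Re z)\<^sup>2)"
        using Ln_diff_minus_inverse_bound(2)[OF im, of "real n"] z False by (simp add: e_def abs_le_iff)
      also have "\<dots> \<le> 1 / (real n - 2)\<^sup>2"
      proof (intro divide_left_mono)
        have "(real n - 2)\<^sup>2 \<le> (real n + Re z)\<^sup>2" using z False by (intro power_mono) auto
        then show "(real n - 2)\<^sup>2 \<le> (Im z)\<^sup>2 + (real n + Re z)\<^sup>2" by (simp add: add_increasing)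
        show "0 < ((Im z)\<^sup>2 + (real n + Re z)\<^sup>2) * (real n - 2)\<^sup>2"
          using im False by (intro mult_pos_pos add_pos_nonneg) auto
      qed auto
      finally show ?thesis using False by (simp add: u_def)
    qed
    have part: "(\<Sum>n<m. inverse (z + of_nat n)) = Ln (z + of_nat m) - Ln z - (\<Sum>n<m. e n)" for m
      by (induction m) (auto simp: e_def algebra_simps)
    have sume: "norm (\<Sum>n<m. e n) \<le> U" for m
    proof -
      have "norm (\<Sum>n<m. e n) \<le> (\<Sum>n<m. u n)" by (rule sum_norm_le) (rule e)
      also have "\<dots> \<le> U" unfolding U_def using \<open>summable u\<close> u0 by (intro sum_le_suminf) auto
      finally show ?thesis .
    qed
    have "z \<noteq> 0" using im by auto
    have lim1: "(\<lambda>m. of_real (ln (real m)) - (\<Sum>n<m. inverse (z + of_nat n))) \<longlonglongrightarrow> Digamma z"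
      by (rule Digamma_LIMSEQ) fact
    have lim2: "(\<lambda>m. Ln (z + of_nat m) - of_real (ln (real m))) \<longlonglongrightarrow> 0"
    proof (rule Lim_transform_eventually)
      have "(\<lambda>m. Ln (1 + z / of_nat m)) \<longlonglongrightarrow> Ln (1 + 0)"
        by (intro tendsto_intros lim_const_over_n) auto
      then show "(\<lambda>m. Ln (1 + z / of_nat m)) \<longlonglongrightarrow> 0" by simp
      show "eventually (\<lambda>m. Ln (1 + z / of_nat m) = Ln (z + of_nat m) - of_real (ln (real m))) sequentially"
        using eventually_gt_at_top[of 0]
      proof eventually_elim
        case (elim m)
        have "z + of_nat m = of_real (real m) * (1 + z / of_nat m)"
          using elim by (simp add: field_simps)
        moreover have "1 + z / of_nat m \<noteq> 0"
          using im elim by (auto simp: complex_eq_iff Im_divide_of_nat)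
        ultimately show ?case
          using elim Ln_times_of_real[of "real m" "1 + z / of_nat m"] by simp
      qed
    qed
    have "(\<lambda>m. (of_real (ln (real m)) - (\<Sum>n<m. inverse (z + of_nat n))) + (Ln (z + of_nat m) - of_real (ln (real m)))) \<longlonglongrightarrow> Digamma z + 0"
      by (intro tendsto_add lim1 lim2)
    then have "(\<lambda>m. Ln z + (\<Sum>n<m. e n)) \<longlonglongrightarrow> Digamma z"
      by (simp add: part)
    then have "(\<lambda>m. norm (Ln z + (\<Sum>n<m. e n) - of_real (ln (norm z)))) \<longlonglongrightarrow> norm (Digamma z - of_real (ln (norm z)))"
      by (intro tendsto_intros)
    then show "norm (Digamma z - of_real (ln (norm z))) \<le> U + pi"
    proof (rule LIMSEQ_le_const2, intro exI[of _ 0] allI impI)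
      fix m
      have "norm (Ln z - of_real (ln (norm z))) \<le> pi"
      proof -
        have "Ln z - of_real (ln (norm z)) = \<i> * of_real (Im (Ln z))"
          using \<open>z \<noteq> 0\<close> by (simp add: complex_eq_iff)
        then show ?thesis using mpi_less_Im_Ln[OF \<open>z \<noteq> 0\<close>] Im_Ln_le_pi[OF \<open>z \<noteq> 0\<close>]
          by (simp add: norm_mult abs_le_iff)
      qed
      then show "norm (Ln z + (\<Sum>n<m. e n) - of_real (ln (norm z))) \<le> U + pi"
        using sume[of m] norm_triangle_ineq[of "Ln z - of_real (ln (norm z))" "\<Sum>n<m. e n"] by (simp add: algebra_simps)
    qed
  qed
qed

section \<open>Zeros and logarithmic derivatives of holomorphic functions on discs\<close>

lemma holomorphic_factor_out_zeros:
  assumes S: "open S" "connected S" and f: "f holomorphic_on S" and w: "w \<in> S" "f w \<noteq> 0"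
    and Z: "finite Z" "Z \<subseteq> S"
  shows "\<exists>g. g holomorphic_on S \<and> (\<forall>z\<in>S. f z = g z * (\<Prod>p\<in>Z. (z - p) ^ nat (zorder f p))) \<and> (\<forall>p\<in>Z. g p \<noteq> 0)"
  using Z
proof (induction Z rule: finite_induct)
  case (insert a Z)
  then obtain g where g: "g holomorphic_on S" "\<And>z. z \<in> S \<Longrightarrow> f z = g z * (\<Prod>p\<in>Z. (z - p) ^ nat (zorder f p))"
    "\<And>p. p \<in> Z \<Longrightarrow> g p \<noteq> 0" by auto
  define P where "P z = (\<Prod>p\<in>Z. (z - p) ^ nat (zorder f p))" for z
  have a: "a \<in> S" "a \<notin> Z" using insert by auto
  have Pa: "P a \<noteq> 0" using insert a by (auto simp: P_def)
  have P_hol: "P holomorphic_on A" for A unfolding P_def by (intro holomorphic_intros)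
  have gw: "g w \<noteq> 0" using g(2)[of w] w by auto
  define n where "n = nat (zorder g a)"
  define h where "h = zor_poly g a"
  have *: "(if g a = 0 then zorder g a > 0 else zorder g a = 0) \<and> (\<exists>r. r > 0 \<and> cball a r \<subseteq> S \<and> h holomorphic_on cball a r
    \<and> (\<forall>w\<in>cball a r. g w = h w * (w - a) ^ n \<and> h w \<noteq> 0))"
    unfolding h_def n_def using g(1) S a w gw by (intro zorder_exist_zero[of g S a]) auto
  then have n0: "zorder g a = int n" by (auto simp: n_def split: if_splits)
  from * obtain r where r: "r > 0" "cball a r \<subseteq> S" "h holomorphic_on cball a r"
    "\<And>w. w \<in> cball a r \<Longrightarrow> g w = h w * (w - a) ^ n \<and> h w \<noteq> 0" by auto
  \<comment> \<open>The factors removed so far do not vanish at a, so f and the quotient g have the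
    same order there.\<close>
  have zf: "zorder f a = int n"
  proof (rule zorder_eqI[of "ball a r" _ "\<lambda>z. h z * P z"])
    show "(\<lambda>z. h z * P z) holomorphic_on ball a r"
      using r(3) by (intro holomorphic_intros P_hol) (auto intro: holomorphic_on_subset)
    show "h a * P a \<noteq> 0" using r Pa by auto
    fix z assume z: "z \<in> ball a r" "z \<noteq> a"
    then have "z \<in> cball a r" "z \<in> S" using r by auto
    then have "f z = (h z * (z - a) ^ n) * P z" using g(2)[of z] r(4)[of z] by (simp add: P_def)
    then show "f z = h z * P z * (z - a) powi int n" by simp
  qed (use r in auto)
  define G where "G z = (if z = a then h a else g z / (z - a) ^ n)" for z
  have Gh: "G z = h z" if "z \<in> cball a r" for z
    using r(4)[OF that] by (auto simp: G_def)
  have "G holomorphic_on (S - {a}) \<union> ball a r"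
  proof (rule holomorphic_on_Un)
    have "(\<lambda>z. g z / (z - a) ^ n) holomorphic_on S - {a}"
      using g(1) by (intro holomorphic_intros) (auto intro: holomorphic_on_subset)
    then show "G holomorphic_on S - {a}"
      by (rule holomorphic_transform) (auto simp: G_def)
    have "h holomorphic_on ball a r" using r(3) by (rule holomorphic_on_subset) auto
    then show "G holomorphic_on ball a r"
      by (rule holomorphic_transform) (use Gh in auto)
  qed (use S in auto)
  moreover have "(S - {a}) \<union> ball a r = S" using r a by auto
  ultimately have "G holomorphic_on S" by simp
  moreover have "f z = G z * (\<Prod>p\<in>insert a Z. (z - p) ^ nat (zorder f p))" if "z \<in> S" for z
  proof -
    have "(\<Prod>p\<in>insert a Z. (z - p) ^ nat (zorder f p)) = (z - a) ^ n * P z"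
      using insert a by (simp add: P_def zf)
    moreover have "g z = G z * (z - a) ^ n"
      using r(4)[of a] r(1) by (cases "z = a") (auto simp: G_def)
    ultimately show ?thesis using g(2)[OF that] by (simp add: P_def)
  qed
  moreover have "G p \<noteq> 0" if "p \<in> insert a Z" for p
  proof (cases "p = a")
    case True
    then show ?thesis using r(4)[of a] r(1) by (simp add: G_def)
  next
    case False
    then show ?thesis using g(3)[of p] that by (simp add: G_def)
  qed
  ultimately show ?case by blast
qed (use f in auto)

text \<open>A zero-free g has a logarithm L of g / g z0 with L z0 = 0 and Re L < A. A bound for L on
  the intermediate disc of radius (r + r')/2 and Cauchy's estimate on discs of radius (r - r')/2
  then bound L' = g'/g.\<close>

lemma borel_caratheodory_logderiv:
  assumes r: "0 < r'" "r' < r" and g: "g holomorphic_on ball z0 r" "\<And>z. z \<in> ball z0 r \<Longrightarrow> g z \<noteq> 0"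
    and A: "A > 0" "\<And>z. z \<in> ball z0 r \<Longrightarrow> norm (g z) < exp A * norm (g z0)"
    and z: "z \<in> cball z0 r'"
  shows "norm (deriv g z / g z) \<le> 16 * r / (r - r')\<^sup>2 * A"
proof -
  have r0: "r > 0" using r by simp
  have "(\<lambda>z. g z / g z0) holomorphic_on ball z0 r" using g r0 by (intro holomorphic_intros) auto
  then obtain L0 where L0: "L0 holomorphic_on ball z0 r" "\<And>z. z \<in> ball z0 r \<Longrightarrow> g z / g z0 = exp (L0 z)"
    by (rule contractible_imp_holomorphic_log) (use g r0 in \<open>auto intro: convex_imp_contractible\<close>)
  define L where "L z = L0 z - L0 z0" for z
  have e0: "exp (L0 z0) = 1" using L0(2)[of z0] g r0 by auto
  have L: "L holomorphic_on ball z0 r" "L z0 = 0" "\<And>z. z \<in> ball z0 r \<Longrightarrow> g z / g z0 = exp (L z)"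
    using L0 e0 by (auto simp: L_def[abs_def] exp_diff intro!: holomorphic_intros)
  have ReL: "Re (L z) < A" if "z \<in> ball z0 r" for z
  proof -
    have "exp (Re (L z)) = norm (g z / g z0)" using L(3)[OF that] by (metis norm_exp_eq_Re)
    also have "\<dots> < exp A" using A(2)[OF that] g(2)[of z0] r0 by (simp add: norm_divide field_simps)
    finally show ?thesis by simp
  qed
  have ne: "2 * of_real A - L z \<noteq> 0" if "z \<in> ball z0 r" for z
    using ReL[OF that] A(1) by (auto simp: complex_eq_iff)
  \<comment> \<open>The Moebius map w -> w/(2A - w) sends the half-plane Re w < A into the unit disc
    and fixes 0, so Schwarz's lemma applies after rescaling.\<close>
  define \<phi> where "\<phi> u = L (z0 + of_real r * u) / (2 * of_real A - L (z0 + of_real r * u))" for u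
  have ball: "z0 + of_real r * u \<in> ball z0 r" if "norm u < 1" for u
    using that r0 by (simp add: dist_norm norm_mult)
  have Lcomp: "(\<lambda>u. L (z0 + of_real r * u)) holomorphic_on ball 0 1"
  proof -
    have "(L \<circ> (\<lambda>u. z0 + of_real r * u)) holomorphic_on ball 0 1"
      by (rule holomorphic_on_compose_gen[OF _ L(1)]) (use ball in \<open>auto intro!: holomorphic_intros\<close>)
    then show ?thesis by (simp add: o_def)
  qed
  have \<phi>: "norm (\<phi> u) \<le> norm u" if u: "norm u < 1" for u
  proof (rule Schwarz_Lemma(1)[of \<phi>])
    show "\<phi> holomorphic_on ball 0 1"
      unfolding \<phi>_def using ne ball by (intro holomorphic_intros Lcomp) auto
    show "\<phi> 0 = 0" by (simp add: \<phi>_def L)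
    fix v :: complex assume v: "norm v < 1"
    define l where "l = L (z0 + of_real r * v)"
    have "Re l < A" unfolding l_def by (intro ReL ball v)
    then have "(Re l)\<^sup>2 < (2 * A - Re l)\<^sup>2" using A(1) 
      by (simp add: power2_eq_square algebra_simps)
    then have "(norm l)\<^sup>2 < (norm (2 * of_real A - l))\<^sup>2" by (simp add: cmod_power2)
    then have "norm l < norm (2 * of_real A - l)" by (rule power2_less_imp_less) simp
    then show "norm (\<phi> v) < 1" unfolding \<phi>_def l_def[symmetric] norm_divide
      by (subst divide_less_eq_1) (auto intro: le_less_trans[OF norm_ge_zero])
  qed (use u in auto)
  \<comment> \<open>The bound is doubled to make it strict, as the open target disc in Cauchy's
    estimate requires; this turns 8 into 16 in the final constant.\<close>
  have Lbound: "norm (L y) < 4 * A * r / (r - r') + 1 * (4 * A * r / (r - r'))" if y: "norm (y - z0) \<le> (r + r') / 2" for y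
  proof -
    define u where "u = (y - z0) / of_real r"
    define q where "q = norm u"
    have q: "q \<le> (r + r') / (2 * r)" using y r0 by (simp add: q_def u_def norm_divide divide_right_mono field_simps)
    moreover have "(r + r') / (2 * r) < 1" using r r0 by (simp add: field_simps)
    moreover have "(r + r') / (2 * r) = 1 - (r - r') / (2 * r)" using r0 by (simp add: field_simps)
    ultimately have q1: "1 - q \<ge> (r - r') / (2 * r)" "q < 1" by linarith+
    have y_eq: "y = z0 + of_real r * u" using r0 by (simp add: u_def)
    have nz: "norm (2 * of_real A - L y) > 0" using ne[OF ball, of u] q1 by (simp add: y_eq q_def)
    have "norm (\<phi> u) \<le> q" unfolding q_def by (rule \<phi>) (use q1 q_def in auto)
    then have "norm (L y) \<le> q * norm (2 * of_real A - L y)"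
      unfolding \<phi>_def y_eq[symmetric] norm_divide using nz by (simp add: pos_divide_le_eq)
    also have "\<dots> \<le> q * (2 * A + norm (L y))"
      using norm_triangle_ineq4[of "2 * complex_of_real A" "L y"] A(1)
      by (intro mult_left_mono) (auto simp: q_def norm_mult)
    finally have "(1 - q) * norm (L y) \<le> q * (2 * A)" by (simp add: algebra_simps)
    also have "\<dots> \<le> 1 * (2 * A)" using q1 A(1) by (intro mult_right_mono) auto
    finally have "(1 - q) * norm (L y) \<le> 2 * A" by simp
    moreover have "(r - r') / (2 * r) * norm (L y) \<le> (1 - q) * norm (L y)"
      using q1 by (intro mult_right_mono) auto
    ultimately have "(r - r') / (2 * r) * norm (L y) \<le> 2 * A" by linarith
    then have "norm (L y) \<le> 4 * A * r / (r - r')" using r r0 by (simp add: field_simps)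
    moreover have "0 < 4 * A * r / (r - r')" using A(1) r r0 by simp
    ultimately show ?thesis by linarith
  qed
  define d where "d = (r - r') / 2"
  have d: "d > 0" using r by (simp add: d_def)
  have zd: "norm (y - z0) \<le> (r + r') / 2" if "y \<in> cball z d" for y
  proof -
    have "norm (y - z0) \<le> norm (y - z) + norm (z - z0)" using norm_triangle_ineq[of "y - z" "z - z0"] by simp
    then show ?thesis using that z by (simp add: d_def dist_norm norm_minus_commute field_simps)
  qed
  have sub: "cball z d \<subseteq> ball z0 r"
  proof
    fix y assume "y \<in> cball z d"
    then show "y \<in> ball z0 r" using zd[of y] r by (simp add: dist_norm norm_minus_commute field_simps)
  qed
  have "norm ((deriv ^^ 1) L z) \<le> fact 1 * (4 * A * r / (r - r') + 1 * (4 * A * r / (r - r'))) / d ^ 1"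
  proof (rule Cauchy_higher_deriv_bound)
    show "L holomorphic_on ball z d" by (rule holomorphic_on_subset[OF L(1)]) (use sub in auto)
    show "continuous_on (cball z d) L"
      by (rule continuous_on_subset[OF holomorphic_on_imp_continuous_on[OF L(1)] sub])
    show "L w \<in> ball 0 (4 * A * r / (r - r') + 1 * (4 * A * r / (r - r')))" if "w \<in> ball z d" for w
      using Lbound[OF zd, of w] that by (simp add: dist_norm)
  qed (use d in auto)
  also have "fact 1 * (4 * A * r / (r - r') + 1 * (4 * A * r / (r - r'))) / d ^ 1 = 16 * r / (r - r')\<^sup>2 * A"
  proof -
    have "(4 * A * r / q + 1 * (4 * A * r / q)) / (q / 2) = 16 * r / q\<^sup>2 * A" if "q > 0" for q
      using that by (simp add: field_simps power2_eq_square)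
    from this[of "r - r'"] show ?thesis using r by (simp add: d_def)
  qed
  finally have Lz: "norm (deriv L z) \<le> 16 * r / (r - r')\<^sup>2 * A" by simp
  have zin: "z \<in> ball z0 r" using subsetD[OF sub, of z] d by simp
  have "deriv g z = deriv L z * g z"
  proof -
    have "((\<lambda>z. g z0 * exp (L z)) has_field_derivative g z0 * (exp (L z) * deriv L z)) (at z)"
      using L(1) zin by (auto intro!: derivative_eq_intros holomorphic_derivI[of _ "ball z0 r"])
    moreover have "\<forall>\<^sub>F u in nhds z. g z0 * exp (L u) = g u"
      using eventually_nhds_in_open[of "ball z0 r" z] zin
    proof (auto elim!: eventually_mono)
      fix u assume "dist z0 u < r"
      then show "g z0 * exp (L u) = g u" using L(3)[of u] g(2)[of z0] r0 by (simp add: field_simps)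
    qed
    ultimately have "(g has_field_derivative g z0 * (exp (L z) * deriv L z)) (at z)"
      using DERIV_cong_ev[of z z "\<lambda>z. g z0 * exp (L z)" g] by simp
    moreover have "g z0 * exp (L z) = g z" using L(3)[OF zin] g(2)[of z0] r0 by (simp add: field_simps)
    ultimately show ?thesis by (simp add: DERIV_imp_deriv mult.assoc[symmetric])
  qed
  then have "deriv g z / g z = deriv L z" using g(2)[OF zin] by simp
  then show ?thesis using Lz by simp
qed

text \<open>Jensen's argument with Blaschke factors. Replacing each z - p by its reflection
  \<open>b p z\<close> keeps the modulus on the circle of radius R and removes the zeros in the disc
  of radius r. At z0 the modulus grows by a factor of at least R/r per zero, while the maximum
  principle bounds the result by e^M times |f z0|; this gives the count. The zero-free G obeys
  \<open>borel_caratheodory_logderiv\<close>, and each reflected factor has logarithmic derivative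
  at most R/(R^2 - r^2).\<close>

lemma logderiv_zeros_disc:
  assumes radii: "0 < r'" "r' < r" "r < R"
    and S: "open S" "connected S" "cball z0 R \<subseteq> S" and f: "f holomorphic_on S" "f z0 \<noteq> 0"
    and M: "M > 0" "\<And>z. z \<in> cball z0 R \<Longrightarrow> norm (f z) \<le> exp M * norm (f z0)"
  defines "Z \<equiv> {z \<in> cball z0 r. f z = 0}"
  shows "finite Z"
    and "(\<Sum>p\<in>Z. real (nat (zorder f p))) \<le> M / ln (R / r)"
    and "\<And>z. z \<in> cball z0 r' \<Longrightarrow> f z \<noteq> 0 \<Longrightarrow>
       norm (deriv f z / f z - (\<Sum>p\<in>Z. of_nat (nat (zorder f p)) / (z - p))) \<le>
         (1 / ln (R / r) * (R / (R\<^sup>2 - r\<^sup>2)) + 16 * r / (r - r')\<^sup>2 * 2) * M"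
proof -
  have R0: "R > 0" "r > 0" using radii by auto
  have z0S: "z0 \<in> S" using S(3) R0 by auto
  show fin: "finite Z"
  proof -
    have "\<not> f constant_on S" if "\<exists>z\<in>S. f z = 0"
      using that f(2) z0S unfolding constant_on_def by metis
    moreover have "cball z0 r \<subseteq> S" using S(3) radii by auto
    ultimately show ?thesis
    proof (cases "\<exists>z\<in>S. f z = 0")
      case True
      then show ?thesis unfolding Z_def
        using \<open>cball z0 r \<subseteq> S\<close> \<open>\<exists>z\<in>S. f z = 0 \<Longrightarrow> \<not> f constant_on S\<close>
        by (intro holomorphic_compact_finite_zeros[OF f(1) S(1,2)]) auto
    next
      case False
      then have "Z = {}" using \<open>cball z0 r \<subseteq> S\<close> by (auto simp: Z_def)
      then show ?thesis by simp
    qed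
  qed
  have ZS: "Z \<subseteq> S" using S(3) radii by (auto simp: Z_def)
  define m where "m p = nat (zorder f p)" for p
  obtain g where g: "g holomorphic_on S" "\<And>z. z \<in> S \<Longrightarrow> f z = g z * (\<Prod>p\<in>Z. (z - p) ^ m p)" "\<And>p. p \<in> Z \<Longrightarrow> g p \<noteq> 0"
    using holomorphic_factor_out_zeros[OF S(1,2) f(1) z0S f(2) fin ZS] unfolding m_def by blast
  define b where "b p z = (of_real (R\<^sup>2) - cnj (p - z0) * (z - z0)) / of_real R" for p z
  define N where "N = (\<Sum>p\<in>Z. m p)"
  define G where "G z = g z * (\<Prod>p\<in>Z. b p z ^ m p)" for z
  have Zr: "norm (p - z0) \<le> r" if "p \<in> Z" for p using that by (simp add: Z_def dist_norm norm_minus_commute)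
  have b_ne: "b p z \<noteq> 0" "norm (b p z) \<ge> (R\<^sup>2 - r * norm (z - z0)) / R" if "p \<in> Z" "norm (z - z0) \<le> R" for p z
  proof -
    have "norm (cnj (p - z0) * (z - z0)) \<le> r * norm (z - z0)"
      unfolding norm_mult complex_mod_cnj using Zr[OF that(1)] by (intro mult_right_mono) auto
    then have "R\<^sup>2 - r * norm (z - z0) \<le> norm (of_real (R\<^sup>2) - cnj (p - z0) * (z - z0))"
    proof -
      have "norm (complex_of_real (R\<^sup>2)) = R\<^sup>2" by (simp only: norm_of_real) simp
      then show ?thesis
        using norm_triangle_ineq2[of "of_real (R\<^sup>2)" "cnj (p - z0) * (z - z0)"]
          \<open>norm (cnj (p - z0) * (z - z0)) \<le> r * norm (z - z0)\<close> by linarith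
    qed
    then show *: "norm (b p z) \<ge> (R\<^sup>2 - r * norm (z - z0)) / R"
      unfolding b_def norm_divide using R0 by (simp add: divide_right_mono)
    have "r * norm (z - z0) < R * R" using that radii R0 mult_left_mono[of "norm (z - z0)" R r] mult_strict_right_mono[of r R R] by linarith
    then have "(R\<^sup>2 - r * norm (z - z0)) / R > 0" using R0 by (simp add: power2_eq_square)
    then show "b p z \<noteq> 0" using * by auto
  qed
  have b_hol: "b p holomorphic_on A" for p A
    unfolding b_def using R0 by (intro holomorphic_intros) auto
  have G_hol: "G holomorphic_on S"
    unfolding G_def by (intro holomorphic_intros g b_hol)
  have circ: "norm (b p z) = norm (z - p)" if "norm (z - z0) = R" for p z
  proof -
    define x where "x = z - z0" define y where "y = p - z0"
    have x2: "of_real (R\<^sup>2) = x * cnj x" using that by (simp only: complex_norm_square[symmetric] x_def)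
    have "of_real (R\<^sup>2) - cnj y * x = x * cnj (x - y)" unfolding x2 by (simp add: algebra_simps)
    then have "norm (of_real (R\<^sup>2) - cnj y * x) = R * norm (x - y)"
      using that by (simp only: norm_mult complex_mod_cnj x_def)
    then show ?thesis unfolding b_def norm_divide x_def[symmetric] y_def[symmetric] using R0
      by (simp add: x_def y_def)
  qed
  have f0: "norm (f z0) > 0" using f by simp
  have circG: "norm (G z) \<le> exp M * norm (f z0)" if "z \<in> sphere z0 R" for z
  proof -
    have nz: "norm (z - z0) = R" using that by (simp add: dist_norm norm_minus_commute)
    have zS: "z \<in> S" using that S(3) by auto
    have "norm (G z) = norm (f z)"
      unfolding G_def g(2)[OF zS] norm_mult prod_norm[symmetric] norm_power using circ[OF nz] by simp
    then show ?thesis using M(2)[of z] that by auto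
  qed
  have Gbound: "norm (G z) \<le> exp M * norm (f z0)" if "z \<in> cball z0 R" for z
  proof (rule maximum_modulus_frontier[of G "cball z0 R"])
    show "G holomorphic_on interior (cball z0 R)"
      by (rule holomorphic_on_subset[OF G_hol]) (use S(3) interior_subset in blast)
    show "continuous_on (closure (cball z0 R)) G"
      by (rule continuous_on_subset[OF holomorphic_on_imp_continuous_on[OF G_hol]]) (use S(3) in auto)
  qed (use that circG R0 in auto)
  have G0: "norm (G z0) \<ge> (R / r) ^ N * norm (f z0)"
  proof -
    have "norm (f z0) = norm (g z0) * (\<Prod>p\<in>Z. norm (z0 - p) ^ m p)"
      unfolding g(2)[OF z0S] by (simp add: norm_mult prod_norm[symmetric] norm_power)
    also have "\<dots> \<le> norm (g z0) * (\<Prod>p\<in>Z. r ^ m p)"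
      using Zr by (intro mult_left_mono prod_mono power_mono conjI) (auto simp: norm_minus_commute)
    also have "(\<Prod>p\<in>Z. r ^ m p) = r ^ N" unfolding N_def by (rule power_sum[symmetric])
    finally have 1: "norm (f z0) \<le> norm (g z0) * r ^ N" .
    have bz0: "norm (b p z0) = R" for p
    proof -
      have "b p z0 = of_real R" using R0 by (simp add: b_def power2_eq_square)
      then show ?thesis using R0 by simp
    qed
    have "norm (G z0) = norm (g z0) * (\<Prod>p\<in>Z. R ^ m p)"
      unfolding G_def norm_mult prod_norm[symmetric] norm_power bz0 by simp
    also have "(\<Prod>p\<in>Z. R ^ m p) = R ^ N" unfolding N_def by (rule power_sum[symmetric])
    finally have 2: "norm (G z0) = norm (g z0) * R ^ N" .
    have "(R / r) ^ N * norm (f z0) \<le> (R / r) ^ N * (norm (g z0) * r ^ N)"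
      using 1 R0 by (intro mult_left_mono) auto
    also have "\<dots> = norm (G z0)" using R0 by (simp add: 2 power_divide)
    finally show ?thesis .
  qed
  have lnR: "ln (R / r) > 0" using radii R0 by (intro ln_gt_zero) (auto simp: field_simps)
  show Nb: "(\<Sum>p\<in>Z. real (nat (zorder f p))) \<le> M / ln (R / r)"
  proof -
    have "(R / r) ^ N * norm (f z0) \<le> exp M * norm (f z0)"
      using G0 Gbound[of z0] R0 by auto
    then have "(R / r) ^ N \<le> exp M" using f0 by simp
    then have "ln ((R / r) ^ N) \<le> ln (exp M)" using R0 by (subst ln_le_cancel_iff) auto
    then have "real N * ln (R / r) \<le> M" using R0 by (simp add: ln_realpow)
    then show ?thesis using lnR by (simp add: N_def m_def field_simps)
  qed
  fix z assume z: "z \<in> cball z0 r'" "f z \<noteq> 0"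
  have zS: "z \<in> S" using z S(3) radii by auto
  have Gnz: "G y \<noteq> 0" if y: "y \<in> cball z0 r" for y
  proof -
    have yS: "y \<in> S" using y S(3) radii by auto
    have "g y \<noteq> 0"
    proof (cases "y \<in> Z")
      case False
      then have "f y \<noteq> 0" using y by (simp add: Z_def)
      then show ?thesis using g(2)[OF yS] by auto
    qed (use g in auto)
    moreover have "b p y \<noteq> 0" if "p \<in> Z" for p
      using b_ne(1)[OF that, of y] y radii by (simp add: dist_norm norm_minus_commute)
    ultimately show ?thesis using fin by (simp add: G_def)
  qed
  \<comment> \<open>The exponent 2M instead of M makes the inequality strict; it is the factor 2 in
    the final constant.\<close>
  have GG: "norm (G y) < exp (2 * M) * norm (G z0)" if y: "y \<in> ball z0 r" for y
  proof -
    have "norm (G y) \<le> exp M * norm (f z0)" using Gbound[of y] y radii by auto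
    also have "\<dots> < exp (2 * M) * norm (f z0)" using f0 M(1) by simp
    also have "\<dots> \<le> exp (2 * M) * ((R / r) ^ N * norm (f z0))"
    proof (intro mult_left_mono)
      have "1 \<le> (R / r) ^ N" using radii R0 by (intro one_le_power) (auto simp: field_simps)
      then show "norm (f z0) \<le> (R / r) ^ N * norm (f z0)" using f0 by (simp add: mult_le_cancel_right1)
    qed auto
    also have "\<dots> \<le> exp (2 * M) * norm (G z0)" using G0 by (intro mult_left_mono) auto
    finally show ?thesis .
  qed
  have BC: "norm (deriv G z / G z) \<le> 16 * r / (r - r')\<^sup>2 * (2 * M)"
  proof (rule borel_caratheodory_logderiv[OF radii(1,2)])
    show "G holomorphic_on ball z0 r" by (rule holomorphic_on_subset[OF G_hol]) (use S(3) radii in auto)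
  qed (use Gnz GG M z in auto)
  have znot: "z \<notin> Z" using z by (simp add: Z_def)
  have zR: "norm (z - z0) \<le> R" "norm (z - z0) \<le> r" using z radii by (auto simp: dist_norm norm_minus_commute)
  have dprod: "((\<lambda>y. \<Prod>p\<in>Z. c p y ^ m p) has_field_derivative
      (\<Prod>p\<in>Z. c p z ^ m p) * (\<Sum>p\<in>Z. of_nat (m p) * c' p / c p z)) (at z)"
    if c: "\<And>p. p \<in> Z \<Longrightarrow> (c p has_field_derivative c' p) (at z)" "\<And>p. p \<in> Z \<Longrightarrow> c p z \<noteq> 0" for c c'
    using fin c
  proof (induction rule: finite_induct)
    case (insert a F)
    have pw: "((\<lambda>y. c a y ^ m a) has_field_derivative c a z ^ m a * (of_nat (m a) * c' a / c a z)) (at z)"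
    proof -
      have "((\<lambda>y. c a y ^ m a) has_field_derivative of_nat (m a) * c a z ^ (m a - 1) * c' a) (at z)"
        using insert.prems(1)[of a] by (auto intro!: derivative_eq_intros)
      moreover have "of_nat (m a) * c a z ^ (m a - 1) * c' a = c a z ^ m a * (of_nat (m a) * c' a / c a z)"
        using insert.prems(2)[of a] by (cases "m a") auto
      ultimately show ?thesis by simp
    qed
    have IH: "((\<lambda>y. \<Prod>p\<in>F. c p y ^ m p) has_field_derivative
      (\<Prod>p\<in>F. c p z ^ m p) * (\<Sum>p\<in>F. of_nat (m p) * c' p / c p z)) (at z)"
      using insert by auto
    from DERIV_mult[OF pw IH] show ?case
      using insert.hyps by (simp add: algebra_simps)
  qed simp
  define s1 where "s1 = (\<Sum>p\<in>Z. of_nat (m p) / (z - p))"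
  define s2 where "s2 = (\<Sum>p\<in>Z. of_nat (m p) * (- cnj (p - z0) / of_real R) / b p z)"
  have gd: "(g has_field_derivative deriv g z) (at z)"
    using g(1) S(1) zS by (meson holomorphic_derivI)
  have f_d: "deriv f z / f z = deriv g z / g z + s1"
  proof -
    have "((\<lambda>y. g y * (\<Prod>p\<in>Z. (y - p) ^ m p)) has_field_derivative
        deriv g z * (\<Prod>p\<in>Z. (z - p) ^ m p) + ((\<Prod>p\<in>Z. (z - p) ^ m p) * s1) * g z) (at z)"
    proof (rule DERIV_mult[OF gd])
      show "((\<lambda>y. \<Prod>p\<in>Z. (y - p) ^ m p) has_field_derivative (\<Prod>p\<in>Z. (z - p) ^ m p) * s1) (at z)"
      proof -
        have "((\<lambda>y. \<Prod>p\<in>Z. (y - p) ^ m p) has_field_derivative (\<Prod>p\<in>Z. (z - p) ^ m p) * (\<Sum>p\<in>Z. of_nat (m p) * 1 / (z - p))) (at z)"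
          by (rule dprod) (use znot in \<open>auto intro!: derivative_eq_intros\<close>)
        then show ?thesis by (simp add: s1_def)
      qed
    qed
    moreover have "\<forall>\<^sub>F u in nhds z. g u * (\<Prod>p\<in>Z. (u - p) ^ m p) = f u"
      using eventually_nhds_in_open[OF S(1) zS] g(2) by (auto elim!: eventually_mono)
    ultimately have "(f has_field_derivative deriv g z * (\<Prod>p\<in>Z. (z - p) ^ m p) + ((\<Prod>p\<in>Z. (z - p) ^ m p) * s1) * g z) (at z)"
      using DERIV_cong_ev[of z z "\<lambda>y. g y * (\<Prod>p\<in>Z. (y - p) ^ m p)" f] by simp
    then have d: "deriv f z = deriv g z * (\<Prod>p\<in>Z. (z - p) ^ m p) + ((\<Prod>p\<in>Z. (z - p) ^ m p) * s1) * g z"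
      by (rule DERIV_imp_deriv)
    have fz: "f z = g z * (\<Prod>p\<in>Z. (z - p) ^ m p)" by (rule g(2)[OF zS])
    have alg: "(g' * P + P * s * g0) / (g0 * P) = g' / g0 + s" if "g0 * P \<noteq> 0" for g' P s g0 :: complex
      using that by (simp add: field_simps)
    show ?thesis unfolding d fz by (rule alg) (use z(2) fz in simp)
  qed
  have G_d: "deriv G z / G z = deriv g z / g z + s2"
  proof -
    have "(G has_field_derivative
        deriv g z * (\<Prod>p\<in>Z. b p z ^ m p) + ((\<Prod>p\<in>Z. b p z ^ m p) * s2) * g z) (at z)"
      unfolding G_def[abs_def]
    proof (rule DERIV_mult[OF gd])
      show "((\<lambda>y. \<Prod>p\<in>Z. b p y ^ m p) has_field_derivative (\<Prod>p\<in>Z. b p z ^ m p) * s2) (at z)"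
        unfolding s2_def
      proof (rule dprod)
        show "(b p has_field_derivative - cnj (p - z0) / of_real R) (at z)" for p
          unfolding b_def[abs_def] using R0 by (auto intro!: derivative_eq_intros)
        show "b p z \<noteq> 0" if "p \<in> Z" for p using b_ne(1)[OF that zR(1)] .
      qed
    qed
    then have d: "deriv G z = deriv g z * (\<Prod>p\<in>Z. b p z ^ m p) + ((\<Prod>p\<in>Z. b p z ^ m p) * s2) * g z"
      by (rule DERIV_imp_deriv)
    have alg: "(g' * P + P * s * g0) / (g0 * P) = g' / g0 + s" if "g0 * P \<noteq> 0" for g' P s g0 :: complex
      using that by (simp add: field_simps)
    show ?thesis unfolding d G_def by (rule alg) (use Gnz[of z] zR in \<open>simp add: G_def dist_norm norm_minus_commute\<close>)
  qed
  have s2b: "norm s2 \<le> (M / ln (R / r)) * (R / (R\<^sup>2 - r\<^sup>2))"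
  proof -
    have den: "R\<^sup>2 - r\<^sup>2 > 0" using radii R0 by (simp add: power_strict_mono)
    have "norm s2 \<le> (\<Sum>p\<in>Z. real (m p) * (R / (R\<^sup>2 - r\<^sup>2)))"
      unfolding s2_def
    proof (rule sum_norm_le)
      fix p assume p: "p \<in> Z"
      have "norm (b p z) \<ge> (R\<^sup>2 - r * norm (z - z0)) / R" by (rule b_ne(2)[OF p zR(1)])
      moreover have "(R\<^sup>2 - r\<^sup>2) / R \<le> (R\<^sup>2 - r * norm (z - z0)) / R"
        using R0 zR by (intro divide_right_mono) (auto simp: power2_eq_square)
      ultimately have bb: "(R\<^sup>2 - r\<^sup>2) / R \<le> norm (b p z)" by linarith
      have "norm (- cnj (p - z0) / of_real R) \<le> 1"
      proof -
        have "norm (- cnj (p - z0) / of_real R) = norm (p - z0) / R"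
          using R0 by (simp only: norm_divide norm_minus_cancel complex_mod_cnj) simp
        then show ?thesis using Zr[OF p] radii R0 by simp
      qed
      then have "norm (- cnj (p - z0) / of_real R) / norm (b p z) \<le> 1 / ((R\<^sup>2 - r\<^sup>2) / R)"
        using bb den R0 by (intro frac_le) auto
      then have "real (m p) * (norm (- cnj (p - z0) / of_real R) / norm (b p z)) \<le> real (m p) * (R / (R\<^sup>2 - r\<^sup>2))"
        by (intro mult_left_mono) auto
      then show "norm (of_nat (m p) * (- cnj (p - z0) / of_real R) / b p z) \<le> real (m p) * (R / (R\<^sup>2 - r\<^sup>2))"
        by (simp add: norm_mult norm_divide)
    qed
    also have "\<dots> = (\<Sum>p\<in>Z. real (m p)) * (R / (R\<^sup>2 - r\<^sup>2))" by (rule sum_distrib_right[symmetric])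
    also have "\<dots> \<le> (M / ln (R / r)) * (R / (R\<^sup>2 - r\<^sup>2))"
      using Nb den R0 by (intro mult_right_mono divide_nonneg_pos) (auto simp: m_def)
    finally show ?thesis .
  qed
  have "deriv f z / f z - s1 = deriv G z / G z - s2" using f_d G_d by simp
  then have "norm (deriv f z / f z - s1) \<le> norm (deriv G z / G z) + norm s2"
    by (metis norm_triangle_ineq4)
  also have "\<dots> \<le> 16 * r / (r - r')\<^sup>2 * (2 * M) + (M / ln (R / r)) * (R / (R\<^sup>2 - r\<^sup>2))"
    using BC s2b by linarith
  also have "\<dots> = (1 / ln (R / r) * (R / (R\<^sup>2 - r\<^sup>2)) + 16 * r / (r - r')\<^sup>2 * 2) * M"
    by (simp add: algebra_simps)
  finally show "norm (deriv f z / f z - (\<Sum>p\<in>Z. of_nat (nat (zorder f p)) / (z - p))) \<le>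
         (1 / ln (R / r) * (R / (R\<^sup>2 - r\<^sup>2)) + 16 * r / (r - r')\<^sup>2 * 2) * M"
    by (simp add: s1_def m_def)
qed

section \<open>The zeta function to the right of the critical strip\<close>

lemma riemann_zeta_holomorphic: "riemann_zeta holomorphic_on - {1}"
  using zeta_continuation_riemann_zeta by (simp add: zeta_continuation_def)

lemma riemann_zeta_sums:
  assumes "Re s > 1"
  shows "(\<lambda>n. 1 / of_nat n powr s) sums riemann_zeta s"
proof -
  have "(\<lambda>n. 1 / of_nat (Suc n) powr s) sums riemann_zeta s"
    using assms zeta_continuation_riemann_zeta by (simp add: zeta_continuation_def)
  then show ?thesis by (subst (asm) sums_Suc_iff) simp
qed

text \<open>For K = 0 the recurrence contains no shifted zeta values, and its remainder series
  converges for Re s > 0; analytic continuation carries the identity there.\<close>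

lemma riemann_zeta_minus_one_mult:
  assumes "Re s > 0" "s \<noteq> 1"
  shows "(s - 1) * riemann_zeta s = 1 + (\<Sum>n. zeta_rem 0 n s)"
proof -
  obtain h where h: "h holomorphic_on UNIV" "\<And>s. Re s > 1 \<Longrightarrow> h s = (s - 1) * zeta_series s"
    using zeta_entire by blast
  have zeta_eq: "riemann_zeta s = h s / (s - 1)" for s
    using zeta_continuation_unique[OF zeta_continuation_riemann_zeta zeta_continuation_if_entire[OF h]]
    by metis
  have "h s = 1 + (\<Sum>n. zeta_rem 0 n s)"
  proof (rule analytic_continuation_open[of "{s. Re s > 1}" "{s. Re s > 0}" h "\<lambda>s. 1 + (\<Sum>n. zeta_rem 0 n s)"])
    show "(\<lambda>s. 1 + (\<Sum>n. zeta_rem 0 n s)) holomorphic_on {s. Re s > 0}"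
      using zeta_rem_sum_holomorphic[of 0] by (intro holomorphic_intros) simp
    show "h holomorphic_on {s. Re s > 0}" using h(1) holomorphic_on_subset by blast
    show "{s. Re s > 1} \<noteq> {}" by (auto intro: exI[of _ 2])
    show "connected {s. Re s > 0}" by (intro convex_connected convex_halfspace_Re_gt)
    show "h z = 1 + (\<Sum>n. zeta_rem 0 n z)" if "z \<in> {s. Re s > 1}" for z
      using that h(2)[of z] zeta_series_recurrence[of z 0] by simp
  qed (use assms in \<open>auto simp: open_halfspace_Re_gt\<close>)
  then show ?thesis using assms by (simp add: zeta_eq)
qed

text \<open>Where \<open>zeta_rem_bound_single\<close> has a factor exponential in |s|, the
  dependence here is polynomial: for Re s > 0 the modulus of x^(-s-1) on the segment is largest at
  its left end. Polynomial growth of zeta is what makes the local zero count logarithmic.\<close>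

lemma zeta_rem_0_bound:
  assumes "Re s > 0"
  shows "norm (zeta_rem 0 n s) \<le> norm s * norm (1 - s) * real (Suc n) powr (- Re s - 1)"
proof -
  define m where "m = real (Suc n)"
  have m: "m \<ge> 1" by (simp add: m_def)
  define S where "S = closed_segment (complex_of_real m) (complex_of_real (m + 1))"
  have S: "\<exists>y. x = of_real y \<and> m \<le> y \<and> y \<le> m + 1" if "x \<in> S" for x
    using that unfolding S_def closed_segment_of_real closed_segment_eq_real_ivl by (auto split: if_splits)
  define f where "f i x = (if i = 0 then x powr (1 - s) else if i = (1::nat) then (1 - s) * x powr (- s)
      else (1 - s) * (- s * x powr (- s - 1)))" for i and x :: complex
  have "norm (f 0 (of_real (m + 1)) - (\<Sum>i\<le>1. f i (of_real m) * (of_real (m + 1) - of_real m) ^ i / fact i))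
        \<le> (norm s * norm (1 - s) * m powr (- Re s - 1)) * norm (complex_of_real (m + 1) - of_real m) ^ Suc 1 / fact 1"
  proof (rule complex_Taylor)
    show "convex S" by (simp add: S_def)
    show "complex_of_real m \<in> S" "complex_of_real (m + 1) \<in> S" by (simp_all add: S_def)
  next
    fix i x assume x: "x \<in> S" "i \<le> (1::nat)"
    then obtain y where y: "x = of_real y" "m \<le> y" using S by blast
    have "x \<notin> \<real>\<^sub>\<le>\<^sub>0" using y m by auto
    then show "(f i has_field_derivative f (Suc i) x) (at x within S)"
      using x(2) unfolding f_def
      by (cases "i = 0") (auto intro!: derivative_eq_intros has_field_derivative_at_within[OF has_field_derivative_powr] simp: algebra_simps)
  next
    fix x assume "x \<in> S"
    then obtain y where y: "x = of_real y" "m \<le> y" using S by blast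
    have "norm (x powr (- s - 1)) = y powr (- Re s - 1)"
      using y m by (subst norm_powr_real_powr) auto
    also have "\<dots> \<le> m powr (- Re s - 1)" using y m assms by (intro powr_mono2') auto
    finally show "norm (f (Suc 1) x) \<le> norm s * norm (1 - s) * m powr (- Re s - 1)"
      by (simp add: f_def norm_mult mult_left_mono mult_ac)
  qed
  also have "f 0 (of_real (m + 1)) - (\<Sum>i\<le>1. f i (of_real m) * (of_real (m + 1) - of_real m) ^ i / fact i)
             = zeta_rem 0 n s"
    by (simp add: zeta_rem_def f_def m_def)
  finally show ?thesis by (simp add: m_def)
qed

text \<open>Dividing by s - 1 cancels one of the two linear factors in the remainder bound; |Im s|
  >= 1 keeps s away from the pole.\<close>

lemma riemann_zeta_growth:
  assumes "\<sigma>0 > 0"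
  shows "\<exists>C\<ge>0. \<forall>s. Re s \<ge> \<sigma>0 \<and> \<bar>Im s\<bar> \<ge> 1 \<longrightarrow> norm (riemann_zeta s) \<le> C * norm s"
proof -
  define C where "C = (\<Sum>n. real (Suc n) powr (- \<sigma>0 - 1))"
  have summ: "summable (\<lambda>n. real (Suc n) powr (- \<sigma>0 - 1))"
    using assms summable_real_powr_iff[of "- \<sigma>0 - 1"] summable_Suc_iff[of "\<lambda>n. real n powr (- \<sigma>0 - 1)"] by simp
  have C0: "C \<ge> 0" unfolding C_def by (intro suminf_nonneg summ) auto
  show ?thesis
  proof (intro exI[of _ "C + 1"] conjI allI impI)
    fix s assume s: "Re s \<ge> \<sigma>0 \<and> \<bar>Im s\<bar> \<ge> 1"
    have s1: "norm (s - 1) \<ge> 1" "norm s \<ge> 1" using s abs_Im_le_cmod[of "s - 1"] abs_Im_le_cmod[of s] by auto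
    have ne: "s \<noteq> 1" using s by auto
    have bd: "norm (zeta_rem 0 n s) \<le> norm s * norm (1 - s) * real (Suc n) powr (- \<sigma>0 - 1)" for n
    proof -
      have "real (Suc n) powr (- Re s - 1) \<le> real (Suc n) powr (- \<sigma>0 - 1)"
        using s by (intro powr_mono) auto
      then show ?thesis
        using s assms by (intro order_trans[OF zeta_rem_0_bound[of s n]] mult_left_mono) auto
    qed
    have summ': "summable (\<lambda>n. norm s * norm (1 - s) * real (Suc n) powr (- \<sigma>0 - 1))"
      by (intro summable_mult summ)
    have "norm (\<Sum>n. zeta_rem 0 n s) \<le> (\<Sum>n. norm s * norm (1 - s) * real (Suc n) powr (- \<sigma>0 - 1))"
      by (rule norm_suminf_le[OF bd summ'])
    also have "\<dots> = norm s * norm (s - 1) * C"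
      unfolding C_def by (subst suminf_mult[OF summ]) (simp add: norm_minus_commute)
    finally have "norm ((s - 1) * riemann_zeta s) \<le> 1 + norm s * norm (s - 1) * C"
      using riemann_zeta_minus_one_mult[of s] s ne assms norm_triangle_ineq[of 1 "\<Sum>n. zeta_rem 0 n s"] by simp
    also have "\<dots> \<le> norm (s - 1) * norm s + norm s * norm (s - 1) * C"
      using mult_mono[OF s1] by simp
    finally have "norm (s - 1) * norm (riemann_zeta s) \<le> norm (s - 1) * ((C + 1) * norm s)"
 unfolding norm_mult by (simp add: distrib_left distrib_right mult_ac)
    moreover have "norm (s - 1) > 0" using s1 by linarith
    ultimately show "norm (riemann_zeta s) \<le> (C + 1) * norm s"
      by (simp only: mult_le_cancel_left_pos)
  qed (use C0 in auto)
qed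

section \<open>The Dirichlet series of the von Mangoldt function\<close>

definition mangoldt_series :: "complex \<Rightarrow> complex" where
  "mangoldt_series s = (\<Sum>n. mangoldt n / of_nat n powr s)"

lemma summable_mangoldt_powr:
  assumes "c > 1"
  shows "summable (\<lambda>n. mangoldt n * real n powr (- c))"
proof -
  define e where "e = (c - 1) / 2"
  have e: "e > 0" "e - c < -1" using assms by (auto simp: e_def field_simps)
  show ?thesis
  proof (rule summable_comparison_test')
    show "summable (\<lambda>n. 1 / e * real n powr (e - c))"
      using e by (intro summable_mult) (simp add: summable_real_powr_iff)
    fix n :: nat assume "n \<ge> 1"
    have "mangoldt n \<le> ln (real n)" using \<open>n \<ge> 1\<close> by (intro mangoldt_le) auto
    also have "\<dots> \<le> real n powr e / e" using e \<open>n \<ge> 1\<close> by (intro ln_powr_bound) auto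
    finally have "mangoldt n * real n powr (- c) \<le> real n powr e / e * real n powr (- c)"
      by (intro mult_right_mono) auto
    also have "\<dots> = 1 / e * real n powr (e - c)"
      using \<open>n \<ge> 1\<close> by (simp add: powr_add[symmetric])
    finally show "norm (mangoldt n * real n powr (- c)) \<le> 1 / e * real n powr (e - c)"
      using mangoldt_nonneg[of n] by simp
  qed
qed

lemma norm_mangoldt_term:
  "norm (mangoldt n / of_nat n powr s :: complex) = mangoldt n * real n powr (- Re s)"
proof (cases "n = 0")
  case False
  then have "norm (of_nat n powr s :: complex) = real n powr Re s"
    by (subst norm_powr_real_powr) auto
  then show ?thesis by (simp add: norm_divide powr_minus_divide)
qed simp

lemma mangoldt_series_sums:
  assumes "Re s > 1"
  shows "(\<lambda>n. mangoldt n / of_nat n powr s) sums mangoldt_series s"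
    and "summable (\<lambda>n. norm (mangoldt n / of_nat n powr s :: complex))"
proof -
  show *: "summable (\<lambda>n. norm (mangoldt n / of_nat n powr s :: complex))"
    unfolding norm_mangoldt_term by (rule summable_mangoldt_powr[OF assms])
  show "(\<lambda>n. mangoldt n / of_nat n powr s) sums mangoldt_series s"
    unfolding mangoldt_series_def by (rule summable_sums[OF summable_norm_cancel[OF *]])
qed

lemma mangoldt_series_holomorphic: "mangoldt_series holomorphic_on {s. Re s > 1}"
proof (subst holomorphic_on_open)
  show "open {s. Re s > 1}" by (simp add: open_halfspace_Re_gt)
  show "\<forall>s\<in>{s. Re s > 1}. \<exists>f'. (mangoldt_series has_field_derivative f') (at s)"
  proof safe
    fix s :: complex assume s: "Re s > 1"
    define c where "c = (1 + Re s) / 2"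
    have c: "c > 1" "Re s > c" using s by (auto simp: c_def)
    define f' where "f' n x = - (mangoldt n * of_real (ln (real n)) / of_nat n powr x :: complex)" for n :: nat and x
    have f': "((\<lambda>s. mangoldt n / of_nat n powr s :: complex) has_field_derivative f' n x) (at x)" for n x
      by (cases "n = 0") (auto simp: f'_def Ln_of_nat intro!: derivative_eq_intros)
    obtain g g' where g: "\<forall>x\<in>{s. Re s > c}. ((\<lambda>n. mangoldt n / of_nat n powr x) sums g x) \<and>
        ((\<lambda>n. f' n x) sums g' x) \<and> (g has_field_derivative g' x) (at x)"
    proof (rule series_and_derivative_comparison[of "{s. Re s > c}" "\<lambda>n. mangoldt n * real n powr (- c)" "\<lambda>n s. mangoldt n / of_nat n powr s" f'])
      show "open {s. Re s > c}" by (simp add: open_halfspace_Re_gt)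
      show "\<forall>\<^sub>F n in sequentially. \<forall>x\<in>{s. c < Re s}. norm (mangoldt n / of_nat n powr x :: complex) \<le> mangoldt n * real n powr (- c)"
        using eventually_ge_at_top[of 1]
      proof eventually_elim
        case (elim n)
        then show ?case unfolding norm_mangoldt_term
          by (auto intro!: mult_left_mono powr_mono mangoldt_nonneg)
      qed
    qed (use c f' summable_mangoldt_powr in auto)
    have "(g has_field_derivative g' s) (at s)" using g c by auto
    moreover have "\<forall>\<^sub>F x in nhds s. g x = mangoldt_series x"
      using eventually_nhds_in_open[of "{s. Re s > c}" s] c
    proof (auto simp: open_halfspace_Re_gt elim!: eventually_mono)
      fix x assume "c < Re x"
      then show "g x = mangoldt_series x" using g sums_unique unfolding mangoldt_series_def by blast
    qed
    ultimately have "(mangoldt_series has_field_derivative g' s) (at s)"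
      using DERIV_cong_ev[of s s g mangoldt_series "g' s" "g' s"] by simp
    then show "\<exists>f'. (mangoldt_series has_field_derivative f') (at s)" by blast
  qed
qed

lemma riemann_zeta_deriv_sums:
  assumes s: "Re s > 1"
  shows "(\<lambda>n. - (of_real (ln (real n)) / of_nat n powr s)) sums deriv riemann_zeta s"
proof -
  define c where "c = (1 + Re s) / 2"
  have c: "c > 1" "Re s > c" using s by (auto simp: c_def)
  define f' where "f' n x = - (of_real (ln (real n)) / of_nat n powr x :: complex)" for n :: nat and x
  obtain g g' where g: "\<forall>x\<in>{s. Re s > c}. ((\<lambda>n. 1 / of_nat n powr x) sums g x) \<and>
      ((\<lambda>n. f' n x) sums g' x) \<and> (g has_field_derivative g' x) (at x)"
  proof (rule series_and_derivative_comparison[of "{s. Re s > c}" "\<lambda>n. real n powr (- c)" "\<lambda>n s. 1 / of_nat n powr s" f'])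
    show "open {s. Re s > c}" by (simp add: open_halfspace_Re_gt)
    show "summable (\<lambda>n. real n powr - c)" using c by (simp add: summable_real_powr_iff)
    show "((\<lambda>s. 1 / of_nat n powr s) has_field_derivative f' n x) (at x)" for n x
      by (cases "n = 0") (auto simp: f'_def Ln_of_nat intro!: derivative_eq_intros)
    show "\<forall>\<^sub>F n in sequentially. \<forall>x\<in>{s. c < Re s}. norm (1 / of_nat n powr x :: complex) \<le> real n powr (- c)"
      using eventually_ge_at_top[of 1]
    proof eventually_elim
      case (elim n)
      then show ?case
        by (auto simp: norm_divide norm_powr_real_powr powr_minus_divide intro!: divide_left_mono powr_mono)
    qed
  qed
  have "(g has_field_derivative g' s) (at s)" using g c by auto
  moreover have "\<forall>\<^sub>F x in nhds s. g x = riemann_zeta x"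
    using eventually_nhds_in_open[of "{s. Re s > c}" s] c
  proof (auto simp: open_halfspace_Re_gt elim!: eventually_mono)
    fix x assume "c < Re x"
    then show "g x = riemann_zeta x" using g c riemann_zeta_sums[of x] sums_unique2 by fastforce
  qed
  ultimately have "(riemann_zeta has_field_derivative g' s) (at s)"
    using DERIV_cong_ev[of s s g riemann_zeta "g' s" "g' s"] by simp
  then have "deriv riemann_zeta s = g' s" by (rule DERIV_imp_deriv)
  then show ?thesis using g c by (auto simp: f'_def)
qed

text \<open>Dirichlet convolution: the von Mangoldt function summed over the divisors of N gives ln
  N. The identity has product form because the non-vanishing of zeta is deduced from it.\<close>

lemma riemann_zeta_deriv:
  assumes s: "Re s > 1"
  shows "deriv riemann_zeta s = - (riemann_zeta s * mangoldt_series s)"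
proof -
  define A where "A = {n::nat. n > 0}"
  define f where "f m = (1 / of_nat m powr s :: complex)" for m :: nat
  define g where "g m = (mangoldt m / of_nat m powr s :: complex)" for m :: nat
  have summf: "summable (\<lambda>n. norm (f n))"
  proof -
    have "norm (f n) = real n powr (- Re s)" for n
    proof (cases "n = 0")
      case False
      then have "norm (of_nat n powr s :: complex) = real n powr Re s"
        by (subst norm_powr_real_powr) auto
      then show ?thesis by (simp add: f_def norm_divide powr_minus_divide)
    qed (simp add: f_def)
    then show ?thesis using s by (simp add: summable_real_powr_iff)
  qed
  have f: "(f has_sum riemann_zeta s) UNIV"
    using riemann_zeta_sums[OF s] summf by (intro norm_summable_imp_has_sum) (auto simp: f_def[abs_def])
  have summg: "summable (\<lambda>n. norm (g n))" using mangoldt_series_sums(2)[OF s] by (simp add: g_def)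
  have g: "(g has_sum mangoldt_series s) UNIV"
    using mangoldt_series_sums(1)[OF s] summg by (intro norm_summable_imp_has_sum) (auto simp: g_def[abs_def])
  have absf: "(\<lambda>n. norm (f n)) summable_on UNIV" and absg: "(\<lambda>n. norm (g n)) summable_on UNIV"
    using summf summg by (auto intro!: summable_nonneg_imp_summable_on)
  have "(\<lambda>x. norm ((\<lambda>(m, n). f m * g n) x)) summable_on UNIV \<times> UNIV"
    unfolding Infinite_Sum.abs_summable_on_Sigma_iff
    using absf absg by (auto simp: norm_mult infsum_cmult_right' abs_mult infsum_nonneg intro!: summable_on_cmult_right summable_on_cmult_left)
  then have "(\<lambda>(m, n). f m * g n) summable_on UNIV \<times> UNIV" by (rule abs_summable_summable)
  then have "((\<lambda>(m, n). f m * g n) has_sum (riemann_zeta s * mangoldt_series s)) (UNIV \<times> UNIV)"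
    by (rule has_sum_SigmaI[rotated 2]) (auto intro!: has_sum_cmult_right g has_sum_cmult_left f)
  then have "((\<lambda>(m, n). f m * g n) has_sum (riemann_zeta s * mangoldt_series s)) (A \<times> A)"
    by (rule has_sum_cong_neutral[THEN iffD1, rotated -1]) (auto simp: A_def f_def g_def)
  then have P: "((\<lambda>(N, n). f (N div n) * g n) has_sum (riemann_zeta s * mangoldt_series s)) (Sigma A (\<lambda>N. {n. n dvd N}))"
    by (subst (asm) has_sum_reindex_bij_witness[of _ "\<lambda>(N, n). (N div n, n)" "\<lambda>(m, n). (m * n, n)"
          "Sigma A (\<lambda>N. {n. n dvd N})" "\<lambda>(N, n). f (N div n) * g n" _ _ "riemann_zeta s * mangoldt_series s"])
       (auto simp: A_def div_greater_zero_iff dvd_imp_le dvd_pos_nat)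
  have "((\<lambda>N. of_real (ln (real N)) / of_nat N powr s) has_sum (riemann_zeta s * mangoldt_series s)) A"
  proof (rule has_sum_SigmaD[OF P])
    fix N assume N: "N \<in> A"
    then have fin: "finite {n. n dvd N}" by (auto simp: A_def)
    have "f (N div n) * g n = mangoldt n / of_nat N powr s" if "n dvd N" for n
    proof -
      have "of_nat N powr s = (of_nat (N div n) * of_nat n) powr s"
        using that by (simp flip: of_nat_mult)
      also have "\<dots> = of_nat (N div n) powr s * of_nat n powr s"
        by (rule powr_times_real) auto
      finally show ?thesis by (simp add: f_def g_def)
    qed
    then have "(\<Sum>n | n dvd N. f (N div n) * g n) = (\<Sum>n | n dvd N. mangoldt n) / of_nat N powr s"
      by (simp add: sum_divide_distrib)
    also have "\<dots> = of_real (ln (real N)) / of_nat N powr s"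
      using N by (subst mangoldt_sum) (auto simp: A_def)
    finally show "((\<lambda>y. case (N, y) of (N, n) \<Rightarrow> f (N div n) * g n) has_sum of_real (ln (real N)) / of_nat N powr s) {n. n dvd N}"
      using has_sum_finite[OF fin, of "\<lambda>n. f (N div n) * g n"] by simp
  qed
  then have "((\<lambda>N. of_real (ln (real N)) / of_nat N powr s) has_sum (riemann_zeta s * mangoldt_series s)) UNIV"
    by (rule has_sum_cong_neutral[THEN iffD1, rotated -1]) (auto simp: A_def)
  then have "(\<lambda>N. of_real (ln (real N)) / of_nat N powr s) sums (riemann_zeta s * mangoldt_series s)"
    by (rule has_sum_imp_sums)
  from sums_unique2[OF sums_minus[OF this] riemann_zeta_deriv_sums[OF s]] show ?thesis by simp
qed

text \<open>By \<open>riemann_zeta_deriv\<close>, zeta times exp P is constant on the half-plane for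
  a primitive P of \<open>mangoldt_series\<close>. One zero would make zeta vanish on all of it,
  whereas the series at s = 2 is at least its first term 1.\<close>

lemma riemann_zeta_nonzero_Re_gt_1:
  assumes s: "Re s > 1"
  shows "riemann_zeta s \<noteq> 0"
proof
  assume z: "riemann_zeta s = 0"
  define H where "H = {s. Re s > (1::real)}"
  have H: "convex H" "open H" by (auto simp: H_def convex_halfspace_Re_gt open_halfspace_Re_gt)
  obtain P where P: "\<And>x. x \<in> H \<Longrightarrow> (P has_field_derivative mangoldt_series x) (at x within H)"
    using holomorphic_convex_primitive'[OF H] mangoldt_series_holomorphic by (auto simp: H_def)
  have "\<exists>c. \<forall>x\<in>H. riemann_zeta x * exp (P x) = c"
  proof (rule has_field_derivative_zero_constant[OF H(1)])
    fix x assume x: "x \<in> H"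
    have "riemann_zeta field_differentiable at x"
      using x riemann_zeta_holomorphic by (intro holomorphic_on_imp_differentiable_at[of _ "- {1}"]) (auto simp: H_def)
    then have "(riemann_zeta has_field_derivative deriv riemann_zeta x) (at x within H)"
      using has_field_derivative_at_within field_differentiable_derivI by blast
    from DERIV_mult[OF this DERIV_chain2[OF DERIV_exp P[OF x]]]
    show "((\<lambda>x. riemann_zeta x * exp (P x)) has_field_derivative 0) (at x within H)"
      using x by (simp add: riemann_zeta_deriv H_def algebra_simps)
  qed
  then have zero: "riemann_zeta x = 0" if "x \<in> H" for x
  proof -
    have "s \<in> H" using s by (simp add: H_def)
    then have "riemann_zeta x * exp (P x) = riemann_zeta s * exp (P s)"
      using \<open>\<exists>c. \<forall>x\<in>H. riemann_zeta x * exp (P x) = c\<close> that by metis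
    then show ?thesis using z by simp
  qed
  have "(\<lambda>n. Re (1 / of_nat n powr 2)) sums Re 0"
    using riemann_zeta_sums[of 2] zero[of 2] by (intro sums_Re) (auto simp: H_def)
  moreover have "Re (1 / of_nat n powr 2) = 1 / real n ^ 2" for n
  proof -
    have "of_nat n powr (2::complex) = complex_of_real (real n ^ 2)"
      by (cases "n = 0") (auto simp: powr_nat'[of _ 2, simplified])
    then show ?thesis by (simp only: Re_divide_of_real one_complex.sel flip: )
  qed
  ultimately have "(\<lambda>n. 1 / real n ^ 2) sums 0" by simp
  then have sq: "summable (\<lambda>n. 1 / real n ^ 2)" "(\<Sum>n. 1 / real n ^ 2) = 0"
    by (auto simp: sums_iff)
  have "1 / real 1 ^ 2 \<le> (\<Sum>n. 1 / real n ^ 2)"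
    using sum_le_suminf[OF sq(1), of "{1}"] by simp
  then show False using sq by simp
qed

lemma riemann_zeta_logderiv:
  assumes "Re s > 1"
  shows "deriv riemann_zeta s / riemann_zeta s = - mangoldt_series s"
  using assms by (simp add: riemann_zeta_deriv riemann_zeta_nonzero_Re_gt_1)

section \<open>Non-vanishing on the line Re s = 1\<close>

lemma logderiv_times_limit:
  assumes f: "f holomorphic_on S" "open S" "connected S" "z \<in> S" "w \<in> S" "f w \<noteq> 0"
  shows "((\<lambda>x. of_real x * (deriv f (z + of_real x) / f (z + of_real x))) \<longlongrightarrow> of_int (zorder f z)) (at_right 0)"
    and "zorder f z \<ge> 0" and "f z = 0 \<Longrightarrow> zorder f z > 0"
proof -
  define n where "n = nat (zorder f z)"
  define g where "g = zor_poly f z"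
  have *: "(if f z = 0 then zorder f z > 0 else zorder f z = 0) \<and> (\<exists>r. r > 0 \<and> cball z r \<subseteq> S \<and> g holomorphic_on cball z r
    \<and> (\<forall>w\<in>cball z r. f w = g w * (w - z) ^ n \<and> g w \<noteq> 0))"
    unfolding g_def n_def using f by (intro zorder_exist_zero[of f S z]) auto
  then show nn: "zorder f z \<ge> 0" and "f z = 0 \<Longrightarrow> zorder f z > 0" by (auto split: if_splits)
  from * obtain r where r: "r > 0" "g holomorphic_on cball z r"
    "\<And>w. w \<in> cball z r \<Longrightarrow> f w = g w * (w - z) ^ n \<and> g w \<noteq> 0" by auto
  have g_hol: "g holomorphic_on ball z r" using r(2) by (rule holomorphic_on_subset) auto
  have eq: "deriv f w / f w * (w - z) = (w - z) * deriv g w / g w + of_nat n" if w: "w \<in> ball z r" "w \<noteq> z" for w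
  proof -
    have "(g has_field_derivative deriv g w) (at w)"
      using g_hol w by (meson holomorphic_derivI open_ball)
    then have "((\<lambda>w. g w * (w - z) ^ n) has_field_derivative deriv g w * (w - z) ^ n + g w * (of_nat n * (w - z) ^ (n - 1))) (at w)"
      by (auto intro!: derivative_eq_intros)
    moreover have "\<forall>\<^sub>F u in nhds w. g u * (u - z) ^ n = f u"
      using eventually_nhds_in_open[of "ball z r" w] w r(3) by (auto elim!: eventually_mono)
    ultimately have "(f has_field_derivative deriv g w * (w - z) ^ n + g w * (of_nat n * (w - z) ^ (n - 1))) (at w)"
      using DERIV_cong_ev[of w w "\<lambda>w. g w * (w - z) ^ n" f] by simp
    then have d: "deriv f w = deriv g w * (w - z) ^ n + g w * (of_nat n * (w - z) ^ (n - 1))"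
      by (rule DERIV_imp_deriv)
    have fw: "f w = g w * (w - z) ^ n" "g w \<noteq> 0" using r(3)[of w] w by auto
    have p: "(w - z) ^ (n - 1) * (w - z) = (w - z) ^ n" if "n > 0"
      using that by (metis Suc_diff_1 power_Suc2)
    show ?thesis unfolding d fw(1) using w fw(2) p
      by (cases "n = 0") (auto simp: field_simps)
  qed
  have "((\<lambda>x. of_real x * deriv g (z + of_real x) / g (z + of_real x) + of_nat n) \<longlongrightarrow> of_real 0 * deriv g (z + of_real 0) / g (z + of_real 0) + of_nat n) (at_right 0)"
  proof (intro tendsto_intros)
    have cont: "isCont g z" "isCont (deriv g) z"
      using g_hol holomorphic_deriv[OF g_hol] r(1) by (auto intro!: continuous_on_interior[of "ball z r"] holomorphic_on_imp_continuous_on)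
    have lim: "((\<lambda>x. z + complex_of_real x) \<longlongrightarrow> z) (at_right 0)"
      by (rule tendsto_eq_intros refl | simp)+
    show "((\<lambda>x. deriv g (z + of_real x)) \<longlongrightarrow> deriv g (z + of_real 0)) (at_right 0)"
      using isCont_tendsto_compose[OF cont(2) lim] by simp
    show "((\<lambda>x. g (z + of_real x)) \<longlongrightarrow> g (z + of_real 0)) (at_right 0)"
      using isCont_tendsto_compose[OF cont(1) lim] by simp
    show "g (z + of_real 0) \<noteq> 0" using r by auto
  qed
  then have "((\<lambda>x. of_real x * deriv g (z + of_real x) / g (z + of_real x) + of_nat n) \<longlongrightarrow> of_nat n) (at_right 0)" by simp
  moreover have "eventually (\<lambda>x. of_real x * deriv g (z + of_real x) / g (z + of_real x) + of_nat n =
      of_real x * (deriv f (z + of_real x) / f (z + of_real x))) (at_right 0)"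
    using eventually_at_right_real[OF r(1)]
  proof eventually_elim
    case (elim x)
    then show ?case using eq[of "z + of_real x"] by (simp add: dist_norm mult.commute)
  qed
  ultimately have "((\<lambda>x. of_real x * (deriv f (z + of_real x) / f (z + of_real x))) \<longlongrightarrow> of_nat n) (at_right 0)"
    by (rule Lim_transform_eventually)
  then show "((\<lambda>x. of_real x * (deriv f (z + of_real x) / f (z + of_real x))) \<longlongrightarrow> of_int (zorder f z)) (at_right 0)"
    using nn by (simp add: n_def)
qed

text \<open>The simple pole at 1, seen through h = (s - 1) zeta, which is holomorphic near 1 with h
  1 = 1.\<close>

lemma zeta_logderiv_times_limit_1:
  "((\<lambda>x. of_real x * mangoldt_series (1 + of_real x)) \<longlongrightarrow> 1) (at_right 0)"
proof -
  define h where "h s = 1 + (\<Sum>n. zeta_rem 0 n s)" for s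
  have h: "h holomorphic_on {s. Re s > 0}"
    unfolding h_def using zeta_rem_sum_holomorphic[of 0] by (intro holomorphic_intros) simp
  have h1: "h 1 = 1"
  proof -
    have "zeta_rem 0 n 1 = 0" for n by (simp add: zeta_rem_def del: of_nat_Suc)
    then show ?thesis by (simp add: h_def)
  qed
  have eq: "of_real x * mangoldt_series (1 + of_real x) = 1 - of_real x * deriv h (1 + of_real x) / h (1 + of_real x)" if x: "x > 0" for x
  proof -
    define s where "s = 1 + complex_of_real x"
    have s: "Re s > 1" "s \<noteq> 1" using x by (auto simp: s_def)
    have hs: "h s = (s - 1) * riemann_zeta s" using riemann_zeta_minus_one_mult[of s] s by (simp add: h_def)
    have "(riemann_zeta has_field_derivative deriv riemann_zeta s) (at s)"
      using riemann_zeta_holomorphic s by (intro holomorphic_derivI[of _ "-{1}"]) auto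
    then have "((\<lambda>s. (s - 1) * riemann_zeta s) has_field_derivative riemann_zeta s + (s - 1) * deriv riemann_zeta s) (at s)"
      by (auto intro!: derivative_eq_intros)
    moreover have "\<forall>\<^sub>F u in nhds s. (u - 1) * riemann_zeta u = h u"
      using eventually_nhds_in_open[of "{s. Re s > 1}" s] s
    proof (auto simp: open_halfspace_Re_gt h_def elim!: eventually_mono)
      fix x :: complex assume "1 < Re x"
      then show "(x - 1) * riemann_zeta x = 1 + (\<Sum>n. zeta_rem 0 n x)"
        by (intro riemann_zeta_minus_one_mult) auto
    qed
    ultimately have "(h has_field_derivative riemann_zeta s + (s - 1) * deriv riemann_zeta s) (at s)"
      using DERIV_cong_ev[of s s "\<lambda>s. (s - 1) * riemann_zeta s" h] by simp
    then have d: "deriv h s = riemann_zeta s + (s - 1) * deriv riemann_zeta s" by (rule DERIV_imp_deriv)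
    have alg: "a * (Z + a * Z') / (a * Z) = 1 + a * (Z' / Z)" if "a \<noteq> 0" "Z \<noteq> 0" for a Z Z' :: complex
      using that by (simp add: field_simps)
    have "(s - 1) * deriv h s / h s = 1 + (s - 1) * (deriv riemann_zeta s / riemann_zeta s)"
      unfolding d hs by (rule alg) (use s riemann_zeta_nonzero_Re_gt_1[of s] in auto)
    also have "\<dots> = 1 - (s - 1) * mangoldt_series s" using s by (simp add: riemann_zeta_logderiv)
    finally show ?thesis by (simp add: s_def)
  qed
  have "((\<lambda>x. 1 - of_real x * deriv h (1 + of_real x) / h (1 + of_real x)) \<longlongrightarrow> 1 - of_real 0 * deriv h (1 + of_real 0) / h (1 + of_real 0)) (at_right 0)"
  proof (intro tendsto_intros)
    have o: "open {s. Re s > (0::real)}" by (rule open_halfspace_Re_gt)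
    have cont: "isCont h 1" "isCont (deriv h) 1"
      using h holomorphic_deriv[OF h o] o
      by (auto intro!: continuous_on_interior[of "{s. Re s > 0}"] holomorphic_on_imp_continuous_on simp: interior_open)
    have lim: "((\<lambda>x. 1 + complex_of_real x) \<longlongrightarrow> 1) (at_right 0)"
      by (rule tendsto_eq_intros refl | simp)+
    show "((\<lambda>x. deriv h (1 + of_real x)) \<longlongrightarrow> deriv h (1 + of_real 0)) (at_right 0)"
      using isCont_tendsto_compose[OF cont(2) lim] by simp
    show "((\<lambda>x. h (1 + of_real x)) \<longlongrightarrow> h (1 + of_real 0)) (at_right 0)"
      using isCont_tendsto_compose[OF cont(1) lim] by simp
    show "h (1 + of_real 0) \<noteq> 0" using h1 by simp
  qed
  then have "((\<lambda>x. 1 - of_real x * deriv h (1 + of_real x) / h (1 + of_real x)) \<longlongrightarrow> 1) (at_right 0)" by simp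
  moreover have "eventually (\<lambda>x. 1 - of_real x * deriv h (1 + of_real x) / h (1 + of_real x) = of_real x * mangoldt_series (1 + of_real x)) (at_right 0)"
    using eventually_at_right_less[of 0] by eventually_elim (simp add: eq)
  ultimately show ?thesis by (rule Lim_transform_eventually)
qed

lemma mangoldt_series_341:
  assumes "x > 0"
  shows "0 \<le> Re (3 * mangoldt_series (1 + of_real x) + 4 * mangoldt_series (1 + \<i> * of_real t + of_real x) + mangoldt_series (1 + \<i> * of_real (2 * t) + of_real x))"
proof -
  have A: "(\<lambda>n. Re (3 * (mangoldt n / of_nat n powr (1 + of_real x)) + 4 * (mangoldt n / of_nat n powr (1 + \<i> * of_real t + of_real x)) +
      mangoldt n / of_nat n powr (1 + \<i> * of_real (2 * t) + of_real x))) sums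
    Re (3 * mangoldt_series (1 + of_real x) + 4 * mangoldt_series (1 + \<i> * of_real t + of_real x) + mangoldt_series (1 + \<i> * of_real (2 * t) + of_real x))"
    using assms by (intro sums_Re sums_add sums_mult mangoldt_series_sums) auto
  have B: "0 \<le> Re (3 * (mangoldt n / of_nat n powr (1 + of_real x)) + 4 * (mangoldt n / of_nat n powr (1 + \<i> * of_real t + of_real x)) +
      mangoldt n / of_nat n powr (1 + \<i> * of_real (2 * t) + of_real x))" for n
  proof (cases "n = 0")
    case False
    define th where "th = t * ln (real n)"
    have trm: "mangoldt n / of_nat n powr (1 + \<i> * of_real u + of_real x) =
        of_real (mangoldt n * real n powr (-1 - x)) * cis (- u * ln (real n))" for u
    proof -
      have "1 / of_nat n powr (1 + \<i> * of_real u + of_real x) = exp (of_real ((-1 - x) * ln (real n)) + \<i> * of_real (- u * ln (real n)))"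
      proof -
        have "of_nat n powr (1 + \<i> * of_real u + of_real x) = exp ((1 + \<i> * of_real u + of_real x) * of_real (ln (real n)))"
          using False by (simp add: powr_def Ln_of_nat)
        then have "1 / of_nat n powr (1 + \<i> * of_real u + of_real x) = exp (- ((1 + \<i> * of_real u + of_real x) * of_real (ln (real n))))"
          by (simp only: exp_minus inverse_eq_divide)
        also have "- ((1 + \<i> * of_real u + of_real x) * of_real (ln (real n))) = of_real ((-1 - x) * ln (real n)) + \<i> * complex_of_real (- u * ln (real n))"
          by (simp add: algebra_simps)
        finally show ?thesis .
      qed
      then have "mangoldt n / of_nat n powr (1 + \<i> * of_real u + of_real x) =
          mangoldt n * (exp (of_real ((-1 - x) * ln (real n))) * exp (\<i> * of_real (- u * ln (real n))))"
        by (simp only: exp_add times_divide_eq_right[symmetric] divide_inverse mult_1)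
      also have "exp (of_real ((-1 - x) * ln (real n))) = complex_of_real (real n powr (-1 - x))"
        using False by (simp only: exp_of_real powr_def) simp
      finally show ?thesis
        by (simp add: cis_conv_exp)
    qed
    have "mangoldt n / of_nat n powr (1 + of_real x) = (of_real (mangoldt n * real n powr (-1 - x)) :: complex)"
      using trm[of 0] by simp
    then have "Re (3 * (mangoldt n / of_nat n powr (1 + of_real x)) + 4 * (mangoldt n / of_nat n powr (1 + \<i> * of_real t + of_real x)) +
      mangoldt n / of_nat n powr (1 + \<i> * of_real (2 * t) + of_real x)) =
      (mangoldt n * real n powr (-1 - x)) * (3 + 4 * cos th + cos (2 * th))"
      unfolding trm by (simp add: th_def algebra_simps)
    also have "3 + 4 * cos th + cos (2 * th) = 2 * (1 + cos th)\<^sup>2"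
      unfolding cos_double_cos by (simp add: power2_eq_square algebra_simps)
    finally show ?thesis using mangoldt_nonneg[of n] by simp
  qed simp
  show ?thesis by (rule sums_le[OF B sums_zero A])
qed

text \<open>The classical 3-4-1 argument in terms of orders: multiplied by x and with x tending to 0
  from the right, the inequality 3 + 4 cos + cos(2 .) >= 0 becomes 3 - 4 k(t) - k(2t) >= 0, which is
  impossible for k(t) >= 1 and k(2t) >= 0.\<close>

lemma riemann_zeta_nonzero_Re_1:
  assumes s: "Re s = 1" "Im s \<noteq> 0"
  shows "riemann_zeta s \<noteq> 0"
proof
  assume zero: "riemann_zeta s = 0"
  define t where "t = Im s"
  have s_eq: "s = 1 + \<i> * of_real t" using s by (simp add: t_def complex_eq_iff)
  have conn: "connected (- {1::complex})" by (rule connected_minus_one)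
  define k where "k u = zorder riemann_zeta (1 + \<i> * of_real u)" for u :: real
  have lim: "((\<lambda>x. of_real x * mangoldt_series (1 + \<i> * of_real u + of_real x)) \<longlongrightarrow> - of_int (k u)) (at_right 0)"
    and k0: "k u \<ge> 0" if "u \<noteq> 0" for u
  proof -
    have ne: "1 + \<i> * of_real u \<in> - {1::complex}" using that by (auto simp: complex_eq_iff)
    have *: "riemann_zeta holomorphic_on - {1}" "open (- {1::complex})" "connected (- {1::complex})" "1 + \<i> * of_real u \<in> - {1}" "(2::complex) \<in> - {1}" "riemann_zeta 2 \<noteq> 0"
      using riemann_zeta_holomorphic conn ne by (auto simp: riemann_zeta_nonzero_Re_gt_1)
    show "k u \<ge> 0" unfolding k_def by (rule logderiv_times_limit(2)[OF *])
    have "((\<lambda>x. of_real x * (deriv riemann_zeta (1 + \<i> * of_real u + of_real x) / riemann_zeta (1 + \<i> * of_real u + of_real x))) \<longlongrightarrow> of_int (k u)) (at_right 0)"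
      unfolding k_def by (rule logderiv_times_limit(1)[OF *])
    then have "((\<lambda>x. - (of_real x * (deriv riemann_zeta (1 + \<i> * of_real u + of_real x) / riemann_zeta (1 + \<i> * of_real u + of_real x)))) \<longlongrightarrow> - of_int (k u)) (at_right 0)"
      by (rule tendsto_minus)
    moreover have "eventually (\<lambda>x. - (of_real x * (deriv riemann_zeta (1 + \<i> * of_real u + of_real x) / riemann_zeta (1 + \<i> * of_real u + of_real x))) =
        of_real x * mangoldt_series (1 + \<i> * of_real u + of_real x)) (at_right 0)"
      using eventually_at_right_less[of 0] by eventually_elim (simp add: riemann_zeta_logderiv)
    ultimately show "((\<lambda>x. of_real x * mangoldt_series (1 + \<i> * of_real u + of_real x)) \<longlongrightarrow> - of_int (k u)) (at_right 0)"
      by (rule Lim_transform_eventually)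
  qed
  have t0: "t \<noteq> 0" "2 * t \<noteq> 0" using s by (auto simp: t_def)
  have "k t > 0"
    unfolding k_def using zero t0 s
    by (intro logderiv_times_limit(3)[of riemann_zeta "- {1}" _ 2])
       (auto simp: s_eq[symmetric] riemann_zeta_holomorphic conn riemann_zeta_nonzero_Re_gt_1)
  have "((\<lambda>x. Re (3 * (of_real x * mangoldt_series (1 + of_real x)) + 4 * (of_real x * mangoldt_series (1 + \<i> * of_real t + of_real x)) +
     of_real x * mangoldt_series (1 + \<i> * of_real (2 * t) + of_real x))) \<longlongrightarrow>
     Re (3 * 1 + 4 * (- of_int (k t)) + (- of_int (k (2 * t))))) (at_right 0)"
    by (intro tendsto_intros zeta_logderiv_times_limit_1 lim t0)
  moreover have "eventually (\<lambda>x. 0 \<le> Re (3 * (of_real x * mangoldt_series (1 + of_real x)) + 4 * (of_real x * mangoldt_series (1 + \<i> * of_real t + of_real x)) +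
     of_real x * mangoldt_series (1 + \<i> * of_real (2 * t) + of_real x))) (at_right 0)"
    using eventually_at_right_less[of 0]
  proof eventually_elim
    case (elim x)
    have "Re (3 * (of_real x * mangoldt_series (1 + of_real x)) + 4 * (of_real x * mangoldt_series (1 + \<i> * of_real t + of_real x)) +
     of_real x * mangoldt_series (1 + \<i> * of_real (2 * t) + of_real x)) =
     x * Re (3 * mangoldt_series (1 + of_real x) + 4 * mangoldt_series (1 + \<i> * of_real t + of_real x) + mangoldt_series (1 + \<i> * of_real (2 * t) + of_real x))"
      by (simp add: algebra_simps)
    then show ?case using mangoldt_series_341[OF elim, of t] elim by simp
  qed
  ultimately have "0 \<le> Re (3 * 1 + 4 * (- of_int (k t)) + (- of_int (k (2 * t))) :: complex)"
    by (rule tendsto_lowerbound) simp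
  then have "real_of_int (4 * k t + k (2 * t)) \<le> 3" by simp
  then show False using \<open>k t > 0\<close> k0[OF t0(2)] by linarith
qed

lemma riemann_zeta_cnj: "riemann_zeta (cnj s) = cnj (riemann_zeta s)"
proof -
  have "zeta_continuation (cnj \<circ> riemann_zeta \<circ> cnj)"
    unfolding zeta_continuation_def
  proof (intro conjI allI impI)
    have "cnj ` (- {1}) = - {1}" 
      by (auto simp: image_cnj_conv_vimage_cnj)
    then show "cnj \<circ> riemann_zeta \<circ> cnj holomorphic_on - {1}"
      using riemann_zeta_holomorphic by (intro holomorphic_on_compose_cnj_cnj) auto
    show "(cnj \<circ> riemann_zeta \<circ> cnj) 1 = 0"
      using zeta_continuation_riemann_zeta by (simp add: zeta_continuation_def)
    fix s assume "1 < Re s"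
    then have "(\<lambda>n. 1 / of_nat (Suc n) powr cnj s) sums riemann_zeta (cnj s)"
      using zeta_continuation_riemann_zeta by (simp add: zeta_continuation_def)
    then have "(\<lambda>n. cnj (1 / of_nat (Suc n) powr cnj s)) sums cnj (riemann_zeta (cnj s))"
      by (subst sums_cnj)
    moreover have "cnj (1 / of_nat (Suc n) powr cnj s) = 1 / of_nat (Suc n) powr s" for n
      by (simp add: cnj_powr del: of_nat_Suc)
    ultimately show "(\<lambda>n. 1 / of_nat (Suc n) powr s) sums (cnj \<circ> riemann_zeta \<circ> cnj) s" by simp
  qed
  from zeta_continuation_unique[OF this zeta_continuation_riemann_zeta]
  show ?thesis by (metis comp_apply complex_cnj_cnj)
qed

lemma riemann_zeta_logderiv_cnj:
  assumes "s \<noteq> 1"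
  shows "deriv riemann_zeta (cnj s) / riemann_zeta (cnj s) = cnj (deriv riemann_zeta s / riemann_zeta s)"
proof -
  have "(riemann_zeta has_field_derivative deriv riemann_zeta s) (at s)"
    using assms riemann_zeta_holomorphic by (intro holomorphic_derivI[of _ "-{1}"]) auto
  then have "(cnj \<circ> riemann_zeta \<circ> cnj has_field_derivative cnj (deriv riemann_zeta s)) (at (cnj s))"
    using has_field_derivative_cnj_cnj[of riemann_zeta "deriv riemann_zeta s" "cnj s"] by simp
  moreover have "cnj \<circ> riemann_zeta \<circ> cnj = riemann_zeta" by (auto simp: riemann_zeta_cnj)
  ultimately have "deriv riemann_zeta (cnj s) = cnj (deriv riemann_zeta s)" by (simp add: DERIV_imp_deriv)
  then show ?thesis by (simp add: riemann_zeta_cnj)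
qed

section \<open>The functional equation\<close>

lemma Digamma_reflection:
  fixes z :: complex
  assumes "Im z \<noteq> 0"
  shows "Digamma z - Digamma (1 - z) = - of_real pi * cos (of_real pi * z) / sin (of_real pi * z)"
proof -
  have ni': "w \<notin> \<int>\<^sub>\<le>\<^sub>0" if "Im w \<noteq> 0" for w :: complex
    using that by (auto elim!: nonpos_Ints_cases')
  have ni: "z \<notin> \<int>\<^sub>\<le>\<^sub>0" "1 - z \<notin> \<int>\<^sub>\<le>\<^sub>0" using assms by (auto intro!: ni')
  have G: "Gamma z \<noteq> 0" "Gamma (1 - z) \<noteq> 0" using ni by (auto simp: Gamma_eq_zero_iff)
  have s: "sin (of_real pi * z) \<noteq> 0" using Gamma_reflection_complex[of z] G by auto
  have "((\<lambda>z. Gamma z * Gamma (1 - z)) has_field_derivative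
      Gamma z * Gamma (1 - z) * (Digamma z - Digamma (1 - z))) (at z)"
    using ni by (auto intro!: derivative_eq_intros simp: algebra_simps)
  moreover have "((\<lambda>z. of_real pi / sin (of_real pi * z)) has_field_derivative
      - of_real pi * (cos (of_real pi * z) * of_real pi) / (sin (of_real pi * z))\<^sup>2) (at z)"
    using s by (auto intro!: derivative_eq_intros simp: power2_eq_square)
  ultimately have "Gamma z * Gamma (1 - z) * (Digamma z - Digamma (1 - z)) =
      - of_real pi * (cos (of_real pi * z) * of_real pi) / (sin (of_real pi * z))\<^sup>2"
    using DERIV_unique by (auto simp: Gamma_reflection_complex)
  then have "of_real pi / sin (of_real pi * z) * (Digamma z - Digamma (1 - z)) =
      of_real pi / sin (of_real pi * z) * (- of_real pi * cos (of_real pi * z) / sin (of_real pi * z))"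
    by (simp add: Gamma_reflection_complex power2_eq_square mult_ac)
  then show ?thesis using s by (simp only: mult_cancel_left) simp
qed

text \<open>The reflection formula for Digamma at z = 1/2 + ix/(2 pi), where the cotangent becomes a
  hyperbolic tangent, combined with the limit formula for Digamma z - Digamma (1 - z), whose terms
  are the fractions on the left.\<close>

lemma tanh_sums:
  assumes x: "x > (0::real)"
  shows "(\<lambda>n. 4 * x / (x\<^sup>2 + (pi * (2 * real n + 1))\<^sup>2)) sums tanh (x / 2)"
proof -
  define \<tau> where "\<tau> = x / (2 * pi)"
  define z where "z = Complex (1 / 2) \<tau>"
  have \<tau>: "\<tau> > 0" using x by (simp add: \<tau>_def)
  have z0: "z \<noteq> 0" "1 - z \<noteq> 0" "Im z \<noteq> 0" using \<tau> by (auto simp: z_def complex_eq_iff)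
  have eq: "inverse (1 - z + of_nat n) - inverse (z + of_nat n) = \<i> * of_real (2 * \<tau> / ((real n + 1/2)\<^sup>2 + \<tau>\<^sup>2))" for n
  proof -
    have "z + of_nat n = Complex (real n + 1/2) \<tau>" "1 - z + of_nat n = Complex (real n + 1/2) (- \<tau>)"
      by (auto simp: z_def complex_eq_iff)
    moreover have "inverse (Complex q (- \<tau>)) - inverse (Complex q \<tau>) = \<i> * of_real (2 * \<tau> / (q\<^sup>2 + \<tau>\<^sup>2))" for q
      by (simp add: complex_eq_iff add_divide_distrib)
    ultimately show ?thesis by (simp only:)
  qed
  have "(\<lambda>m. (of_real (ln (real m)) - (\<Sum>n<m. inverse (z + of_nat n))) - (of_real (ln (real m)) - (\<Sum>n<m. inverse (1 - z + of_nat n))))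
      \<longlonglongrightarrow> Digamma z - Digamma (1 - z)"
    by (intro tendsto_diff Digamma_LIMSEQ z0)
  then have "(\<lambda>n. inverse (1 - z + of_nat n) - inverse (z + of_nat n)) sums (Digamma z - Digamma (1 - z))"
    unfolding sums_def by (simp add: sum_subtractf)
  then have s1: "(\<lambda>n. \<i> * of_real (2 * \<tau> / ((real n + 1/2)\<^sup>2 + \<tau>\<^sup>2))) sums (Digamma z - Digamma (1 - z))"
    by (simp only: eq)
  have "of_real pi * z = of_real (pi / 2) + \<i> * of_real (pi * \<tau>)"
    by (simp add: z_def complex_eq_iff)
  then have "cos (of_real pi * z) = - sin (\<i> * of_real (pi * \<tau>))" "sin (of_real pi * z) = cos (\<i> * of_real (pi * \<tau>))"
    by (simp_all add: cos_add sin_add flip: cos_of_real sin_of_real)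
  then have "Digamma z - Digamma (1 - z) = of_real pi * tan (\<i> * of_real (pi * \<tau>))"
    using Digamma_reflection[OF z0(3)] by (simp add: tan_def)
  also have "tan (\<i> * of_real (pi * \<tau>)) = \<i> * of_real (tanh (pi * \<tau>))"
  proof -
    have "complex_of_real (tanh y) = tanh (of_real y)" for y
      by (simp add: tanh_altdef exp_of_real flip: of_real_minus)
    from this[of "pi * \<tau>"] have "complex_of_real (tanh (pi * \<tau>)) = tanh (of_real (pi * \<tau>))" .
    then show ?thesis using tanh_conv_tan[of "of_real (pi * \<tau>)"] by simp
  qed
  finally have "(\<lambda>n. Im (\<i> * of_real (2 * \<tau> / ((real n + 1/2)\<^sup>2 + \<tau>\<^sup>2)))) sums Im (of_real pi * (\<i> * of_real (tanh (pi * \<tau>))))"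
    using sums_Im[OF s1] by simp
  then have "(\<lambda>n. 2 * \<tau> / ((real n + 1/2)\<^sup>2 + \<tau>\<^sup>2)) sums (pi * tanh (pi * \<tau>))" by simp
  then have "(\<lambda>n. 2 * \<tau> / ((real n + 1/2)\<^sup>2 + \<tau>\<^sup>2) / pi) sums (pi * tanh (pi * \<tau>) / pi)" by (rule sums_divide)
  moreover have "pi * tanh (pi * \<tau>) / pi = tanh (x / 2)" by (simp add: \<tau>_def)
  moreover have "2 * \<tau> / ((real n + 1/2)\<^sup>2 + \<tau>\<^sup>2) / pi = 4 * x / (x\<^sup>2 + (pi * (2 * real n + 1))\<^sup>2)" for n
  proof -
    have "(real n + 1/2)\<^sup>2 + \<tau>\<^sup>2 = (x\<^sup>2 + (pi * (2 * real n + 1))\<^sup>2) / (4 * pi\<^sup>2)"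
      by (simp add: \<tau>_def field_simps power2_eq_square)
    moreover have "2 * (x / (2 * pi)) / (Q / (4 * pi\<^sup>2)) / pi = 4 * x / Q" for Q
      by (cases "Q = 0") (auto simp: field_simps power2_eq_square)
    ultimately show ?thesis by (simp only: \<tau>_def)
  qed
  ultimately show ?thesis by simp
qed

section \<open>Gamma integrals evaluated by Tonelli's theorem\<close>

lemma nn_integral_Gamma_scaled:
  assumes p: "p > (0::real)" and c: "c > 0"
  shows "(\<integral>\<^sup>+r. ennreal (indicator {0<..} r * (r powr (p - 1) * exp (- (c * r)))) \<partial>lborel) = ennreal (Gamma p * c powr (- p))"
proof -
  have "ennreal (Gamma p) = (\<integral>\<^sup>+t. ennreal (indicator {0..} t * t powr (p - 1) / exp t) \<partial>lborel)"
    by (rule Gamma_conv_nn_integral_real[OF p])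
  also have "\<dots> = \<bar>c\<bar> * (\<integral>\<^sup>+r. ennreal (indicator {0..} (0 + c * r) * (0 + c * r) powr (p - 1) / exp (0 + c * r)) \<partial>lborel)"
    by (rule nn_integral_real_affine) (use c in auto)
  also have "(\<integral>\<^sup>+r. ennreal (indicator {0..} (0 + c * r) * (0 + c * r) powr (p - 1) / exp (0 + c * r)) \<partial>lborel) =
      (\<integral>\<^sup>+r. ennreal (c powr (p - 1)) * ennreal (indicator {0<..} r * (r powr (p - 1) * exp (- (c * r)))) \<partial>lborel)"
  proof (rule nn_integral_cong_AE)
    have "AE r in lborel. r \<noteq> (0::real)" by (rule AE_lborel_singleton)
    then show "AE r in lborel. ennreal (indicator {0..} (0 + c * r) * (0 + c * r) powr (p - 1) / exp (0 + c * r)) =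
       ennreal (c powr (p - 1)) * ennreal (indicator {0<..} r * (r powr (p - 1) * exp (- (c * r))))"
    proof (rule AE_mp, intro AE_I2 impI)
      fix r :: real assume r: "r \<noteq> 0"
      show "ennreal (indicator {0..} (0 + c * r) * (0 + c * r) powr (p - 1) / exp (0 + c * r)) =
       ennreal (c powr (p - 1)) * ennreal (indicator {0<..} r * (r powr (p - 1) * exp (- (c * r))))"
        using r c by (subst ennreal_mult'[symmetric])
          (auto simp: indicator_def zero_le_mult_iff powr_mult exp_minus field_simps)
    qed
  qed
  also have "\<dots> = ennreal (c powr (p - 1)) * (\<integral>\<^sup>+r. ennreal (indicator {0<..} r * (r powr (p - 1) * exp (- (c * r)))) \<partial>lborel)"
    by (rule nn_integral_cmult) measurable
  finally have "ennreal (c powr (- p)) * ennreal (Gamma p) =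
      ennreal (c powr (- p)) * (ennreal \<bar>c\<bar> * (ennreal (c powr (p - 1)) * (\<integral>\<^sup>+r. ennreal (indicator {0<..} r * (r powr (p - 1) * exp (- (c * r)))) \<partial>lborel)))"
    by simp
  also have "\<dots> = ennreal (c powr (- p) * (c * c powr (p - 1))) * (\<integral>\<^sup>+r. ennreal (indicator {0<..} r * (r powr (p - 1) * exp (- (c * r)))) \<partial>lborel)"
    using c by (simp add: ennreal_mult' mult.assoc)
  also have "c powr (- p) * (c * c powr (p - 1)) = 1"
  proof -
    have "c * c powr (p - 1) = c powr p" using c by (simp add: powr_mult_base)
    then show ?thesis using c by (simp add: powr_minus)
  qed
  finally show ?thesis using p by (simp add: ennreal_mult' mult.commute)
qed

lemma nn_integral_powr_gauss:
  assumes s: "-1 < s" and r: "r > (0::real)"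
  shows "(\<integral>\<^sup>+u. ennreal (indicator {0<..} u * (u powr s * exp (- (r * u\<^sup>2)))) \<partial>lborel) = ennreal (Gamma ((1 + s) / 2) * r powr (- (1 + s) / 2) / 2)"
proof -
  define p where "p = (1 + s) / 2"
  have p: "p > 0" using s by (simp add: p_def)
  define I where "I = Gamma p * r powr (- p)"
  have I0: "I \<ge> 0" using p by (simp add: I_def)
  define f where "f v = v powr (p - 1) * exp (- (r * v))" for v :: real
  have "((\<lambda>v. indicator {0<..} v * f v) has_integral I) UNIV"
    by (rule nn_integral_has_integral) (use nn_integral_Gamma_scaled[OF p r] I0 in \<open>auto simp: f_def I_def indicator_def\<close>)
  then have "((\<lambda>v. if v \<in> {0<..} then f v else 0) has_integral I) UNIV"
    by (rule has_integral_eq[rotated]) auto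
  then have fI: "(f has_integral I) {0<..}" by (simp only: has_integral_restrict_UNIV)
  have f_abs: "f absolutely_integrable_on {0<..}"
    using fI by (intro nonnegative_absolutely_integrable_1) (auto simp: f_def)
  have img: "(\<lambda>u::real. u\<^sup>2) ` {0<..} = {0<..}"
  proof (intro equalityI subsetI)
    fix v :: real assume "v \<in> {0<..}"
    then show "v \<in> (\<lambda>u. u\<^sup>2) ` {0<..}" by (intro image_eqI[of _ _ "sqrt v"]) auto
  qed auto
  have "(\<lambda>u. \<bar>2 * u\<bar> * f (u\<^sup>2)) absolutely_integrable_on {0<..} \<and> integral {0<..} (\<lambda>u. \<bar>2 * u\<bar> * f (u\<^sup>2)) = I"
  proof -
    have "((\<lambda>u. \<bar>2 * u\<bar> * f (u\<^sup>2)) absolutely_integrable_on {0<..} \<and> integral {0<..} (\<lambda>u. \<bar>2 * u\<bar> * f (u\<^sup>2)) = I) \<longleftrightarrow>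
        (f absolutely_integrable_on (\<lambda>u. u\<^sup>2) ` {0<..} \<and> integral ((\<lambda>u. u\<^sup>2) ` {0<..}) f = I)"
    proof (rule has_absolute_integral_change_of_variables_1')
      show "((\<lambda>u. u\<^sup>2) has_field_derivative 2 * x) (at x within {0<..})" for x :: real
        by (auto intro!: derivative_eq_intros)
    qed (auto simp: inj_on_def power2_eq_iff)
    then show ?thesis unfolding img using f_abs fI by (auto simp: integral_unique)
  qed
  then have hi: "((\<lambda>u. \<bar>2 * u\<bar> * f (u\<^sup>2)) has_integral I) {0<..}"
    by (auto simp: absolutely_integrable_on_def has_integral_integral)
  have hi2: "((\<lambda>u. u powr s * exp (- (r * u\<^sup>2))) has_integral I / 2) {0<..}"
  proof -
    have "((\<lambda>u. \<bar>2 * u\<bar> * f (u\<^sup>2) / 2) has_integral I / 2) {0<..}" using hi by (rule has_integral_divide)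
    then show ?thesis
    proof (rule has_integral_eq[rotated])
      fix u :: real assume u: "u \<in> {0<..}"
      have "(u\<^sup>2) powr (p - 1) = u powr (s - 1)"
      proof -
        have "u\<^sup>2 = u powr 2" using u by (simp add: powr_numeral)
        then have "(u\<^sup>2) powr (p - 1) = u powr (2 * (p - 1))" by (simp only: powr_powr)
        moreover have "2 * (p - 1) = s - 1" by (simp add: p_def field_simps)
        ultimately show ?thesis by simp
      qed
      moreover have "u * u powr (s - 1) = u powr s" using u by (simp add: powr_mult_base)
      ultimately show "\<bar>2 * u\<bar> * f (u\<^sup>2) / 2 = u powr s * exp (- (r * u\<^sup>2))"
        using u by (simp add: f_def mult.assoc[symmetric])
    qed
  qed
  have "(\<integral>\<^sup>+u. ennreal (indicator {0<..} u * (u powr s * exp (- (r * u\<^sup>2)))) \<partial>lborel) = ennreal (I / 2)"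
    by (rule nn_integral_has_integral_lebesgue[OF _ hi2]) auto
  moreover have "- (1 + s) / 2 = - p" by (simp add: p_def field_simps)
  ultimately show ?thesis by (simp only: I_def p_def[symmetric])
qed

text \<open>1/(u^2 + a^2) is the integral of e^(-r(u^2 + a^2)) over r > 0. After the swap the inner
  integral is a Gaussian moment and the outer one a Gamma integral; their convergence is what -1 < s
  and s < 1 stand for.\<close>

lemma nn_integral_powr_rational:
  assumes s: "-1 < s" "s < 1" and a: "a > (0::real)"
  shows "(\<integral>\<^sup>+u. ennreal (indicator {0<..} u * (u powr s / (u\<^sup>2 + a\<^sup>2))) \<partial>lborel) =
     ennreal (Gamma ((1 + s) / 2) * Gamma ((1 - s) / 2) * a powr (s - 1) / 2)"
proof -
  define h where "h u r = indicator {0<..} u * (u powr s * exp (- (r * u\<^sup>2))) * (indicator {0<..} r * exp (- (a\<^sup>2 * r)))" for u r :: real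
  have meas: "(\<lambda>(u, r). ennreal (h u r)) \<in> borel_measurable (lborel \<Otimes>\<^sub>M lborel)"
    unfolding h_def by measurable
  have a2: "a\<^sup>2 > 0" using a by simp
  have "(\<integral>\<^sup>+u. ennreal (indicator {0<..} u * (u powr s / (u\<^sup>2 + a\<^sup>2))) \<partial>lborel) = (\<integral>\<^sup>+u. (\<integral>\<^sup>+r. ennreal (h u r) \<partial>lborel) \<partial>lborel)"
  proof (rule nn_integral_cong)
    fix u :: real
    show "ennreal (indicator {0<..} u * (u powr s / (u\<^sup>2 + a\<^sup>2))) = (\<integral>\<^sup>+r. ennreal (h u r) \<partial>lborel)"
    proof (cases "u > 0")
      case True
      define c where "c = u\<^sup>2 + a\<^sup>2"
      have c: "c > 0" using a2 by (simp add: c_def add_nonneg_pos)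
      have "(\<integral>\<^sup>+r. ennreal (h u r) \<partial>lborel) = (\<integral>\<^sup>+r. ennreal (u powr s) * ennreal (indicator {0<..} r * (r powr (1 - 1) * exp (- (c * r)))) \<partial>lborel)"
      proof (rule nn_integral_cong)
        fix r :: real
        show "ennreal (h u r) = ennreal (u powr s) * ennreal (indicator {0<..} r * (r powr (1 - 1) * exp (- (c * r))))"
          using True by (subst ennreal_mult'[symmetric])
            (auto simp: h_def indicator_def c_def exp_add[symmetric] algebra_simps)
      qed
      also have "\<dots> = ennreal (u powr s) * (\<integral>\<^sup>+r. ennreal (indicator {0<..} r * (r powr (1 - 1) * exp (- (c * r)))) \<partial>lborel)"
        by (rule nn_integral_cmult) measurable
      also have "\<dots> = ennreal (u powr s) * ennreal (1 * c powr (-1))"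
        using nn_integral_Gamma_scaled[of 1 c] c by simp
      also have "\<dots> = ennreal (u powr s / c)" using c by (subst ennreal_mult'[symmetric]) (auto simp: powr_minus divide_inverse)
      finally show ?thesis using True by (simp add: c_def)
    qed (simp add: h_def)
  qed
  also have "\<dots> = (\<integral>\<^sup>+r. (\<integral>\<^sup>+u. ennreal (h u r) \<partial>lborel) \<partial>lborel)"
    using lborel_pair.Fubini'[OF meas] by simp
  also have "\<dots> = (\<integral>\<^sup>+r. ennreal (Gamma ((1 + s) / 2) / 2) * ennreal (indicator {0<..} r * (r powr ((1 - s) / 2 - 1) * exp (- (a\<^sup>2 * r)))) \<partial>lborel)"
  proof (rule nn_integral_cong)
    fix r :: real
    show "(\<integral>\<^sup>+u. ennreal (h u r) \<partial>lborel) = ennreal (Gamma ((1 + s) / 2) / 2) * ennreal (indicator {0<..} r * (r powr ((1 - s) / 2 - 1) * exp (- (a\<^sup>2 * r))))"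
    proof (cases "r > 0")
      case True
      have "(\<integral>\<^sup>+u. ennreal (h u r) \<partial>lborel) = (\<integral>\<^sup>+u. ennreal (exp (- (a\<^sup>2 * r))) * ennreal (indicator {0<..} u * (u powr s * exp (- (r * u\<^sup>2)))) \<partial>lborel)"
        using True by (intro nn_integral_cong, subst ennreal_mult'[symmetric]) (auto simp: h_def mult_ac)
      also have "\<dots> = ennreal (exp (- (a\<^sup>2 * r))) * (\<integral>\<^sup>+u. ennreal (indicator {0<..} u * (u powr s * exp (- (r * u\<^sup>2)))) \<partial>lborel)"
        by (rule nn_integral_cmult) measurable
      also have "\<dots> = ennreal (exp (- (a\<^sup>2 * r))) * ennreal (Gamma ((1 + s) / 2) * r powr (- (1 + s) / 2) / 2)"
        by (subst nn_integral_powr_gauss[OF s(1) True]) simp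
      also have "\<dots> = ennreal (Gamma ((1 + s) / 2) / 2 * (r powr (- (1 + s) / 2) * exp (- (a\<^sup>2 * r))))"
        by (subst ennreal_mult'[symmetric]) (auto simp: mult_ac)
      also have "- (1 + s) / 2 = (1 - s) / 2 - 1" by (simp add: field_simps)
      finally show ?thesis using True s by (subst ennreal_mult'[symmetric]) (auto simp: mult_ac)
    qed (simp add: h_def)
  qed
  also have "\<dots> = ennreal (Gamma ((1 + s) / 2) / 2) * (\<integral>\<^sup>+r. ennreal (indicator {0<..} r * (r powr ((1 - s) / 2 - 1) * exp (- (a\<^sup>2 * r)))) \<partial>lborel)"
    by (rule nn_integral_cmult) measurable
  also have "\<dots> = ennreal (Gamma ((1 + s) / 2) / 2) * ennreal (Gamma ((1 - s) / 2) * (a\<^sup>2) powr (- ((1 - s) / 2)))"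
    using s a2 by (subst nn_integral_Gamma_scaled) auto
  also have "(a\<^sup>2) powr (- ((1 - s) / 2)) = a powr (s - 1)"
  proof -
    have "a\<^sup>2 = a powr 2" using a by (simp add: powr_numeral)
    then have "(a\<^sup>2) powr (- ((1 - s) / 2)) = a powr (2 * (- ((1 - s) / 2)))" by (simp only: powr_powr)
    moreover have "2 * (- ((1 - s) / 2)) = s - 1" by (simp add: field_simps)
    ultimately show ?thesis by (simp only:)
  qed
  also have "ennreal (Gamma ((1 + s) / 2) / 2) * ennreal (Gamma ((1 - s) / 2) * a powr (s - 1)) =
      ennreal (Gamma ((1 + s) / 2) * Gamma ((1 - s) / 2) * a powr (s - 1) / 2)"
    using s by (subst ennreal_mult'[symmetric]) (auto simp: mult_ac)
  finally show ?thesis .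
qed

text \<open>Minus the derivative of 1/(e^x + 1). Its Mellin transform drives the functional
  equation: expanded in exponentials it yields zeta(s) for s > 1, and through the partial fractions
  of tanh it yields zeta(1 - s) for -1 < s < 0. As the density is bounded near 0 and decays
  exponentially, the transform exists for Re s > -1, a connected region containing both
  ranges.\<close>

definition logistic_density :: "real \<Rightarrow> real" where
  "logistic_density x = exp x / (exp x + 1)\<^sup>2"

lemma logistic_density_nonneg: "logistic_density x \<ge> 0"
  by (simp add: logistic_density_def)

lemma logistic_density_le: "logistic_density x \<le> exp (- x)"
proof -
  have "exp x * exp x \<le> (exp x + 1)\<^sup>2"
    by (simp add: power2_eq_square algebra_simps)
  then have "exp x / (exp x + 1)\<^sup>2 \<le> 1 / exp x"
    by (simp add: divide_simps add_nonneg_eq_0_iff)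
  then show ?thesis by (simp add: logistic_density_def exp_minus divide_inverse)
qed

lemma borel_measurable_logistic_density [measurable]: "logistic_density \<in> borel_measurable borel"
  unfolding logistic_density_def by measurable

lemma nn_integral_logistic_density:
  assumes "u \<ge> 0"
  shows "(\<integral>\<^sup>+x. ennreal (logistic_density x) * indicator {0..u} x \<partial>lborel) = ennreal (tanh (u / 2) / 2)"
proof -
  have ne: "exp x + 1 \<noteq> (0::real)" for x by (smt (verit) exp_gt_zero)
  have "(\<integral>\<^sup>+x. ennreal (logistic_density x) * indicator {0..u} x \<partial>lborel) =
      ennreal (- 1 / (exp u + 1) - (- 1 / (exp 0 + 1)))"
  proof (rule nn_integral_FTC_Icc)
    show "((\<lambda>x. - 1 / (exp x + 1)) has_real_derivative logistic_density x) (at x)" for x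
      unfolding logistic_density_def using ne[of x]
      by (auto intro!: derivative_eq_intros simp: power2_eq_square)
  qed (use assms logistic_density_nonneg in auto)
  also have "- 1 / (exp u + 1) - (- 1 / (exp 0 + 1)) = tanh (u / 2) / 2"
  proof -
    have "- 1 / (e + 1) - (- 1 / (1 + 1)) = ((1 - inverse e) / (1 + inverse e)) / 2" if "e > 0" for e :: real
    proof -
      have "1 - inverse e = (e - 1) / e" "1 + inverse e = (e + 1) / e" using that by (simp_all add: field_simps)
      then have *: "(1 - inverse e) / (1 + inverse e) = (e - 1) / (e + 1)" using that by simp
      show ?thesis unfolding * using that by (simp add: field_simps)
    qed
    from this[of "exp u"] show ?thesis by (simp add: tanh_real_altdef exp_minus)
  qed
  finally show ?thesis .
qed

lemma nn_integral_powr_atLeast: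
  assumes "s < 0" "x > (0::real)"
  shows "(\<integral>\<^sup>+u. ennreal (- s * u powr (s - 1)) * indicator {x..} u \<partial>lborel) = ennreal (x powr s)"
proof -
  have "(\<integral>\<^sup>+u. ennreal (- s * u powr (s - 1)) * indicator {x..} u \<partial>lborel) = ennreal (0 - (- (x powr s)))"
  proof (rule nn_integral_FTC_atLeast)
    show "((\<lambda>u. - (u powr s)) has_real_derivative - s * u powr (s - 1)) (at u)" if "x \<le> u" for u
      using that assms by (auto intro!: derivative_eq_intros)
    have "((\<lambda>u::real. u powr s) \<longlongrightarrow> 0) at_top"
      using assms by (intro tendsto_neg_powr filterlim_ident)
    from tendsto_minus[OF this] show "((\<lambda>u. - (u powr s)) \<longlongrightarrow> 0) at_top" by simp
  qed (use assms in \<open>auto simp: mult_le_0_iff\<close>)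
  then show ?thesis by simp
qed

text \<open>For s < 0 the power x^s is the integral of -s u^(s-1) over u >= x. After swapping, the
  density integrated over [0, u] gives tanh(u/2)/2, whose partial fractions are integrated term by
  term with \<open>nn_integral_powr_rational\<close>.\<close>

lemma nn_integral_powr_logistic:
  assumes s: "-1 < s" "s < 0"
  shows "(\<integral>\<^sup>+x. ennreal (indicator {0<..} x * (x powr s * logistic_density x)) \<partial>lborel) =
    (\<Sum>n. ennreal (- s * (Gamma ((1 + s) / 2) * Gamma ((1 - s) / 2)) * (pi * (2 * real n + 1)) powr (s - 1)))"
proof -
  define h where "h x u = indicator {0<..} x * logistic_density x * (- s * u powr (s - 1)) * (if x \<le> u then 1 else 0)" for x u :: real
  have meas: "(\<lambda>(x, u). ennreal (h x u)) \<in> borel_measurable (lborel \<Otimes>\<^sub>M lborel)"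
    unfolding h_def by measurable
  have "(\<integral>\<^sup>+x. ennreal (indicator {0<..} x * (x powr s * logistic_density x)) \<partial>lborel) = (\<integral>\<^sup>+x. (\<integral>\<^sup>+u. ennreal (h x u) \<partial>lborel) \<partial>lborel)"
  proof (rule nn_integral_cong)
    fix x :: real
    show "ennreal (indicator {0<..} x * (x powr s * logistic_density x)) = (\<integral>\<^sup>+u. ennreal (h x u) \<partial>lborel)"
    proof (cases "x > 0")
      case True
      have "(\<integral>\<^sup>+u. ennreal (h x u) \<partial>lborel) = (\<integral>\<^sup>+u. ennreal (logistic_density x) * (ennreal (- s * u powr (s - 1)) * indicator {x..} u) \<partial>lborel)"
        using True logistic_density_nonneg[of x]
        by (intro nn_integral_cong) (auto simp: h_def indicator_def ennreal_mult'[symmetric] mult_ac)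
      also have "\<dots> = ennreal (logistic_density x) * (\<integral>\<^sup>+u. ennreal (- s * u powr (s - 1)) * indicator {x..} u \<partial>lborel)"
        by (rule nn_integral_cmult) measurable
      also have "\<dots> = ennreal (logistic_density x) * ennreal (x powr s)"
        by (subst nn_integral_powr_atLeast) (use s True in auto)
      finally show ?thesis using True logistic_density_nonneg[of x] by (simp add: ennreal_mult' mult.commute)
    qed (simp add: h_def)
  qed
  also have "\<dots> = (\<integral>\<^sup>+u. (\<integral>\<^sup>+x. ennreal (h x u) \<partial>lborel) \<partial>lborel)"
    using lborel_pair.Fubini'[OF meas] by simp
  also have "\<dots> = (\<integral>\<^sup>+u. (\<Sum>n. ennreal (- 2 * s) * ennreal (indicator {0<..} u * (u powr s / (u\<^sup>2 + (pi * (2 * real n + 1))\<^sup>2)))) \<partial>lborel)"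
  proof (rule nn_integral_cong)
    fix u :: real
    show "(\<integral>\<^sup>+x. ennreal (h x u) \<partial>lborel) = (\<Sum>n. ennreal (- 2 * s) * ennreal (indicator {0<..} u * (u powr s / (u\<^sup>2 + (pi * (2 * real n + 1))\<^sup>2))))"
    proof (cases "u > 0")
      case True
      have "(\<integral>\<^sup>+x. ennreal (h x u) \<partial>lborel) = (\<integral>\<^sup>+x. ennreal (- s * u powr (s - 1)) * (ennreal (logistic_density x) * indicator {0..u} x) \<partial>lborel)"
      proof (rule nn_integral_cong_AE)
        have "AE x in lborel. x \<noteq> (0::real)" by (rule AE_lborel_singleton)
        then show "AE x in lborel. ennreal (h x u) = ennreal (- s * u powr (s - 1)) * (ennreal (logistic_density x) * indicator {0..u} x)"
        proof (rule AE_mp, intro AE_I2 impI)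
          fix x :: real assume "x \<noteq> 0"
          then show "ennreal (h x u) = ennreal (- s * u powr (s - 1)) * (ennreal (logistic_density x) * indicator {0..u} x)"
            using True s logistic_density_nonneg[of x]
            by (auto simp: h_def indicator_def ennreal_mult'[symmetric] mult_ac)
        qed
      qed
      also have "\<dots> = ennreal (- s * u powr (s - 1)) * (\<integral>\<^sup>+x. (ennreal (logistic_density x) * indicator {0..u} x) \<partial>lborel)"
        by (rule nn_integral_cmult) measurable
      also have "\<dots> = ennreal (- s * u powr (s - 1)) * ennreal (tanh (u / 2) / 2)"
        using True by (subst nn_integral_logistic_density) auto
      also have "\<dots> = ennreal (- s * u powr (s - 1) * (tanh (u / 2) / 2))"
        using True by (subst ennreal_mult'') auto
      finally have lhs: "(\<integral>\<^sup>+x. ennreal (h x u) \<partial>lborel) = ennreal (- s * u powr (s - 1) * (tanh (u / 2) / 2))" .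
      have "(\<lambda>n. - s * u powr (s - 1) * (4 * u / (u\<^sup>2 + (pi * (2 * real n + 1))\<^sup>2) / 2)) sums (- s * u powr (s - 1) * (tanh (u / 2) / 2))"
        by (intro sums_mult sums_divide tanh_sums True)
      moreover have "- s * u powr (s - 1) * (4 * u / q / 2) = (- 2 * s) * (u powr s / q)" for q
      proof -
        have "u * u powr (s - 1) = u powr s" using True by (simp add: powr_mult_base)
        then have "u powr s = u * u powr (s - 1)" by simp
        then show ?thesis by (simp add: field_simps)
      qed
      ultimately have "(\<lambda>n. (- 2 * s) * (u powr s / (u\<^sup>2 + (pi * (2 * real n + 1))\<^sup>2))) sums (- s * u powr (s - 1) * (tanh (u / 2) / 2))"
        by (simp only:)
      then have "(\<Sum>n. ennreal ((- 2 * s) * (u powr s / (u\<^sup>2 + (pi * (2 * real n + 1))\<^sup>2)))) = ennreal (- s * u powr (s - 1) * (tanh (u / 2) / 2))"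
      proof -
        have "0 \<le> (- 2 * s) * (u powr s / (u\<^sup>2 + (pi * (2 * real n + 1))\<^sup>2))" for n
        proof (rule mult_nonneg_nonneg)
          show "0 \<le> - 2 * s" using s by simp
        qed (intro divide_nonneg_nonneg, auto)
        then show ?thesis
          using \<open>(\<lambda>n. (- 2 * s) * (u powr s / (u\<^sup>2 + (pi * (2 * real n + 1))\<^sup>2))) sums (- s * u powr (s - 1) * (tanh (u / 2) / 2))\<close>
          by (subst suminf_ennreal2) (simp_all only: sums_iff)
      qed
      moreover have "ennreal (- 2 * s) * ennreal (indicator {0<..} u * q) = ennreal ((- 2 * s) * q)" for q
        using s True by (subst ennreal_mult'[symmetric]) auto
      ultimately show ?thesis unfolding lhs by (simp only:)
    next
      case False
      then have "h x u = 0" for x by (auto simp: h_def indicator_def)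
      then show ?thesis using False by simp
    qed
  qed
  also have "\<dots> = (\<Sum>n. (\<integral>\<^sup>+u. ennreal (- 2 * s) * ennreal (indicator {0<..} u * (u powr s / (u\<^sup>2 + (pi * (2 * real n + 1))\<^sup>2))) \<partial>lborel))"
    by (rule nn_integral_suminf) measurable
  also have "\<dots> = (\<Sum>n. ennreal (- s * (Gamma ((1 + s) / 2) * Gamma ((1 - s) / 2)) * (pi * (2 * real n + 1)) powr (s - 1)))"
  proof (rule suminf_cong)
    fix n
    have "(\<integral>\<^sup>+u. ennreal (- 2 * s) * ennreal (indicator {0<..} u * (u powr s / (u\<^sup>2 + (pi * (2 * real n + 1))\<^sup>2))) \<partial>lborel) =
       ennreal (- 2 * s) * (\<integral>\<^sup>+u. ennreal (indicator {0<..} u * (u powr s / (u\<^sup>2 + (pi * (2 * real n + 1))\<^sup>2))) \<partial>lborel)"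
      by (rule nn_integral_cmult) measurable
    also have "\<dots> = ennreal (- 2 * s) * ennreal (Gamma ((1 + s) / 2) * Gamma ((1 - s) / 2) * (pi * (2 * real n + 1)) powr (s - 1) / 2)"
      using s by (subst nn_integral_powr_rational) (auto intro!: mult_pos_pos add_nonneg_pos)
    also have "\<dots> = ennreal (- s * (Gamma ((1 + s) / 2) * Gamma ((1 - s) / 2)) * (pi * (2 * real n + 1)) powr (s - 1))"
      using s by (subst ennreal_mult'[symmetric]) (auto simp: mult_ac)
    finally show "(\<integral>\<^sup>+u. ennreal (- 2 * s) * ennreal (indicator {0<..} u * (u powr s / (u\<^sup>2 + (pi * (2 * real n + 1))\<^sup>2))) \<partial>lborel) =
      ennreal (- s * (Gamma ((1 + s) / 2) * Gamma ((1 - s) / 2)) * (pi * (2 * real n + 1)) powr (s - 1))" .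
  qed
  finally show ?thesis .
qed

section \<open>Analyticity and the two evaluations of the Mellin transform\<close>

definition logistic_mellin :: "complex \<Rightarrow> complex" where
  "logistic_mellin s = (LINT x|lborel. indicator {0<..} x *\<^sub>R (exp (s * of_real (ln x)) * of_real (logistic_density x)))"

lemma integrable_Gamma:
  fixes \<sigma> c :: real
  assumes "\<sigma> > -1" "c > 0"
  shows "has_bochner_integral lborel (\<lambda>x. indicator {0<..} x * (x powr \<sigma> * exp (- (c * x)))) (Gamma (\<sigma> + 1) * c powr (- (\<sigma> + 1)))"
  using nn_integral_Gamma_scaled[of "\<sigma> + 1" c] assms
  by (intro has_bochner_integral_nn_integral) (auto simp: indicator_def)

lemma integrable_logistic_mellin:
  assumes "Re s > -1"
  shows "integrable lborel (\<lambda>x. indicator {0<..} x *\<^sub>R (exp (s * of_real (ln x)) * of_real (logistic_density x) :: complex))"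
proof (rule Bochner_Integration.integrable_bound)
  show "integrable lborel (\<lambda>x. indicator {0<..} x * (x powr Re s * exp (- (1 * x))))"
    using integrable_Gamma[OF assms, of 1] by (auto simp: has_bochner_integral_iff)
  show "AE x in lborel. norm (indicator {0<..} x *\<^sub>R (exp (s * of_real (ln x)) * of_real (logistic_density x) :: complex)) \<le> norm (indicator {0<..} x * (x powr Re s * exp (- (1 * x))))"
  proof (intro AE_I2)
    fix x :: real
    show "norm (indicator {0<..} x *\<^sub>R (exp (s * of_real (ln x)) * of_real (logistic_density x) :: complex)) \<le> norm (indicator {0<..} x * (x powr Re s * exp (- (1 * x))))"
      using logistic_density_le[of x] logistic_density_nonneg[of x]
      by (auto simp: indicator_def norm_mult powr_def intro!: mult_left_mono)
  qed
qed measurable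

text \<open>The integrals over [1/(n+1), n+1] are holomorphic and converge locally uniformly: if Re
  s stays in [\<sigma>0, \<sigma>1], then x^(Re s) <= x^\<sigma>0 + x^\<sigma>1, so the tail is
  dominated by that of a sum of two Gamma integrands, independently of s.\<close>

lemma logistic_mellin_holomorphic: "logistic_mellin holomorphic_on {s. Re s > -1}"
proof (rule holomorphic_uniform_sequence[where f = "\<lambda>n s. integral (cbox (1 / real (Suc n)) (real (Suc n))) (\<lambda>x. exp (s * of_real (ln x)) * of_real (logistic_density x))"])
  show "open {s. Re s > -1}" by (simp add: open_halfspace_Re_gt)
  have ldc: "continuous_on A logistic_density" for A
    unfolding logistic_density_def by (intro continuous_intros) (auto simp: add_nonneg_eq_0_iff)
  show "(\<lambda>s. integral (cbox (1 / real (Suc n)) (real (Suc n))) (\<lambda>x. exp (s * of_real (ln x)) * of_real (logistic_density x))) holomorphic_on {s. Re s > -1}" for n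
  proof (rule leibniz_rule_holomorphic[where fx = "\<lambda>s x. of_real (ln x) * exp (s * of_real (ln x)) * of_real (logistic_density x)"])
    fix s x assume "x \<in> cbox (1 / real (Suc n)) (real (Suc n))"
    show "((\<lambda>s. exp (s * of_real (ln x)) * of_real (logistic_density x)) has_field_derivative
        of_real (ln x) * exp (s * of_real (ln x)) * of_real (logistic_density x)) (at s within {s. Re s > -1})"
      by (auto intro!: derivative_eq_intros)
  next
    have pos: "x \<noteq> 0" if "x \<in> {1 / real (Suc n)..real (Suc n)}" for x using that
      by (smt (verit) atLeastAtMost_iff of_nat_0_less_iff zero_less_Suc zero_less_divide_1_iff)
    show "(\<lambda>x. exp (s * of_real (ln x)) * of_real (logistic_density x)) integrable_on cbox (1 / real (Suc n)) (real (Suc n))" for s :: complex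
      using pos by (intro integrable_continuous continuous_intros ldc) auto
    show "continuous_on ({s. Re s > -1} \<times> cbox (1 / real (Suc n)) (real (Suc n))) (\<lambda>(s, x). of_real (ln x) * exp (s * of_real (ln x)) * of_real (logistic_density x))"
      unfolding case_prod_unfold using pos
      by (intro continuous_intros continuous_on_compose2[OF ldc[of UNIV]]) auto
    show "convex {s. Re s > -1}" by (rule convex_halfspace_Re_gt)
  qed
  fix z assume z: "z \<in> {s. Re s > -1}"
  define d where "d = (Re z + 1) / 2"
  have d: "d > 0" using z by (simp add: d_def)
  define \<sigma>0 \<sigma>1 where "\<sigma>0 = Re z - d" and "\<sigma>1 = Re z + d"
  have \<sigma>: "\<sigma>0 > -1" "\<sigma>1 > -1" using z d by (auto simp: \<sigma>0_def \<sigma>1_def d_def field_simps)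
  define \<phi> where "\<phi> x = indicator {0<..} x * (x powr \<sigma>0 * exp (- (1 * x))) + indicator {0<..} x * (x powr \<sigma>1 * exp (- (1 * x)))" for x :: real
  have \<phi>_int: "integrable lborel \<phi>"
    unfolding \<phi>_def[abs_def] using integrable_Gamma[OF \<sigma>(1), of 1] integrable_Gamma[OF \<sigma>(2), of 1]
    by (intro Bochner_Integration.integrable_add) (auto simp: has_bochner_integral_iff)
  have \<phi>0: "\<phi> x \<ge> 0" for x by (simp add: \<phi>_def)
  define I where "I n = {1 / real (Suc n)..real (Suc n)}" for n :: nat
  define T where "T n = (LINT x|lborel. indicator (- I n) x * \<phi> x)" for n
  have [measurable]: "\<phi> \<in> borel_measurable borel" unfolding \<phi>_def by measurable
  have [measurable]: "I n \<in> sets borel" for n by (simp add: I_def)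
  have T_lim: "T \<longlonglongrightarrow> (LINT x|(lborel :: real measure). (0::real))"
    unfolding T_def
  proof (rule Bochner_Integration.integral_dominated_convergence[where w = \<phi> and M = lborel and s = "\<lambda>n x. indicator (- I n) x * \<phi> x" and f = "\<lambda>x. 0 :: real"])
    show "AE x in lborel. (\<lambda>n. indicator (- I n) x * \<phi> x) \<longlonglongrightarrow> 0"
    proof (intro AE_I2)
      fix x :: real
      show "(\<lambda>n. indicator (- I n) x * \<phi> x) \<longlonglongrightarrow> 0"
      proof (cases "x > 0")
        case True
        have "eventually (\<lambda>n. x \<in> I n) sequentially"
        proof -
          obtain N where N: "real N > max x (1 / x)" using reals_Archimedean2 by blast
          show ?thesis
          proof (rule eventually_sequentiallyI[of N])
            fix n assume "n \<ge> N"
            then have n: "x \<le> real (Suc n)" "1 / x \<le> real (Suc n)" using N by auto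
            then have "1 / real (Suc n) \<le> x" using True by (simp add: field_simps)
            then show "x \<in> I n" using n by (simp add: I_def)
          qed
        qed
        then show ?thesis by (intro tendsto_eventually) (auto elim: eventually_mono)
      qed (simp add: \<phi>_def)
    qed
    show "AE x in lborel. norm (indicator (- I n) x * \<phi> x) \<le> \<phi> x" for n
      using \<phi>0 by (intro AE_I2) (auto simp: indicator_def)
  qed (use \<phi>_int in auto)
  have bound: "norm (logistic_mellin s - integral (cbox (1 / real (Suc n)) (real (Suc n))) (\<lambda>x. exp (s * of_real (ln x)) * of_real (logistic_density x))) \<le> T n"
    if s: "s \<in> cball z d" for s n
  proof -
    define g where "g x = exp (s * of_real (ln x)) * of_real (logistic_density x)" for x :: real
    have re: "\<sigma>0 \<le> Re s" "Re s \<le> \<sigma>1"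
    proof -
      have "norm (z - s) \<le> d" using s by (simp add: dist_norm)
      then have "\<bar>Re z - Re s\<bar> \<le> d" using abs_Re_le_cmod[of "z - s"] by simp
      then show "\<sigma>0 \<le> Re s" "Re s \<le> \<sigma>1" by (auto simp: \<sigma>0_def \<sigma>1_def)
    qed
    have g_int: "integrable lborel (\<lambda>x. indicator {0<..} x *\<^sub>R g x)"
      unfolding g_def by (rule integrable_logistic_mellin) (use re \<sigma> in auto)
    have gI: "integrable lborel (\<lambda>x. indicator (I n) x *\<^sub>R g x)"
    proof (rule Bochner_Integration.integrable_bound[OF g_int])
      show "(\<lambda>x. indicator (I n) x *\<^sub>R g x) \<in> borel_measurable lborel" unfolding g_def by measurable
      have "I n \<subseteq> {0<..}" by (auto simp: I_def intro: less_le_trans[of 0 "1 / real (Suc n)"])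
      then show "AE x in lborel. norm (indicator (I n) x *\<^sub>R g x) \<le> norm (indicator {0<..} x *\<^sub>R g x)"
        by (intro AE_I2) (auto simp: indicator_def)
    qed
    have "integral (I n) g = (LINT x|lborel. indicator (I n) x *\<^sub>R g x)"
      using set_borel_integral_eq_integral(2)[of "I n" g] gI by (simp add: set_integrable_def set_lebesgue_integral_def)
    then have "logistic_mellin s - integral (I n) g = (LINT x|lborel. indicator {0<..} x *\<^sub>R g x - indicator (I n) x *\<^sub>R g x)"
      using g_int gI by (simp add: logistic_mellin_def g_def)
    also have "norm \<dots> \<le> (LINT x|lborel. norm (indicator {0<..} x *\<^sub>R g x - indicator (I n) x *\<^sub>R g x))"
      by (rule integral_norm_bound)
    also have "\<dots> \<le> T n"
      unfolding T_def
    proof (rule integral_mono)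
      show "integrable lborel (\<lambda>x. norm (indicator {0<..} x *\<^sub>R g x - indicator (I n) x *\<^sub>R g x))"
        using g_int gI by simp
      show "integrable lborel (\<lambda>x. indicator (- I n) x * \<phi> x)"
        by (rule Bochner_Integration.integrable_bound[OF \<phi>_int]) (auto simp: indicator_def \<phi>0)
      fix x :: real
      show "norm (indicator {0<..} x *\<^sub>R g x - indicator (I n) x *\<^sub>R g x) \<le> indicator (- I n) x * \<phi> x"
      proof (cases "x > 0 \<and> x \<notin> I n")
        case True
        have pw: "x powr Re s \<le> x powr \<sigma>0 + x powr \<sigma>1"
        proof (cases "x \<ge> 1")
          case True
          then have "x powr Re s \<le> x powr \<sigma>1" using re by (intro powr_mono) auto
          then show ?thesis by (simp add: add_increasing)
        next
          case False
          then have "x powr Re s \<le> x powr \<sigma>0" using re True by (intro powr_mono') auto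
          then show ?thesis by (simp add: add_increasing2)
        qed
        have "norm (g x) = x powr Re s * logistic_density x"
          using True logistic_density_nonneg[of x] by (simp add: g_def norm_mult powr_def)
        also have "\<dots> \<le> (x powr \<sigma>0 + x powr \<sigma>1) * exp (- x)"
          using pw logistic_density_le[of x] logistic_density_nonneg[of x] by (intro mult_mono) auto
        also have "\<dots> = \<phi> x" using True by (simp add: \<phi>_def algebra_simps)
        finally show ?thesis using True by simp
      next
        case False
        have "0 \<notin> I n" by (auto simp: I_def)
        then have "x \<in> I n \<longrightarrow> x > 0" by (auto simp: I_def intro: less_le_trans[of 0 "1 / real (Suc n)"])
        then show ?thesis using False \<phi>0 by (auto simp: indicator_def)
      qed
    qed
    finally show ?thesis by (simp add: I_def g_def[abs_def])
  qed
  have "cball z d \<subseteq> {s. Re s > -1}"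
  proof
    fix s assume "s \<in> cball z d"
    then have "\<bar>Re z - Re s\<bar> \<le> d" using abs_Re_le_cmod[of "z - s"] by (simp add: dist_norm)
    then have "Re s \<ge> Re z - d" by linarith
    then show "s \<in> {s. Re s > -1}" using z \<sigma>(1) by (simp add: \<sigma>0_def)
  qed
  moreover have "uniform_limit (cball z d) (\<lambda>n s. integral (cbox (1 / real (Suc n)) (real (Suc n))) (\<lambda>x. exp (s * of_real (ln x)) * of_real (logistic_density x))) logistic_mellin sequentially"
  proof (rule uniform_limitI)
    fix e :: real assume "e > 0"
    then have "eventually (\<lambda>n. T n < e) sequentially"
      using T_lim by (auto intro: order_tendstoD)
    then show "\<forall>\<^sub>F n in sequentially. \<forall>s\<in>cball z d. dist (integral (cbox (1 / real (Suc n)) (real (Suc n))) (\<lambda>x. exp (s * of_real (ln x)) * of_real (logistic_density x))) (logistic_mellin s) < e"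
    proof eventually_elim
      case (elim n)
      show ?case
      proof
        fix s assume s: "s \<in> cball z d"
        show "dist (integral (cbox (1 / real (Suc n)) (real (Suc n))) (\<lambda>x. exp (s * of_real (ln x)) * of_real (logistic_density x))) (logistic_mellin s) < e"
          using bound[OF s, of n] elim by (subst dist_commute) (simp only: dist_norm)
      qed
    qed
  qed
  ultimately show "\<exists>d>0. cball z d \<subseteq> {s. - 1 < Re s} \<and> uniform_limit (cball z d) (\<lambda>n s. integral (cbox (1 / real (Suc n)) (real (Suc n))) (\<lambda>x. exp (s * of_real (ln x)) * of_real (logistic_density x))) logistic_mellin sequentially"
    using d by blast
qed

lemma logistic_mellin_of_real:
  "logistic_mellin (of_real s) = of_real (LINT x|lborel. indicator {0<..} x * (x powr s * logistic_density x))"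
proof -
  have "(LINT x|lborel. indicator {0<..} x *\<^sub>R (exp (of_real s * of_real (ln x)) * complex_of_real (logistic_density x))) =
      (LINT x|lborel. of_real (indicator {0<..} x * (x powr s * logistic_density x)))"
  proof (rule Bochner_Integration.integral_cong[OF refl])
    fix x :: real
    have "exp (complex_of_real s * of_real (ln x)) = of_real (x powr s)" if "x > 0"
      using that by (simp add: powr_def exp_of_real flip: of_real_mult)
    then show "indicator {0<..} x *\<^sub>R (exp (of_real s * of_real (ln x)) * complex_of_real (logistic_density x)) =
      of_real (indicator {0<..} x * (x powr s * logistic_density x))"
      by (auto simp: indicator_def)
  qed
  then show ?thesis by (simp only: logistic_mellin_def integral_complex_of_real)
qed

lemma riemann_zeta_real_sums:
  assumes "p > 1"
  shows "(\<lambda>n. real (Suc n) powr (- p)) sums Re (riemann_zeta (of_real p))"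
    and "riemann_zeta (of_real p) = of_real (Re (riemann_zeta (of_real p)))"
proof -
  have "(\<lambda>n. 1 / of_nat (Suc n) powr complex_of_real p) sums riemann_zeta (of_real p)"
    using assms zeta_continuation_riemann_zeta by (simp add: zeta_continuation_def)
  moreover have "1 / of_nat (Suc n) powr complex_of_real p = of_real (real (Suc n) powr (- p))" for n
  proof -
    have "of_nat (Suc n) powr complex_of_real p = of_real (real (Suc n) powr p)"
      using powr_of_real[of "real (Suc n)" p] by simp
    then show ?thesis by (simp add: powr_minus_divide)
  qed
  ultimately have *: "(\<lambda>n. complex_of_real (real (Suc n) powr (- p))) sums riemann_zeta (of_real p)" by (simp only:)
  from sums_Re[OF this] show 1: "(\<lambda>n. real (Suc n) powr (- p)) sums Re (riemann_zeta (of_real p))" by simp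
  from sums_of_real[OF 1] have "(\<lambda>n. complex_of_real (real (Suc n) powr (- p))) sums of_real (Re (riemann_zeta (of_real p)))" .
  with * show "riemann_zeta (of_real p) = of_real (Re (riemann_zeta (of_real p)))" by (rule sums_unique2)
qed

lemma odd_and_alternating_zeta_sums:
  assumes p: "p > 1"
  defines "Z \<equiv> Re (riemann_zeta (of_real p))"
  shows "(\<lambda>n. (2 * real n + 1) powr (- p)) sums ((1 - 2 powr (- p)) * Z)"
    and "(\<lambda>n. (-1) ^ n * real (Suc n) powr (- p)) sums ((1 - 2 powr (1 - p)) * Z)"
proof -
  have sums: "(\<lambda>n. real (Suc n) powr (- p)) sums Z" unfolding Z_def by (rule riemann_zeta_real_sums[OF p])
  have "(\<lambda>n. 2 powr (- p) * real (Suc n) powr (- p)) sums (2 powr (- p) * Z)" by (rule sums_mult[OF sums])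
  moreover have "2 powr (- p) * real (Suc n) powr (- p) = (2 * real n + 2) powr (- p)" for n
    by (subst powr_mult[symmetric]) (auto simp: algebra_simps)
  ultimately have even: "(\<lambda>n. (2 * real n + 2) powr (- p)) sums (2 powr (- p) * Z)" by simp
  have split: "(\<Sum>i<2 * n. if even i then f i else g i) = (\<Sum>i<n. f (2 * i)) + (\<Sum>i<n. g (2 * i + 1))" for f g :: "nat \<Rightarrow> real" and n
    by (rule sum_split_even_odd)
  have dbl: "filterlim (\<lambda>n::nat. 2 * n) at_top at_top" by (rule filterlim_at_top_mono[OF filterlim_ident]) auto
  have "(\<lambda>N. (\<Sum>n<2 * N. real (Suc n) powr (- p)) - (\<Sum>n<N. (2 * real n + 2) powr (- p))) \<longlonglongrightarrow> Z - 2 powr (- p) * Z"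
    using sums even filterlim_compose[OF _ dbl] unfolding sums_def by (intro tendsto_diff) auto
  moreover have "(\<Sum>n<2 * N. real (Suc n) powr (- p)) - (\<Sum>n<N. (2 * real n + 2) powr (- p)) = (\<Sum>n<N. (2 * real n + 1) powr (- p))" for N
    using split[of "\<lambda>n. real (Suc n) powr (- p)" "\<lambda>n. real (Suc n) powr (- p)" N] by (simp add: algebra_simps)
  ultimately show odd: "(\<lambda>n. (2 * real n + 1) powr (- p)) sums ((1 - 2 powr (- p)) * Z)"
    unfolding sums_def by (simp add: algebra_simps)
  have "summable (\<lambda>n. norm ((-1) ^ n * real (Suc n) powr (- p)))"
    using sums by (simp add: sums_iff abs_mult)
  then have summ: "summable (\<lambda>n. (-1) ^ n * real (Suc n) powr (- p))" by (rule summable_norm_cancel)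
  have "(\<lambda>N. (\<Sum>n<N. (2 * real n + 1) powr (- p)) - (\<Sum>n<N. (2 * real n + 2) powr (- p))) \<longlonglongrightarrow> (1 - 2 powr (- p)) * Z - 2 powr (- p) * Z"
    using odd even unfolding sums_def by (intro tendsto_diff) auto
  moreover have "(\<Sum>n<N. (2 * real n + 1) powr (- p)) - (\<Sum>n<N. (2 * real n + 2) powr (- p)) = (\<Sum>n<2 * N. (-1) ^ n * real (Suc n) powr (- p))" for N
  proof -
    have "(\<Sum>n<2 * N. (-1) ^ n * real (Suc n) powr (- p)) = (\<Sum>n<2 * N. if even n then real (Suc n) powr (- p) else - (real (Suc n) powr (- p)))"
      by (intro sum.cong) auto
    then show ?thesis unfolding split by (simp add: algebra_simps sum_negf)
  qed
  ultimately have "(\<lambda>N. \<Sum>n<2 * N. (-1) ^ n * real (Suc n) powr (- p)) \<longlonglongrightarrow> (1 - 2 powr (- p)) * Z - 2 powr (- p) * Z" by simp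
  moreover have "(\<lambda>N. \<Sum>n<2 * N. (-1) ^ n * real (Suc n) powr (- p)) \<longlonglongrightarrow> (\<Sum>n. (-1) ^ n * real (Suc n) powr (- p))"
    using filterlim_compose[OF summable_LIMSEQ[OF summ] dbl] .
  ultimately have "(\<Sum>n. (-1) ^ n * real (Suc n) powr (- p)) = (1 - 2 powr (- p)) * Z - 2 powr (- p) * Z"
    using LIMSEQ_unique by blast
  also have "\<dots> = (1 - 2 powr (1 - p)) * Z"
    by (simp add: powr_diff powr_minus divide_inverse algebra_simps)
  finally show "(\<lambda>n. (-1) ^ n * real (Suc n) powr (- p)) sums ((1 - 2 powr (1 - p)) * Z)"
    using summable_sums[OF summ] by simp
qed

text \<open>The density is the series of (-1)^n (n+1) e^(-(n+1)x), a differentiated geometric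
  series. Its terms have absolute integrals Gamma(s+1) (n+1)^(-s), which are summable for s > 1, so
  it may be integrated term by term.\<close>

lemma logistic_mellin_gt_1:
  assumes s: "s > 1"
  shows "logistic_mellin (of_real s) = of_real (Gamma (s + 1) * ((1 - 2 powr (1 - s)) * Re (riemann_zeta (of_real s))))"
proof -
  define f where "f n x = indicator {0<..} x * (x powr s * ((-1) ^ n * real (Suc n) * exp (- (real (Suc n) * x))))" for n :: nat and x :: real
  have base: "has_bochner_integral lborel (\<lambda>x. indicator {0<..} x * (x powr s * exp (- (real (Suc n) * x)))) (Gamma (s + 1) * real (Suc n) powr (- (s + 1)))" for n
    using s by (intro integrable_Gamma) auto
  have pw: "real (Suc n) * real (Suc n) powr (- (s + 1)) = real (Suc n) powr (- s)" for n
    by (subst powr_mult_base) auto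
  have fb: "has_bochner_integral lborel (f n) (Gamma (s + 1) * ((-1) ^ n * real (Suc n) powr (- s)))" for n
  proof -
    have "has_bochner_integral lborel (\<lambda>x. ((-1) ^ n * real (Suc n)) * (indicator {0<..} x * (x powr s * exp (- (real (Suc n) * x)))))
       (((-1) ^ n * real (Suc n)) * (Gamma (s + 1) * real (Suc n) powr (- (s + 1))))"
      by (rule has_bochner_integral_mult_right[OF base])
    also have "((-1) ^ n * real (Suc n)) * (Gamma (s + 1) * real (Suc n) powr (- (s + 1))) = Gamma (s + 1) * ((-1) ^ n * (real (Suc n) * real (Suc n) powr (- (s + 1))))"
      by (simp only: mult_ac)
    also note pw
    also have "(\<lambda>x. ((-1) ^ n * real (Suc n)) * (indicator {0<..} x * (x powr s * exp (- (real (Suc n) * x))))) = f n"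
      by (auto simp: f_def fun_eq_iff mult_ac)
    finally show ?thesis .
  qed
  have fn: "has_bochner_integral lborel (\<lambda>x. norm (f n x)) (Gamma (s + 1) * real (Suc n) powr (- s))" for n
  proof -
    have "has_bochner_integral lborel (\<lambda>x. real (Suc n) * (indicator {0<..} x * (x powr s * exp (- (real (Suc n) * x)))))
       (real (Suc n) * (Gamma (s + 1) * real (Suc n) powr (- (s + 1))))"
      by (rule has_bochner_integral_mult_right[OF base])
    also have "real (Suc n) * (Gamma (s + 1) * real (Suc n) powr (- (s + 1))) = Gamma (s + 1) * (real (Suc n) * real (Suc n) powr (- (s + 1)))"
      by (simp only: mult_ac)
    also note pw
    also have "(\<lambda>x. real (Suc n) * (indicator {0<..} x * (x powr s * exp (- (real (Suc n) * x))))) = (\<lambda>x. norm (f n x))"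
      by (auto simp: f_def fun_eq_iff abs_mult indicator_def simp del: of_nat_Suc)
    finally show ?thesis .
  qed
  have sumf: "(\<lambda>n. f n x) sums (indicator {0<..} x * (x powr s * logistic_density x))" for x
  proof (cases "x > 0")
    case True
    define z where "z = - exp (- x)"
    have z: "norm z < 1" using True by (simp add: z_def)
    have "(\<lambda>n. (x powr s * exp (- x)) * (of_nat (Suc n) * z ^ n)) sums ((x powr s * exp (- x)) * (1 / (1 - z)\<^sup>2))"
      by (intro sums_mult geometric_deriv_sums z)
    moreover have "(x powr s * exp (- x)) * (of_nat (Suc n) * z ^ n) = f n x" for n
    proof -
      have "z ^ n = (-1) ^ n * exp (- (real n * x))"
        by (simp add: z_def power_minus[of "exp (- x)"] exp_of_nat_mult[symmetric])
      moreover have "exp (- (real (Suc n) * x)) = exp (- x) * exp (- (real n * x))"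
        by (simp add: exp_add[symmetric] algebra_simps)
      ultimately show ?thesis using True by (simp add: f_def mult_ac)
    qed
    moreover have "exp (- x) * (1 / (1 - z)\<^sup>2) = logistic_density x"
    proof -
      have "inverse e * (1 / (1 + inverse e)\<^sup>2) = e / (e + 1)\<^sup>2" if "e > 0" for e :: real
        using that by (simp add: field_simps power2_eq_square add_nonneg_eq_0_iff)
      from this[of "exp x"] show ?thesis by (simp add: z_def logistic_density_def exp_minus)
    qed
    ultimately have "(\<lambda>n. f n x) sums (x powr s * logistic_density x)"
      by (simp only: mult.assoc)
    then show ?thesis using True by simp
  qed (simp add: f_def)
  have sumn: "summable (\<lambda>n. norm (f n x))" for x
  proof (cases "x > 0")
    case True
    have "(\<lambda>n. (x powr s * exp (- x)) * (of_nat (Suc n) * exp (- x) ^ n)) sums ((x powr s * exp (- x)) * (1 / (1 - exp (- x))\<^sup>2))"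
      using True by (intro sums_mult geometric_deriv_sums) auto
    moreover have "(x powr s * exp (- x)) * (of_nat (Suc n) * exp (- x) ^ n) = norm (f n x)" for n
    proof -
      have "exp (- (real (Suc n) * x)) = exp (- x) * exp (- x) ^ n"
        by (simp add: exp_of_nat_mult[symmetric] exp_add[symmetric] algebra_simps)
      then show ?thesis using True by (simp add: f_def abs_mult mult_ac del: of_nat_Suc)
    qed
    ultimately have "(\<lambda>n. norm (f n x)) sums ((x powr s * exp (- x)) * (1 / (1 - exp (- x))\<^sup>2))" by (simp only:)
    then show ?thesis by (rule sums_summable)
  qed (simp add: f_def)
  have "(\<lambda>n. integral\<^sup>L lborel (f n)) sums (LINT x|lborel. (\<Sum>n. f n x))"
  proof (rule sums_integral)
    show "integrable lborel (f n)" for n using fb[of n] by (simp add: has_bochner_integral_iff)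
    show "AE x in lborel. summable (\<lambda>n. norm (f n x))" using sumn by simp
    have "summable (\<lambda>n. Gamma (s + 1) * real (Suc n) powr (- s))"
      using riemann_zeta_real_sums(1)[OF s] by (intro summable_mult) (simp add: sums_iff)
    then show "summable (\<lambda>n. LINT x|lborel. norm (f n x))"
      using fn by (simp add: has_bochner_integral_iff)
  qed
  moreover have "(LINT x|lborel. (\<Sum>n. f n x)) = (LINT x|lborel. indicator {0<..} x * (x powr s * logistic_density x))"
    using sumf by (simp add: sums_iff)
  moreover have "integral\<^sup>L lborel (f n) = Gamma (s + 1) * ((-1) ^ n * real (Suc n) powr (- s))" for n
    using fb[of n] by (simp add: has_bochner_integral_iff)
  ultimately have "(\<lambda>n. Gamma (s + 1) * ((-1) ^ n * real (Suc n) powr (- s))) sums (LINT x|lborel. indicator {0<..} x * (x powr s * logistic_density x))"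
    by simp
  moreover have "(\<lambda>n. Gamma (s + 1) * ((-1) ^ n * real (Suc n) powr (- s))) sums (Gamma (s + 1) * ((1 - 2 powr (1 - s)) * Re (riemann_zeta (of_real s))))"
    by (intro sums_mult odd_and_alternating_zeta_sums s)
  ultimately have "(LINT x|lborel. indicator {0<..} x * (x powr s * logistic_density x)) = Gamma (s + 1) * ((1 - 2 powr (1 - s)) * Re (riemann_zeta (of_real s)))"
    by (rule sums_unique2)
  then show ?thesis by (simp only: logistic_mellin_of_real)
qed

lemma logistic_mellin_neg:
  assumes s: "-1 < s" "s < 0"
  shows "logistic_mellin (of_real s) = of_real (- s * (Gamma ((1 + s) / 2) * Gamma ((1 - s) / 2)) * pi powr (s - 1) *
      ((1 - 2 powr (s - 1)) * Re (riemann_zeta (of_real (1 - s)))))"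
proof -
  define C where "C = - s * (Gamma ((1 + s) / 2) * Gamma ((1 - s) / 2)) * pi powr (s - 1)"
  have C: "C \<ge> 0" using s unfolding C_def by (intro mult_nonneg_nonneg) auto
  define A where "A = C * ((1 - 2 powr (s - 1)) * Re (riemann_zeta (of_real (1 - s))))"
  have "(\<lambda>n. C * (2 * real n + 1) powr (- (1 - s))) sums (C * ((1 - 2 powr (- (1 - s))) * Re (riemann_zeta (of_real (1 - s)))))"
    using s by (intro sums_mult odd_and_alternating_zeta_sums) auto
  then have sums: "(\<lambda>n. C * (2 * real n + 1) powr (s - 1)) sums A" by (simp add: A_def)
  have A: "A \<ge> 0" using sums_le[OF _ sums_zero sums] C by simp
  have "(\<integral>\<^sup>+x. ennreal (indicator {0<..} x * (x powr s * logistic_density x)) \<partial>lborel) =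
    (\<Sum>n. ennreal (- s * (Gamma ((1 + s) / 2) * Gamma ((1 - s) / 2)) * (pi * (2 * real n + 1)) powr (s - 1)))"
    by (rule nn_integral_powr_logistic[OF s])
  also have "\<dots> = (\<Sum>n. ennreal (C * (2 * real n + 1) powr (s - 1)))"
    by (intro suminf_cong arg_cong[where f = ennreal]) (subst powr_mult, auto simp: C_def mult_ac)
  also have "\<dots> = ennreal A"
    using sums C by (subst suminf_ennreal2) (auto simp: sums_iff)
  finally have "has_bochner_integral lborel (\<lambda>x. indicator {0<..} x * (x powr s * logistic_density x)) A"
    using A logistic_density_nonneg by (intro has_bochner_integral_nn_integral) (auto simp: indicator_def)
  then show ?thesis by (simp only: logistic_mellin_of_real has_bochner_integral_iff A_def C_def)
qed

lemma islimpt_of_real_image: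
  assumes "open A" "x \<in> A"
  shows "complex_of_real x islimpt of_real ` A"
  unfolding islimpt_approachable
proof (intro allI impI)
  fix e :: real assume e: "e > 0"
  obtain d where d: "d > 0" "ball x d \<subseteq> A" using assms by (meson openE)
  define y where "y = x + min d e / 2"
  have "y \<in> A" using d e by (intro subsetD[OF d(2)]) (auto simp: y_def dist_real_def)
  moreover have "of_real y \<noteq> complex_of_real x" using d e by (auto simp: y_def)
  moreover have "dist (of_real y) (complex_of_real x) < e"
    using d e by (simp add: dist_of_real) (auto simp: y_def dist_real_def min_def)
  ultimately show "\<exists>x'\<in>of_real ` A. x' \<noteq> complex_of_real x \<and> dist x' (of_real x) < e" by blast
qed

text \<open>Removing the point 1 leaves the half-plane connected, so agreement on the real ray s > 1
  spreads to all of it, in particular to -1 < s < 0.\<close>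

lemma logistic_mellin_eq:
  assumes s: "Re s > -1" "s \<noteq> 1"
  shows "logistic_mellin s = Gamma (s + 1) * ((1 - 2 powr (1 - s)) * riemann_zeta s)"
proof -
  define S where "S = {s. Re s > -1} - {1}"
  define f where "f s = logistic_mellin s - Gamma (s + 1) * ((1 - 2 powr (1 - s)) * riemann_zeta s)" for s
  have "f s = 0"
  proof (rule analytic_continuation[of f S "of_real ` {1<..}" "of_real 2"])
    have ni: "s + 1 \<notin> \<int>\<^sub>\<le>\<^sub>0" if "Re s > -1" for s :: complex
      using that by (auto elim!: nonpos_Ints_cases' simp: complex_eq_iff)
    show "f holomorphic_on S"
      unfolding f_def
      using holomorphic_on_subset[OF logistic_mellin_holomorphic, of S] holomorphic_on_subset[OF riemann_zeta_holomorphic, of S] ni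
      by (intro holomorphic_intros) (auto simp: S_def)
    show "open S" unfolding S_def by (intro open_delete open_halfspace_Re_gt)
    show "connected S" unfolding S_def
      by (intro connected_open_delete open_halfspace_Re_gt convex_connected convex_halfspace_Re_gt) simp
    show "of_real ` {1<..} \<subseteq> S" by (auto simp: S_def)
    show "complex_of_real 2 \<in> S" by (auto simp: S_def)
    show "complex_of_real 2 islimpt of_real ` {1<..}" by (rule islimpt_of_real_image) auto
    show "s \<in> S" using s by (simp add: S_def)
    fix z :: complex assume "z \<in> of_real ` {1<..}"
    then obtain x where x: "z = of_real x" "x > 1" by auto
    have "Gamma (z + 1) = of_real (Gamma (x + 1))" using Gamma_complex_of_real[of "x + 1"] x by simp
    moreover have "2 powr (1 - z) = of_real (2 powr (1 - x))"
      using powr_of_real[of 2 "1 - x"] x by simp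
    moreover have "riemann_zeta z = of_real (Re (riemann_zeta z))"
      using riemann_zeta_real_sums(2)[OF x(2)] x by simp
    ultimately show "f z = 0"
      using logistic_mellin_gt_1[OF x(2)] unfolding f_def x(1)[symmetric]
      by (metis (no_types, lifting) of_real_1 of_real_diff of_real_mult right_minus_eq)
  qed
  then show ?thesis by (simp add: f_def)
qed

text \<open>On -1 < s < 0 both evaluations of \<open>logistic_mellin\<close> are available and must
  agree; the resulting identity is then continued. The product of the last two Gamma values is
  pi/cos(pi s/2), so this is the classical equation; in the Gamma form its logarithmic derivative is
  a combination of Digamma values.\<close>

theorem riemann_zeta_functional_equation:
  assumes s: "Im s \<noteq> 0"
  shows "Gamma s * riemann_zeta s =
    (2 * of_real pi) powr (s - 1) * riemann_zeta (1 - s) * (Gamma ((1 + s) / 2) * Gamma ((1 - s) / 2))"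
proof -
  \<comment> \<open>U joins the strip around the interval (-1, 0) to the complement of the real
    axis. It is star-shaped about -1/2 and avoids the poles of all factors.\<close>
  define U where "U = {s. Im s \<noteq> 0} \<union> {s. -1 < Re s \<and> Re s < 0}"
  define f where "f s = Gamma s * riemann_zeta s -
    (2 * of_real pi) powr (s - 1) * riemann_zeta (1 - s) * (Gamma ((1 + s) / 2) * Gamma ((1 - s) / 2))" for s
  have "f s = 0"
  proof (rule analytic_continuation[of f U "of_real ` {-1<..<0}" "of_real (-1/2)"])
    have ni: "w \<notin> \<int>\<^sub>\<le>\<^sub>0" if "Im w \<noteq> 0" for w :: complex
      using that by (auto elim!: nonpos_Ints_cases')
    have ni2: "w \<notin> \<int>\<^sub>\<le>\<^sub>0" if "Re w > 0" for w :: complex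
      using that by (auto elim!: nonpos_Ints_cases')
    have ni3: "w \<notin> \<int>\<^sub>\<le>\<^sub>0" if w: "-1 < Re w" "Re w < 0" for w :: complex
    proof
      assume "w \<in> \<int>\<^sub>\<le>\<^sub>0"
      then obtain n where n: "w = - of_nat n" by (auto elim!: nonpos_Ints_cases')
      then have "real n < 1" "real n > 0" using w by auto
      then show False by simp
    qed
    have U: "w \<notin> \<int>\<^sub>\<le>\<^sub>0" "(1 + w) / 2 \<notin> \<int>\<^sub>\<le>\<^sub>0" "(1 - w) / 2 \<notin> \<int>\<^sub>\<le>\<^sub>0" "w \<noteq> 1" "1 - w \<noteq> 1" if "w \<in> U" for w
    proof -
      show "w \<notin> \<int>\<^sub>\<le>\<^sub>0" using that ni[of w] ni3[of w] by (auto simp: U_def)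
      show "(1 + w) / 2 \<notin> \<int>\<^sub>\<le>\<^sub>0" using that ni[of "(1 + w) / 2"] ni2[of "(1 + w) / 2"] by (auto simp: U_def)
      show "(1 - w) / 2 \<notin> \<int>\<^sub>\<le>\<^sub>0" using that ni[of "(1 - w) / 2"] ni2[of "(1 - w) / 2"] by (auto simp: U_def)
      show "w \<noteq> 1" "1 - w \<noteq> 1" using that by (auto simp: U_def)
    qed
    have z1: "(\<lambda>s. riemann_zeta (1 - s)) holomorphic_on U"
    proof -
      have "(riemann_zeta \<circ> (\<lambda>s. 1 - s)) holomorphic_on U"
        by (rule holomorphic_on_compose_gen[OF _ riemann_zeta_holomorphic]) (use U in \<open>auto intro!: holomorphic_intros\<close>)
      then show ?thesis by (simp add: o_def)
    qed
    have z2: "riemann_zeta holomorphic_on U"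
      by (rule holomorphic_on_subset[OF riemann_zeta_holomorphic]) (use U in auto)
    show "f holomorphic_on U"
      unfolding f_def using U by (intro holomorphic_intros z1 z2) auto
    show "open U"
    proof -
      have "U = ({s. Im s < 0} \<union> {s. Im s > 0}) \<union> ({s. Re s > -1} \<inter> {s. Re s < 0})"
        by (auto simp: U_def)
      then show ?thesis
        by (simp only:) (intro open_Un open_Int open_halfspace_Im_gt open_halfspace_Im_lt open_halfspace_Re_gt open_halfspace_Re_lt)
    qed
    have "starlike U"
      unfolding starlike_def
    proof (intro bexI[of _ "of_real (-1/2)"] ballI subsetI)
      fix x y assume x: "x \<in> U" and y: "y \<in> closed_segment (complex_of_real (-1/2)) x"
      then obtain t where t: "0 \<le> t" "t \<le> 1" "y = (1 - t) *\<^sub>R of_real (-1/2) + t *\<^sub>R x"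
        by (auto simp: closed_segment_def)
      have re: "Re y = (1 - t) * (-1/2) + t * Re x" and im: "Im y = t * Im x" using t by simp_all
      show "y \<in> U"
      proof (cases "t = 0 \<or> Im x \<noteq> 0")
        case True
        then show ?thesis using re im by (auto simp: U_def)
      next
        case False
        then have "-1 < Re x" "Re x < 0" using x by (auto simp: U_def)
        then have "t * (-1) < t * Re x" "t * Re x < t * 0" 
          using False t by (intro mult_strict_left_mono; simp)+
        moreover have "(1 - t) * (-1/2) = t / 2 - 1 / 2" by (simp add: field_simps)
        ultimately have "-1 < Re y" "Re y < 0" using re t(1,2) by linarith+
        then show ?thesis by (simp add: U_def)
      qed
    qed (simp add: U_def)
    then show "connected U" by (rule starlike_imp_connected)
    show "of_real ` {-1<..<0} \<subseteq> U" by (auto simp: U_def)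
    show "complex_of_real (-1/2) \<in> U" by (auto simp: U_def)
    show "complex_of_real (-1/2) islimpt of_real ` {-1<..<0}" by (rule islimpt_of_real_image) auto
    show "s \<in> U" using s by (simp add: U_def)
    fix z :: complex assume "z \<in> of_real ` {-1<..<0}"
    then obtain x where x: "z = of_real x" "-1 < x" "x < 0" by auto
    define a where "a = 2 powr (x - 1)"
    have a: "a > 0" "a \<noteq> 1"
    proof -
      have "2 powr (x - 1) < 2 powr (0::real)" using x by (intro powr_less_mono) auto
      then show "a > 0" "a \<noteq> 1" by (auto simp: a_def)
    qed
    have ia: "2 powr (1 - x) = 1 / a"
      using powr_minus_divide[of 2 "x - 1"] by (simp add: a_def)
    have g1: "Gamma (z + 1) = z * Gamma z"
      using ni3[of z] x by (intro Gamma_plus1) auto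
    have p1: "2 powr (1 - z) = complex_of_real (1 / a)"
      using powr_of_real[of 2 "1 - x"] x ia by simp
    have g2: "Gamma ((1 + z) / 2) = of_real (Gamma ((1 + x) / 2))" using Gamma_complex_of_real[of "(1 + x) / 2"] x by simp
    have g3: "Gamma ((1 - z) / 2) = of_real (Gamma ((1 - x) / 2))" using Gamma_complex_of_real[of "(1 - x) / 2"] x by simp
    have p2: "(2 * of_real pi) powr (z - 1) = complex_of_real (a * pi powr (x - 1))"
      using powr_of_real[of "2 * pi" "x - 1"] x by (simp add: a_def powr_mult)
    have z1x: "riemann_zeta (1 - z) = of_real (Re (riemann_zeta (of_real (1 - x))))"
      using riemann_zeta_real_sums(2)[of "1 - x"] x by simp
    have "z * Gamma z * ((1 - of_real (1 / a)) * riemann_zeta z) =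
       - z * (Gamma ((1 + z) / 2) * Gamma ((1 - z) / 2)) * of_real (pi powr (x - 1)) * ((1 - of_real a) * riemann_zeta (1 - z))"
      using logistic_mellin_eq[of z] logistic_mellin_neg[OF x(2,3)] x(2,3)
      unfolding g1 p1 g2 g3 z1x x(1)[symmetric] a_def[symmetric] by (simp add: x(1))
    then have "Gamma z * ((1 - of_real (1 / a)) * riemann_zeta z) =
       - (Gamma ((1 + z) / 2) * Gamma ((1 - z) / 2)) * of_real (pi powr (x - 1)) * ((1 - of_real a) * riemann_zeta (1 - z))"
    proof -
      have "A * B = - C * D * E" if "w * A * B = - w * C * D * E" "w \<noteq> 0" for w A B C D E :: complex
      proof -
        have "w * (A * B) = w * (- C * D * E)" using that(1) by (simp add: mult.assoc)
        then show ?thesis using that(2) by (simp only: mult_cancel_left) simp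
      qed
      moreover have "z \<noteq> 0" using x by auto
      ultimately show ?thesis
        using \<open>z * Gamma z * ((1 - of_real (1 / a)) * riemann_zeta z) = _\<close> by blast
    qed
    moreover have "complex_of_real a \<noteq> 0" "complex_of_real a \<noteq> 1" using a by (auto simp: of_real_eq_1_iff)
    \<comment> \<open>With A = 2^(x-1) the two Euler-type factors satisfy 1 - 1/A = -(1 - A)/A, so
      they cancel up to the factor A.\<close>
    moreover have "G * Z = A * P * Z1 * Y"
      if "G * ((1 - 1 / A) * Z) = - Y * P * ((1 - A) * Z1)" "A \<noteq> 0" "A \<noteq> 1" for G Z A P Z1 Y :: complex
    proof -
      have "(A - 1) * (G * Z) = A * (G * ((1 - 1 / A) * Z))" using that(2) by (simp add: field_simps)
      also have "\<dots> = (A - 1) * (A * P * Z1 * Y)" unfolding that(1) by (simp add: algebra_simps)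
      finally show ?thesis using that(3) by simp
    qed
    ultimately have "Gamma z * riemann_zeta z = of_real a * of_real (pi powr (x - 1)) * riemann_zeta (1 - z) * (Gamma ((1 + z) / 2) * Gamma ((1 - z) / 2))"
      by (metis of_real_1 of_real_divide)
    then show "f z = 0" unfolding f_def p2 by simp
  qed
  then show ?thesis by (simp add: f_def)
qed

section \<open>Zeros and good heights\<close>

abbreviation zeta_logderiv :: "complex \<Rightarrow> complex" where
  "zeta_logderiv s \<equiv> deriv riemann_zeta s / riemann_zeta s"

text \<open>The logarithmic derivative of chi in zeta(s) = chi(s) zeta(1 - s), with chi read off
  from \<open>riemann_zeta_functional_equation\<close>.\<close>

definition chi_logderiv :: "complex \<Rightarrow> complex" where
  "chi_logderiv s = of_real (ln (2 * pi)) + Digamma ((1 + s) / 2) / 2 - Digamma ((1 - s) / 2) / 2 - Digamma s"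

lemma not_nonpos_Int_if_Im: "Im w \<noteq> 0 \<Longrightarrow> (w :: complex) \<notin> \<int>\<^sub>\<le>\<^sub>0"
  by (auto elim!: nonpos_Ints_cases')

lemma riemann_zeta_zero_reflect:
  assumes "Im s \<noteq> 0"
  shows "riemann_zeta (1 - s) = 0 \<longleftrightarrow> riemann_zeta s = 0"
proof -
  have "s \<notin> \<int>\<^sub>\<le>\<^sub>0" "(1 + s) / 2 \<notin> \<int>\<^sub>\<le>\<^sub>0" "(1 - s) / 2 \<notin> \<int>\<^sub>\<le>\<^sub>0"
    using assms by (auto intro!: not_nonpos_Int_if_Im)
  then have "Gamma s \<noteq> 0" "Gamma ((1 + s) / 2) \<noteq> 0" "Gamma ((1 - s) / 2) \<noteq> 0"
    by (auto simp: Gamma_eq_zero_iff)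
  moreover have "(2 * complex_of_real pi) powr (s - 1) \<noteq> 0" by simp
  ultimately show ?thesis
    using riemann_zeta_functional_equation[OF assms] by (metis mult_eq_0_iff)
qed

text \<open>The functional equation is differentiated in product form and divided by the common
  value Q of its sides, which is non-zero because zeta does not vanish at s and Gamma has no
  zeros.\<close>

lemma zeta_logderiv_reflect:
  assumes s: "Im s \<noteq> 0" and z: "riemann_zeta s \<noteq> 0"
  shows "zeta_logderiv s = chi_logderiv s - zeta_logderiv (1 - s)"
proof -
  define P where "P s = (2 * of_real pi) powr (s - 1)" for s :: complex
  define A where "A s = Gamma ((1 + s) / 2)" for s :: complex
  define B where "B s = Gamma ((1 - s) / 2)" for s :: complex
  have z1: "riemann_zeta (1 - s) \<noteq> 0" using riemann_zeta_zero_reflect[OF s] z by simp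
  have ni: "s \<notin> \<int>\<^sub>\<le>\<^sub>0" "(1 + s) / 2 \<notin> \<int>\<^sub>\<le>\<^sub>0" "(1 - s) / 2 \<notin> \<int>\<^sub>\<le>\<^sub>0"
    using s by (auto intro!: not_nonpos_Int_if_Im)
  have ne1: "s \<noteq> 1" "1 - s \<noteq> 1" using s by auto
  have dz: "(riemann_zeta has_field_derivative deriv riemann_zeta s) (at s)"
    using riemann_zeta_holomorphic ne1 by (intro holomorphic_derivI[of _ "-{1}"]) auto
  have dz1: "(riemann_zeta has_field_derivative deriv riemann_zeta (1 - s)) (at (1 - s))"
    using riemann_zeta_holomorphic ne1 by (intro holomorphic_derivI[of _ "-{1}"]) auto
  have dz1': "((\<lambda>s. riemann_zeta (1 - s)) has_field_derivative - deriv riemann_zeta (1 - s)) (at s)"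
  proof -
    have "((\<lambda>s. riemann_zeta (1 - s)) has_field_derivative deriv riemann_zeta (1 - s) * (- 1)) (at s)"
      by (rule DERIV_chain2[where f = riemann_zeta and g = "\<lambda>s. 1 - s"]) (auto intro!: dz1 derivative_eq_intros)
    then show ?thesis by simp
  qed
  have dG: "(Gamma has_field_derivative Gamma s * Digamma s) (at s)"
    by (rule has_field_derivative_Gamma[OF ni(1)])
  have dA: "(A has_field_derivative A s * (Digamma ((1 + s) / 2) / 2)) (at s)"
    unfolding A_def[abs_def] using ni(2) by (auto intro!: derivative_eq_intros)
  have dB: "(B has_field_derivative - (B s * (Digamma ((1 - s) / 2) / 2))) (at s)"
    unfolding B_def[abs_def] using ni(3) by (auto intro!: derivative_eq_intros)
  have dP: "(P has_field_derivative P s * of_real (ln (2 * pi))) (at s)"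
  proof -
    have "Ln (2 * of_real pi) = of_real (ln (2 * pi))" using Ln_of_real[of "2 * pi"] by simp
    then have "P = (\<lambda>u. exp ((u - 1) * of_real (ln (2 * pi))))" by (simp add: P_def powr_def fun_eq_iff)
    moreover have "((\<lambda>u. exp ((u - 1) * of_real (ln (2 * pi)))) has_field_derivative
        exp ((s - 1) * of_real (ln (2 * pi))) * of_real (ln (2 * pi))) (at s)"
      by (auto intro!: derivative_eq_intros)
    ultimately show ?thesis by simp
  qed
  have L: "((\<lambda>s. Gamma s * riemann_zeta s) has_field_derivative
      Gamma s * Digamma s * riemann_zeta s + deriv riemann_zeta s * Gamma s) (at s)"
    by (rule DERIV_mult[OF dG dz])
  have R: "((\<lambda>s. P s * riemann_zeta (1 - s) * (A s * B s)) has_field_derivative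
      (P s * of_real (ln (2 * pi)) * riemann_zeta (1 - s) + - deriv riemann_zeta (1 - s) * P s) * (A s * B s) +
      (A s * (Digamma ((1 + s) / 2) / 2) * B s + - (B s * (Digamma ((1 - s) / 2) / 2)) * A s) * (P s * riemann_zeta (1 - s))) (at s)"
    by (intro DERIV_mult dP dz1' dA dB)
  have fe: "Gamma u * riemann_zeta u = P u * riemann_zeta (1 - u) * (A u * B u)" if "Im u \<noteq> 0" for u
    using riemann_zeta_functional_equation[OF that] by (simp add: P_def A_def B_def)
  have op: "open {s. Im s \<noteq> 0}"
  proof -
    have "{s. Im s \<noteq> 0} = {s. Im s < 0} \<union> {s. Im s > 0}" by auto
    then show ?thesis by (simp only:) (intro open_Un open_halfspace_Im_gt open_halfspace_Im_lt)
  qed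
  have "\<forall>\<^sub>F u in nhds s. Gamma u * riemann_zeta u = P u * riemann_zeta (1 - u) * (A u * B u)"
    using eventually_nhds_in_open[OF op, of s] s fe by (auto elim!: eventually_mono)
  then have "((\<lambda>s. P s * riemann_zeta (1 - s) * (A s * B s)) has_field_derivative
      Gamma s * Digamma s * riemann_zeta s + deriv riemann_zeta s * Gamma s) (at s)"
    using L DERIV_cong_ev[of s s "\<lambda>s. Gamma s * riemann_zeta s" "\<lambda>s. P s * riemann_zeta (1 - s) * (A s * B s)"] by simp
  from DERIV_unique[OF this R]
  have eq: "Gamma s * Digamma s * riemann_zeta s + deriv riemann_zeta s * Gamma s =
     (P s * of_real (ln (2 * pi)) * riemann_zeta (1 - s) + - deriv riemann_zeta (1 - s) * P s) * (A s * B s) +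
      (A s * (Digamma ((1 + s) / 2) / 2) * B s + - (B s * (Digamma ((1 - s) / 2) / 2)) * A s) * (P s * riemann_zeta (1 - s))" .
  define Q where "Q = Gamma s * riemann_zeta s"
  have Q0: "Q \<noteq> 0" using z ni by (auto simp: Q_def Gamma_eq_zero_iff)
  have Q2: "Q = P s * riemann_zeta (1 - s) * (A s * B s)" using fe[OF s] by (simp add: Q_def)
  have "Gamma s * Digamma s * riemann_zeta s + deriv riemann_zeta s * Gamma s = Q * (Digamma s + zeta_logderiv s)"
    using z by (simp add: Q_def field_simps)
  moreover have "(P s * of_real (ln (2 * pi)) * riemann_zeta (1 - s) + - deriv riemann_zeta (1 - s) * P s) * (A s * B s) +
      (A s * (Digamma ((1 + s) / 2) / 2) * B s + - (B s * (Digamma ((1 - s) / 2) / 2)) * A s) * (P s * riemann_zeta (1 - s)) =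
     Q * (of_real (ln (2 * pi)) - zeta_logderiv (1 - s) + Digamma ((1 + s) / 2) / 2 - Digamma ((1 - s) / 2) / 2)"
    unfolding Q2 using z1 by (simp add: field_simps)
  ultimately have "Digamma s + zeta_logderiv s = of_real (ln (2 * pi)) - zeta_logderiv (1 - s) + Digamma ((1 + s) / 2) / 2 - Digamma ((1 - s) / 2) / 2"
    using eq Q0 by (simp only: mult_cancel_left) simp
  then show ?thesis by (simp add: chi_logderiv_def algebra_simps)
qed

text \<open>(1 + s)/2 and (1 - s)/2 have imaginary parts of equal size, so their halved Digamma
  values cancel up to a constant and only -Digamma s, close to -ln t, remains. In the strip |z| and
  |Im z| differ by a factor of at most 5, which accounts for ln 5.\<close>

lemma chi_logderiv_bound:
  "\<exists>C\<ge>0. \<forall>s. \<bar>Re s\<bar> \<le> 2 \<and> Im s \<ge> 1 \<longrightarrow> norm (chi_logderiv s + of_real (ln (Im s))) \<le> C"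
proof -
  obtain C0 where C0: "\<And>z. \<bar>Re z\<bar> \<le> 2 \<Longrightarrow> \<bar>Im z\<bar> \<ge> 1 / 2 \<Longrightarrow> norm (Digamma z - of_real (ln (norm z))) \<le> C0"
    using Digamma_bound by blast
  define C1 where "C1 = C0 + ln 5"
  have C1: "norm (Digamma z - of_real (ln \<bar>Im z\<bar>)) \<le> C1" if z: "\<bar>Re z\<bar> \<le> 2" "\<bar>Im z\<bar> \<ge> 1 / 2" for z
  proof -
    have "\<bar>Im z\<bar> \<le> norm z" by (rule abs_Im_le_cmod)
    moreover have "norm z \<le> 5 * \<bar>Im z\<bar>" using cmod_le[of z] z by linarith
    ultimately have "ln \<bar>Im z\<bar> \<le> ln (norm z)" "ln (norm z) \<le> ln (5 * \<bar>Im z\<bar>)"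
      using z by (subst ln_le_cancel_iff; force)+
    moreover have "ln (5 * \<bar>Im z\<bar>) = ln 5 + ln \<bar>Im z\<bar>" using z by (subst ln_mult) auto
    ultimately have "norm (complex_of_real (ln (norm z)) - of_real (ln \<bar>Im z\<bar>)) \<le> ln 5"
      by (simp flip: of_real_diff)
    then show ?thesis
      using C0[OF z] norm_triangle_ineq[of "Digamma z - of_real (ln (norm z))" "complex_of_real (ln (norm z)) - of_real (ln \<bar>Im z\<bar>)"]
      by (simp add: C1_def)
  qed
  have "norm (Digamma \<i> - of_real (ln \<bar>Im \<i>\<bar>)) \<le> C1" by (rule C1) auto
  then have "C1 \<ge> 0" using norm_ge_zero order_trans by blast
  show ?thesis
  proof (intro exI[of _ "2 * C1 + ln (2 * pi)"] conjI allI impI)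
    have "ln (2 * pi) \<ge> 0" using pi_ge_two by (intro ln_ge_zero) linarith
    then show "2 * C1 + ln (2 * pi) \<ge> 0" using \<open>C1 \<ge> 0\<close> by simp
    fix s assume s: "\<bar>Re s\<bar> \<le> 2 \<and> Im s \<ge> 1"
    define t where "t = Im s"
    have t: "t \<ge> 1" using s by (simp add: t_def)
    have 1: "norm (Digamma ((1 + s) / 2) - of_real (ln (t / 2))) \<le> C1"
      using C1[of "(1 + s) / 2"] s by (simp add: t_def abs_le_iff)
    have 2: "norm (Digamma ((1 - s) / 2) - of_real (ln (t / 2))) \<le> C1"
      using C1[of "(1 - s) / 2"] s by (simp add: t_def abs_le_iff)
    have 3: "norm (Digamma s - of_real (ln t)) \<le> C1"
      using C1[of s] s by (simp add: t_def)
    have "chi_logderiv s + of_real (ln t) = of_real (ln (2 * pi)) + (Digamma ((1 + s) / 2) - of_real (ln (t / 2))) / 2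
       - (Digamma ((1 - s) / 2) - of_real (ln (t / 2))) / 2 - (Digamma s - of_real (ln t))"
      by (simp add: chi_logderiv_def algebra_simps diff_divide_distrib)
    also have "norm \<dots> \<le> norm (complex_of_real (ln (2 * pi))) + norm ((Digamma ((1 + s) / 2) - of_real (ln (t / 2))) / 2)
       + norm ((Digamma ((1 - s) / 2) - of_real (ln (t / 2))) / 2) + norm (Digamma s - of_real (ln t))"
      by (intro norm_triangle_le_diff norm_triangle_le add_mono order_refl)
    also have "\<dots> \<le> ln (2 * pi) + C1 / 2 + C1 / 2 + C1"
      using 1 2 3 \<open>ln (2 * pi) \<ge> 0\<close> by (intro add_mono) (auto simp: norm_divide simp del: of_real_diff)
    finally show "norm (chi_logderiv s + of_real (ln (Im s))) \<le> 2 * C1 + ln (2 * pi)" by (simp add: t_def)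
  qed
qed

lemma continuous_on_chi_logderiv:
  assumes "A \<subseteq> {s. Im s \<noteq> 0}"
  shows "continuous_on A chi_logderiv"
proof -
  have D: "continuous_on B Digamma" if "B \<subseteq> {s. Im s \<noteq> 0}" for B :: "complex set"
    using that by (intro continuous_on_Polygamma) (auto dest: not_nonpos_Int_if_Im)
  show ?thesis unfolding chi_logderiv_def
    using assms by (intro continuous_intros continuous_on_compose2[OF D[OF order_refl]]) auto
qed

text \<open>The region Re s >= 1 is free of zeros, and the functional equation reflects this to Re s
  <= 0.\<close>

lemma riemann_zeta_zero_strip:
  assumes "riemann_zeta s = 0" "Im s \<noteq> 0"
  shows "0 < Re s \<and> Re s < 1"
proof -
  have "Re s < 1"
    using assms riemann_zeta_nonzero_Re_gt_1[of s] riemann_zeta_nonzero_Re_1[of s] by (cases "Re s" "1::real" rule: linorder_cases) auto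
  moreover have "Re (1 - s) < 1"
    using assms riemann_zeta_zero_reflect[of s] riemann_zeta_nonzero_Re_gt_1[of "1 - s"] riemann_zeta_nonzero_Re_1[of "1 - s"]
    by (cases "Re (1 - s)" "1::real" rule: linorder_cases) auto
  ultimately show ?thesis by simp
qed

section \<open>Local zero counts and heights at which zeta'/zeta is small\<close>

lemma zorder_riemann_zeta:
  assumes "s \<noteq> 1" "riemann_zeta s = 0"
  shows "zorder riemann_zeta s > 0"
  using assms riemann_zeta_holomorphic connected_minus_one
  by (intro logderiv_times_limit(3)[of riemann_zeta "- {1}" _ 2]) (auto simp: riemann_zeta_nonzero_Re_gt_1)

text \<open>A lower bound, uniform in the height, at the centres 2 + iT of the discs to which
  Jensen's argument is applied: the terms after the first add up to at most pi^2/6 - 1 <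
  4/5.\<close>

lemma norm_riemann_zeta_2_ge: "norm (riemann_zeta (Complex 2 t)) \<ge> 1 / 5"
proof -
  define s where "s = Complex 2 t"
  define a where "a n = 1 / of_nat (Suc n) powr s" for n :: nat
  have "a sums riemann_zeta s"
    unfolding a_def using zeta_continuation_riemann_zeta by (simp add: zeta_continuation_def s_def)
  then have sa: "(\<lambda>n. a (Suc n)) sums (riemann_zeta s - a 0)" by (subst sums_Suc_iff) simp
  have na: "norm (a n) = 1 / real (Suc n) ^ 2" for n
  proof -
    have "norm (of_nat (Suc n) powr s) = real (Suc n) powr 2"
      by (subst norm_powr_real_powr) (auto simp: s_def simp del: of_nat_Suc)
    also have "\<dots> = real (Suc n) ^ 2" by (rule powr_numeral) simp
    finally show ?thesis by (simp add: a_def norm_divide del: of_nat_Suc)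
  qed
  have sq: "(\<lambda>n. 1 / real (Suc n) ^ 2) sums (pi\<^sup>2 / 6)"
    using inverse_squares_sums by (simp add: add.commute)
  then have sq': "(\<lambda>n. 1 / real (Suc (Suc n)) ^ 2) sums (pi\<^sup>2 / 6 - 1)"
    using sums_Suc_iff[of "\<lambda>n. 1 / real (Suc n) ^ 2" "pi\<^sup>2 / 6 - 1"] by simp
  have "norm (riemann_zeta s - a 0) \<le> pi\<^sup>2 / 6 - 1"
  proof -
    have "norm (\<Sum>n. a (Suc n)) \<le> (\<Sum>n. 1 / real (Suc (Suc n)) ^ 2)"
      using sq' na by (intro norm_suminf_le) (auto simp: sums_iff)
    then show ?thesis using sa sq' by (simp add: sums_iff)
  qed
  moreover have "a 0 = 1" by (simp add: a_def)
  moreover have "pi\<^sup>2 \<le> (3.2)\<^sup>2" using pi_approx by (intro power_mono) auto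
  ultimately have "norm (riemann_zeta s - 1) \<le> 4 / 5" by (simp add: power2_eq_square)
  then show ?thesis using norm_triangle_ineq2[of 1 "1 - riemann_zeta s"] by (simp add: s_def norm_minus_commute)
qed

text \<open>Cut the interval into card Y + 1 equal cells. A point of Y is closer than half a cell to
  at most one midpoint, so some midpoint is free.\<close>

lemma pigeonhole_gap:
  fixes Y :: "real set"
  assumes Y: "finite Y" and d: "d > 0"
  shows "\<exists>x\<in>{T..T + d}. \<forall>y\<in>Y. \<bar>x - y\<bar> \<ge> d / (2 * real (card Y + 1))"
proof (rule ccontr)
  define K where "K = card Y + 1"
  define c where "c j = T + d * (real j + 1 / 2) / real K" for j :: nat
  have K: "real K > 0" by (simp add: K_def)
  assume neg: "\<not> ?thesis"
  have cin: "c j \<in> {T..T + d}" if "j < K" for j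
  proof -
    have "d * (real j + 1 / 2) / real K \<le> d * 1"
      unfolding times_divide_eq_right[symmetric] using that K d by (intro mult_left_mono) auto
    moreover have "0 \<le> d * (real j + 1 / 2) / real K" using d by simp
    ultimately show ?thesis by (simp add: c_def)
  qed
  have "\<forall>j\<in>{..<K}. \<exists>y\<in>Y. \<bar>c j - y\<bar> < d / (2 * real K)"
    using neg cin unfolding K_def by (meson lessThan_iff not_le)
  then obtain f where f: "\<And>j. j < K \<Longrightarrow> f j \<in> Y \<and> \<bar>c j - f j\<bar> < d / (2 * real K)" by (metis lessThan_iff)
  have "inj_on f {..<K}"
  proof (rule inj_onI, rule ccontr)
    fix i j assume ij: "i \<in> {..<K}" "j \<in> {..<K}" "f i = f j" "i \<noteq> j"
    have "\<bar>c i - c j\<bar> < d / (2 * real K) + d / (2 * real K)"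
      using f[of i] f[of j] ij by auto
    also have "\<dots> = d / real K" by (simp add: field_simps)
    also have "c i - c j = d / real K * (real i - real j)" using K by (simp add: c_def diff_divide_distrib[symmetric] right_diff_distrib[symmetric])
    also have "\<bar>d / real K * (real i - real j)\<bar> = d / real K * \<bar>real i - real j\<bar>" using d K by (simp add: abs_mult)
    finally have "\<bar>real i - real j\<bar> < 1" using d K by (simp add: field_simps)
    then show False using ij(4) by linarith
  qed
  then have "card {..<K} \<le> card Y" using f Y by (intro card_inj_on_le[of f]) auto
  then show False by (simp add: K_def)
qed

text \<open>The radii are 16/10 < 17/10 < 19/10 around 2 + iT. The smallest disc reaches Re s = 1/2
  at all heights within 1/10 of T; the largest stays in Re s > 1/20, where zeta grows at most
  linearly. Since |zeta| is at least 1/5 at the centre, the exponent M of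
  \<open>logderiv_zeros_disc\<close> is of order ln T.\<close>

lemma riemann_zeta_local_zeros:
  "\<exists>C\<ge>1. \<forall>T\<ge>4. finite {z \<in> cball (Complex 2 T) (17/10). riemann_zeta z = 0} \<and>
     (\<Sum>p\<in>{z \<in> cball (Complex 2 T) (17/10). riemann_zeta z = 0}. real (nat (zorder riemann_zeta p))) \<le> C * ln T \<and>
     (\<forall>z\<in>cball (Complex 2 T) (16/10). riemann_zeta z \<noteq> 0 \<longrightarrow>
        norm (zeta_logderiv z - (\<Sum>p\<in>{z \<in> cball (Complex 2 T) (17/10). riemann_zeta z = 0}. of_nat (nat (zorder riemann_zeta p)) / (z - p))) \<le> C * ln T)"
proof -
  obtain C where C: "C \<ge> 0" "\<And>s. Re s \<ge> 1/20 \<Longrightarrow> \<bar>Im s\<bar> \<ge> 1 \<Longrightarrow> norm (riemann_zeta s) \<le> C * norm s"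
    using riemann_zeta_growth[of "1/20"] by auto
  define r' r R :: real where "r' = 16/10" and "r = 17/10" and "R = 19/10"
  define k1 where "k1 = 1 / ln (R / r)"
  define k2 where "k2 = k1 * (R / (R\<^sup>2 - r\<^sup>2)) + 16 * r / (r - r')\<^sup>2 * 2"
  have k1: "k1 > 0" unfolding k1_def by (auto simp: R_def r_def intro!: divide_pos_pos ln_gt_zero)
  have k2: "k2 \<ge> 0" unfolding k2_def using k1
    by (intro add_nonneg_nonneg mult_nonneg_nonneg) (auto simp: R_def r_def r'_def power2_eq_square)
  define m where "m = ln (5 * (C + 1)) + 2"
  have m: "m > 0" using C(1) by (auto simp: m_def intro!: add_nonneg_pos ln_ge_zero)
  show ?thesis
  proof (intro exI[of _ "k1 * m + k2 * m + 1"] conjI allI impI)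
    show "1 \<le> k1 * m + k2 * m + 1" using k1 k2 m by simp
    fix T :: real assume T: "T \<ge> 4"
    define z0 where "z0 = Complex 2 T"
    define M where "M = ln ((C + 1) * (T + 5) * 5)"
    have lnT: "ln T \<ge> 1"
    proof -
      have "exp 1 \<le> (4::real)" using exp_le by simp
      then show ?thesis using T by (subst ln_ge_iff) auto
    qed
    have Mpos: "M > 0"
    proof -
      have "(C + 1) * (T + 5) \<ge> 1 * 1" using C(1) T by (intro mult_mono) auto
      then show ?thesis unfolding M_def by (intro ln_gt_zero) linarith
    qed
    have MT: "M \<le> m * ln T"
    proof -
      have "M = ln (5 * (C + 1)) + ln (T + 5)"
      proof -
        have "(C + 1) * (T + 5) * 5 = (5 * (C + 1)) * (T + 5)" by (simp only: mult_ac)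
        then show ?thesis unfolding M_def using C(1) T by (simp only:) (subst ln_mult, auto)
      qed
      also have "ln (T + 5) \<le> ln (T * T)"
      proof -
        have "4 * T \<le> T * T" using T by (intro mult_right_mono) auto
        then have "T + 5 \<le> T * T" using T by linarith
        then show ?thesis using T by (subst ln_le_cancel_iff) auto
      qed
      also have "ln (T * T) = 2 * ln T" using T by (simp add: ln_mult)
      also have "ln (5 * (C + 1)) \<le> ln (5 * (C + 1)) * ln T"
        using lnT C(1) by (simp add: mult_le_cancel_left1 ln_ge_zero)
      finally show ?thesis by (simp add: m_def algebra_simps)
    qed
    have ballS: "Re z > 1/20 \<and> Im z > 1 \<and> norm z \<le> T + 5" if "z \<in> ball z0 (39/20)" for z
    proof -
      have n: "norm (z0 - z) < 39/20" using that by (simp add: dist_norm)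
      have "\<bar>2 - Re z\<bar> < 39/20" "\<bar>T - Im z\<bar> < 39/20"
        using n abs_Re_le_cmod[of "z0 - z"] abs_Im_le_cmod[of "z0 - z"] by (auto simp: z0_def)
      moreover have "norm z \<le> norm z0 + norm (z0 - z)"
        using norm_triangle_ineq2[of z z0] by (simp add: norm_minus_commute)
      moreover have "norm z0 \<le> 2 + T" using cmod_le[of z0] T by (simp add: z0_def)
      ultimately show ?thesis using n T by linarith
    qed
    have sub: "cball z0 R \<subseteq> ball z0 (39/20)" by (auto simp: R_def)
    have hol: "riemann_zeta holomorphic_on ball z0 (39/20)"
      by (rule holomorphic_on_subset[OF riemann_zeta_holomorphic]) (use ballS in force)
    have z0: "norm (riemann_zeta z0) \<ge> 1 / 5" unfolding z0_def by (rule norm_riemann_zeta_2_ge)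
    have bound: "norm (riemann_zeta z) \<le> exp M * norm (riemann_zeta z0)" if z: "z \<in> cball z0 R" for z
    proof -
      have zb: "z \<in> ball z0 (39/20)" using z sub by blast
      have "norm (riemann_zeta z) \<le> C * norm z" using C(2)[of z] ballS[OF zb] by auto
      also have "\<dots> \<le> (C + 1) * (T + 5)" using ballS[OF zb] C(1) by (intro mult_mono) auto
      also have "\<dots> = ((C + 1) * (T + 5) * 5) * (1 / 5)" by simp
      also have "\<dots> \<le> ((C + 1) * (T + 5) * 5) * norm (riemann_zeta z0)"
        using z0 C(1) T by (intro mult_left_mono) auto
      also have "(C + 1) * (T + 5) * 5 = exp M" unfolding M_def using C(1) T by (subst exp_ln) auto
      finally show ?thesis .
    qed
    have radii: "0 < r'" "r' < r" "r < R" by (auto simp: r'_def r_def R_def)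
    have nz0: "riemann_zeta z0 \<noteq> 0" using z0 by auto
    note * = logderiv_zeros_disc[OF radii open_ball connected_ball sub hol nz0 Mpos bound]
    have mono1: "k1 * M \<le> (k1 * m + k2 * m + 1) * ln T" "k2 * M \<le> (k1 * m + k2 * m + 1) * ln T"
    proof -
      have "k1 * M \<le> k1 * (m * ln T)" "k2 * M \<le> k2 * (m * ln T)"
        using MT k1 k2 by (auto intro!: mult_left_mono)
      moreover have "0 \<le> k1 * (m * ln T)" "0 \<le> k2 * (m * ln T)" using k1 k2 m lnT by auto
      ultimately show "k1 * M \<le> (k1 * m + k2 * m + 1) * ln T" "k2 * M \<le> (k1 * m + k2 * m + 1) * ln T"
        using lnT by (auto simp: distrib_right mult.assoc)
    qed
    have Z: "{z \<in> cball (Complex 2 T) (17/10). riemann_zeta z = 0} = {z \<in> cball z0 r. riemann_zeta z = 0}"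
      by (simp add: z0_def r_def)
    show "finite {z \<in> cball (Complex 2 T) (17/10). riemann_zeta z = 0}" unfolding Z by (rule *(1))
    show "(\<Sum>p\<in>{z \<in> cball (Complex 2 T) (17/10). riemann_zeta z = 0}. real (nat (zorder riemann_zeta p))) \<le> (k1 * m + k2 * m + 1) * ln T"
      unfolding Z using *(2) mono1(1) by (simp add: k1_def)
    show "\<forall>z\<in>cball (Complex 2 T) (16/10). riemann_zeta z \<noteq> 0 \<longrightarrow>
        norm (zeta_logderiv z - (\<Sum>p\<in>{z \<in> cball (Complex 2 T) (17/10). riemann_zeta z = 0}. of_nat (nat (zorder riemann_zeta p)) / (z - p))) \<le> (k1 * m + k2 * m + 1) * ln T"
    proof (intro ballI impI)
      fix z assume z: "z \<in> cball (Complex 2 T) (16/10)" "riemann_zeta z \<noteq> 0"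
      have "norm (zeta_logderiv z - (\<Sum>p\<in>{z \<in> cball z0 r. riemann_zeta z = 0}. of_nat (nat (zorder riemann_zeta p)) / (z - p))) \<le> k2 * M"
        unfolding k2_def k1_def by (rule *(3)) (use z in \<open>auto simp: z0_def r'_def\<close>)
      then show "norm (zeta_logderiv z - (\<Sum>p\<in>{z \<in> cball (Complex 2 T) (17/10). riemann_zeta z = 0}. of_nat (nat (zorder riemann_zeta p)) / (z - p))) \<le> (k1 * m + k2 * m + 1) * ln T"
        unfolding Z using mono1(2) by linarith
    qed
  qed
qed

lemma dist_Complex_le:
  assumes "\<bar>a - c\<bar> \<le> x" "\<bar>b - d\<bar> \<le> y" "x\<^sup>2 + y\<^sup>2 \<le> z\<^sup>2" "z \<ge> 0"
  shows "dist (Complex a b) (Complex c d) \<le> z"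
proof -
  have "(a - c)\<^sup>2 \<le> x\<^sup>2" "(b - d)\<^sup>2 \<le> y\<^sup>2"
    using assms(1,2) power_mono[of "\<bar>a - c\<bar>" x 2] power_mono[of "\<bar>b - d\<bar>" y 2] by auto
  then have "(dist (Complex a b) (Complex c d))\<^sup>2 \<le> z\<^sup>2"
    using assms(3) by (simp add: dist_norm cmod_power2)
  then show ?thesis using assms(4) by (rule power2_le_imp_le)
qed

text \<open>Order ln T zeros lie near height T, so some T' in the window keeps a distance of order
  1/ln T from all their ordinates. Each of the order ln T fractions 1/(z - p) is then at most of
  order ln T, whence the square. This covers the right half of the segment; the left half follows by
  reflection.\<close>

lemma riemann_zeta_good_height:
  assumes RH: "riemann_hypothesis"
  shows "\<exists>C\<ge>0. \<forall>T\<ge>4.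
     (\<Sum>\<rho>\<in>zeros_upto (T + 1/10) - zeros_upto T. real (zero_mult \<rho>)) \<le> C * ln T \<and>
     (\<exists>T'\<in>{T..T + 1/10}. \<forall>\<sigma>\<in>{-1/2..3/2}. riemann_zeta (Complex \<sigma> T') \<noteq> 0 \<and>
         norm (zeta_logderiv (Complex \<sigma> T')) \<le> C * (ln T)\<^sup>2)"
proof -
  obtain C where C: "C \<ge> 1"
    and fin: "\<And>T. T \<ge> 4 \<Longrightarrow> finite {z \<in> cball (Complex 2 T) (17/10). riemann_zeta z = 0}"
    and cnt: "\<And>T. T \<ge> 4 \<Longrightarrow> (\<Sum>p\<in>{z \<in> cball (Complex 2 T) (17/10). riemann_zeta z = 0}. real (nat (zorder riemann_zeta p))) \<le> C * ln T"
    and ld: "\<And>T z. T \<ge> 4 \<Longrightarrow> z \<in> cball (Complex 2 T) (16/10) \<Longrightarrow> riemann_zeta z \<noteq> 0 \<Longrightarrow>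
        norm (zeta_logderiv z - (\<Sum>p\<in>{z \<in> cball (Complex 2 T) (17/10). riemann_zeta z = 0}. of_nat (nat (zorder riemann_zeta p)) / (z - p))) \<le> C * ln T"
    using riemann_zeta_local_zeros by blast
  obtain C1 where C1: "C1 \<ge> 0" "\<And>s. \<bar>Re s\<bar> \<le> 2 \<Longrightarrow> Im s \<ge> 1 \<Longrightarrow> norm (chi_logderiv s + of_real (ln (Im s))) \<le> C1"
    using chi_logderiv_bound by blast
  define C2 where "C2 = 20 * C * (C + 1) + C"
  have C20: "C2 \<ge> 0" using C by (simp add: C2_def)
  show ?thesis
  proof (intro exI[of _ "C + C2 + C1 + 2"] conjI allI impI)
    show "0 \<le> C + C2 + C1 + 2" using C C1 C20 by simp
    fix T :: real assume T: "T \<ge> 4"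
    have lnT: "ln T \<ge> 1"
    proof -
      have "exp 1 \<le> (4::real)" using exp_le by simp
      then show ?thesis using T by (subst ln_ge_iff) auto
    qed
    define Z where "Z = {z \<in> cball (Complex 2 T) (17/10). riemann_zeta z = 0}"
    define m where "m p = nat (zorder riemann_zeta p)" for p
    have fZ: "finite Z" unfolding Z_def by (rule fin[OF T])
    have cZ: "(\<Sum>p\<in>Z. real (m p)) \<le> C * ln T" unfolding Z_def m_def by (rule cnt[OF T])
    \<comment> \<open>The Riemann hypothesis puts these zeros on Re s = 1/2, hence into the disc:
      (3/2)^2 + (1/10)^2 < (17/10)^2.\<close>
    have "zeros_upto (T + 1/10) - zeros_upto T \<subseteq> Z"
    proof
      fix \<rho> assume "\<rho> \<in> zeros_upto (T + 1/10) - zeros_upto T"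
      then have r: "\<rho> \<in> nontrivial_zeros" "T < Im \<rho>" "Im \<rho> \<le> T + 1/10" by (auto simp: zeros_upto_def)
      then have re: "Re \<rho> = 1/2" using RH by (auto simp: riemann_hypothesis_def)
      have "dist (Complex 2 T) (Complex (1/2) (Im \<rho>)) \<le> 17/10"
        by (rule dist_Complex_le[of _ _ "3/2" _ _ "1/10"]) (use r in \<open>auto simp: power2_eq_square\<close>)
      moreover have "\<rho> = Complex (1/2) (Im \<rho>)" using re by (simp add: complex_eq_iff)
      ultimately show "\<rho> \<in> Z" using r by (auto simp: Z_def nontrivial_zeros_def)
    qed
    then have "(\<Sum>\<rho>\<in>zeros_upto (T + 1/10) - zeros_upto T. real (zero_mult \<rho>)) \<le> (\<Sum>p\<in>Z. real (m p))"
      unfolding zero_mult_def m_def by (intro sum_mono2 fZ) auto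
    also have "\<dots> \<le> (C + C2 + C1 + 2) * ln T" using cZ C20 C1 lnT C
      by (smt (verit, best) mult_right_mono)
    finally show "(\<Sum>\<rho>\<in>zeros_upto (T + 1/10) - zeros_upto T. real (zero_mult \<rho>)) \<le> (C + C2 + C1 + 2) * ln T" .
    define Y where "Y = Im ` Z"
    obtain T' where T': "T' \<in> {T..T + 1/10}" "\<And>y. y \<in> Y \<Longrightarrow> \<bar>T' - y\<bar> \<ge> (1/10) / (2 * real (card Y + 1))"
    proof -
      have "\<exists>x\<in>{T..T + 1/10}. \<forall>y\<in>Y. \<bar>x - y\<bar> \<ge> (1/10) / (2 * real (card Y + 1))"
        by (rule pigeonhole_gap) (use fZ in \<open>auto simp: Y_def\<close>)
      then show ?thesis using that by blast
    qed
    have cY: "real (card Y) \<le> C * ln T"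
    proof -
      have "card Y \<le> card Z" unfolding Y_def by (rule card_image_le[OF fZ])
      then have "real (card Y) \<le> (\<Sum>p\<in>Z. 1)" by simp
      also have "\<dots> \<le> (\<Sum>p\<in>Z. real (m p))"
      proof (rule sum_mono)
        fix p assume "p \<in> Z"
        then have p: "riemann_zeta p = 0" "p \<in> cball (Complex 2 T) (17/10)" by (auto simp: Z_def)
        have "p \<noteq> 1"
        proof
          assume "p = 1"
          then have "norm (Complex 2 T - 1) \<le> 17/10" using p by (simp add: dist_norm)
          then show False using abs_Im_le_cmod[of "Complex 2 T - 1"] T by simp
        qed
        then have "zorder riemann_zeta p > 0" using p by (intro zorder_riemann_zeta)
        then show "1 \<le> real (m p)" by (simp add: m_def)
      qed
      finally show ?thesis using cZ by linarith
    qed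
    have half: "riemann_zeta (Complex \<sigma> T') \<noteq> 0 \<and> norm (zeta_logderiv (Complex \<sigma> T')) \<le> C2 * (ln T)\<^sup>2" if \<sigma>: "\<sigma> \<in> {1/2..3/2}" for \<sigma>
    proof -
      define z where "z = Complex \<sigma> T'"
      have "dist (Complex 2 T) (Complex \<sigma> T') \<le> 16/10"
        by (rule dist_Complex_le[of _ _ "3/2" _ _ "1/10"]) (use T' \<sigma> in \<open>auto simp: power2_eq_square\<close>)
      then have zin: "z \<in> cball (Complex 2 T) (16/10)" by (simp add: z_def)
      define \<delta> where "\<delta> = (1/10) / (2 * real (card Y + 1))"
      have \<delta>: "\<delta> > 0" by (simp add: \<delta>_def)
      have gap: "norm (z - p) \<ge> \<delta>" if "p \<in> Z" for p
        using T'(2)[of "Im p"] that abs_Im_le_cmod[of "z - p"] by (simp add: Y_def z_def \<delta>_def)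
      have nz: "riemann_zeta z \<noteq> 0"
      proof
        assume "riemann_zeta z = 0"
        then have "z \<in> Z" using zin by (auto simp: Z_def)
        then show False using gap[of z] \<delta> by simp
      qed
      have "norm (\<Sum>p\<in>Z. of_nat (m p) / (z - p)) \<le> (\<Sum>p\<in>Z. real (m p) * (1 / \<delta>))"
      proof (rule sum_norm_le)
        fix p assume p: "p \<in> Z"
        have "real (m p) / norm (z - p) \<le> real (m p) / \<delta>"
          using gap[OF p] \<delta> by (intro divide_left_mono mult_pos_pos) auto
        then show "norm (of_nat (m p) / (z - p)) \<le> real (m p) * (1 / \<delta>)" by (simp add: norm_divide)
      qed
      also have "\<dots> = (\<Sum>p\<in>Z. real (m p)) * (1 / \<delta>)" by (rule sum_distrib_right[symmetric])
      also have "\<dots> \<le> (C * ln T) * (20 * (C * ln T + 1))"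
      proof (rule mult_mono)
        have "1 / \<delta> = 20 * (real (card Y) + 1)" by (simp add: \<delta>_def)
        then show "1 / \<delta> \<le> 20 * (C * ln T + 1)" using cY by simp
      qed (use cZ \<delta> C lnT in auto)
      also have "\<dots> \<le> (C * ln T) * (20 * (C * ln T + ln T))"
        using C lnT by (intro mult_left_mono) auto
      also have "\<dots> = 20 * C * (C + 1) * (ln T)\<^sup>2" by (simp add: power2_eq_square algebra_simps)
      finally have s1: "norm (\<Sum>p\<in>Z. of_nat (m p) / (z - p)) \<le> 20 * C * (C + 1) * (ln T)\<^sup>2" .
      have "norm (zeta_logderiv z - (\<Sum>p\<in>Z. of_nat (m p) / (z - p))) \<le> C * ln T"
        unfolding Z_def m_def by (rule ld[OF T zin nz])
      also have "\<dots> \<le> C * (ln T)\<^sup>2" using C lnT by (simp add: power2_eq_square)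
      finally have "norm (zeta_logderiv z) \<le> C2 * (ln T)\<^sup>2"
        using s1 norm_triangle_sub[of "zeta_logderiv z" "\<Sum>p\<in>Z. of_nat (m p) / (z - p)"]
        by (simp add: C2_def distrib_right)
      then show ?thesis using nz by (simp add: z_def)
    qed
    show "\<exists>T'\<in>{T..T + 1/10}. \<forall>\<sigma>\<in>{-1/2..3/2}. riemann_zeta (Complex \<sigma> T') \<noteq> 0 \<and>
         norm (zeta_logderiv (Complex \<sigma> T')) \<le> (C + C2 + C1 + 2) * (ln T)\<^sup>2"
    proof (intro bexI[of _ T'] ballI T'(1))
      fix \<sigma> :: real assume \<sigma>: "\<sigma> \<in> {-1/2..3/2}"
      have le: "C2 * (ln T)\<^sup>2 \<le> (C + C2 + C1 + 2) * (ln T)\<^sup>2" using C C1 by (intro mult_right_mono) auto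
      show "riemann_zeta (Complex \<sigma> T') \<noteq> 0 \<and> norm (zeta_logderiv (Complex \<sigma> T')) \<le> (C + C2 + C1 + 2) * (ln T)\<^sup>2"
      proof (cases "\<sigma> \<ge> 1/2")
        case True
        then show ?thesis using half[of \<sigma>] \<sigma> le by auto
      next
        case False
        define s where "s = Complex \<sigma> T'"
        \<comment> \<open>w is the mirror image of s in the critical line at the same height, so 1 -
          s = \<open>cnj w\<close>. As zeta'/zeta commutes with conjugation, the bound for the right
          half applies at w without changing T'.\<close>
        define w where "w = Complex (1 - \<sigma>) T'"
        have T'pos: "T' \<ge> 4" "T' \<le> T + 1/10" using T' T by auto
        have cw: "1 - s = cnj w" by (simp add: s_def w_def complex_eq_iff)
        have w1: "w \<noteq> 1" using T'pos by (auto simp: w_def complex_eq_iff)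
        have hw: "riemann_zeta w \<noteq> 0" "norm (zeta_logderiv w) \<le> C2 * (ln T)\<^sup>2"
          using half[of "1 - \<sigma>"] \<sigma> False by (auto simp: w_def)
        have im: "Im s \<noteq> 0" using T'pos by (simp add: s_def)
        have nz: "riemann_zeta s \<noteq> 0"
          using riemann_zeta_zero_reflect[OF im] hw(1) unfolding cw riemann_zeta_cnj by simp
        have "zeta_logderiv s = chi_logderiv s - cnj (zeta_logderiv w)"
          using zeta_logderiv_reflect[OF im nz] riemann_zeta_logderiv_cnj[OF w1] unfolding cw by simp
        then have "norm (zeta_logderiv s) \<le> norm (chi_logderiv s) + norm (zeta_logderiv w)"
          using norm_triangle_ineq4[of "chi_logderiv s" "cnj (zeta_logderiv w)"] by (simp only: complex_mod_cnj)
        also have "norm (chi_logderiv s) \<le> C1 + ln T'"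
        proof -
          have "norm (chi_logderiv s + of_real (ln T')) \<le> C1"
            using C1(2)[of s] \<sigma> T'pos by (simp add: s_def abs_le_iff)
          moreover have "norm (complex_of_real (ln T')) = ln T'" using T'pos by simp
          ultimately show ?thesis
            using norm_triangle_ineq4[of "chi_logderiv s + of_real (ln T')" "of_real (ln T')"] by simp
        qed
        also have "ln T' \<le> ln (T * T)"
        proof -
          have "4 * T \<le> T * T" using T by (intro mult_right_mono) auto
          then have "T' \<le> T * T" using T T'pos by linarith
          then show ?thesis using T'pos by (subst ln_le_cancel_iff) auto
        qed
        also have "ln (T * T) = 2 * ln T" using T by (simp add: ln_mult)
        finally have "norm (zeta_logderiv s) \<le> C1 + 2 * ln T + C2 * (ln T)\<^sup>2" using hw(2) by linarith
        moreover have "ln T \<le> (ln T)\<^sup>2" "1 \<le> (ln T)\<^sup>2" using lnT by (auto simp: power2_eq_square mult_ge1_I)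
        moreover have "C1 * 1 \<le> C1 * (ln T)\<^sup>2" using \<open>1 \<le> (ln T)\<^sup>2\<close> C1 by (intro mult_left_mono) auto
        moreover have "0 \<le> C * (ln T)\<^sup>2" using C by simp
        ultimately have "norm (zeta_logderiv s) \<le> (C + C2 + C1 + 2) * (ln T)\<^sup>2"
          by (simp add: distrib_right)
        then show ?thesis using nz by (simp add: s_def)
      qed
    qed
  qed
qed

section \<open>Resonance formula for exponential sums over zeros\<close>

definition zero_sum :: "real \<Rightarrow> real \<Rightarrow> complex" where
  "zero_sum T y = (\<Sum>\<rho>\<in>zeros_upto T. of_nat (zero_mult \<rho>) * cis (y * Im \<rho>))"

abbreviation cis_integral :: "real \<Rightarrow> real \<Rightarrow> real \<Rightarrow> complex" where
  "cis_integral a b v \<equiv> integral {a..b} (\<lambda>t. cis (v * t))"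

lemma continuous_on_cis_mult [continuous_intros]:
  "continuous_on A f \<Longrightarrow> continuous_on A (\<lambda>t. cis (f t))"
  unfolding cis_conv_exp by (intro continuous_intros)

lemma continuous_on_Complex_const [continuous_intros]:
  assumes "continuous_on A f" "continuous_on A g"
  shows "continuous_on A (\<lambda>t. Complex (f t) (g t))"
proof -
  have "(\<lambda>t. Complex (f t) (g t)) = (\<lambda>t. of_real (f t) + \<i> * of_real (g t))"
    by (simp add: complex_eq_iff fun_eq_iff)
  then show ?thesis using assms by (simp only:) (intro continuous_intros)
qed

lemma cis_integral_bound:
  assumes "a \<le> b" "v \<noteq> 0"
  shows "norm (cis_integral a b v) \<le> 2 / \<bar>v\<bar>"
proof -
  have "((\<lambda>t. cis (v * t)) has_integral (- \<i> / of_real v * cis (v * b) - - \<i> / of_real v * cis (v * a))) {a..b}"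
  proof (rule fundamental_theorem_of_calculus[OF assms(1)])
    fix x assume "x \<in> {a..b}"
    have "((\<lambda>z. - \<i> / of_real v * exp (\<i> * (of_real v * z))) has_field_derivative exp (\<i> * (of_real v * of_real x))) (at (of_real x))"
      using assms by (auto intro!: derivative_eq_intros)
    then have "((\<lambda>t. - \<i> / of_real v * exp (\<i> * (of_real v * of_real t))) has_vector_derivative exp (\<i> * (of_real v * of_real x))) (at x within {a..b})"
      by (rule has_vector_derivative_real_field[OF has_field_derivative_at_within])
    then show "((\<lambda>t. - \<i> / of_real v * cis (v * t)) has_vector_derivative cis (v * x)) (at x within {a..b})"
      by (simp add: cis_conv_exp)
  qed
  then have "cis_integral a b v = - \<i> / of_real v * (cis (v * b) - cis (v * a))"
    by (simp add: integral_unique algebra_simps)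
  then have "norm (cis_integral a b v) = norm (cis (v * b) - cis (v * a)) / \<bar>v\<bar>"
    by (simp add: norm_mult norm_divide)
  also have "\<dots> \<le> 2 / \<bar>v\<bar>"
    using norm_triangle_ineq4[of "cis (v * b)" "cis (v * a)"] by (intro divide_right_mono) auto
  finally show ?thesis .
qed

lemma cis_integral_le_length:
  assumes "a \<le> b"
  shows "norm (cis_integral a b v) \<le> b - a"
  using integral_bound[of a b "\<lambda>t. cis (v * t)" 1] assms by (simp add: continuous_intros)

text \<open>The sign e = 1 serves the right edge of the contour; e = -1 serves the left edge, where
  reflection turns 1 - c + it into c - it. Convergence is uniform in t because c > 1.\<close>

lemma mangoldt_integral_sums:
  fixes e :: real
  assumes c: "c > 1" and ab: "a \<le> b"
  shows "(\<lambda>n. of_real (mangoldt n * real n powr (- c)) * cis_integral a b (y - e * ln (real n))) sums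
     integral {a..b} (\<lambda>t. mangoldt_series (Complex c (e * t)) * cis (y * t))"
proof -
  define g where "g n t = of_real (mangoldt n * real n powr (- c)) * cis ((y - e * ln (real n)) * t)" for n :: nat and t
  have g_eq: "mangoldt n / of_nat n powr (Complex c (e * t)) * cis (y * t) = g n t" for n t
  proof (cases "n = 0")
    case False
    have "of_nat n powr (Complex c (e * t)) = of_real (real n powr c) * cis (e * t * ln (real n))"
    proof -
      have "of_nat n powr (Complex c (e * t)) = exp (Complex c (e * t) * of_real (ln (real n)))"
        using False by (simp add: powr_def Ln_of_nat)
      also have "Complex c (e * t) * of_real (ln (real n)) = of_real (c * ln (real n)) + \<i> * of_real (e * t * ln (real n))"
        by (simp add: complex_eq_iff)
      also have "exp \<dots> = of_real (exp (c * ln (real n))) * cis (e * t * ln (real n))"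
        by (simp only: exp_add exp_of_real cis_conv_exp)
      finally show ?thesis using False by (simp add: powr_def)
    qed
    then have "mangoldt n / of_nat n powr (Complex c (e * t)) = mangoldt n * (inverse (of_real (real n powr c)) * inverse (cis (e * t * ln (real n))))"
      by (simp only: divide_inverse inverse_mult_distrib)
    also have "inverse (cis (e * t * ln (real n))) = cis (- (e * t * ln (real n)))" by (rule cis_inverse)
    also have "inverse (complex_of_real (real n powr c)) = of_real (real n powr (- c))"
      by (simp only: powr_minus of_real_inverse)
    finally have "mangoldt n / of_nat n powr (Complex c (e * t)) = mangoldt n * (of_real (real n powr (- c)) * cis (- (e * t * ln (real n))))" .
    then have "mangoldt n / of_nat n powr (Complex c (e * t)) * cis (y * t) =
       mangoldt n * of_real (real n powr (- c)) * (cis (- (e * t * ln (real n))) * cis (y * t))"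
      by (simp only: mult_ac)
    also have "cis (- (e * t * ln (real n))) * cis (y * t) = cis ((y - e * ln (real n)) * t)"
      by (simp add: cis_mult algebra_simps)
    finally show ?thesis by (simp add: g_def)
  qed (simp add: g_def)
  have sums: "(\<lambda>n. g n t) sums (mangoldt_series (Complex c (e * t)) * cis (y * t))" for t
    unfolding g_eq[symmetric] by (intro sums_mult2 mangoldt_series_sums(1)) (use c in auto)
  have "uniform_limit {a..b} (\<lambda>N t. \<Sum>n<N. g n t) (\<lambda>t. \<Sum>n. g n t) sequentially"
  proof (rule Weierstrass_m_test)
    show "summable (\<lambda>n. mangoldt n * real n powr (- c))" by (rule summable_mangoldt_powr[OF c])
    show "norm (g n t) \<le> mangoldt n * real n powr (- c)" for n t
      using mangoldt_nonneg[of n] by (simp add: g_def norm_mult)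
  qed
  then have ul: "uniform_limit {a..b} (\<lambda>N t. \<Sum>n<N. g n t) (\<lambda>t. mangoldt_series (Complex c (e * t)) * cis (y * t)) sequentially"
    using sums by (simp add: sums_iff)
  obtain I J where IJ: "\<And>N. ((\<lambda>t. \<Sum>n<N. g n t) has_integral I N) {a..b}"
     "((\<lambda>t. mangoldt_series (Complex c (e * t)) * cis (y * t)) has_integral J) {a..b}" "I \<longlonglongrightarrow> J"
  proof (rule uniform_limit_integral[OF ul])
    show "continuous_on {a..b} (\<lambda>t. \<Sum>n<N. g n t)" for N unfolding g_def by (intro continuous_intros)
  qed auto
  have "I N = (\<Sum>n<N. of_real (mangoldt n * real n powr (- c)) * cis_integral a b (y - e * ln (real n)))" for N
  proof -
    have "((\<lambda>t. \<Sum>n<N. g n t) has_integral (\<Sum>n<N. of_real (mangoldt n * real n powr (- c)) * cis_integral a b (y - e * ln (real n)))) {a..b}"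
      unfolding g_def
      by (intro has_integral_sum has_integral_mult_right integrable_integral integrable_continuous_interval continuous_intros finite_lessThan)
    then show ?thesis using IJ(1)[of N] has_integral_unique by blast
  qed
  then have "I = (\<lambda>N. \<Sum>n<N. of_real (mangoldt n * real n powr (- c)) * cis_integral a b (y - e * ln (real n)))" by blast
  then show ?thesis using IJ(3) unfolding sums_def integral_unique[OF IJ(2)] by (simp only:)
qed

section \<open>Contribution of the non-resonant prime powers\<close>

lemma sum_inverse_le: "(\<Sum>j=1..n. 1 / real j) \<le> 1 + ln (real n + 1)"
proof (cases "n = 0")
  case False
  have "(\<Sum>j=1..m. 1 / real j) \<le> 1 + ln (real m)" if "m \<ge> 1" for m
    using that
  proof (induction m rule: nat_induct_at_least)
    case (Suc m)
    have "ln (real m / real (Suc m)) \<le> real m / real (Suc m) - 1" using Suc.hyps by (intro ln_le_minus_one) auto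
    also have "\<dots> = - (1 / real (Suc m))" by (simp add: field_simps)
    finally have "1 / real (Suc m) \<le> ln (real (Suc m)) - ln (real m)" using Suc.hyps by (subst (asm) ln_divide_pos) auto
    then show ?case using Suc.IH by simp
  qed simp
  from this[of n] have "(\<Sum>j=1..n. 1 / real j) \<le> 1 + ln (real n)" using False by simp
  also have "ln (real n) \<le> ln (real n + 1)" using False by simp
  finally show ?thesis by simp
qed simp

lemma sum_inverse_dist_le:
  fixes n0 N :: nat
  shows "(\<Sum>n\<in>{1..N} - {n0}. 1 / \<bar>real n - real n0\<bar>) \<le> 2 * (1 + ln (real (N + n0) + 1))"
proof -
  have "(\<Sum>n\<in>{1..N} - {n0}. 1 / \<bar>real n - real n0\<bar>) \<le> (\<Sum>n\<in>{1..<n0} \<union> {n0<..N}. 1 / \<bar>real n - real n0\<bar>)"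
    by (intro sum_mono2) auto
  also have "\<dots> = (\<Sum>n\<in>{1..<n0}. 1 / \<bar>real n - real n0\<bar>) + (\<Sum>n\<in>{n0<..N}. 1 / \<bar>real n - real n0\<bar>)"
    by (rule sum.union_disjoint) auto
  also have "(\<Sum>n\<in>{1..<n0}. 1 / \<bar>real n - real n0\<bar>) = (\<Sum>j=1..n0-1. 1 / real j)"
    by (rule sum.reindex_bij_witness[of _ "\<lambda>j. n0 - j" "\<lambda>n. n0 - n"]) (auto simp: of_nat_diff)
  also have "(\<Sum>n\<in>{n0<..N}. 1 / \<bar>real n - real n0\<bar>) = (\<Sum>j=1..N-n0. 1 / real j)"
    by (rule sum.reindex_bij_witness[of _ "\<lambda>j. n0 + j" "\<lambda>n. n - n0"]) (auto simp: of_nat_diff)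
  also have "(\<Sum>j=1..n0-1. 1 / real j) \<le> 1 + ln (real (N + n0) + 1)"
    by (rule order_trans[OF sum_inverse_le]) auto
  also have "(\<Sum>j=1..N-n0. 1 / real j) \<le> 1 + ln (real (N + n0) + 1)"
    by (rule order_trans[OF sum_inverse_le]) auto
  finally show ?thesis by simp
qed

text \<open>Write x = e^y. Terms with |y - ln n| >= 1/2 gain at most a factor 2. The other n lie
  between x/2 and 2x, where the coefficient is at most 4 (y + 1) x^(-c) and |y - ln n| is at least
  |n - n0|/(4x); a harmonic sum over n - n0 then gives a further factor of order y + 2, and x^(1-c)
  = e^(y(1-c)) remains.\<close>

lemma mangoldt_off_diagonal:
  assumes c: "1 < c" "c \<le> 3/2" and y: "y \<ge> 0"
  defines "n0 \<equiv> nat (round (exp y))"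
  defines "a \<equiv> \<lambda>n::nat. if n = n0 then 0 else mangoldt n * real n powr (- c) / \<bar>y - ln (real n)\<bar>"
  shows "summable a" and "suminf a \<le> 2 * (\<Sum>n. mangoldt n * real n powr (- c)) + 200 * exp (y * (1 - c)) * (y + 2)\<^sup>2"
    and "n0 \<ge> 1" and "\<And>n. n \<noteq> n0 \<Longrightarrow> n \<ge> 1 \<Longrightarrow> y \<noteq> ln (real n)"
proof -
  define x where "x = exp y"
  have x: "x \<ge> 1" using y by (simp add: x_def)
  have yx: "y = ln x" by (simp add: x_def)
  have rnd: "\<bar>real n0 - x\<bar> \<le> 1 / 2"
  proof -
    have "round x \<ge> 1" using x round_mono[of 1 x] by simp
    then have "real n0 = of_int (round x)" by (simp add: n0_def x_def)
    then show ?thesis using of_int_round_abs_le[of x] by simp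
  qed
  show n01: "n0 \<ge> 1" using rnd x by linarith
  \<comment> \<open>Rounding leaves x within 1/2 of n0, while any other integer is at least 1 away
    from n0; hence its distance to x is at least half its distance to n0.\<close>
  have distn: "\<bar>real n - real n0\<bar> / 2 \<le> \<bar>x - real n\<bar>" if "n \<noteq> n0" for n
  proof -
    have d1: "\<bar>real n - real n0\<bar> \<ge> 1" using that by linarith
    have d2: "\<bar>real n - real n0\<bar> \<le> \<bar>x - real n\<bar> + \<bar>real n0 - x\<bar>" by linarith
    have "\<bar>real n - real n0\<bar> - 1 / 2 \<le> \<bar>x - real n\<bar>" using d2 rnd by linarith
    moreover have "a / 2 \<le> b" if "a \<ge> 1" "a - 1/2 \<le> b" for a b :: real using that by (simp add: field_simps)
    ultimately show ?thesis using d1 by blast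
  qed
  have lnd: "\<bar>x - real n\<bar> / max x (real n) \<le> \<bar>y - ln (real n)\<bar>" if "n \<ge> 1" for n :: nat
  proof (cases "real n \<le> x")
    case True
    have "ln (real n / x) \<le> real n / x - 1" using that x by (intro ln_le_minus_one) auto
    then have "ln (real n) - ln x \<le> real n / x - 1" using that x by (subst (asm) ln_divide_pos) auto
    moreover have "real n / x - 1 = - ((x - real n) / x)" using x by (simp add: field_simps)
    ultimately show ?thesis using True by (simp add: yx max_def)
  next
    case False
    have "ln (x / real n) \<le> x / real n - 1" using that x by (intro ln_le_minus_one) auto
    then have "ln x - ln (real n) \<le> x / real n - 1" using that x by (subst (asm) ln_divide_pos) auto
    moreover have "x / real n - 1 = - ((real n - x) / real n)" using that by (simp add: field_simps)
    ultimately show ?thesis using False by (simp add: yx max_def)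
  qed
  show ne: "y \<noteq> ln (real n)" if "n \<noteq> n0" "n \<ge> 1" for n
  proof -
    have "\<bar>real n - real n0\<bar> \<ge> 1" using that by linarith
    then have "\<bar>x - real n\<bar> / max x (real n) > 0" using distn[OF that(1)] x by (intro divide_pos_pos) (auto simp: less_max_iff_disj)
    then show ?thesis using lnd[OF that(2)] by auto
  qed
  define N where "N = nat \<lfloor>2 * x\<rfloor>"
  define k where "k = 16 * (y + 1) * exp (y * (1 - c))"
  have k0: "k \<ge> 0" using y by (simp add: k_def)
  define u where "u n = (if n \<in> {1..N} - {n0} then k * (1 / \<bar>real n - real n0\<bar>) else 0)" for n
  have pt: "a n \<le> 2 * (mangoldt n * real n powr (- c)) + u n" for n
  proof (cases "n = n0 \<or> n = 0")
    case True
    have "u n = 0" using True by (auto simp: u_def)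
    then show ?thesis using True mangoldt_nonneg[of n] by (auto simp: a_def)
  next
    case False
    then have n: "n \<noteq> n0" "n \<ge> 1" by auto
    define w where "w = mangoldt n * real n powr (- c)"
    have w0: "w \<ge> 0" using mangoldt_nonneg[of n] by (simp add: w_def)
    have an: "a n = w / \<bar>y - ln (real n)\<bar>" using n by (simp add: a_def w_def)
    have u0: "u n \<ge> 0" using k0 by (simp add: u_def)
    show ?thesis
    proof (cases "\<bar>y - ln (real n)\<bar> \<ge> 1 / 2")
      case True
      have "w / \<bar>y - ln (real n)\<bar> \<le> w / (1 / 2)" using True w0 by (intro divide_left_mono) auto
      then show ?thesis using u0 an by (simp add: w_def)
    next
      case False
      have ny: "ln (real n) \<le> y + 1/2" "y \<le> ln (real n) + 1/2" using False by linarith+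
      have e2: "exp (1/2) \<le> (2::real)"
      proof -
        have "exp (1/2) ^ 2 = exp (1::real)" by (simp add: exp_of_nat_mult[symmetric])
        also have "\<dots> \<le> 2 ^ 2" using exp_le by simp
        finally show ?thesis by (rule power2_le_imp_le) simp
      qed
      have n_le: "real n \<le> 2 * x"
      proof -
        have "real n = exp (ln (real n))" using n by simp
        also have "\<dots> \<le> exp (y + 1/2)" using ny by simp
        also have "\<dots> = x * exp (1/2)" by (simp add: exp_add x_def)
        also have "\<dots> \<le> x * 2" using e2 x by (intro mult_left_mono) auto
        finally show ?thesis by simp
      qed
      have n_ge: "x / 2 \<le> real n"
      proof -
        have "x = exp (ln x)" using x by simp
        also have "\<dots> \<le> exp (ln (real n) + 1/2)" using ny by (simp add: yx)
        also have "\<dots> = real n * exp (1/2)" using n by (simp add: exp_add)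
        also have "\<dots> \<le> real n * 2" using e2 by (intro mult_left_mono) auto
        finally show ?thesis by simp
      qed
      have w_le: "w \<le> (y + 1) * (4 * x powr (- c))"
        unfolding w_def
      proof (rule mult_mono)
        have "mangoldt n \<le> ln (real n)" using n by (intro mangoldt_le) auto
        then show "mangoldt n \<le> y + 1" using False by linarith
        have "real n powr (- c) \<le> (x / 2) powr (- c)" using n_ge c x by (intro powr_mono2') auto
        also have "\<dots> = x powr (- c) * 2 powr c" using x by (simp add: powr_divide powr_minus field_simps)
        also have "\<dots> \<le> x powr (- c) * 2 powr 2" using c by (intro mult_left_mono powr_mono) auto
        finally show "real n powr (- c) \<le> 4 * x powr (- c)" by (simp add: powr_numeral)
      qed (use y in auto)
      have d: "\<bar>real n - real n0\<bar> / (4 * x) \<le> \<bar>y - ln (real n)\<bar>"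
      proof -
        have "\<bar>real n - real n0\<bar> / 2 / (2 * x) \<le> \<bar>x - real n\<bar> / max x (real n)"
          using distn[OF n(1)] n_le x by (intro frac_le) auto
        then show ?thesis using lnd[OF n(2)] by (simp add: field_simps)
      qed
      have dpos: "\<bar>real n - real n0\<bar> / (4 * x) > 0" using n x by simp
      have "a n \<le> ((y + 1) * (4 * x powr (- c))) / (\<bar>real n - real n0\<bar> / (4 * x))"
        unfolding an using w_le d dpos w0 by (intro frac_le) auto
      also have "\<dots> = 16 * (y + 1) * (x * x powr (- c)) * (1 / \<bar>real n - real n0\<bar>)"
        using x by simp
      also have "x * x powr (- c) = exp (y * (1 - c))"
        by (simp add: x_def powr_def mult_exp_exp algebra_simps)
      also have "16 * (y + 1) * exp (y * (1 - c)) * (1 / \<bar>real n - real n0\<bar>) = u n"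
      proof -
        have "n \<le> N" unfolding N_def using n_le by linarith
        then show ?thesis using n by (simp add: u_def k_def)
      qed
      finally show ?thesis using w0 by (simp add: w_def)
    qed
  qed
  have a0: "a n \<ge> 0" for n using mangoldt_nonneg[of n] by (simp add: a_def)
  have s1: "summable (\<lambda>n. mangoldt n * real n powr (- c))" by (rule summable_mangoldt_powr[OF c(1)])
  have su: "u sums (\<Sum>n\<in>{1..N} - {n0}. k * (1 / \<bar>real n - real n0\<bar>))"
    unfolding u_def by (rule sums_If_finite_set) auto
  have s2: "summable (\<lambda>n. 2 * (mangoldt n * real n powr (- c)) + u n)"
    using s1 su by (intro summable_add summable_mult) (auto simp: sums_iff)
  show sa: "summable a"
    by (rule summable_comparison_test'[OF s2, of 0]) (use a0 pt in auto)
  have "suminf a \<le> (\<Sum>n. 2 * (mangoldt n * real n powr (- c)) + u n)"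
    by (rule suminf_le[OF pt sa s2])
  also have "\<dots> = 2 * (\<Sum>n. mangoldt n * real n powr (- c)) + suminf u"
    using s1 su by (subst suminf_add[symmetric]) (auto simp: sums_iff suminf_mult intro!: summable_mult)
  also have "suminf u = k * (\<Sum>n\<in>{1..N} - {n0}. 1 / \<bar>real n - real n0\<bar>)"
    using su by (simp add: sums_iff sum_distrib_left)
  also have "\<dots> \<le> k * (2 * (1 + ln (real (N + n0) + 1)))"
    using k0 by (intro mult_left_mono sum_inverse_dist_le)
  also have "\<dots> \<le> k * (2 * (1 + (y + 3)))"
  proof (intro mult_left_mono add_left_mono k0)
    have "real (N + n0) + 1 \<le> 2 * x + (x + 1/2) + 1"
      using rnd x unfolding N_def of_nat_add by linarith
    also have "\<dots> \<le> 8 * x" using x by simp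
    also have "\<dots> \<le> exp 3 * x"
    proof -
      have "2 ^ 3 \<le> exp (1::real) ^ 3" using exp_ge_add_one_self[of "1::real"] by (intro power_mono) auto
      also have "exp (1::real) ^ 3 = exp 3" by (simp add: exp_of_nat_mult[symmetric])
      finally show ?thesis using x by (intro mult_right_mono) auto
    qed
    also have "\<dots> = exp (y + 3)" by (simp add: x_def exp_add)
    finally show "ln (real (N + n0) + 1) \<le> y + 3"
      by (subst ln_le_iff_le_exp) auto
  qed auto
  also have "\<dots> = 32 * exp (y * (1 - c)) * ((y + 1) * (y + 4))" by (simp add: k_def algebra_simps)
  also have "\<dots> \<le> 32 * exp (y * (1 - c)) * (2 * (y + 2)\<^sup>2)"
    using y by (intro mult_left_mono) (auto simp: power2_eq_square algebra_simps)
  also have "\<dots> = 64 * exp (y * (1 - c)) * (y + 2)\<^sup>2" by simp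
  also have "\<dots> \<le> 200 * exp (y * (1 - c)) * (y + 2)\<^sup>2" by (intro mult_right_mono) auto
  finally show "suminf a \<le> 2 * (\<Sum>n. mangoldt n * real n powr (- c)) + 200 * exp (y * (1 - c)) * (y + 2)\<^sup>2" by simp
qed

section \<open>The contour integral for the sum over zeros\<close>

lemma zeta_logderiv_exp_continuous:
  assumes "A \<subseteq> - {1}" "\<And>s. s \<in> A \<Longrightarrow> riemann_zeta s \<noteq> 0"
  shows "continuous_on A (\<lambda>s. deriv riemann_zeta s * exp (of_real y * (s - 1/2)) / riemann_zeta s)"
proof -
  have "continuous_on A riemann_zeta" "continuous_on A (deriv riemann_zeta)"
    using riemann_zeta_holomorphic holomorphic_deriv[OF riemann_zeta_holomorphic] assms(1)
    by (auto intro!: holomorphic_on_imp_continuous_on intro: holomorphic_on_subset)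
  then show ?thesis using assms(2) by (intro continuous_intros) auto
qed

lemma riemann_zeta_nonzero_vertical:
  assumes "c > 1" "t \<noteq> 0"
  shows "riemann_zeta (Complex c t) \<noteq> 0" "riemann_zeta (Complex (1 - c) t) \<noteq> 0"
proof -
  show "riemann_zeta (Complex c t) \<noteq> 0" using assms by (intro riemann_zeta_nonzero_Re_gt_1) auto
  have "1 - Complex (1 - c) t = Complex c (- t)" by (simp add: complex_eq_iff)
  moreover have "riemann_zeta (Complex c (- t)) \<noteq> 0" using assms by (intro riemann_zeta_nonzero_Re_gt_1) auto
  ultimately show "riemann_zeta (Complex (1 - c) t) \<noteq> 0"
    using riemann_zeta_zero_reflect[of "Complex (1 - c) t"] assms by simp
qed

text \<open>The argument principle with weight e^(y(s - 1/2)). The Riemann hypothesis makes the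
  weight at a zero equal to e^(iy gamma) and keeps the zeros off the vertical sides; the assumptions
  on T0 and T keep them off the horizontal sides.\<close>

lemma zero_sum_contour:
  fixes y :: real
  assumes RH: "riemann_hypothesis" and c: "1 < c" "c \<le> 3/2" and T: "1 < T0" "T0 < T"
    and nz: "\<And>\<sigma>. \<sigma> \<in> {-1/2..3/2} \<Longrightarrow> riemann_zeta (Complex \<sigma> T0) \<noteq> 0"
            "\<And>\<sigma>. \<sigma> \<in> {-1/2..3/2} \<Longrightarrow> riemann_zeta (Complex \<sigma> T) \<noteq> 0"
  defines "f \<equiv> \<lambda>s. deriv riemann_zeta s * exp (of_real y * (s - 1/2)) / riemann_zeta s"
  shows "2 * pi * \<i> * (zero_sum T y - zero_sum T0 y) =
     contour_integral (linepath (Complex (1 - c) T0) (Complex c T0)) f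
     + \<i> * integral {T0..T} (\<lambda>t. f (Complex c t))
     - contour_integral (linepath (Complex (1 - c) T) (Complex c T)) f
     - \<i> * integral {T0..T} (\<lambda>t. f (Complex (1 - c) t))"
proof -
  define a1 a2 a3 a4 where "a1 = Complex (1 - c) T0" and "a2 = Complex c T0" and "a3 = Complex c T" and "a4 = Complex (1 - c) T"
  \<comment> \<open>S contains the closed rectangle but begins at height 1/2, above the pole at 1;
    its zeros outside the rectangle have winding number 0.\<close>
  define S where "S = box (Complex (-1) (1/2)) (Complex 2 (T + 1))"
  define pz where "pz = {w\<in>S. riemann_zeta w = 0 \<or> w \<in> {}}"
  have S_iff: "w \<in> S \<longleftrightarrow> -1 < Re w \<and> Re w < 2 \<and> 1/2 < Im w \<and> Im w < T + 1" for w
    by (auto simp: S_def in_box_complex_iff)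
  have S: "open S" "connected S" by (auto simp: S_def intro: convex_connected)
  have S1: "S \<subseteq> - {1}" by (auto simp: S_iff)
  have zero: "Re w = 1/2 \<and> w \<in> nontrivial_zeros" if "w \<in> pz" for w
    using that riemann_zeta_zero_strip[of w] RH by (auto simp: pz_def S_iff riemann_hypothesis_def nontrivial_zeros_def)
  have fin: "finite pz"
    by (rule finite_subset[OF _ finite_zeros_upto[of "T + 1"]])
       (use zero in \<open>auto simp: zeros_upto_def pz_def S_iff\<close>)
  have img: "path_image (rectpath a1 a3) = cbox a1 a3 - box a1 a3"
    using c T by (intro path_image_rectpath_cbox_minus_box) (auto simp: a1_def a3_def)
  have cb: "w \<in> cbox a1 a3 \<longleftrightarrow> 1 - c \<le> Re w \<and> Re w \<le> c \<and> T0 \<le> Im w \<and> Im w \<le> T" for w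
    by (auto simp: a1_def a3_def in_cbox_complex_iff)
  have bx: "w \<in> box a1 a3 \<longleftrightarrow> 1 - c < Re w \<and> Re w < c \<and> T0 < Im w \<and> Im w < T" for w
    by (auto simp: a1_def a3_def in_box_complex_iff)
  have nzim: "Im w \<noteq> T0 \<and> Im w \<noteq> T" if "w \<in> pz" for w
  proof -
    have "w = Complex (1/2) (Im w)" using zero[OF that] by (simp add: complex_eq_iff)
    moreover have "riemann_zeta w = 0" using that by (simp add: pz_def)
    ultimately show ?thesis using nz[of "1/2"] by auto
  qed
  have avoid: "path_image (rectpath a1 a3) \<subseteq> S - pz"
  proof
    fix w assume w: "w \<in> path_image (rectpath a1 a3)"
    then have cbw: "w \<in> cbox a1 a3" "w \<notin> box a1 a3" using img by auto
    then have "w \<in> S" using c T by (auto simp: cb S_iff)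
    moreover have "w \<notin> pz"
    proof
      assume p: "w \<in> pz"
      then have "T0 < Im w" "Im w < T" using nzim[OF p] cbw by (auto simp: cb)
      then show False using zero[OF p] cbw c by (auto simp: bx)
    qed
    ultimately show "w \<in> S - pz" by blast
  qed
  define h where "h s = exp (of_real y * (s - 1/2))" for s :: complex
  have "contour_integral (rectpath a1 a3) (\<lambda>x. deriv riemann_zeta x * h x / riemann_zeta x) =
      2 * pi * \<i> * (\<Sum>p\<in>pz. winding_number (rectpath a1 a3) p * h p * zorder riemann_zeta p)"
    unfolding pz_def
  proof (rule argument_principle)
    show "riemann_zeta holomorphic_on S - {}" using holomorphic_on_subset[OF riemann_zeta_holomorphic S1] by simp
    show "h holomorphic_on S" unfolding h_def by (intro holomorphic_intros)
    show "path_image (rectpath a1 a3) \<subseteq> S - {w \<in> S. riemann_zeta w = 0 \<or> w \<in> {}}" using avoid by (simp add: pz_def)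
    show "finite {w \<in> S. riemann_zeta w = 0 \<or> w \<in> {}}" using fin by (simp add: pz_def)
    show "\<forall>z. z \<notin> S \<longrightarrow> winding_number (rectpath a1 a3) z = 0"
    proof (intro allI impI)
      fix z assume "z \<notin> S"
      then have "z \<notin> cbox a1 a3" using c T by (auto simp: cb S_iff)
      then show "winding_number (rectpath a1 a3) z = 0"
        using c T by (intro winding_number_rectpath_outside) (auto simp: a1_def a3_def)
    qed
  qed (use S in auto)
  also have "(\<lambda>x. deriv riemann_zeta x * h x / riemann_zeta x) = f" by (simp add: f_def h_def)
  also have "(\<Sum>p\<in>pz. winding_number (rectpath a1 a3) p * h p * zorder riemann_zeta p) =
      (\<Sum>p\<in>zeros_upto T - zeros_upto T0. of_nat (zero_mult p) * cis (y * Im p))"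
  proof (rule sum.mono_neutral_cong_right[OF fin])
    show "zeros_upto T - zeros_upto T0 \<subseteq> pz"
      using T by (auto simp: zeros_upto_def pz_def S_iff nontrivial_zeros_def)
    show "\<forall>p\<in>pz - (zeros_upto T - zeros_upto T0). winding_number (rectpath a1 a3) p * h p * zorder riemann_zeta p = 0"
    proof
      fix p assume p: "p \<in> pz - (zeros_upto T - zeros_upto T0)"
      have im: "1/2 < Im p" using p by (auto simp: pz_def S_iff)
      have "p \<notin> cbox a1 a3"
      proof
        assume "p \<in> cbox a1 a3"
        then have "T0 \<le> Im p" "Im p \<le> T" by (auto simp: cb)
        then have "T0 < Im p" "Im p \<le> T" using nzim[of p] p by auto
        then have "p \<in> zeros_upto T - zeros_upto T0" using zero[of p] p im by (auto simp: zeros_upto_def)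
        then show False using p by blast
      qed
      then have "winding_number (rectpath a1 a3) p = 0"
        using c T by (intro winding_number_rectpath_outside) (auto simp: a1_def a3_def)
      then show "winding_number (rectpath a1 a3) p * h p * zorder riemann_zeta p = 0" by simp
    qed
    fix p assume p: "p \<in> zeros_upto T - zeros_upto T0"
    then have pz: "p \<in> pz" using T by (auto simp: zeros_upto_def pz_def S_iff nontrivial_zeros_def)
    have "T0 < Im p" "Im p < T" using p nzim[OF pz] T by (auto simp: zeros_upto_def)
    then have "p \<in> box a1 a3" using zero[OF pz] c by (auto simp: bx)
    then have w1: "winding_number (rectpath a1 a3) p = 1" by (rule winding_number_rectpath)
    have "of_real y * (p - 1/2) = \<i> * of_real (y * Im p)" using zero[OF pz] by (simp add: complex_eq_iff)
    then have hp: "h p = cis (y * Im p)" by (simp only: h_def cis_conv_exp)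
    have "zorder riemann_zeta p > 0" using pz S1 by (intro zorder_riemann_zeta) (auto simp: pz_def)
    then have "(of_int (zorder riemann_zeta p) :: complex) = of_nat (zero_mult p)" by (simp add: zero_mult_def)
    then show "winding_number (rectpath a1 a3) p * h p * zorder riemann_zeta p = of_nat (zero_mult p) * cis (y * Im p)"
      by (simp add: w1 hp)
  qed
  also have "\<dots> = zero_sum T y - zero_sum T0 y"
    unfolding zero_sum_def using T finite_zeros_upto[of T] by (subst sum_diff) (auto simp: zeros_upto_def)
  finally have main: "contour_integral (rectpath a1 a3) f = 2 * pi * \<i> * (zero_sum T y - zero_sum T0 y)" .
  have cont: "continuous_on (closed_segment u v) f" if "closed_segment u v \<subseteq> path_image (rectpath a1 a3)" for u v
    unfolding f_def using that avoid S1 by (intro zeta_logderiv_exp_continuous) (auto simp: pz_def)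
  have pim: "path_image (rectpath a1 a3) = closed_segment a1 a2 \<union> closed_segment a2 a3 \<union> closed_segment a3 a4 \<union> closed_segment a4 a1"
    by (simp add: rectpath_def Let_def path_image_join a1_def a2_def a3_def a4_def Un_assoc)
  have segs: "continuous_on (closed_segment a1 a2) f" "continuous_on (closed_segment a2 a3) f"
    "continuous_on (closed_segment a3 a4) f" "continuous_on (closed_segment a4 a1) f"
    by (intro cont; use pim in blast)+
  have "contour_integral (rectpath a1 a3) f = contour_integral (linepath a1 a2) f + (contour_integral (linepath a2 a3) f +
      (contour_integral (linepath a3 a4) f + contour_integral (linepath a4 a1) f))"
    using segs by (simp add: rectpath_def Let_def a1_def a2_def a3_def a4_def contour_integrable_continuous_linepath)
  moreover have "contour_integral (linepath a3 a4) f = - contour_integral (linepath a4 a3) f"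
    using segs(3) by (rule contour_integral_reverse_linepath)
  moreover have "contour_integral (linepath a4 a1) f = - contour_integral (linepath a1 a4) f"
    using segs(4) by (rule contour_integral_reverse_linepath)
  moreover have "contour_integral (linepath a2 a3) f = \<i> * integral {T0..T} (\<lambda>t. f (Complex c t))"
    by (rule contour_integral_linepath_same_Re) (use T in \<open>auto simp: a2_def a3_def\<close>)
  moreover have "contour_integral (linepath a1 a4) f = \<i> * integral {T0..T} (\<lambda>t. f (Complex (1 - c) t))"
    by (rule contour_integral_linepath_same_Re) (use T in \<open>auto simp: a1_def a4_def\<close>)
  ultimately have "contour_integral (rectpath a1 a3) f =
     contour_integral (linepath a1 a2) f + \<i> * integral {T0..T} (\<lambda>t. f (Complex c t))
     - contour_integral (linepath a4 a3) f - \<i> * integral {T0..T} (\<lambda>t. f (Complex (1 - c) t))"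
    by simp
  then show ?thesis unfolding main by (simp only: a1_def a2_def a3_def a4_def)
qed

text \<open>Only the integer nearest to $e^y$ can resonate with $y$; the reflected side of the contour
  contributes the term with \<^const>\<open>chi_logderiv\<close>.\<close>

theorem landau_gonek_formula:
  assumes RH: "riemann_hypothesis" and c: "1 < c" "c \<le> 3/2"
  shows "\<exists>T0 K. 4 \<le> T0 \<and> T0 \<le> 5 \<and> 0 \<le> K \<and> (\<forall>T\<ge>6. \<forall>y\<in>{0..ln T}.
    norm (zero_sum T y
      + of_real (exp (y * (c - 1/2)) * (mangoldt (nat (round (exp y))) * real (nat (round (exp y))) powr (- c)) / (2 * pi))
          * cis_integral T0 T (y - ln (real (nat (round (exp y)))))
      + of_real (exp (- (y * (c - 1/2))) / (2 * pi)) * integral {T0..T} (\<lambda>t. chi_logderiv (Complex (1 - c) t) * cis (y * t)))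
    \<le> K * (ln T)\<^sup>2 * exp (y * (c - 1/2)))"
proof -
  obtain C where C: "C \<ge> 0"
    and cnt: "\<And>T. T \<ge> 4 \<Longrightarrow> (\<Sum>\<rho>\<in>zeros_upto (T + 1/10) - zeros_upto T. real (zero_mult \<rho>)) \<le> C * ln T"
    and good: "\<And>T. T \<ge> 4 \<Longrightarrow> \<exists>T'\<in>{T..T + 1/10}. \<forall>\<sigma>\<in>{-1/2..3/2}. riemann_zeta (Complex \<sigma> T') \<noteq> 0 \<and>
         norm (zeta_logderiv (Complex \<sigma> T')) \<le> C * (ln T)\<^sup>2"
    using riemann_zeta_good_height[OF RH] by blast
  \<comment> \<open>A fixed good height for the bottom edge; the finitely many zeros up to it
    contribute at most the constant N0.\<close>
  obtain T0 where T0: "T0 \<in> {4..4 + 1/10}" "\<And>\<sigma>. \<sigma> \<in> {-1/2..3/2} \<Longrightarrow> riemann_zeta (Complex \<sigma> T0) \<noteq> 0"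
     "\<And>\<sigma>. \<sigma> \<in> {-1/2..3/2} \<Longrightarrow> norm (zeta_logderiv (Complex \<sigma> T0)) \<le> C * (ln 4)\<^sup>2"
    using good[of 4] by auto
  obtain C1 where C1: "C1 \<ge> 0" "\<And>s. \<bar>Re s\<bar> \<le> 2 \<Longrightarrow> Im s \<ge> 1 \<Longrightarrow> norm (chi_logderiv s + of_real (ln (Im s))) \<le> C1"
    using chi_logderiv_bound by blast
  define D where "D = (\<Sum>n. mangoldt n * real n powr (- c))"
  have D0: "D \<ge> 0" unfolding D_def using mangoldt_nonneg by (intro suminf_nonneg summable_mangoldt_powr c) auto
  define N0 where "N0 = (\<Sum>\<rho>\<in>zeros_upto T0. real (zero_mult \<rho>))"
  have N0: "N0 \<ge> 0" unfolding N0_def by (intro sum_nonneg) auto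
  have D_sums: "(\<Sum>n. w n) = D" if "\<And>n. w n = mangoldt n * real n powr (- c)" for w
    unfolding D_def that ..
  define K where "K = N0 + C + 4 * C + (D + 4 * D + 400 * 9) + (2 + C1) + 4 * D"
  have K0: "K \<ge> 0" using N0 C D0 C1 by (simp add: K_def)
  show ?thesis
  proof (rule exI[of _ T0], rule exI[of _ K], intro conjI allI impI ballI)
    show "4 \<le> T0" "T0 \<le> 5" using T0 by auto
    show "0 \<le> K" by (rule K0)
    fix T y :: real assume T: "T \<ge> 6" and y: "y \<in> {0..ln T}"
    have y0: "y \<ge> 0" using y by simp
    define L where "L = ln T"
    have L1: "L \<ge> 1"
    proof -
      have "exp 1 \<le> (6::real)" using exp_le by simp
      then show ?thesis unfolding L_def using T by (subst ln_ge_iff) auto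
    qed
    have L2: "1 \<le> L\<^sup>2" "L \<le> L\<^sup>2" using L1 by (auto simp: power2_eq_square mult_ge1_I)
    define E where "E = exp (y * (c - 1/2))"
    have E1: "E \<ge> 1" using c y0 by (simp add: E_def)
    \<comment> \<open>The contour ends at a good height just above T. What lies between T and T',
      namely the zeros and the pieces of the two main integrals, is moved into the error
      afterwards.\<close>
    obtain T' where T': "T' \<in> {T..T + 1/10}" "\<And>\<sigma>. \<sigma> \<in> {-1/2..3/2} \<Longrightarrow> riemann_zeta (Complex \<sigma> T') \<noteq> 0"
       "\<And>\<sigma>. \<sigma> \<in> {-1/2..3/2} \<Longrightarrow> norm (zeta_logderiv (Complex \<sigma> T')) \<le> C * L\<^sup>2"
      using good[of T] T unfolding L_def by auto
    have TT: "T0 < T'" "T0 \<le> T" "T \<le> T'" "T' \<le> T + 1/10" "1 < T0" using T0 T T' by auto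
    define f where "f = (\<lambda>s. deriv riemann_zeta s * exp (of_real y * (s - 1/2)) / riemann_zeta s)"
    define HB where "HB = contour_integral (linepath (Complex (1 - c) T0) (Complex c T0)) f"
    define HT where "HT = contour_integral (linepath (Complex (1 - c) T') (Complex c T')) f"
    \<comment> \<open>On a horizontal edge the weight is at most E, its value at Re s = c, and the
      length 2c - 1 is at most 2.\<close>
    have hor: "norm (contour_integral (linepath (Complex (1 - c) u) (Complex c u)) f) \<le> 2 * B * E"
      if u: "u \<noteq> 0" "\<And>\<sigma>. \<sigma> \<in> {-1/2..3/2} \<Longrightarrow> riemann_zeta (Complex \<sigma> u) \<noteq> 0" "\<And>\<sigma>. \<sigma> \<in> {-1/2..3/2} \<Longrightarrow> norm (zeta_logderiv (Complex \<sigma> u)) \<le> B" for u B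
    proof -
      have B0: "B \<ge> 0" by (rule order_trans[OF norm_ge_zero u(3)[of 0]]) auto
      have seg: "\<exists>\<sigma>\<in>{1 - c..c}. s = Complex \<sigma> u" if s: "s \<in> closed_segment (Complex (1 - c) u) (Complex c u)" for s
      proof -
        obtain v where v: "0 \<le> v" "v \<le> 1" "s = (1 - v) *\<^sub>R Complex (1 - c) u + v *\<^sub>R Complex c u"
          using s by (auto simp: closed_segment_def)
        have "Im s = u" unfolding v(3) by (simp add: left_diff_distrib)
        moreover have "Re s = (1 - c) + v * (2 * c - 1)" unfolding v(3) by (simp add: algebra_simps)
        moreover have "0 \<le> v * (2 * c - 1)" "v * (2 * c - 1) \<le> 1 * (2 * c - 1)" using v(1,2) c by (auto intro!: mult_right_mono)
        ultimately show ?thesis by (intro bexI[of _ "Re s"]) (auto simp: complex_eq_iff)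
      qed
      have "norm (contour_integral (linepath (Complex (1 - c) u) (Complex c u)) f) \<le> (B * E) * norm (Complex c u - Complex (1 - c) u)"
      proof (rule contour_integral_bound_linepath)
        show "f contour_integrable_on linepath (Complex (1 - c) u) (Complex c u)"
          unfolding f_def
        proof (intro contour_integrable_continuous_linepath zeta_logderiv_exp_continuous)
          show "closed_segment (Complex (1 - c) u) (Complex c u) \<subseteq> - {1}"
            using seg u(1) by (fastforce simp: complex_eq_iff)
          show "riemann_zeta s \<noteq> 0" if "s \<in> closed_segment (Complex (1 - c) u) (Complex c u)" for s
            using seg[OF that] u(2) c by force
        qed
        show "0 \<le> B * E" using B0 E1 by simp
        fix s assume "s \<in> closed_segment (Complex (1 - c) u) (Complex c u)"
        then obtain \<sigma> where \<sigma>: "\<sigma> \<in> {1 - c..c}" "s = Complex \<sigma> u" using seg by blast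
        have "norm (f s) = norm (zeta_logderiv s) * exp (y * (\<sigma> - 1/2))"
          by (simp add: f_def norm_mult norm_divide \<sigma>)
        also have "\<dots> \<le> B * E"
        proof (rule mult_mono)
          show "norm (zeta_logderiv s) \<le> B" using u(3)[of \<sigma>] \<sigma> c by auto
          show "exp (y * (\<sigma> - 1/2)) \<le> E" unfolding E_def using \<sigma> y0 by (auto intro!: mult_left_mono)
        qed (use B0 in auto)
        finally show "norm (f s) \<le> B * E" .
      qed
      also have "Complex c u - Complex (1 - c) u = of_real (2 * c - 1)" by (simp add: complex_eq_iff)
      also have "(B * E) * norm (complex_of_real (2 * c - 1)) \<le> (B * E) * 2"
      proof (rule mult_left_mono)
        show "norm (complex_of_real (2 * c - 1)) \<le> 2" using c by (simp only: norm_of_real)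
      qed (use B0 E1 in auto)
      finally show ?thesis by simp
    qed
    have HTb: "norm HT \<le> 2 * (C * L\<^sup>2) * E"
      unfolding HT_def by (rule hor) (use T' T in auto)
    have HBb: "norm HB \<le> 2 * (C * (ln 4)\<^sup>2) * E"
      unfolding HB_def by (rule hor) (use T0 in auto)
    have "ln 4 \<le> L" unfolding L_def using T by simp
    then have "(ln 4)\<^sup>2 \<le> L\<^sup>2" by (intro power_mono) auto
    then have HBb': "norm HB \<le> 2 * (C * L\<^sup>2) * E"
      using C E1 by (intro order_trans[OF HBb] mult_right_mono mult_left_mono) auto
    define X where "X t = chi_logderiv (Complex (1 - c) t)" for t
    define n0 where "n0 = nat (round (exp y))"
    define R1 where "R1 = integral {T0..T'} (\<lambda>t. mangoldt_series (Complex c (1 * t)) * cis (y * t))"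
    define R2 where "R2 = integral {T0..T'} (\<lambda>t. mangoldt_series (Complex c ((- 1) * t)) * cis (y * t))"
    define RX where "RX = integral {T0..T'} (\<lambda>t. X t * cis (y * t))"
    have right: "integral {T0..T'} (\<lambda>t. f (Complex c t)) = - (of_real E * R1)"
    proof -
      have "integral {T0..T'} (\<lambda>t. f (Complex c t)) = integral {T0..T'} (\<lambda>t. - of_real E * (mangoldt_series (Complex c (1 * t)) * cis (y * t)))"
      proof (rule Henstock_Kurzweil_Integration.integral_cong)
        fix t assume "t \<in> {T0..T'}"
        have "of_real y * (Complex c t - 1/2) = of_real (y * (c - 1/2)) + \<i> * of_real (y * t)" by (simp add: complex_eq_iff)
        then have "exp (of_real y * (Complex c t - 1/2)) = of_real E * cis (y * t)"
          by (simp only: exp_add E_def exp_of_real cis_conv_exp)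
        moreover have "zeta_logderiv (Complex c t) = - mangoldt_series (Complex c t)"
          using c by (intro riemann_zeta_logderiv) auto
        moreover have "f (Complex c t) = zeta_logderiv (Complex c t) * exp (of_real y * (Complex c t - 1/2))"
          by (simp add: f_def)
        ultimately show "f (Complex c t) = - of_real E * (mangoldt_series (Complex c (1 * t)) * cis (y * t))" by simp
      qed
      then show ?thesis by (simp add: R1_def)
    qed
    have Xc: "continuous_on {T0..T'} (\<lambda>t. X t * cis (y * t))"
      unfolding X_def using T0
      by (intro continuous_intros continuous_on_compose2[OF continuous_on_chi_logderiv[OF order_refl]]) auto
    have Dc: "continuous_on {T0..T'} (\<lambda>t. mangoldt_series (Complex c ((- 1) * t)) * cis (y * t))"
      using c by (intro continuous_intros continuous_on_compose2[OF holomorphic_on_imp_continuous_on[OF mangoldt_series_holomorphic]]) auto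
    \<comment> \<open>On the left edge the weight has modulus 1/E, and reflection replaces
      zeta'/zeta by chi'/chi plus the von Mangoldt series at c - it.\<close>
    have left: "integral {T0..T'} (\<lambda>t. f (Complex (1 - c) t)) = of_real (1 / E) * (RX + R2)"
    proof -
      have "integral {T0..T'} (\<lambda>t. f (Complex (1 - c) t)) = integral {T0..T'} (\<lambda>t. of_real (1 / E) * (X t * cis (y * t) + mangoldt_series (Complex c ((- 1) * t)) * cis (y * t)))"
      proof (rule Henstock_Kurzweil_Integration.integral_cong)
        fix t assume t: "t \<in> {T0..T'}"
        have "of_real y * (Complex (1 - c) t - 1/2) = of_real (- (y * (c - 1/2))) + \<i> * of_real (y * t)"
          by (simp add: complex_eq_iff algebra_simps)
        then have ex: "exp (of_real y * (Complex (1 - c) t - 1/2)) = of_real (1 / E) * cis (y * t)"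
          by (simp only: exp_add E_def exp_of_real cis_conv_exp exp_minus inverse_eq_divide)
        have t0: "t \<noteq> 0" using t T0 by auto
        have "1 - Complex (1 - c) t = Complex c (- t)" by (simp add: complex_eq_iff)
        moreover have "zeta_logderiv (Complex c (- t)) = - mangoldt_series (Complex c (- t))"
          using c by (intro riemann_zeta_logderiv) auto
        ultimately have ld: "zeta_logderiv (Complex (1 - c) t) = X t + mangoldt_series (Complex c ((- 1) * t))"
          using zeta_logderiv_reflect[of "Complex (1 - c) t"] riemann_zeta_nonzero_vertical(2)[OF c(1) t0] t0
          by (simp add: X_def)
        have "f (Complex (1 - c) t) = zeta_logderiv (Complex (1 - c) t) * exp (of_real y * (Complex (1 - c) t - 1/2))"
          by (simp add: f_def)
        then show "f (Complex (1 - c) t) = of_real (1 / E) * (X t * cis (y * t) + mangoldt_series (Complex c ((- 1) * t)) * cis (y * t))"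
          unfolding ld ex by (simp only: distrib_left distrib_right mult_ac)
      qed
      also have "\<dots> = of_real (1 / E) * integral {T0..T'} (\<lambda>t. X t * cis (y * t) + mangoldt_series (Complex c ((- 1) * t)) * cis (y * t))"
        by (rule integral_mult_right)
      also have "integral {T0..T'} (\<lambda>t. X t * cis (y * t) + mangoldt_series (Complex c ((- 1) * t)) * cis (y * t)) = RX + R2"
        unfolding RX_def R2_def by (intro Henstock_Kurzweil_Integration.integral_add integrable_continuous_interval Xc Dc)
      finally show ?thesis .
    qed
    have "2 * pi * \<i> * (zero_sum T' y - zero_sum T0 y) = HB + \<i> * integral {T0..T'} (\<lambda>t. f (Complex c t)) - HT - \<i> * integral {T0..T'} (\<lambda>t. f (Complex (1 - c) t))"
      unfolding HB_def HT_def f_def by (rule zero_sum_contour[OF RH c]) (use T0 T' TT in auto)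
    then have id: "2 * pi * \<i> * (zero_sum T' y - zero_sum T0 y) = HB - \<i> * (of_real E * R1) - HT - \<i> * (of_real (1 / E) * (RX + R2))"
      unfolding right left by simp
    have mainid: "zero_sum T' y = zero_sum T0 y - \<i> * (HB - HT) / (2 * pi) - of_real (E / (2 * pi)) * R1 - of_real (1 / E / (2 * pi)) * (RX + R2)"
    proof -
      have "W = V - \<i> * (hb - ht) / p - e / p * r1 - e' / p * r2"
        if "p * \<i> * (W - V) = hb - \<i> * (e * r1) - ht - \<i> * (e' * r2)" "p \<noteq> 0" for W V hb ht e e' r1 r2 p :: complex
      proof -
        have "p * (W - V) = - \<i> * (p * \<i> * (W - V))" by (simp add: algebra_simps)
        also have "\<dots> = - \<i> * (hb - ht) - e * r1 - e' * r2" unfolding that(1) by (simp add: algebra_simps)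
        finally have "W - V = (- \<i> * (hb - ht) - e * r1 - e' * r2) / p" using that(2) by (simp add: field_simps)
        then show ?thesis by (simp add: diff_divide_distrib add_divide_distrib algebra_simps)
      qed
      from this[OF id] show ?thesis by simp
    qed
    define w where "w n = mangoldt n * real n powr (- c)" for n :: nat
    have w0: "w n \<ge> 0" for n using mangoldt_nonneg[of n] by (simp add: w_def)
    have sw: "summable w" unfolding w_def by (rule summable_mangoldt_powr[OF c(1)])
    have wD: "w n \<le> D" for n
      using sum_le_suminf[OF sw, of "{n}"] w0 D_sums[of w, OF w_def] by simp
    \<comment> \<open>On the reflected side the phase is y + ln n, which is at least 1/2 since y >=
      0 and the terms n <= 1 vanish; so nothing resonates.\<close>
    have R2b: "norm R2 \<le> 4 * D"
    proof -
      have s: "(\<lambda>n. of_real (w n) * cis_integral T0 T' (y - (- 1) * ln (real n))) sums R2"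
        unfolding w_def R2_def by (rule mangoldt_integral_sums[OF c(1)]) (use TT in simp)
      have b: "norm (of_real (w n) * cis_integral T0 T' (y - (- 1) * ln (real n))) \<le> 4 * w n" for n
      proof (cases "n \<le> 1")
        case True
        then have "w n = 0" by (cases "n = 0") (auto simp: w_def le_Suc_eq)
        then show ?thesis by simp
      next
        case False
        have "ln 2 \<le> ln (real n)" using False by simp
        moreover have "1/2 \<le> ln (2::real)"
        proof -
          have "exp (1/2) ^ 2 = exp (1::real)" by (simp add: exp_of_nat_mult[symmetric])
          also have "\<dots> \<le> 2 ^ 2" using exp_le by simp
          finally have "exp (1/2) \<le> (2::real)" by (rule power2_le_imp_le) simp
          then show ?thesis by (subst ln_ge_iff) auto
        qed
        ultimately have v: "y + ln (real n) \<ge> 1/2" using y0 by linarith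
        have "norm (cis_integral T0 T' (y - (- 1) * ln (real n))) \<le> 2 / \<bar>y - (- 1) * ln (real n)\<bar>"
          by (rule cis_integral_bound) (use TT v in auto)
        also have "\<dots> \<le> 2 / (1/2)" using v by (intro divide_left_mono) auto
        finally have "norm (cis_integral T0 T' (y - (- 1) * ln (real n))) \<le> 4" by simp
        then have "w n * norm (cis_integral T0 T' (y - (- 1) * ln (real n))) \<le> w n * 4"
          using w0 by (intro mult_left_mono)
        then show ?thesis using w0[of n] by (simp add: norm_mult)
      qed
      have "norm R2 \<le> (\<Sum>n. 4 * w n)"
        using s norm_suminf_le[OF b summable_mult[OF sw]] by (simp add: sums_iff)
      then show ?thesis using suminf_mult[OF sw, of 4] D_sums[of w, OF w_def] by simp
    qed
    define a where "a n = (if n = n0 then 0 else w n / \<bar>y - ln (real n)\<bar>)" for n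
    have od: "summable a" "suminf a \<le> 2 * D + 200 * exp (y * (1 - c)) * (y + 2)\<^sup>2" "n0 \<ge> 1"
      "\<And>n. n \<noteq> n0 \<Longrightarrow> n \<ge> 1 \<Longrightarrow> y \<noteq> ln (real n)"
      using mangoldt_off_diagonal[OF c y0] unfolding a_def w_def n0_def D_def by auto
    define G where "G = cis_integral T0 T' (y - ln (real n0))"
    have R1b: "norm (R1 - of_real (w n0) * G) \<le> 2 * suminf a"
    proof -
      have s: "(\<lambda>n. of_real (w n) * cis_integral T0 T' (y - 1 * ln (real n))) sums R1"
        unfolding w_def R1_def by (rule mangoldt_integral_sums[OF c(1)]) (use TT in simp)
      have s1: "(\<lambda>n. if n = n0 then of_real (w n) * cis_integral T0 T' (y - 1 * ln (real n)) else 0) sums (of_real (w n0) * cis_integral T0 T' (y - 1 * ln (real n0)))"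
        by (rule sums_single)
      define b where "b n = (if n = n0 then 0 else of_real (w n) * cis_integral T0 T' (y - ln (real n)))" for n
      have "(\<lambda>n. of_real (w n) * cis_integral T0 T' (y - 1 * ln (real n)) - (if n = n0 then of_real (w n) * cis_integral T0 T' (y - 1 * ln (real n)) else 0)) sums
          (R1 - of_real (w n0) * cis_integral T0 T' (y - 1 * ln (real n0)))"
        by (rule sums_diff[OF s s1])
      also have "(\<lambda>n. of_real (w n) * cis_integral T0 T' (y - 1 * ln (real n)) - (if n = n0 then of_real (w n) * cis_integral T0 T' (y - 1 * ln (real n)) else 0)) = b"
        by (auto simp: b_def fun_eq_iff)
      finally have sb: "b sums (R1 - of_real (w n0) * G)" by (simp add: G_def)
      have bb: "norm (b n) \<le> 2 * a n" for n
      proof (cases "n = n0 \<or> n = 0")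
        case True
        then show ?thesis by (auto simp: b_def a_def w_def)
      next
        case False
        then have v: "y - ln (real n) \<noteq> 0" using od(4)[of n] by auto
        have "w n * norm (cis_integral T0 T' (y - ln (real n))) \<le> w n * (2 / \<bar>y - ln (real n)\<bar>)"
          using w0 TT v by (intro mult_left_mono cis_integral_bound) auto
        then show ?thesis using False w0[of n] by (simp add: b_def a_def norm_mult mult.commute)
      qed
      have "norm (R1 - of_real (w n0) * G) \<le> (\<Sum>n. 2 * a n)"
        using sb norm_suminf_le[OF bb summable_mult[OF od(1)]] by (simp add: sums_iff)
      then show ?thesis using suminf_mult[OF od(1), of 2] by simp
    qed
    \<comment> \<open>Since c > 1 and y >= 0, the factor e^(y(1-c)) is at most 1, and y + 2 <= 3L
      leaves an error of order L^2.\<close>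
    have R1E: "E * norm (R1 - of_real (w n0) * G) \<le> (4 * D + 400 * 9) * L\<^sup>2 * E"
    proof -
      have "(y + 2)\<^sup>2 \<le> (3 * L)\<^sup>2" using y L1 by (intro power_mono) (auto simp: L_def)
      moreover have "exp (y * (1 - c)) \<le> 1" using y0 c by (auto simp: mult_nonneg_nonpos)
      ultimately have "exp (y * (1 - c)) * (y + 2)\<^sup>2 \<le> 1 * (3 * L)\<^sup>2" by (intro mult_mono) auto
      then have "suminf a \<le> 2 * D + 200 * (9 * L\<^sup>2)" using od(2) by (simp add: power_mult_distrib)
      also have "\<dots> \<le> (2 * D + 200 * 9) * L\<^sup>2" using L2 D0 by (simp add: distrib_right mult_le_cancel_left1)
      finally have "norm (R1 - of_real (w n0) * G) \<le> (4 * D + 400 * 9) * L\<^sup>2" using R1b by (simp add: distrib_right)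
      then have "E * norm (R1 - of_real (w n0) * G) \<le> E * ((4 * D + 400 * 9) * L\<^sup>2)" using E1 by (intro mult_left_mono) auto
      then show ?thesis by (simp only: mult_ac)
    qed
    define GT where "GT = cis_integral T0 T (y - ln (real n0))"
    have cisint: "(\<lambda>t. cis (v * t)) integrable_on {u..u'}" for v u u'
      by (intro integrable_continuous_interval continuous_intros)
    have GG: "norm (G - GT) \<le> 1"
    proof -
      have "GT + cis_integral T T' (y - ln (real n0)) = G"
        unfolding GT_def G_def using TT cisint by (intro Henstock_Kurzweil_Integration.integral_combine) auto
      then have "G - GT = cis_integral T T' (y - ln (real n0))" by (simp add: algebra_simps)
      then show ?thesis using cis_integral_le_length[of T T' "y - ln (real n0)"] TT by simp
    qed
    define RXT where "RXT = integral {T0..T} (\<lambda>t. X t * cis (y * t))"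
    have RXb: "norm (RX - RXT) \<le> (2 + C1) * L\<^sup>2"
    proof -
      have "RXT + integral {T..T'} (\<lambda>t. X t * cis (y * t)) = RX"
        unfolding RXT_def RX_def using TT integrable_continuous_interval[OF Xc]
        by (intro Henstock_Kurzweil_Integration.integral_combine) auto
      then have "RX - RXT = integral {T..T'} (\<lambda>t. X t * cis (y * t))" by (simp add: algebra_simps)
      also have "norm \<dots> \<le> (2 * L + C1) * (T' - T)"
      proof (rule integral_bound)
        show "continuous_on {T..T'} (\<lambda>t. X t * cis (y * t))"
          by (rule continuous_on_subset[OF Xc]) (use TT in auto)
        fix t assume t: "t \<in> {T..T'}"
        have "norm (X t + of_real (ln t)) \<le> C1"
          using C1(2)[of "Complex (1 - c) t"] t T c by (simp add: X_def abs_le_iff)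
        moreover have "norm (complex_of_real (ln t)) = ln t" using t T by simp
        ultimately have "norm (X t) \<le> C1 + ln t"
          using norm_triangle_ineq4[of "X t + of_real (ln t)" "of_real (ln t)"] by simp
        moreover have "ln t \<le> 2 * L"
        proof -
          have "6 * T \<le> T * T" using T by (intro mult_right_mono) auto
          moreover have "t \<le> T + 1/10" using t TT by auto
          ultimately have "t \<le> T * T" using T by linarith
          then have "ln t \<le> ln (T * T)" using t T by (subst ln_le_cancel_iff) auto
          then show ?thesis using T by (simp add: ln_mult L_def)
        qed
        ultimately show "norm (X t * cis (y * t)) \<le> 2 * L + C1" by (simp add: norm_mult)
      qed (use TT in auto)
      also have "\<dots> \<le> (2 * L + C1) * 1" using TT L1 C1 by (intro mult_left_mono) auto
      also have "\<dots> \<le> (2 + C1) * L\<^sup>2"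
        using L2 C1(1) mult_left_mono[OF L2(1) C1(1)] by (simp add: distrib_right)
      finally show ?thesis .
    qed
    have zs: "norm (zero_sum T' y - zero_sum T y) \<le> C * L\<^sup>2"
    proof -
      have "zero_sum T' y - zero_sum T y = (\<Sum>\<rho>\<in>zeros_upto T' - zeros_upto T. of_nat (zero_mult \<rho>) * cis (y * Im \<rho>))"
        unfolding zero_sum_def using TT finite_zeros_upto[of T'] by (subst sum_diff) (auto simp: zeros_upto_def)
      also have "norm \<dots> \<le> (\<Sum>\<rho>\<in>zeros_upto T' - zeros_upto T. real (zero_mult \<rho>))"
        by (rule sum_norm_le) (simp add: norm_mult)
      also have "\<dots> \<le> (\<Sum>\<rho>\<in>zeros_upto (T + 1/10) - zeros_upto T. real (zero_mult \<rho>))"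
        using TT finite_zeros_upto[of "T + 1/10"] by (intro sum_mono2) (auto simp: zeros_upto_def)
      also have "\<dots> \<le> C * L" unfolding L_def using T by (intro cnt) auto
      also have "\<dots> \<le> C * L\<^sup>2" using L2 C by (intro mult_left_mono) auto
      finally show ?thesis .
    qed
    have zs0: "norm (zero_sum T0 y) \<le> N0"
      unfolding zero_sum_def N0_def by (rule sum_norm_le) (simp add: norm_mult)
    define p where "p = 2 * pi"
    have p1: "p \<ge> 1" using pi_ge_two by (simp add: p_def)
    have "zero_sum T y + of_real (E * w n0 / p) * GT + of_real (1 / E / p) * RXT =
        (zero_sum T0 y - (zero_sum T' y - zero_sum T y)) - \<i> * (HB - HT) / p
        - of_real (E / p) * (R1 - of_real (w n0) * G) - of_real (E * w n0 / p) * (G - GT)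
        - of_real (1 / E / p) * (RX - RXT) - of_real (1 / E / p) * R2"
      unfolding mainid p_def[symmetric] by (simp add: algebra_simps add_divide_distrib diff_divide_distrib)
    also have "norm \<dots> \<le> norm (zero_sum T0 y) + norm (zero_sum T' y - zero_sum T y) + norm (\<i> * (HB - HT) / p)
        + norm (of_real (E / p) * (R1 - of_real (w n0) * G)) + norm (of_real (E * w n0 / p) * (G - GT))
        + norm (of_real (1 / E / p) * (RX - RXT)) + norm (of_real (1 / E / p) * R2)"
      by (intro norm_triangle_le_diff add_mono order_refl)
    also have "\<dots> \<le> N0 * L\<^sup>2 * E + C * L\<^sup>2 * E + 4 * C * L\<^sup>2 * E + (4 * D + 400 * 9) * L\<^sup>2 * E + D * L\<^sup>2 * E
        + (2 + C1) * L\<^sup>2 * E + 4 * D * L\<^sup>2 * E"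
    proof (intro add_mono)
      have LE: "1 \<le> L\<^sup>2 * E" using mult_mono[OF L2(1) E1] by simp
      have big: "q \<le> q * L\<^sup>2 * E" if "q \<ge> 0" for q
        using mult_left_mono[OF LE that] by (simp add: mult.assoc)
      have bigE: "q \<le> q * E" if "q \<ge> 0" for q using mult_left_mono[OF E1 that] by simp
      have divp: "q / p \<le> q" if "q \<ge> 0" for q using that p1 by (simp add: divide_le_eq mult_le_cancel_left1)
      show "norm (zero_sum T0 y) \<le> N0 * L\<^sup>2 * E" using zs0 big[OF N0] by linarith
      show "norm (zero_sum T' y - zero_sum T y) \<le> C * L\<^sup>2 * E" using zs bigE[of "C * L\<^sup>2"] C by simp
      have "norm (\<i> * (HB - HT) / p) = norm (HB - HT) / p" using p1 by (simp add: norm_divide norm_mult)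
      also have "\<dots> \<le> norm (HB - HT)" by (rule divp) simp
      also have "\<dots> \<le> norm HB + norm HT" by (rule norm_triangle_ineq4)
      also have "\<dots> \<le> 4 * C * L\<^sup>2 * E" using HTb HBb' by simp
      finally show "norm (\<i> * (HB - HT) / p) \<le> 4 * C * L\<^sup>2 * E" .
      have "norm (of_real (E / p) * (R1 - of_real (w n0) * G)) = (E * norm (R1 - of_real (w n0) * G)) / p"
        using E1 p1 by (simp only: norm_mult norm_of_real) simp
      also have "\<dots> \<le> E * norm (R1 - of_real (w n0) * G)" using E1 by (intro divp) auto
      finally show "norm (of_real (E / p) * (R1 - of_real (w n0) * G)) \<le> (4 * D + 400 * 9) * L\<^sup>2 * E" using R1E by linarith
      have "norm (of_real (E * w n0 / p) * (G - GT)) = (E * w n0 * norm (G - GT)) / p"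
        using E1 p1 w0[of n0] by (simp only: norm_mult norm_of_real) simp
      also have "\<dots> \<le> E * w n0 * norm (G - GT)" using E1 w0[of n0] by (intro divp) auto
      also have "\<dots> \<le> E * D * 1" using GG wD[of n0] w0[of n0] E1 D0 by (intro mult_mono mult_left_mono) auto
      also have "\<dots> \<le> D * L\<^sup>2 * E" using L2(1) D0 E1 mult_left_mono[OF L2(1), of "D * E"] by (simp add: mult_ac)
      finally show "norm (of_real (E * w n0 / p) * (G - GT)) \<le> D * L\<^sup>2 * E" .
      have ip: "norm (complex_of_real (1 / E / p)) \<le> 1" using E1 p1 mult_mono[of 1 E 1 p] by (simp only: norm_of_real) (simp add: divide_le_eq)
      have small: "norm (of_real (1 / E / p) * z) \<le> norm z" for z :: complex
        using mult_right_mono[OF ip, of "norm z"] by (simp only: norm_mult) simp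
      show "norm (of_real (1 / E / p) * (RX - RXT)) \<le> (2 + C1) * L\<^sup>2 * E"
        by (rule order_trans[OF small order_trans[OF RXb bigE]]) (use C1(1) in simp)
      show "norm (of_real (1 / E / p) * R2) \<le> 4 * D * L\<^sup>2 * E"
        by (rule order_trans[OF small order_trans[OF R2b big]]) (use D0 in simp)
    qed
    also have "\<dots> = K * L\<^sup>2 * E" by (simp add: K_def algebra_simps)
    finally show "norm (zero_sum T y
      + of_real (exp (y * (c - 1/2)) * (mangoldt (nat (round (exp y))) * real (nat (round (exp y))) powr (- c)) / (2 * pi))
          * cis_integral T0 T (y - ln (real (nat (round (exp y)))))
      + of_real (exp (- (y * (c - 1/2))) / (2 * pi)) * integral {T0..T} (\<lambda>t. chi_logderiv (Complex (1 - c) t) * cis (y * t)))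
    \<le> K * (ln T)\<^sup>2 * exp (y * (c - 1/2))"
      by (simp add: E_def w_def n0_def GT_def RXT_def X_def L_def p_def exp_minus inverse_eq_divide)
  qed
qed

section \<open>Mean square of the exponential sums\<close>

text \<open>The weights are those produced by \<open>integral_resonant_block\<close>. As the von
  Mangoldt function is at most ln n, the leading part is the triangle sum of size Y^2/6. The
  correction 1/Y multiplies a sum of order Y^2 and the correction 2/n a convergent series.\<close>

lemma sum_mangoldt_squared_tapered:
  "\<exists>C\<ge>0. \<forall>Y\<ge>1. (\<Sum>n=2..nat \<lceil>exp Y\<rceil>. (mangoldt n)\<^sup>2 / real n * ((max 0 (1 - ln (real n) / Y) + 1 / Y) * (1 + 2 / real n)))
      \<le> Y\<^sup>2 / 6 + C * Y"
proof -
  define D where "D = (\<Sum>n. mangoldt n * real n powr (- (3/2)))"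
  have sD: "summable (\<lambda>n. mangoldt n * real n powr (- (3/2)))" by (rule summable_mangoldt_powr) simp
  have D0: "D \<ge> 0" unfolding D_def using mangoldt_nonneg by (intro suminf_nonneg sD) auto
  define C where "C = 4 + 4 * D + 4 * (16 / 6 + 16)"
  show ?thesis
  proof (intro exI[of _ C] conjI allI impI)
    show "C \<ge> 0" using D0 by (simp add: C_def)
    fix Y :: real assume Y: "Y \<ge> 1"
    define N where "N = nat \<lceil>exp Y\<rceil>"
    define a where "a n = mangoldt n * ln (real n) / real n" for n
    define t where "t n = max 0 (1 - ln (real n) / Y)" for n
    have N_le: "real N \<le> exp (Y + 1)"
    proof -
      have "real N \<le> exp Y + 1" using ceiling_correct[of "exp Y"] by (simp add: N_def)
      also have "\<dots> \<le> exp Y * 2" using Y by simp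
      also have "\<dots> \<le> exp Y * exp 1" using exp_ge_add_one_self[of "1::real"] by (intro mult_left_mono) auto
      finally show ?thesis by (simp add: exp_add)
    qed
    have a0: "a n \<ge> 0" if "n \<ge> 1" for n unfolding a_def using that mangoldt_nonneg[of n] by (intro divide_nonneg_nonneg mult_nonneg_nonneg) auto
    have t: "0 \<le> t n" "t n \<le> 1" if "n \<ge> 1" for n using that Y by (auto simp: t_def)
    have pt: "(mangoldt n)\<^sup>2 / real n * ((max 0 (1 - ln (real n) / Y) + 1 / Y) * (1 + 2 / real n))
       \<le> a n * t n + 4 * (mangoldt n * real n powr (- (3/2))) + 2 / Y * a n" if n: "n \<in> {2..N}" for n
    proof -
      have n2: "real n \<ge> 2" using n by simp
      have "(mangoldt n)\<^sup>2 \<le> mangoldt n * ln (real n)"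
        unfolding power2_eq_square using n mangoldt_nonneg[of n] by (intro mult_left_mono mangoldt_le) auto
      then have m: "(mangoldt n)\<^sup>2 / real n \<le> a n" unfolding a_def by (intro divide_right_mono) auto
      have f: "(t n + 1 / Y) * (1 + 2 / real n) \<le> t n + 2 / real n + 2 / Y"
      proof -
        have "t n * (2 / real n) \<le> 1 * (2 / real n)" using t[of n] n by (intro mult_right_mono) auto
        moreover have "1 / Y * (1 + 2 / real n) \<le> 1 / Y * 2" using n2 Y by (intro mult_left_mono) auto
        moreover have "(t n + 1 / Y) * (1 + 2 / real n) = t n + t n * (2 / real n) + 1 / Y * (1 + 2 / real n)"
          by (simp only: distrib_left distrib_right mult_1_right)
        ultimately show ?thesis by linarith
      qed
      have "(mangoldt n)\<^sup>2 / real n * ((t n + 1 / Y) * (1 + 2 / real n)) \<le> a n * (t n + 2 / real n + 2 / Y)"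
        using m f a0[of n] t[of n] n Y by (intro mult_mono) auto
      moreover have "a n * (2 / real n) \<le> 4 * (mangoldt n * real n powr (- (3/2)))"
      proof -
        have "ln (real n) = 2 * ln (sqrt (real n))" using n2 by (simp add: ln_sqrt)
        also have "\<dots> \<le> 2 * sqrt (real n)" using n2 ln_bound[of "sqrt (real n)"] by simp
        finally have l: "ln (real n) \<le> 2 * real n powr (1/2)" using n2 by (simp add: powr_half_sqrt)
        have r: "real n powr (1/2) / (real n * real n) = real n powr (- (3/2))"
        proof -
          have "real n * real n = real n powr 2" using n2 by (simp add: powr_numeral power2_eq_square)
          then have "real n powr (1/2) / (real n * real n) = real n powr (1/2 - 2)" by (simp only: powr_diff)
          then show ?thesis by simp
        qed
        have "a n * (2 / real n) = 2 * mangoldt n * (ln (real n) / (real n * real n))" by (simp add: a_def)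
        also have "\<dots> \<le> 2 * mangoldt n * (2 * real n powr (1/2) / (real n * real n))"
          using l mangoldt_nonneg[of n] by (intro mult_left_mono divide_right_mono) auto
        also have "\<dots> = 4 * mangoldt n * (real n powr (1/2) / (real n * real n))" by simp
        finally show ?thesis unfolding r by simp
      qed
      ultimately show ?thesis by (simp add: t_def algebra_simps)
    qed
    have "(\<Sum>n=2..N. (mangoldt n)\<^sup>2 / real n * ((max 0 (1 - ln (real n) / Y) + 1 / Y) * (1 + 2 / real n)))
        \<le> (\<Sum>n=2..N. a n * t n + 4 * (mangoldt n * real n powr (- (3/2))) + 2 / Y * a n)"
      by (rule sum_mono[OF pt])
    also have "\<dots> = (\<Sum>n=2..N. a n * t n) + 4 * (\<Sum>n=2..N. mangoldt n * real n powr (- (3/2))) + 2 / Y * (\<Sum>n=2..N. a n)"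
      by (simp add: sum.distrib sum_distrib_left)
    also have "(\<Sum>n=2..N. a n * t n) \<le> Y\<^sup>2 / 6 + 4 * Y"
    proof -
      have "(\<Sum>n=2..N. a n * t n) \<le> (\<Sum>n | 1 \<le> n \<and> ln (real n) \<le> Y. a n * t n)" (is "_ \<le> sum _ ?B")
      proof -
        have "(\<Sum>n=2..N. a n * t n) = (\<Sum>n\<in>{2..N} \<inter> ?B. a n * t n)"
          using Y by (intro sum.mono_neutral_right) (auto simp: t_def max_def)
        also have "\<dots> \<le> sum (\<lambda>n. a n * t n) ?B"
          using a0 t by (intro sum_mono2 finite_ln_le) auto
        finally show ?thesis .
      qed
      also have "\<dots> = (\<Sum>n | 1 \<le> n \<and> ln (real n) \<le> Y. mangoldt n * ln (real n) / real n * (1 - ln (real n) / Y))"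
        using Y by (intro sum.cong) (auto simp: a_def t_def max_def)
      also have "\<dots> \<le> Y\<^sup>2 / 6 + 4 * Y" using Y by (intro sum_mangoldt_triangle) auto
      finally show ?thesis .
    qed
    also have "(\<Sum>n=2..N. mangoldt n * real n powr (- (3/2))) \<le> D"
      unfolding D_def using mangoldt_nonneg by (intro sum_le_suminf sD) auto
    also have "(\<Sum>n=2..N. a n) \<le> 2 * ((16 / 6 + 16) * Y\<^sup>2)"
    proof -
      \<comment> \<open>With V beyond twice the range of ln n, the factor 1 - ln n / V is at least
        1/2, so the triangle sum also bounds the sum without taper.\<close>
      define V where "V = 2 * (Y + 1)"
      have "(\<Sum>n=2..N. a n) \<le> (\<Sum>n=2..N. 2 * (a n * (1 - ln (real n) / V)))"
      proof (rule sum_mono)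
        fix n assume n: "n \<in> {2..N}"
        have "ln (real n) \<le> Y + 1" using n N_le by (subst ln_le_iff_le_exp) auto
        then have "ln (real n) / V \<le> 1/2" using Y by (simp add: V_def field_simps)
        moreover have "1 \<le> 2 * (1 - q)" if "q \<le> 1/2" for q :: real using that by simp
        ultimately have "1 \<le> 2 * (1 - ln (real n) / V)" by blast
        then have "a n * 1 \<le> a n * (2 * (1 - ln (real n) / V))" using a0[of n] n by (intro mult_left_mono) auto
        then show "a n \<le> 2 * (a n * (1 - ln (real n) / V))" by (simp only: mult_1_right mult.left_commute)
      qed
      also have "\<dots> \<le> (\<Sum>n | 1 \<le> n \<and> ln (real n) \<le> V. 2 * (a n * (1 - ln (real n) / V)))"
      proof (rule sum_mono2)
        show "finite {n. 1 \<le> n \<and> ln (real n) \<le> V}" using finite_ln_le by auto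
        have "ln (real n) \<le> V" if "n \<in> {2..N}" for n
        proof -
          have "ln (real n) \<le> Y + 1" using that N_le by (subst ln_le_iff_le_exp) auto
          then show ?thesis using Y by (simp add: V_def)
        qed
        then show "{2..N} \<subseteq> {n. 1 \<le> n \<and> ln (real n) \<le> V}" by auto
        show "0 \<le> 2 * (a n * (1 - ln (real n) / V))" if "n \<in> {n. 1 \<le> n \<and> ln (real n) \<le> V} - {2..N}" for n
          using that a0[of n] Y by (auto simp: V_def intro!: mult_nonneg_nonneg)
      qed
      also have "\<dots> = 2 * (\<Sum>n | 1 \<le> n \<and> ln (real n) \<le> V. mangoldt n * ln (real n) / real n * (1 - ln (real n) / V))"
        by (simp add: a_def sum_distrib_left)
      also have "\<dots> \<le> 2 * (V\<^sup>2 / 6 + 4 * V)" using Y by (intro mult_left_mono sum_mangoldt_triangle) (auto simp: V_def)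
      also have "\<dots> \<le> 2 * ((16 / 6 + 16) * Y\<^sup>2)"
      proof -
        have V: "V \<le> 4 * Y" "V \<ge> 0" using Y by (auto simp: V_def)
        have "V\<^sup>2 \<le> (4 * Y)\<^sup>2" using V by (intro power_mono) auto
        moreover have "Y \<le> Y\<^sup>2" using Y by (simp add: power2_eq_square mult_le_cancel_left1)
        ultimately show ?thesis using V by (simp add: power_mult_distrib)
      qed
      finally show ?thesis .
    qed
    also have "Y\<^sup>2 / 6 + 4 * Y + 4 * D + 2 / Y * (2 * ((16 / 6 + 16) * Y\<^sup>2)) \<le> Y\<^sup>2 / 6 + C * Y"
    proof -
      have "2 / Y * (2 * ((16 / 6 + 16) * Y\<^sup>2)) = 4 * (16 / 6 + 16) * Y" using Y by (simp add: power2_eq_square)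
      moreover have "4 * D \<le> 4 * D * Y" using Y D0 by (simp add: mult_le_cancel_left1)
      ultimately show ?thesis by (simp add: C_def distrib_right)
    qed
    finally show "(\<Sum>n=2..nat \<lceil>exp Y\<rceil>. (mangoldt n)\<^sup>2 / real n * ((max 0 (1 - ln (real n) / Y) + 1 / Y) * (1 + 2 / real n)))
      \<le> Y\<^sup>2 / 6 + C * Y" using Y unfolding N_def by (simp add: divide_right_mono)
  qed
qed

text \<open>In mean square over [T0, T], replacing ln t by ln T costs only O(T), without a
  logarithm. This is what allows chi'/chi to be treated as the constant -ln T.\<close>

lemma integral_ln_ratio_squared_le:
  fixes T :: real
  assumes "0 < T0" "T0 \<le> T"
  shows "(\<lambda>t. (ln T - ln t)\<^sup>2) integrable_on {T0..T}" "integral {T0..T} (\<lambda>t. (ln T - ln t)\<^sup>2) \<le> 2 * T"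
proof -
  define F where "F t = t * ((ln T - ln t)\<^sup>2 + 2 * (ln T - ln t) + 2)" for t
  have *: "((\<lambda>t. (ln T - ln t)\<^sup>2) has_integral (F T - F T0)) {T0..T}"
  proof (rule fundamental_theorem_of_calculus[OF assms(2)])
    fix t assume t: "t \<in> {T0..T}"
    have "(F has_real_derivative (ln T - ln t)\<^sup>2) (at t)"
      unfolding F_def using t assms
      by (auto intro!: derivative_eq_intros simp: field_simps power2_eq_square)
    then show "(F has_vector_derivative (ln T - ln t)\<^sup>2) (at t within {T0..T})"
      by (simp add: has_real_derivative_iff_has_vector_derivative has_vector_derivative_at_within)
  qed
  then show "(\<lambda>t. (ln T - ln t)\<^sup>2) integrable_on {T0..T}" by blast
  have "F T0 \<ge> 0" unfolding F_def using assms by (intro mult_nonneg_nonneg add_nonneg_nonneg) auto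
  moreover have "F T = 2 * T" by (simp add: F_def)
  ultimately show "integral {T0..T} (\<lambda>t. (ln T - ln t)\<^sup>2) \<le> 2 * T" using * by (simp add: integral_unique)
qed


section \<open>Mean values obtained from Bessel's inequality\<close>

lemma continuous_on_fourier_integral:
  fixes f :: "real \<Rightarrow> complex"
  assumes "continuous_on {a..b} f"
  shows "continuous_on A (\<lambda>y. integral {a..b} (\<lambda>t. f t * cis (y * t)))"
  unfolding interval_cbox cis_conv_exp
  by (rule integral_continuous_on_param)
     (auto simp: case_prod_unfold intro!: continuous_intros continuous_on_compose2[OF assms])

lemma continuous_on_cis_integral: "continuous_on A (\<lambda>y. cis_integral a b (y - v))"
proof -
  have "(\<lambda>y. cis_integral a b (y - v)) = (\<lambda>y. integral {a..b} (\<lambda>t. cis (- (v * t)) * cis (y * t)))"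
    by (simp add: cis_mult algebra_simps)
  then show ?thesis by (simp only:) (intro continuous_on_fourier_integral continuous_intros)
qed

lemma integral_cis_integral_squared_le:
  assumes "0 \<le> a" "a \<le> b"
  shows "integral {-M..M} (\<lambda>y. (norm (cis_integral a b (y - v)))\<^sup>2) \<le> 2 * pi * b"
proof -
  have eq: "(\<lambda>y. cis_integral a b (y - v)) = (\<lambda>y. integral {a..b} (\<lambda>t. cis (- (v * t)) * cis (y * t)))"
    by (simp add: cis_mult algebra_simps)
  have "integral {-M..M} (\<lambda>y. (norm (cis_integral a b (y - v)))\<^sup>2) \<le> 2 * pi * integral {a..b} (\<lambda>t. (norm (cis (- (v * t))))\<^sup>2)"
    unfolding fun_cong[OF eq] by (rule bessel_inequality[OF assms(2)]) (intro continuous_intros)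
  also have "\<dots> \<le> 2 * pi * b" using assms by simp
  finally show ?thesis .
qed

text \<open>Changing the sign of y conjugates the inner integral, so the half line carries half of
  Bessel's bound. This factor fixes the coefficient of the leading term h.\<close>

lemma integral_half_cis_integral_squared_le:
  assumes "0 \<le> a" "a \<le> b" "M \<ge> 0"
  shows "integral {0..M} (\<lambda>y. (norm (cis_integral a b y))\<^sup>2) \<le> pi * b"
proof -
  define g where "g y = (norm (cis_integral a b y))\<^sup>2" for y
  have cont: "continuous_on A g" for A
    unfolding g_def using continuous_on_cis_integral[of A a b 0] by (auto intro!: continuous_intros)
  have sym: "g (- y) = g y" for y
  proof -
    have "cis_integral a b (- y) = cnj (cis_integral a b y)"
      using integral_cnj[of "{a..b}" "\<lambda>t. cis (y * t)"] by (simp add: cis_cnj)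
    then show ?thesis by (simp add: g_def)
  qed
  have "integral {-M..0} g = integral {0..M} g"
    using Henstock_Kurzweil_Integration.integral_reflect_real[of M 0 g] sym by simp
  moreover have "integral {-M..0} g + integral {0..M} g = integral {-M..M} g"
    using assms by (intro Henstock_Kurzweil_Integration.integral_combine integrable_continuous_interval cont) auto
  moreover have "integral {-M..M} g \<le> 2 * pi * b"
    using integral_cis_integral_squared_le[OF assms(1,2), of M 0] by (simp add: g_def[abs_def])
  ultimately have "integral {0..M} g \<le> pi * b" by linarith
  then show ?thesis by (simp add: g_def[abs_def])
qed

lemma nearest_integer_exp:
  assumes "y \<ge> 0"
  defines "n \<equiv> nat (round (exp y))"
  shows "n \<ge> 1" "y \<in> {ln (real n - 1/2)..ln (real n + 1/2)}"
proof -
  have "round (exp y) \<ge> 1" using assms(1) round_mono[of 1 "exp y"] by simp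
  then have n: "real n = of_int (round (exp y))" by (simp add: n_def)
  then have r: "\<bar>real n - exp y\<bar> \<le> 1 / 2" using of_int_round_abs_le[of "exp y"] by simp
  show n1: "n \<ge> 1" using \<open>round (exp y) \<ge> 1\<close> by (simp add: n_def)
  have r': "real n - 1/2 \<le> exp y" "exp y \<le> real n + 1/2" using r by linarith+
  have "ln (real n - 1/2) \<le> y" using r' n1 by (subst ln_le_iff_le_exp) auto
  moreover have "y \<le> ln (real n + 1/2)" using r' n1 by (subst ln_ge_iff) auto
  ultimately show "y \<in> {ln (real n - 1/2)..ln (real n + 1/2)}" by simp
qed

text \<open>On this block n is the integer nearest to e^y. There e^(y(2c-1)) is at most n^(2c-1) (1
  + 2/n), and the squared factor n^(-c) reduces this to (1 + 2/n)/n, so c drops out. The taper at y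
  exceeds the one at ln n by at most 1/Y because y >= ln n - 1. Bessel's inequality bounds the
  remaining integral.\<close>

lemma integral_resonant_block:
  fixes n :: nat
  assumes c: "1 < c" "c \<le> 3/2" and n: "n \<ge> 2" and Y: "Y \<ge> 1" and T: "0 \<le> T0" "T0 \<le> T"
  shows "integral {ln (real n - 1/2)..ln (real n + 1/2)} (\<lambda>y. (norm (of_real (exp (y * (c - 1/2)) * (mangoldt n * real n powr (- c)) / (2 * pi))
          * cis_integral T0 T (y - ln (real n))))\<^sup>2 * max 0 (1 - y / Y))
      \<le> T / (2 * pi) * ((mangoldt n)\<^sup>2 / real n * ((max 0 (1 - ln (real n) / Y) + 1 / Y) * (1 + 2 / real n)))"
proof -
  have n2: "real n \<ge> 2" using n by simp
  define I where "I = {ln (real n - 1/2)..ln (real n + 1/2)}"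
  define G where "G y = (norm (cis_integral T0 T (y - ln (real n))))\<^sup>2" for y
  define w where "w = max 0 (1 - ln (real n) / Y) + 1 / Y"
  define k where "k = (mangoldt n)\<^sup>2 / real n * (1 + 2 / real n) / (4 * pi\<^sup>2) * w"
  have w0: "w \<ge> 0" using Y by (simp add: w_def)
  have k0: "k \<ge> 0" using w0 by (simp add: k_def)
  have G: "continuous_on A G" for A unfolding G_def by (intro continuous_intros continuous_on_cis_integral)
  have Gexp: "continuous_on A (\<lambda>y. (norm (of_real (exp (y * (c - 1/2)) * (mangoldt n * real n powr (- c)) / (2 * pi))
          * cis_integral T0 T (y - ln (real n))))\<^sup>2 * max 0 (1 - y / Y))" for A
    using Y by (intro continuous_intros continuous_on_cis_integral) auto
  have "integral I (\<lambda>y. (norm (of_real (exp (y * (c - 1/2)) * (mangoldt n * real n powr (- c)) / (2 * pi))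
          * cis_integral T0 T (y - ln (real n))))\<^sup>2 * max 0 (1 - y / Y)) \<le> integral I (\<lambda>y. k * G y)"
    unfolding I_def
  proof (intro integral_le integrable_continuous_interval continuous_on_mult_left G Gexp)
    fix y assume "y \<in> {ln (real n - 1/2)..ln (real n + 1/2)}"
    then have y: "ln (real n - 1/2) \<le> y" "y \<le> ln (real n + 1/2)" by auto
    have "max 0 (1 - y / Y) \<le> w"
    proof -
      have "ln (real n) - ln (real n - 1/2) \<le> 1"
      proof -
        have "real n \<le> (real n - 1/2) * exp 1"
          using n2 exp_ge_add_one_self[of "1::real"] mult_left_mono[of 2 "exp 1" "real n - 1/2"] by auto
        then have "ln (real n) \<le> ln ((real n - 1/2) * exp 1)" using n2 by (subst ln_le_cancel_iff) auto
        also have "\<dots> = ln (real n - 1/2) + 1" using n2 by (simp add: ln_mult)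
        finally show ?thesis by simp
      qed
      then have "ln (real n) - 1 \<le> y" using y by linarith
      then have "ln (real n) / Y - 1 / Y \<le> y / Y"
        unfolding diff_divide_distrib[symmetric] using Y by (intro divide_right_mono) auto
      moreover have "1 / Y \<ge> 0" using Y by simp
      ultimately show ?thesis unfolding w_def by linarith
    qed
    moreover have "(exp (y * (c - 1/2)) * (mangoldt n * real n powr (- c)) / (2 * pi))\<^sup>2 \<le> (mangoldt n)\<^sup>2 / real n * (1 + 2 / real n) / (4 * pi\<^sup>2)"
    proof -
      have ey: "exp y \<le> real n * (1 + 1 / (2 * real n))"
      proof -
        have "exp y \<le> exp (ln (real n + 1/2))" using y by (simp only: exp_le_cancel_iff)
        also have "\<dots> = real n * (1 + 1 / (2 * real n))" using n2 by (simp add: distrib_left)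
        finally show ?thesis .
      qed
      have "(exp (y * (c - 1/2)))\<^sup>2 = exp (y * (2 * c - 1))"
        by (simp add: power2_eq_square mult_exp_exp algebra_simps)
      also have "\<dots> = exp y powr (2 * c - 1)" by (simp add: powr_def mult.commute)
      also have "\<dots> \<le> (real n * (1 + 1 / (2 * real n))) powr (2 * c - 1)" using ey c by (intro powr_mono2) auto
      also have "\<dots> = real n powr (2 * c - 1) * (1 + 1 / (2 * real n)) powr (2 * c - 1)" using n2 by (simp add: powr_mult)
      also have "\<dots> \<le> real n powr (2 * c - 1) * (1 + 1 / (2 * real n)) powr 2"
        using c n2 by (intro mult_left_mono powr_mono) auto
      also have "(1 + 1 / (2 * real n)) powr 2 \<le> 1 + 2 / real n"
      proof -
        define x where "x = 1 / real n"
        have x: "0 < x" "x \<le> 1" using n2 by (auto simp: x_def)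
        have "(1 + 1 / (2 * real n)) powr 2 = (1 + x / 2)\<^sup>2" using n2 by (simp add: x_def powr_numeral)
        also have "\<dots> = 1 + x + x * x / 4" by (simp add: power2_eq_square algebra_simps)
        also have "\<dots> \<le> 1 + x + x * 1 / 4" using x by (intro add_left_mono divide_right_mono mult_left_mono) auto
        also have "\<dots> \<le> 1 + 2 * x" using x by simp
        finally show ?thesis by (simp add: x_def)
      qed
      finally have e: "(exp (y * (c - 1/2)))\<^sup>2 \<le> real n powr (2 * c - 1) * (1 + 2 / real n)" by (simp add: mult_left_mono)
      have pw: "real n powr (2 * c - 1) * (real n powr (- c))\<^sup>2 = 1 / real n"
      proof -
        have "real n powr (2 * c - 1) * (real n powr (- c))\<^sup>2 = real n powr (2 * c - 1 + (- c + - c))"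
          by (simp only: powr_add power2_eq_square)
        also have "2 * c - 1 + (- c + - c) = - 1" by simp
        finally show ?thesis using n2 by (simp add: powr_minus_divide)
      qed
      have "(exp (y * (c - 1/2)) * (mangoldt n * real n powr (- c)) / (2 * pi))\<^sup>2 =
          (exp (y * (c - 1/2)))\<^sup>2 * ((mangoldt n)\<^sup>2 * (real n powr (- c))\<^sup>2 / (4 * pi\<^sup>2))"
        by (simp add: power_mult_distrib power_divide)
      also have "\<dots> \<le> (real n powr (2 * c - 1) * (1 + 2 / real n)) * ((mangoldt n)\<^sup>2 * (real n powr (- c))\<^sup>2 / (4 * pi\<^sup>2))"
        using e by (rule mult_right_mono) simp
      also have "\<dots> = (real n powr (2 * c - 1) * (real n powr (- c))\<^sup>2) * (mangoldt n)\<^sup>2 * (1 + 2 / real n) / (4 * pi\<^sup>2)"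
        by (simp add: mult_ac)
      finally show ?thesis unfolding pw by simp
    qed
    ultimately have "(exp (y * (c - 1/2)) * (mangoldt n * real n powr (- c)) / (2 * pi))\<^sup>2 * max 0 (1 - y / Y) * G y \<le> k * G y"
      unfolding k_def by (intro mult_right_mono mult_mono) (auto simp: G_def)
    moreover have "(norm (of_real (exp (y * (c - 1/2)) * (mangoldt n * real n powr (- c)) / (2 * pi))
          * cis_integral T0 T (y - ln (real n))))\<^sup>2 = (exp (y * (c - 1/2)) * (mangoldt n * real n powr (- c)) / (2 * pi))\<^sup>2 * G y"
      unfolding norm_mult norm_of_real power_mult_distrib G_def by (simp only: power2_abs)
    ultimately show "(norm (of_real (exp (y * (c - 1/2)) * (mangoldt n * real n powr (- c)) / (2 * pi))
          * cis_integral T0 T (y - ln (real n))))\<^sup>2 * max 0 (1 - y / Y) \<le> k * G y"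
      by (simp only: mult_ac)
  qed
  also have "\<dots> = k * integral I G" by simp
  also have "\<dots> \<le> k * (2 * pi * T)"
  proof (rule mult_left_mono[OF _ k0])
    have "integral I G \<le> integral {- ln (real n + 1/2)..ln (real n + 1/2)} G"
      unfolding I_def
    proof (intro integral_subset_le integrable_continuous_interval G)
      have "0 \<le> ln (real n - 1/2)" "0 \<le> ln (real n + 1/2)" using n2 by auto
      then show "{ln (real n - 1/2)..ln (real n + 1/2)} \<subseteq> {- ln (real n + 1/2)..ln (real n + 1/2)}" by auto
    qed (simp add: G_def)
    also have "\<dots> \<le> 2 * pi * T" unfolding G_def by (rule integral_cis_integral_squared_le[OF T])
    finally show "integral I G \<le> 2 * pi * T" .
  qed
  also have "\<dots> = T / (2 * pi) * ((mangoldt n)\<^sup>2 / real n * (w * (1 + 2 / real n)))"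
  proof -
    have "m / r * u / (4 * pi\<^sup>2) * w * (2 * pi * T) = T / (2 * pi) * (m / r * (w * u))" for m r u :: real
      by (cases "r = 0") (simp_all add: power2_eq_square field_simps)
    then show ?thesis unfolding k_def .
  qed
  finally show ?thesis by (simp add: I_def w_def)
qed

text \<open>X + ln T splits into the bounded X + ln t and into ln T - ln t, whose mean square is
  O(T); Bessel's inequality transfers this to the variable y.\<close>

lemma integral_chi_logderiv_deviation_le:
  assumes C: "\<And>t. t \<in> {T0..T} \<Longrightarrow> norm (X t + of_real (ln t)) \<le> C"
    and X: "continuous_on {T0..T} X" and T: "1 \<le> T0" "T0 \<le> T"
  shows "integral {-M..M} (\<lambda>y. (norm (integral {T0..T} (\<lambda>t. (X t + of_real (ln T)) * cis (y * t))))\<^sup>2)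
      \<le> 2 * pi * ((2 * C\<^sup>2 + 4) * T)"
proof -
  have X': "continuous_on {T0..T} (\<lambda>t. X t + complex_of_real (ln T))" by (intro continuous_intros X)
  have "integral {-M..M} (\<lambda>y. (norm (integral {T0..T} (\<lambda>t. (X t + of_real (ln T)) * cis (y * t))))\<^sup>2)
     \<le> 2 * pi * integral {T0..T} (\<lambda>t. (norm (X t + of_real (ln T)))\<^sup>2)"
    by (rule bessel_inequality[OF T(2) X'])
  also have "integral {T0..T} (\<lambda>t. (norm (X t + of_real (ln T)))\<^sup>2) \<le> integral {T0..T} (\<lambda>t. 2 * C\<^sup>2 + 2 * (ln T - ln t)\<^sup>2)"
  proof (rule integral_le)
    show "(\<lambda>t. (norm (X t + of_real (ln T)))\<^sup>2) integrable_on {T0..T}"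
      by (intro integrable_continuous_interval continuous_intros X)
    show "(\<lambda>t. 2 * C\<^sup>2 + 2 * (ln T - ln t)\<^sup>2) integrable_on {T0..T}"
      using T by (intro integrable_add integrable_const_ivl integrable_on_mult_right integral_ln_ratio_squared_le(1)) auto
    fix t assume t: "t \<in> {T0..T}"
    have l: "ln T - ln t \<ge> 0" using t T by simp
    have "norm (X t + of_real (ln T)) \<le> norm (X t + of_real (ln t)) + norm (complex_of_real (ln T - ln t))"
      using norm_triangle_ineq[of "X t + of_real (ln t)" "complex_of_real (ln T - ln t)"] by (simp add: add.assoc)
    also have "\<dots> \<le> C + (ln T - ln t)" using C[OF t] l by (simp only: norm_of_real)
    finally have "(norm (X t + of_real (ln T)))\<^sup>2 \<le> (C + (ln T - ln t))\<^sup>2" by (intro power_mono) auto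
    also have "\<dots> \<le> 2 * C\<^sup>2 + 2 * (ln T - ln t)\<^sup>2"
      using zero_le_power2[of "C - (ln T - ln t)"] by (simp add: power2_eq_square algebra_simps)
    finally show "(norm (X t + of_real (ln T)))\<^sup>2 \<le> 2 * C\<^sup>2 + 2 * (ln T - ln t)\<^sup>2" .
  qed
  also have "\<dots> = 2 * C\<^sup>2 * (T - T0) + 2 * integral {T0..T} (\<lambda>t. (ln T - ln t)\<^sup>2)"
    using T integral_ln_ratio_squared_le(1)[of T0 T]
    by (subst Henstock_Kurzweil_Integration.integral_add) (auto intro!: integrable_on_mult_right)
  also have "\<dots> \<le> (2 * C\<^sup>2 + 4) * T"
  proof -
    have "2 * C\<^sup>2 * (T - T0) \<le> 2 * C\<^sup>2 * T" using T by (intro mult_left_mono) auto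
    moreover have "integral {T0..T} (\<lambda>t. (ln T - ln t)\<^sup>2) \<le> 2 * T" using T by (intro integral_ln_ratio_squared_le) auto
    ultimately show ?thesis by (simp add: distrib_right)
  qed
  finally show ?thesis by simp
qed

lemma integral_indicator_interval_le:
  fixes g :: "real \<Rightarrow> real"
  assumes g: "continuous_on {a..b} g" "\<And>x. x \<in> {a..b} \<Longrightarrow> g x \<ge> 0"
  shows "(\<lambda>x. if x \<in> {a..b} then g x else 0) integrable_on {u..v}"
    and "integral {u..v} (\<lambda>x. if x \<in> {a..b} then g x else 0) \<le> integral {a..b} g"
proof -
  have eq: "{a..b} \<inter> {u..v} = {max a u..min b v}" by auto
  have int: "g integrable_on {max a u..min b v}"
    by (intro integrable_continuous_interval continuous_on_subset[OF g(1)]) auto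
  show "(\<lambda>x. if x \<in> {a..b} then g x else 0) integrable_on {u..v}"
    unfolding integrable_restrict_Int eq by (rule int)
  show "integral {u..v} (\<lambda>x. if x \<in> {a..b} then g x else 0) \<le> integral {a..b} g"
    unfolding integral_restrict_Int eq
    using g by (intro integral_subset_le int integrable_continuous_interval) auto
qed

text \<open>The weight \<kappa> keeps the coefficient of the main term close to 1 and charges the
  cross term to the error.\<close>

lemma square_sum_le:
  fixes x y \<kappa> :: real
  assumes "\<kappa> > 0"
  shows "(x + y)\<^sup>2 \<le> (1 + \<kappa>) * x\<^sup>2 + (1 + 1 / \<kappa>) * y\<^sup>2"
proof -
  have "0 \<le> (\<kappa> * x - y)\<^sup>2 / \<kappa>" using assms by simp
  also have "\<dots> = \<kappa> * x\<^sup>2 - 2 * x * y + y\<^sup>2 / \<kappa>"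
    using assms by (simp add: power2_eq_square field_simps)
  finally show ?thesis by (simp add: power2_eq_square algebra_simps)
qed

lemma continuous_on_zero_sum: "continuous_on A (zero_sum T)"
  unfolding zero_sum_def[abs_def] by (intro continuous_intros)

text \<open>For $y < \log(3/2)$ the logarithmic derivative of $\chi$ dominates, for larger $y$ the resonant
  prime powers do.\<close>

lemma zero_sum_mean_square_explicit:
  assumes RH: "riemann_hypothesis" and \<Delta>: "0 < \<Delta>" "\<Delta> < 1" and \<kappa>: "\<kappa> > 0"
  shows "\<exists>C \<theta>. \<theta> < 1 \<and> (\<forall>T\<ge>6. \<Delta> * ln T \<ge> 1 \<longrightarrow>
    integral {0..\<Delta> * ln T} (\<lambda>y. (norm (zero_sum T y))\<^sup>2 * (1 - y / (\<Delta> * ln T)))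
      \<le> (1 + \<kappa>) * (T * (ln T)\<^sup>2 / (4 * pi) + T / (2 * pi) * ((\<Delta> * ln T)\<^sup>2 / 6 + C * (\<Delta> * ln T)))
        + C * (T + (ln T) ^ 3 + (ln T) ^ 5 * T powr \<theta>))"
proof -
  \<comment> \<open>The squared error e^(y(2c-1)) reaches T^\<theta> with \<theta> = \<Delta>(2c -
    1). The choice c <= 3/4 + 1/(4\<Delta>) makes this at most (1 + \<Delta>)/2 < 1, and \<Delta> <
    1 is what leaves room for c > 1.\<close>
  define c where "c = min (3/2) (3/4 + 1 / (4 * \<Delta>))"
  have c: "1 < c" "c \<le> 3/2" using \<Delta> by (auto simp: c_def field_simps)
  define \<theta> where "\<theta> = \<Delta> * (2 * c - 1)"
  have \<theta>: "\<theta> < 1"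
  proof -
    have "c \<le> 3/4 + 1 / (4 * \<Delta>)" by (simp add: c_def)
    then have "\<Delta> * (2 * c - 1) \<le> \<Delta> * (2 * (3/4 + 1 / (4 * \<Delta>)) - 1)" using \<Delta> by (intro mult_left_mono diff_right_mono) auto
    also have "\<dots> = \<Delta> / 2 + 1 / 2" using \<Delta> by (simp add: field_simps)
    finally show ?thesis using \<Delta> by (simp add: \<theta>_def)
  qed
  obtain T0 K where T0: "4 \<le> T0" "T0 \<le> 5" and K: "0 \<le> K" and LG: "\<And>T y. T \<ge> 6 \<Longrightarrow> y \<in> {0..ln T} \<Longrightarrow>
    norm (zero_sum T y
      + of_real (exp (y * (c - 1/2)) * (mangoldt (nat (round (exp y))) * real (nat (round (exp y))) powr (- c)) / (2 * pi))
          * cis_integral T0 T (y - ln (real (nat (round (exp y)))))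
      + of_real (exp (- (y * (c - 1/2))) / (2 * pi)) * integral {T0..T} (\<lambda>t. chi_logderiv (Complex (1 - c) t) * cis (y * t)))
    \<le> K * (ln T)\<^sup>2 * exp (y * (c - 1/2))"
    using landau_gonek_formula[OF RH c] by blast
  obtain C1 where C1: "C1 \<ge> 0" "\<And>s. \<bar>Re s\<bar> \<le> 2 \<Longrightarrow> Im s \<ge> 1 \<Longrightarrow> norm (chi_logderiv s + of_real (ln (Im s))) \<le> C1"
    using chi_logderiv_bound by blast
  obtain CA where CA: "CA \<ge> 0" "\<And>Y. Y \<ge> 1 \<Longrightarrow>
     (\<Sum>n=2..nat \<lceil>exp Y\<rceil>. (mangoldt n)\<^sup>2 / real n * ((max 0 (1 - ln (real n) / Y) + 1 / Y) * (1 + 2 / real n))) \<le> Y\<^sup>2 / 6 + CA * Y"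
    using sum_mangoldt_squared_tapered by blast
  define \<kappa>' where "\<kappa>' = 3 * (1 + 1 / \<kappa>)"
  have \<kappa>'0: "\<kappa>' \<ge> 0" using \<kappa> by (simp add: \<kappa>'_def)
  \<comment> \<open>Below ln(3/2) the nearest integer to e^y is 1, where the von Mangoldt function
    vanishes; above it the integral of e^(iyt) is at most 2/\<eta>. So the two main terms act on
    disjoint ranges and produce no cross term.\<close>
  define \<eta> where "\<eta> = ln (3/2 :: real)"
  have \<eta>: "\<eta> > 0" "exp \<eta> = 3/2" by (auto simp: \<eta>_def)
  define CQ where "CQ = 2 * pi * (2 * C1\<^sup>2 + 4)"
  have CQ0: "CQ \<ge> 0" by (simp add: CQ_def)
  define C where "C = CA + \<kappa>' * (CQ + 1 / (pi * \<eta>)\<^sup>2 + K\<^sup>2)"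
  have C_CA: "CA \<le> C" using CQ0 \<kappa>'0 by (simp add: C_def)
  have C_ge: "\<kappa>' * CQ \<le> C" "\<kappa>' * (1 / (pi * \<eta>)\<^sup>2) \<le> C" "\<kappa>' * K\<^sup>2 \<le> C"
  proof -
    have "0 \<le> \<kappa>' * CQ" "0 \<le> \<kappa>' * (1 / (pi * \<eta>)\<^sup>2)" "0 \<le> \<kappa>' * K\<^sup>2"
      using CQ0 \<kappa>'0 by (auto intro!: mult_nonneg_nonneg)
    then show "\<kappa>' * CQ \<le> C" "\<kappa>' * (1 / (pi * \<eta>)\<^sup>2) \<le> C" "\<kappa>' * K\<^sup>2 \<le> C"
      using CA(1) unfolding C_def distrib_left by linarith+
  qed
  show ?thesis
  proof (rule exI[of _ C], rule exI[of _ \<theta>], intro conjI \<theta> allI impI)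
    fix T :: real assume T: "T \<ge> 6" and Y1: "\<Delta> * ln T \<ge> 1"
    define L where "L = ln T"
    define Y where "Y = \<Delta> * L"
    have L0: "L > 0" using T by (simp add: L_def)
    have Y: "Y \<ge> 1" "Y \<le> L" using Y1 \<Delta> L0 by (auto simp: Y_def L_def mult_le_cancel_right1)
    have TT: "0 \<le> T0" "T0 \<le> T" "1 \<le> T0" using T T0 by auto
    define X where "X t = chi_logderiv (Complex (1 - c) t)" for t
    have Xc: "continuous_on {T0..T} X"
      unfolding X_def using T0
      by (intro continuous_intros continuous_on_compose2[OF continuous_on_chi_logderiv[OF order_refl]]) auto
    have XC: "norm (X t + of_real (ln t)) \<le> C1" if "t \<in> {T0..T}" for t
      using C1(2)[of "Complex (1 - c) t"] that T0 c by (simp add: X_def abs_le_iff)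
    define Q where "Q y = integral {T0..T} (\<lambda>t. (X t + of_real L) * cis (y * t))" for y
    have Qc: "continuous_on A Q" for A
      unfolding Q_def by (intro continuous_on_fourier_integral continuous_intros Xc)
    define G where "G y = cis_integral T0 T y" for y
    have Gc: "continuous_on A G" for A
      using continuous_on_cis_integral[of A T0 T 0] by (simp add: G_def[abs_def])
    define A where "A n y = of_real (exp (y * (c - 1/2)) * (mangoldt n * real n powr (- c)) / (2 * pi)) * cis_integral T0 T (y - ln (real n))" for n y
    have Ac: "continuous_on B (A n)" for B n unfolding A_def by (intro continuous_intros continuous_on_cis_integral) auto
    define b1 where "b1 = L / (pi * \<eta>)"
    define e where "e = K * L\<^sup>2 * exp (Y * (c - 1/2))"
    have b10: "b1 \<ge> 0" using L0 \<eta> by (simp add: b1_def)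
    have e0: "e \<ge> 0" using K by (simp add: e_def)
    define I where "I n = {ln (real n - 1/2)..ln (real n + 1/2)}" for n :: nat
    define N where "N = nat \<lceil>exp Y\<rceil>"
    \<comment> \<open>The interval [0, \<eta>] and the blocks I n with 2 <= n <= N cover [0, Y];
      overlaps at end points only enlarge the majorant.\<close>
    define m0 where "m0 y = (if y \<in> {0..\<eta>} then (L / (2 * pi))\<^sup>2 * (norm (G y))\<^sup>2 else 0)" for y
    define mm where "mm n y = (if y \<in> I n then (norm (A n y))\<^sup>2 * max 0 (1 - y / Y) else 0)" for n y
    have mm0: "mm n y \<ge> 0" for n y by (simp add: mm_def)
    have m00: "m0 y \<ge> 0" for y by (simp add: m0_def)
    have pt: "(norm (zero_sum T y))\<^sup>2 * (1 - y / Y) \<le> (1 + \<kappa>) * (m0 y + (\<Sum>n=2..N. mm n y)) + \<kappa>' * ((norm (Q y))\<^sup>2 + (b1\<^sup>2 + e\<^sup>2))"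
      if y: "y \<in> {0..Y}" for y
    proof -
      define \<phi> where "\<phi> = 1 - y / Y"
      have \<phi>: "0 \<le> \<phi>" "\<phi> \<le> 1" "\<phi> = max 0 (1 - y / Y)" using y Y by (auto simp: \<phi>_def)
      define n where "n = nat (round (exp y))"
      have n: "n \<ge> 1" "y \<in> I n" using nearest_integer_exp[of y] y by (auto simp: n_def I_def)
      define q where "q = exp (- (y * (c - 1/2))) / (2 * pi)"
      have q: "0 \<le> q" "q \<le> 1 / (2 * pi)" using y c by (auto simp: q_def intro!: divide_right_mono)
      have "1 / (2 * pi) \<le> 1" using pi_ge_two by simp
      then have q1: "q \<le> 1" using q(2) by linarith
      have "integral {T0..T} (\<lambda>t. X t * cis (y * t)) = Q y - of_real L * G y"
      proof -
        have "Q y = integral {T0..T} (\<lambda>t. X t * cis (y * t) + of_real L * cis (y * t))"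
          unfolding Q_def by (simp only: distrib_right)
        also have "\<dots> = integral {T0..T} (\<lambda>t. X t * cis (y * t)) + integral {T0..T} (\<lambda>t. of_real L * cis (y * t))"
          by (intro Henstock_Kurzweil_Integration.integral_add integrable_continuous_interval continuous_intros Xc)
        also have "integral {T0..T} (\<lambda>t. of_real L * cis (y * t)) = of_real L * G y"
          unfolding G_def by (rule integral_mult_right)
        finally show ?thesis by simp
      qed
      then have lg: "norm (zero_sum T y + A n y + of_real q * (Q y - of_real L * G y)) \<le> e"
      proof -
        have "K * L\<^sup>2 * exp (y * (c - 1/2)) \<le> e"
          unfolding e_def using y c K by (intro mult_left_mono) (auto intro!: mult_right_mono)
        then show ?thesis using LG[OF T, of y] y Y \<open>integral {T0..T} _ = _\<close>
          unfolding A_def n_def q_def X_def L_def by auto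
      qed
      define B1 where "B1 = L / (2 * pi) * norm (G y)"
      have B10: "B1 \<ge> 0" using L0 by (simp add: B1_def)
      have S: "norm (zero_sum T y) \<le> norm (A n y) + B1 + norm (Q y) + e"
      proof -
        have "zero_sum T y = (zero_sum T y + A n y + of_real q * (Q y - of_real L * G y)) - A n y - of_real q * Q y + of_real (q * L) * G y"
          by (simp add: algebra_simps)
        then have "norm (zero_sum T y) \<le> norm (zero_sum T y + A n y + of_real q * (Q y - of_real L * G y)) + norm (A n y) + norm (of_real q * Q y) + norm (of_real (q * L) * G y)"
          by (smt (verit) norm_triangle_ineq norm_triangle_ineq4)
        moreover have "norm (of_real q * Q y) \<le> norm (Q y)"
          using q q1 mult_right_mono[OF q1, of "norm (Q y)"] by (simp add: norm_mult)
        moreover have "norm (of_real (q * L) * G y) \<le> B1"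
        proof -
          have "norm (of_real (q * L) * G y) = q * L * norm (G y)" using q L0 by (simp add: norm_mult)
          also have "\<dots> \<le> 1 / (2 * pi) * L * norm (G y)" using q L0 by (intro mult_right_mono) auto
          finally show ?thesis by (simp add: B1_def)
        qed
        ultimately show ?thesis using lg by linarith
      qed
      define M where "M = (if y < \<eta> then B1 else norm (A n y))"
      have "norm (zero_sum T y) \<le> M + (norm (Q y) + b1 + e)"
      proof (cases "y < \<eta>")
        case True
        have "n = 1"
        proof -
          have "exp y < 3/2" using True \<eta> by (metis exp_less_cancel_iff)
          then have "round (exp y) < 2" by (simp add: round_def floor_less_iff)
          then show ?thesis using n(1) by (simp add: n_def)
        qed
        then have "A n y = 0" by (simp add: A_def)
        then show ?thesis using S b10 True by (simp add: M_def)
      next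
        case False
        have y\<eta>: "y \<ge> \<eta>" "y > 0" using False \<eta> by auto
        have "norm (G y) \<le> 2 / \<bar>y\<bar>" unfolding G_def using TT y\<eta> by (intro cis_integral_bound) auto
        also have "\<dots> \<le> 2 / \<eta>" using y\<eta> \<eta> by (intro divide_left_mono) auto
        finally have "B1 \<le> L / (2 * pi) * (2 / \<eta>)" unfolding B1_def using L0 by (intro mult_left_mono) auto
        then have "B1 \<le> b1" by (simp add: b1_def)
        then show ?thesis using S False by (simp add: M_def)
      qed
      then have "(norm (zero_sum T y))\<^sup>2 \<le> (M + (norm (Q y) + b1 + e))\<^sup>2" by (intro power_mono) auto
      also have "\<dots> \<le> (1 + \<kappa>) * M\<^sup>2 + (1 + 1 / \<kappa>) * (norm (Q y) + b1 + e)\<^sup>2" by (rule square_sum_le[OF \<kappa>])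
      also have "\<dots> \<le> (1 + \<kappa>) * M\<^sup>2 + (1 + 1 / \<kappa>) * (3 * ((norm (Q y))\<^sup>2 + (b1\<^sup>2 + e\<^sup>2)))"
      proof (intro add_left_mono mult_left_mono)
        have "(u + v + w)\<^sup>2 \<le> 3 * (u\<^sup>2 + (v\<^sup>2 + w\<^sup>2))" for u v w :: real
          using zero_le_power2[of "u - v"] zero_le_power2[of "u - w"] zero_le_power2[of "v - w"]
          by (simp add: power2_eq_square algebra_simps)
        then show "(norm (Q y) + b1 + e)\<^sup>2 \<le> 3 * ((norm (Q y))\<^sup>2 + (b1\<^sup>2 + e\<^sup>2))" .
      qed (use \<kappa> in auto)
      finally have sq: "(norm (zero_sum T y))\<^sup>2 \<le> (1 + \<kappa>) * M\<^sup>2 + \<kappa>' * ((norm (Q y))\<^sup>2 + (b1\<^sup>2 + e\<^sup>2))" by (simp only: \<kappa>'_def mult.assoc mult.left_commute[of _ 3])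
      have "(norm (zero_sum T y))\<^sup>2 * \<phi> \<le> ((1 + \<kappa>) * M\<^sup>2 + \<kappa>' * ((norm (Q y))\<^sup>2 + (b1\<^sup>2 + e\<^sup>2))) * \<phi>"
        using sq \<phi> by (intro mult_right_mono)
      also have "\<dots> = (1 + \<kappa>) * (M\<^sup>2 * \<phi>) + \<kappa>' * ((norm (Q y))\<^sup>2 + (b1\<^sup>2 + e\<^sup>2)) * \<phi>" by (simp only: distrib_right mult.assoc)
      also have "\<dots> \<le> (1 + \<kappa>) * (M\<^sup>2 * \<phi>) + \<kappa>' * ((norm (Q y))\<^sup>2 + (b1\<^sup>2 + e\<^sup>2)) * 1"
        using \<phi> \<kappa>'0 by (intro add_left_mono mult_left_mono) auto
      also have "M\<^sup>2 * \<phi> \<le> m0 y + (\<Sum>n=2..N. mm n y)"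
      proof (cases "y < \<eta>")
        case True
        have "M\<^sup>2 * \<phi> \<le> M\<^sup>2 * 1" using \<phi> by (intro mult_left_mono) auto
        also have "\<dots> = m0 y" using True y by (simp add: M_def m0_def B1_def power_mult_distrib power_divide)
        also have "\<dots> \<le> m0 y + (\<Sum>n=2..N. mm n y)" using mm0 by (simp add: sum_nonneg)
        finally show ?thesis .
      next
        case False
        have "n \<ge> 2"
        proof -
          have "exp y \<ge> 3/2" using False \<eta> by (metis exp_le_cancel_iff not_le)
          then have "round (exp y) \<ge> 2" by (simp add: round_def le_floor_iff)
          then show ?thesis by (simp add: n_def)
        qed
        moreover have "n \<le> N"
        proof -
          have "exp y \<le> exp Y" using y by simp
          also have "\<dots> \<le> real N" unfolding N_def by (rule real_nat_ceiling_ge)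
          finally have "round (exp y) \<le> round (real N)" by (rule round_mono)
          then show ?thesis by (simp add: n_def)
        qed
        ultimately have "mm n y \<le> (\<Sum>n=2..N. mm n y)" using mm0 by (intro member_le_sum) auto
        moreover have "M\<^sup>2 * \<phi> = mm n y" using False n by (simp add: M_def mm_def \<phi>(3))
        ultimately show ?thesis using m00[of y] by simp
      qed
      finally show ?thesis using \<kappa> by (simp add: \<phi>_def mult_left_mono)
    qed
    have mm_int: "mm n integrable_on {0..Y}" "integral {0..Y} (mm n) \<le> T / (2 * pi) * ((mangoldt n)\<^sup>2 / real n * ((max 0 (1 - ln (real n) / Y) + 1 / Y) * (1 + 2 / real n)))"
      if "n \<ge> 2" for n
    proof -
      have cont: "continuous_on B (\<lambda>y. (norm (A n y))\<^sup>2 * max 0 (1 - y / Y))" for B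
        using Y by (intro continuous_intros Ac) auto
      note * = integral_indicator_interval_le[of "ln (real n - 1/2)" "ln (real n + 1/2)" "\<lambda>y. (norm (A n y))\<^sup>2 * max 0 (1 - y / Y)" 0 Y, OF cont]
      show "mm n integrable_on {0..Y}" unfolding mm_def I_def by (rule *(1)) simp
      have "integral {0..Y} (mm n) \<le> integral {ln (real n - 1/2)..ln (real n + 1/2)} (\<lambda>y. (norm (A n y))\<^sup>2 * max 0 (1 - y / Y))"
        unfolding mm_def I_def by (rule *(2)) simp
      also have "\<dots> \<le> T / (2 * pi) * ((mangoldt n)\<^sup>2 / real n * ((max 0 (1 - ln (real n) / Y) + 1 / Y) * (1 + 2 / real n)))"
        unfolding A_def by (rule integral_resonant_block[OF c that Y(1) TT(1,2)])
      finally show "integral {0..Y} (mm n) \<le> T / (2 * pi) * ((mangoldt n)\<^sup>2 / real n * ((max 0 (1 - ln (real n) / Y) + 1 / Y) * (1 + 2 / real n)))" .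
    qed
    have m0_int: "m0 integrable_on {0..Y}" "integral {0..Y} m0 \<le> T * L\<^sup>2 / (4 * pi)"
    proof -
      have cont: "continuous_on B (\<lambda>y. (L / (2 * pi))\<^sup>2 * (norm (G y))\<^sup>2)" for B by (intro continuous_intros Gc)
      note * = integral_indicator_interval_le[of 0 \<eta> "\<lambda>y. (L / (2 * pi))\<^sup>2 * (norm (G y))\<^sup>2" 0 Y, OF cont]
      show "m0 integrable_on {0..Y}" unfolding m0_def by (rule *(1)) simp
      have "integral {0..Y} m0 \<le> integral {0..\<eta>} (\<lambda>y. (L / (2 * pi))\<^sup>2 * (norm (G y))\<^sup>2)"
        unfolding m0_def by (rule *(2)) simp
      also have "\<dots> = (L / (2 * pi))\<^sup>2 * integral {0..\<eta>} (\<lambda>y. (norm (G y))\<^sup>2)" by (rule integral_mult_right)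
      also have "\<dots> \<le> (L / (2 * pi))\<^sup>2 * (pi * T)"
        unfolding G_def using \<eta> by (intro mult_left_mono integral_half_cis_integral_squared_le TT) auto
      also have "\<dots> = T * L\<^sup>2 / (4 * pi)" by (simp add: power2_eq_square)
      finally show "integral {0..Y} m0 \<le> T * L\<^sup>2 / (4 * pi)" .
    qed
    have Q_int: "(\<lambda>y. (norm (Q y))\<^sup>2) integrable_on {0..Y}" "integral {0..Y} (\<lambda>y. (norm (Q y))\<^sup>2) \<le> CQ * T"
    proof -
      show int: "(\<lambda>y. (norm (Q y))\<^sup>2) integrable_on {0..Y}" by (intro integrable_continuous_interval continuous_intros Qc)
      have "integral {0..Y} (\<lambda>y. (norm (Q y))\<^sup>2) \<le> integral {-Y..Y} (\<lambda>y. (norm (Q y))\<^sup>2)"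
        using Y by (intro integral_subset_le integrable_continuous_interval continuous_intros Qc) auto
      also have "\<dots> \<le> 2 * pi * ((2 * C1\<^sup>2 + 4) * T)"
        unfolding Q_def L_def by (rule integral_chi_logderiv_deviation_le[OF XC Xc TT(3,2)])
      finally show "integral {0..Y} (\<lambda>y. (norm (Q y))\<^sup>2) \<le> CQ * T" by (simp add: CQ_def mult.assoc)
    qed
    have "((\<lambda>y. (1 + \<kappa>) * (m0 y + (\<Sum>n=2..N. mm n y)) + \<kappa>' * ((norm (Q y))\<^sup>2 + (b1\<^sup>2 + e\<^sup>2))) has_integral
       (1 + \<kappa>) * (integral {0..Y} m0 + (\<Sum>n=2..N. integral {0..Y} (mm n))) + \<kappa>' * (integral {0..Y} (\<lambda>y. (norm (Q y))\<^sup>2) + (Y - 0) *\<^sub>R (b1\<^sup>2 + e\<^sup>2))) {0..Y}"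
    proof (intro has_integral_add has_integral_mult_right has_integral_sum integrable_integral m0_int mm_int Q_int)
      show "((\<lambda>y. b1\<^sup>2 + e\<^sup>2) has_integral (Y - 0) *\<^sub>R (b1\<^sup>2 + e\<^sup>2)) {0..Y}"
        using has_integral_const_real[of "b1\<^sup>2 + e\<^sup>2" 0 Y] Y by simp
    qed auto
    moreover have "((\<lambda>y. (norm (zero_sum T y))\<^sup>2 * (1 - y / Y)) has_integral integral {0..Y} (\<lambda>y. (norm (zero_sum T y))\<^sup>2 * (1 - y / Y))) {0..Y}"
      using Y by (intro integrable_integral integrable_continuous_interval continuous_intros continuous_on_zero_sum) auto
    ultimately have "integral {0..Y} (\<lambda>y. (norm (zero_sum T y))\<^sup>2 * (1 - y / Y)) \<le>
       (1 + \<kappa>) * (integral {0..Y} m0 + (\<Sum>n=2..N. integral {0..Y} (mm n))) + \<kappa>' * (integral {0..Y} (\<lambda>y. (norm (Q y))\<^sup>2) + (Y - 0) *\<^sub>R (b1\<^sup>2 + e\<^sup>2))"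
      using has_integral_le pt by meson
    also have "\<dots> \<le> (1 + \<kappa>) * (T * L\<^sup>2 / (4 * pi) + T / (2 * pi) * (Y\<^sup>2 / 6 + C * Y)) + \<kappa>' * (CQ * T + L * (b1\<^sup>2 + e\<^sup>2))"
    proof (intro add_mono mult_left_mono m0_int Q_int)
      have "(\<Sum>n=2..N. integral {0..Y} (mm n)) \<le> (\<Sum>n=2..N. T / (2 * pi) * ((mangoldt n)\<^sup>2 / real n * ((max 0 (1 - ln (real n) / Y) + 1 / Y) * (1 + 2 / real n))))"
        by (intro sum_mono mm_int) auto
      also have "\<dots> = T / (2 * pi) * (\<Sum>n=2..N. (mangoldt n)\<^sup>2 / real n * ((max 0 (1 - ln (real n) / Y) + 1 / Y) * (1 + 2 / real n)))"
        by (simp only: sum_distrib_left)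
      also have "\<dots> \<le> T / (2 * pi) * (Y\<^sup>2 / 6 + CA * Y)"
        unfolding N_def using T by (intro mult_left_mono CA Y) auto
      also have "\<dots> \<le> T / (2 * pi) * (Y\<^sup>2 / 6 + C * Y)"
        using T C_CA Y by (intro mult_left_mono add_left_mono mult_right_mono) auto
      finally show "(\<Sum>n=2..N. integral {0..Y} (mm n)) \<le> T / (2 * pi) * (Y\<^sup>2 / 6 + C * Y)" .
      show "(Y - 0) *\<^sub>R (b1\<^sup>2 + e\<^sup>2) \<le> L * (b1\<^sup>2 + e\<^sup>2)" using Y by (simp add: mult_right_mono)
    qed (use \<kappa> \<kappa>'0 in auto)
    also have "\<kappa>' * (CQ * T + L * (b1\<^sup>2 + e\<^sup>2)) \<le> C * (T + L ^ 3 + L ^ 5 * T powr \<theta>)"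
    proof -
      have b: "L * b1\<^sup>2 = 1 / (pi * \<eta>)\<^sup>2 * L ^ 3" by (simp add: b1_def power_divide power2_eq_square power3_eq_cube)
      have "(exp (Y * (c - 1/2)))\<^sup>2 = exp (L * \<theta>)"
        by (simp add: power2_eq_square mult_exp_exp Y_def \<theta>_def algebra_simps)
      also have "\<dots> = T powr \<theta>" using T by (simp add: powr_def L_def mult.commute)
      finally have e: "L * e\<^sup>2 = K\<^sup>2 * (L ^ 5 * T powr \<theta>)"
        by (simp add: e_def power_mult_distrib power2_eq_square eval_nat_numeral mult_ac)
      have "\<kappa>' * (CQ * T + L * (b1\<^sup>2 + e\<^sup>2)) = (\<kappa>' * CQ) * T + (\<kappa>' * (1 / (pi * \<eta>)\<^sup>2)) * L ^ 3 + (\<kappa>' * K\<^sup>2) * (L ^ 5 * T powr \<theta>)"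
        unfolding distrib_left b e by (simp only: mult.assoc add.assoc)
      also have "\<dots> \<le> C * T + C * L ^ 3 + C * (L ^ 5 * T powr \<theta>)"
        using T L0 by (intro add_mono mult_right_mono C_ge) auto
      finally show ?thesis by (simp only: distrib_left)
    qed
    finally show "integral {0..\<Delta> * ln T} (\<lambda>y. (norm (zero_sum T y))\<^sup>2 * (1 - y / (\<Delta> * ln T)))
      \<le> (1 + \<kappa>) * (T * (ln T)\<^sup>2 / (4 * pi) + T / (2 * pi) * ((\<Delta> * ln T)\<^sup>2 / 6 + C * (\<Delta> * ln T)))
        + C * (T + (ln T) ^ 3 + (ln T) ^ 5 * T powr \<theta>)"
      by (simp add: Y_def L_def)
  qed
qed

text \<open>Divided by T (ln T)^2/(4 pi), the part from chi'/chi contributes 1 and the prime powers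
  contribute \<Delta>^2/3. All other terms tend to 0, including the one with T^\<theta>, because
  \<theta> < 1.\<close>

theorem zero_sum_mean_square:
  assumes RH: "riemann_hypothesis" and \<Delta>: "0 < \<Delta>" "\<Delta> < 1" and \<epsilon>: "\<epsilon> > 0"
  shows "eventually (\<lambda>T. integral {0..\<Delta> * ln T} (\<lambda>y. (norm (zero_sum T y))\<^sup>2 * (1 - y / (\<Delta> * ln T)))
     \<le> (1 + \<Delta>\<^sup>2 / 3 + \<epsilon>) * (T * (ln T)\<^sup>2 / (4 * pi))) at_top"
proof -
  define B where "B = 1 + \<Delta>\<^sup>2 / 3"
  have B: "B \<ge> 1" by (simp add: B_def)
  \<comment> \<open>This choice gives (1 + \<kappa>) B = B + \<epsilon>/2 and leaves \<epsilon>/2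
    for the vanishing terms.\<close>
  define \<kappa> where "\<kappa> = \<epsilon> / (2 * B)"
  have \<kappa>: "\<kappa> > 0" using \<epsilon> B by (simp add: \<kappa>_def)
  obtain C \<theta> where \<theta>: "\<theta> < 1" and bound: "\<And>T. T \<ge> 6 \<Longrightarrow> \<Delta> * ln T \<ge> 1 \<Longrightarrow>
    integral {0..\<Delta> * ln T} (\<lambda>y. (norm (zero_sum T y))\<^sup>2 * (1 - y / (\<Delta> * ln T)))
      \<le> (1 + \<kappa>) * (T * (ln T)\<^sup>2 / (4 * pi) + T / (2 * pi) * ((\<Delta> * ln T)\<^sup>2 / 6 + C * (\<Delta> * ln T)))
        + C * (T + (ln T) ^ 3 + (ln T) ^ 5 * T powr \<theta>)"
    using zero_sum_mean_square_explicit[OF RH \<Delta> \<kappa>] by blast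
  define g where "g T = (1 + \<kappa>) * (B + 2 * C * \<Delta> * (1 / ln T)) + 4 * pi * C * (1 / (ln T)\<^sup>2 + ln T / T + (ln T) ^ 3 * T powr (\<theta> - 1))" for T :: real
  have "((\<lambda>T::real. 1 / ln T) \<longlongrightarrow> 0) at_top" "((\<lambda>T::real. 1 / (ln T)\<^sup>2) \<longlongrightarrow> 0) at_top" "((\<lambda>T::real. ln T / T) \<longlongrightarrow> 0) at_top"
    "((\<lambda>T. (ln T) ^ 3 * T powr (\<theta> - 1)) \<longlongrightarrow> 0) at_top"
    using \<theta> by real_asymp+
  then have "(g \<longlongrightarrow> (1 + \<kappa>) * (B + 2 * C * \<Delta> * 0) + 4 * pi * C * (0 + 0 + 0)) at_top"
    unfolding g_def by (intro tendsto_intros)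
  moreover have "(1 + \<kappa>) * (B + 2 * C * \<Delta> * 0) + 4 * pi * C * (0 + 0 + 0) < B + \<epsilon>"
    using B \<epsilon> by (simp add: \<kappa>_def field_simps)
  ultimately have "eventually (\<lambda>T. g T < B + \<epsilon>) at_top" by (rule order_tendstoD)
  moreover have "eventually (\<lambda>T. \<Delta> * ln T \<ge> 1) at_top"
    using \<Delta> by real_asymp
  ultimately show ?thesis using eventually_ge_at_top[of 6]
  proof eventually_elim
    case (elim T)
    define L where "L = ln T"
    have L: "L > 0" using elim by (simp add: L_def)
    have T: "T > 0" using elim by simp
    have "(1 + \<kappa>) * (T * L\<^sup>2 / (4 * pi) + T / (2 * pi) * ((\<Delta> * L)\<^sup>2 / 6 + C * (\<Delta> * L))) + C * (T + L ^ 3 + L ^ 5 * T powr \<theta>)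
        = g T * (T * L\<^sup>2 / (4 * pi))"
    proof -
      have p: "T powr (\<theta> - 1) = T powr \<theta> / T" using T by (simp add: powr_diff)
      have 1: "T * L\<^sup>2 / (4 * pi) + T / (2 * pi) * ((\<Delta> * L)\<^sup>2 / 6 + C * (\<Delta> * L)) = (B + 2 * C * \<Delta> * (1 / L)) * (T * L\<^sup>2 / (4 * pi))"
        using L T by (simp add: B_def field_simps power2_eq_square)
      have 2: "C * (T + L ^ 3 + L ^ 5 * T powr \<theta>) = 4 * pi * C * (1 / L\<^sup>2 + L / T + L ^ 3 * T powr (\<theta> - 1)) * (T * L\<^sup>2 / (4 * pi))"
        unfolding p using L T by (simp add: field_simps eval_nat_numeral)
      show ?thesis unfolding 1 2 g_def L_def[symmetric] by (simp only: distrib_right mult.assoc)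
    qed
    also have "\<dots> \<le> (B + \<epsilon>) * (T * L\<^sup>2 / (4 * pi))" using elim T by (intro mult_right_mono) auto
    finally show ?case using bound[of T] elim unfolding L_def B_def by linarith
  qed
qed

text \<open>The resonance formula at y = 0: the nearest integer to e^0 is 1, where the von Mangoldt
  function vanishes, so only the integral of chi'/chi survives. Its integrand is -ln t up to a
  bounded error, which gives the main term of the Riemann-von Mangoldt formula.\<close>

lemma zero_count_lower_bound:
  assumes RH: "riemann_hypothesis" and \<epsilon>: "\<epsilon> > 0"
  shows "eventually (\<lambda>T. (1 - \<epsilon>) * (T * ln T / (2 * pi)) \<le> (\<Sum>\<rho>\<in>zeros_upto T. real (zero_mult \<rho>))) at_top"
proof -
  obtain T0 K where T0: "4 \<le> T0" "T0 \<le> 5" and K: "0 \<le> K" and LG: "\<And>T y. T \<ge> 6 \<Longrightarrow> y \<in> {0..ln T} \<Longrightarrow>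
    norm (zero_sum T y
      + of_real (exp (y * (3/2 - 1/2)) * (mangoldt (nat (round (exp y))) * real (nat (round (exp y))) powr (- (3/2))) / (2 * pi))
          * cis_integral T0 T (y - ln (real (nat (round (exp y)))))
      + of_real (exp (- (y * (3/2 - 1/2))) / (2 * pi)) * integral {T0..T} (\<lambda>t. chi_logderiv (Complex (1 - 3/2) t) * cis (y * t)))
    \<le> K * (ln T)\<^sup>2 * exp (y * (3/2 - 1/2))"
    using landau_gonek_formula[OF RH, of "3/2"] by auto
  obtain C1 where C1: "C1 \<ge> 0" "\<And>s. \<bar>Re s\<bar> \<le> 2 \<Longrightarrow> Im s \<ge> 1 \<Longrightarrow> norm (chi_logderiv s + of_real (ln (Im s))) \<le> C1"
    using chi_logderiv_bound by blast
  define X where "X t = chi_logderiv (Complex (1 - 3/2) t)" for t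
  have "eventually (\<lambda>T. (1 - \<epsilon>) * (T * ln T / (2 * pi)) \<le> (T * ln T - T - 25 - C1 * T) / (2 * pi) - K * (ln T)\<^sup>2) at_top"
    using \<epsilon> K C1(1) by real_asymp
  then show ?thesis using eventually_ge_at_top[of 6]
  proof eventually_elim
    case (elim T)
    define N where "N = (\<Sum>\<rho>\<in>zeros_upto T. real (zero_mult \<rho>))"
    have Xc: "continuous_on {T0..T} X"
      unfolding X_def using T0
      by (intro continuous_intros continuous_on_compose2[OF continuous_on_chi_logderiv[OF order_refl]]) auto
    have lnc: "continuous_on {T0..T} (\<lambda>t. complex_of_real (ln t))" using T0 by (intro continuous_intros) auto
    have TT: "T0 \<le> T" using T0 elim by simp
    have "norm (of_real N + of_real (1 / (2 * pi)) * integral {T0..T} X) \<le> K * (ln T)\<^sup>2"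
      using LG[of T 0] elim by (simp add: zero_sum_def N_def X_def[abs_def])
    then have "\<bar>Re (of_real N + of_real (1 / (2 * pi)) * integral {T0..T} X)\<bar> \<le> K * (ln T)\<^sup>2"
      using abs_Re_le_cmod order_trans by blast
    then have 1: "\<bar>N + Re (integral {T0..T} X) / (2 * pi)\<bar> \<le> K * (ln T)\<^sup>2" by simp
    have "norm (integral {T0..T} (\<lambda>t. X t + of_real (ln t))) \<le> C1 * (T - T0)"
    proof (rule integral_bound[OF TT])
      show "continuous_on {T0..T} (\<lambda>t. X t + of_real (ln t))" by (intro continuous_on_add Xc lnc)
      show "norm (X t + of_real (ln t)) \<le> C1" if "t \<in> {T0..T}" for t
        using C1(2)[of "Complex (1 - 3/2) t"] that T0 by (simp add: X_def)
    qed
    also have "integral {T0..T} (\<lambda>t. X t + of_real (ln t)) = integral {T0..T} X + integral {T0..T} (\<lambda>t. complex_of_real (ln t))"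
      by (intro Henstock_Kurzweil_Integration.integral_add integrable_continuous_interval Xc lnc)
    also have "integral {T0..T} (\<lambda>t. complex_of_real (ln t)) = of_real ((T * ln T - T) - (T0 * ln T0 - T0))"
    proof -
      have "(ln has_integral ((T * ln T - T) - (T0 * ln T0 - T0))) {T0..T}"
      proof (rule fundamental_theorem_of_calculus[OF TT])
        fix t assume "t \<in> {T0..T}"
        then have "((\<lambda>t. t * ln t - t) has_real_derivative ln t) (at t)"
          using T0 by (auto intro!: derivative_eq_intros)
        then show "((\<lambda>t. t * ln t - t) has_vector_derivative ln t) (at t within {T0..T})"
          by (simp add: has_real_derivative_iff_has_vector_derivative has_vector_derivative_at_within)
      qed
      from has_integral_of_real[OF this] show ?thesis by (rule integral_unique)
    qed
    finally have "\<bar>Re (integral {T0..T} X + of_real ((T * ln T - T) - (T0 * ln T0 - T0)))\<bar> \<le> C1 * (T - T0)"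
      using abs_Re_le_cmod order_trans by blast
    then have "Re (integral {T0..T} X) \<le> C1 * (T - T0) - ((T * ln T - T) - (T0 * ln T0 - T0))" by simp
    also have "\<dots> \<le> C1 * T - ((T * ln T - T) - 25)"
    proof -
      have "ln T0 \<le> T0 - 1" using T0 by (intro ln_le_minus_one) auto
      then have "T0 * ln T0 \<le> 5 * 5" using T0 by (intro mult_mono) auto
      moreover have "C1 * (T - T0) \<le> C1 * T" using C1(1) T0 by (intro mult_left_mono) auto
      ultimately show ?thesis using T0 by linarith
    qed
    finally have "(T * ln T - T - 25 - C1 * T) \<le> - Re (integral {T0..T} X)" by simp
    then have "(T * ln T - T - 25 - C1 * T) / (2 * pi) \<le> - Re (integral {T0..T} X) / (2 * pi)"
      by (intro divide_right_mono) auto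
    then show ?case using 1 elim unfolding N_def[symmetric] by linarith
  qed
qed

section \<open>From the mean square to triangular averages of the form factor\<close>

lemma zero_sum_minus: "zero_sum T (- y) = cnj (zero_sum T y)"
  by (simp add: zero_sum_def cis_cnj)

text \<open>The substitution y = \<alpha> ln T, after folding the triangle at 0, where |S| is
  even.\<close>

lemma tri_avg_zero_sum:
  assumes T: "T > 1" and h: "h > 0"
  shows "tri_avg h 0 (\<lambda>\<alpha>. (norm (zero_sum T (\<alpha> * ln T)))\<^sup>2) =
    2 * h / ln T * integral {0..h * ln T} (\<lambda>y. (norm (zero_sum T y))\<^sup>2 * (1 - y / (h * ln T)))"
proof -
  define L where "L = ln T"
  have L: "L > 0" using T by (simp add: L_def)
  define f where "f y = (norm (zero_sum T y))\<^sup>2 * (1 - y / (h * L))" for y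
  define g where "g \<alpha> = tri h \<alpha> * (norm (zero_sum T (\<alpha> * L)))\<^sup>2" for \<alpha>
  have gc: "continuous_on A g" for A
    unfolding g_def by (intro continuous_intros continuous_on_compose2[OF continuous_on_zero_sum[of UNIV T]]) auto
  have fc: "continuous_on A f" for A
    unfolding f_def using L h by (intro continuous_intros continuous_on_zero_sum) auto
  have sym: "g (- \<alpha>) = g \<alpha>" for \<alpha> by (simp add: g_def tri_def zero_sum_minus)
  have "integral {-h..0} g = integral {0..h} g"
    using Henstock_Kurzweil_Integration.integral_reflect_real[of h 0 g] sym by simp
  moreover have "integral {-h..0} g + integral {0..h} g = integral {-h..h} g"
    using h by (intro Henstock_Kurzweil_Integration.integral_combine integrable_continuous_interval gc) auto
  ultimately have "integral {-h..h} g = 2 * integral {0..h} g" by simp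
  moreover have "integral {0..h} g = h / L * integral {0..h * L} f"
  proof -
    have "(f has_integral integral {0..h * L} f) (cbox 0 (h * L))"
      unfolding box_real by (intro integrable_integral integrable_continuous_interval fc)
    from has_integral_affinity'[OF this L, of 0] have "((\<lambda>x. f (L * x)) has_integral integral {0..h * L} f / L) {0..h}"
      using L by (simp add: field_simps)
    from has_integral_mult_right[OF this, of h] have int: "((\<lambda>x. h * f (L * x)) has_integral h / L * integral {0..h * L} f) {0..h}" by simp
    have "h * f (L * x) = g x" if "x \<in> {0..h}" for x
    proof -
      have "h * (1 - L * x / (h * L)) = h - x" using L h by (simp add: right_diff_distrib)
      moreover have "h * f (L * x) = (norm (zero_sum T (L * x)))\<^sup>2 * (h * (1 - L * x / (h * L)))"
        unfolding f_def by (rule mult.left_commute)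
      moreover have "tri h x = h - x" using that by (simp add: tri_def)
      ultimately show ?thesis by (simp only: g_def mult.commute[of x] mult.commute[of "h - x"])
    qed
    then have "(g has_integral h / L * integral {0..h * L} f) {0..h}" by (rule has_integral_eq[OF _ int])
    then show ?thesis by (rule integral_unique)
  qed
  ultimately show ?thesis by (simp add: tri_avg_def g_def[abs_def] f_def[abs_def] L_def)
qed

lemma tri_avg_form_factor_bounds:
  assumes T: "T > 1" and h: "h > 0"
  defines "J \<equiv> integral {0..h * ln T} (\<lambda>y. (norm (zero_sum T y))\<^sup>2 * (1 - y / (h * ln T)))"
  shows "tri_avg h \<beta> (\<lambda>\<alpha>. form_factor \<alpha> T) \<le> 2 * pi / (T * ln T) * (2 * h / ln T * J)"
    and "2 * pi / (T * ln T) * (2 * h\<^sup>2 * (\<Sum>\<rho>\<in>zeros_upto T. real (zero_mult \<rho>)) - 2 * h / ln T * J) \<le> tri_avg h \<beta> (\<lambda>\<alpha>. form_factor \<alpha> T)"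
proof -
  define k where "k = 2 * pi / (T * ln T)"
  have k: "k \<ge> 0" using T by (simp add: k_def)
  define m where "m p = real (zero_mult p)" for p
  define g where "g p = ln T * Im p" for p
  define W where "W p q = pair_weight (Im p - Im q)" for p q
  define G where "G \<alpha> = (\<Sum>p\<in>zeros_upto T. \<Sum>q\<in>zeros_upto T. m p * m q * W p q * cos (\<alpha> * (g p - g q)))" for \<alpha>
  have W: "0 \<le> W p q" "W p q \<le> 1" "W p p = 1" for p q
    by (auto simp: W_def pair_weight_def divide_le_eq add_pos_nonneg)
  have "(\<lambda>\<alpha>. form_factor \<alpha> T) = (\<lambda>\<alpha>. k * G \<alpha>)"
    using T by (simp add: form_factor_eq_cos_sum k_def G_def m_def g_def W_def fun_eq_iff)
  then have avg: "tri_avg h \<beta> (\<lambda>\<alpha>. form_factor \<alpha> T) = k * tri_avg h \<beta> G"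
    by (simp add: tri_avg_def mult.left_commute[of _ k])
  have S: "(\<Sum>p\<in>zeros_upto T. of_real (m p) * cis (\<alpha> * g p)) = zero_sum T (\<alpha> * ln T)" for \<alpha>
    by (simp add: zero_sum_def m_def g_def mult.assoc)
  have J: "tri_avg h 0 (\<lambda>\<alpha>. (norm (\<Sum>p\<in>zeros_upto T. of_real (m p) * cis (\<alpha> * g p)))\<^sup>2) = 2 * h / ln T * J"
    unfolding S J_def by (rule tri_avg_zero_sum[OF T h])
  note b = tri_avg_bounds[where Z = "zeros_upto T" and h = h and m = m and W = W and g = g and \<beta> = \<beta>, OF finite_zeros_upto _ _ W, folded G_def, unfolded J]
  have "tri_avg h \<beta> G \<le> 2 * h / ln T * J" using b(1) h by (simp add: m_def)
  then show "tri_avg h \<beta> (\<lambda>\<alpha>. form_factor \<alpha> T) \<le> 2 * pi / (T * ln T) * (2 * h / ln T * J)"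
    unfolding avg k_def[symmetric] using k by (rule mult_left_mono)
  have "2 * h\<^sup>2 * (\<Sum>\<rho>\<in>zeros_upto T. m \<rho>) \<le> 2 * h\<^sup>2 * (\<Sum>\<rho>\<in>zeros_upto T. (m \<rho>)\<^sup>2)"
  \<comment> \<open>Multiplicities are natural numbers, so m <= m^2 and the diagonal dominates the
    zero count.\<close>
  proof (intro mult_left_mono sum_mono)
    show "m \<rho> \<le> (m \<rho>)\<^sup>2" for \<rho>
      using le_square[of "zero_mult \<rho>"] by (simp only: m_def power2_eq_square of_nat_mult[symmetric] of_nat_le_iff)
  qed auto
  moreover have "2 * h\<^sup>2 * (\<Sum>\<rho>\<in>zeros_upto T. (m \<rho>)\<^sup>2) - 2 * h / ln T * J \<le> tri_avg h \<beta> G" using b(2) h by (simp add: m_def)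
  ultimately have "2 * h\<^sup>2 * (\<Sum>\<rho>\<in>zeros_upto T. m \<rho>) - 2 * h / ln T * J \<le> tri_avg h \<beta> G" by linarith
  then show "2 * pi / (T * ln T) * (2 * h\<^sup>2 * (\<Sum>\<rho>\<in>zeros_upto T. real (zero_mult \<rho>)) - 2 * h / ln T * J) \<le> tri_avg h \<beta> (\<lambda>\<alpha>. form_factor \<alpha> T)"
    unfolding avg k_def[symmetric] m_def using k by (rule mult_left_mono)
qed

text \<open>The normalisations match: 2 pi/(T ln T) times 2h/ln T times T (ln T)^2/(4 pi) is h, so
  the mean square gives h (1 + h^2/3), while the zero count gives the diagonal 2 h^2 from
  below.\<close>

lemma eventually_tri_avg_form_factor_less_1:
  assumes RH: "riemann_hypothesis" and h: "0 < h" "h < 1" and \<epsilon>: "\<epsilon> > 0"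
  shows "eventually (\<lambda>T. \<forall>\<beta>. tri_avg h \<beta> (\<lambda>\<alpha>. form_factor \<alpha> T) \<le> h + h ^ 3 / 3 + \<epsilon>) at_top"
    and "eventually (\<lambda>T. \<forall>\<beta>. h * (2 * h - 1 - h\<^sup>2 / 3) - \<epsilon> \<le> tri_avg h \<beta> (\<lambda>\<alpha>. form_factor \<alpha> T)) at_top"
proof -
  define J where "J T = integral {0..h * ln T} (\<lambda>y. (norm (zero_sum T y))\<^sup>2 * (1 - y / (h * ln T)))" for T
  have up: "2 * pi / (T * ln T) * (2 * h / ln T * J T) \<le> h + h ^ 3 / 3 + e"
    if "J T \<le> (1 + h\<^sup>2 / 3 + e) * (T * (ln T)\<^sup>2 / (4 * pi))" "T > 1" "e > 0" for T e
  proof -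
    have L: "ln T > 0" using that by simp
    have "2 * pi / (T * ln T) * (2 * h / ln T * J T) \<le> 2 * pi / (T * ln T) * (2 * h / ln T * ((1 + h\<^sup>2 / 3 + e) * (T * (ln T)\<^sup>2 / (4 * pi))))"
      using that h L by (intro mult_left_mono) auto
    also have "\<dots> = h * (1 + h\<^sup>2 / 3 + e)" using L that by (simp add: power2_eq_square)
    also have "\<dots> = h + h ^ 3 / 3 + h * e" by (simp add: algebra_simps power2_eq_square power3_eq_cube)
    also have "\<dots> \<le> h + h ^ 3 / 3 + e" using h that by (simp add: mult_le_cancel_right1)
    finally show ?thesis .
  qed
  show "eventually (\<lambda>T. \<forall>\<beta>. tri_avg h \<beta> (\<lambda>\<alpha>. form_factor \<alpha> T) \<le> h + h ^ 3 / 3 + \<epsilon>) at_top"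
    using zero_sum_mean_square[OF RH h \<epsilon>] eventually_gt_at_top[of 1]
  proof eventually_elim
    case (elim T)
    have "2 * pi / (T * ln T) * (2 * h / ln T * J T) \<le> h + h ^ 3 / 3 + \<epsilon>"
      by (rule up) (use elim \<epsilon> in \<open>auto simp: J_def\<close>)
    then show ?case
      using tri_avg_form_factor_bounds(1)[OF elim(2) h(1), folded J_def] by (blast intro: order_trans)
  qed
  \<comment> \<open>The zero count loses 2 h^2 \<delta> <= 2\<delta> and the mean square loses
    \<delta>, together 3\<delta> < \<epsilon>.\<close>
  define \<delta> where "\<delta> = \<epsilon> / 4"
  have \<delta>: "\<delta> > 0" using \<epsilon> by (simp add: \<delta>_def)
  show "eventually (\<lambda>T. \<forall>\<beta>. h * (2 * h - 1 - h\<^sup>2 / 3) - \<epsilon> \<le> tri_avg h \<beta> (\<lambda>\<alpha>. form_factor \<alpha> T)) at_top"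
    using zero_sum_mean_square[OF RH h \<delta>] zero_count_lower_bound[OF RH \<delta>] eventually_gt_at_top[of 1]
  proof eventually_elim
    case (elim T)
    define N where "N = (\<Sum>\<rho>\<in>zeros_upto T. real (zero_mult \<rho>))"
    have L: "ln T > 0" using elim by simp
    have "2 * h\<^sup>2 * (1 - \<delta>) = 2 * pi / (T * ln T) * (2 * h\<^sup>2 * ((1 - \<delta>) * (T * ln T / (2 * pi))))"
      using L elim by simp
    also have "\<dots> \<le> 2 * pi / (T * ln T) * (2 * h\<^sup>2 * N)"
      unfolding N_def using L elim by (intro mult_left_mono) auto
    finally have 1: "2 * h\<^sup>2 * (1 - \<delta>) \<le> 2 * pi / (T * ln T) * (2 * h\<^sup>2 * N)" .
    have 2: "2 * pi / (T * ln T) * (2 * h / ln T * J T) \<le> h + h ^ 3 / 3 + \<delta>"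
      by (rule up) (use elim \<delta> in \<open>auto simp: J_def\<close>)
    have "2 * h\<^sup>2 * \<delta> \<le> 2 * \<delta>" using h \<delta> power_le_one[of h 2] by simp
    then have "h * (2 * h - 1 - h\<^sup>2 / 3) - \<epsilon> \<le> 2 * h\<^sup>2 * (1 - \<delta>) - (h + h ^ 3 / 3 + \<delta>)"
      using \<epsilon> by (simp add: \<delta>_def algebra_simps power2_eq_square power3_eq_cube)
    also have "\<dots> \<le> 2 * pi / (T * ln T) * (2 * h\<^sup>2 * N) - 2 * pi / (T * ln T) * (2 * h / ln T * J T)" using 1 2 by (rule diff_mono)
    also have "\<dots> = 2 * pi / (T * ln T) * (2 * h\<^sup>2 * N - 2 * h / ln T * J T)" by (simp only: right_diff_distrib)
    finally show ?case
      using tri_avg_form_factor_bounds(2)[OF elim(3) h(1), folded J_def N_def] by (blast intro: order_trans)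
  qed
qed

text \<open>On [-1, 1] the unit triangle exceeds the one of height h by at most 1 - h. Two triangles
  of height 3/4 centred at -1/2 and 1/2 are together at least 1/4 on [-1, 1], so four times their
  sum absorbs this excess; their height is below 1, where averages are already bounded.\<close>

lemma tri_avg_1_bounds:
  assumes G: "continuous_on UNIV G" "\<And>\<alpha>. G \<alpha> \<ge> 0" and h: "0 \<le> h" "h \<le> 1"
  shows "tri_avg h \<beta> G \<le> tri_avg 1 \<beta> G"
    and "tri_avg 1 \<beta> G \<le> tri_avg h \<beta> G + (1 - h) * (4 * tri_avg (3/4) (\<beta> - 1/2) G + 4 * tri_avg (3/4) (\<beta> + 1/2) G)"
proof -
  show "tri_avg h \<beta> G \<le> tri_avg 1 \<beta> G"
    by (rule has_integral_le[OF has_integral_tri[OF G(1)] has_integral_tri[OF G(1)]])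
       (use G(2) h in \<open>auto simp: tri_def intro!: mult_right_mono\<close>)
  have "((\<lambda>\<alpha>. tri h (\<alpha> - \<beta>) * G \<alpha> + (1 - h) * (4 * (tri (3/4) (\<alpha> - (\<beta> - 1/2)) * G \<alpha>) + 4 * (tri (3/4) (\<alpha> - (\<beta> + 1/2)) * G \<alpha>))) has_integral
      tri_avg h \<beta> G + (1 - h) * (4 * tri_avg (3/4) (\<beta> - 1/2) G + 4 * tri_avg (3/4) (\<beta> + 1/2) G)) UNIV"
    by (intro has_integral_add has_integral_mult_right has_integral_tri G)
  then show "tri_avg 1 \<beta> G \<le> tri_avg h \<beta> G + (1 - h) * (4 * tri_avg (3/4) (\<beta> - 1/2) G + 4 * tri_avg (3/4) (\<beta> + 1/2) G)"
  proof (rule has_integral_le[OF has_integral_tri[OF G(1)]])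
    fix \<alpha>
    define u where "u = \<alpha> - \<beta>"
    define v where "v = 4 * tri (3/4) (u + 1/2) + 4 * tri (3/4) (u - 1/2)"
    have v0: "v \<ge> 0" by (simp add: v_def tri_def)
    have v1: "v \<ge> 1" if "\<bar>u\<bar> \<le> 1" using that by (auto simp: v_def tri_def abs_if max_def split: if_splits)
    have "tri 1 u \<le> tri h u + (1 - h) * v"
    proof (cases "\<bar>u\<bar> \<le> 1")
      case True
      have "tri 1 u \<le> tri h u + (1 - h)" using h by (auto simp: tri_def)
      also have "\<dots> \<le> tri h u + (1 - h) * v" using v1[OF True] h mult_left_mono[of 1 v "1 - h"] by simp
      finally show ?thesis .
    next
      case False
      then have "tri 1 u = 0" by (simp add: tri_def)
      then show ?thesis using v0 h by (simp add: tri_def)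
    qed
    then have "tri 1 u * G \<alpha> \<le> (tri h u + (1 - h) * v) * G \<alpha>" using G(2) by (rule mult_right_mono)
    moreover have "\<alpha> - (\<beta> - 1/2) = u + 1/2" "\<alpha> - (\<beta> + 1/2) = u - 1/2" by (simp_all add: u_def)
    ultimately show "tri 1 (\<alpha> - \<beta>) * G \<alpha> \<le> tri h (\<alpha> - \<beta>) * G \<alpha> + (1 - h) * (4 * (tri (3/4) (\<alpha> - (\<beta> - 1/2)) * G \<alpha>) + 4 * (tri (3/4) (\<alpha> - (\<beta> + 1/2)) * G \<alpha>))"
      by (simp only: u_def[symmetric] v_def distrib_right distrib_left mult.assoc)
  qed
qed

theorem triangle_averages_form_factor:
  assumes RH: "riemann_hypothesis"
  shows "triangle_averages (\<lambda>T \<alpha>. form_factor \<alpha> T)"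
proof
  show "continuous_on UNIV (\<lambda>\<alpha>. form_factor \<alpha> T)" for T by (rule continuous_on_form_factor)
  show "T > 1 \<Longrightarrow> form_factor \<alpha> T \<ge> 0" for T \<alpha> by (rule form_factor_nonneg)
  fix h \<epsilon> :: real assume h: "0 < h" "h \<le> 1" and \<epsilon>: "\<epsilon> > 0"
  \<comment> \<open>The correction factor in \<open>tri_avg_1_bounds\<close> is eventually at most 4
    * 2 + 4 * 2 = 16, so replacing height 1 by 1 - d costs at most 16 d <= \<epsilon>/4. In the
    lower bound the loss is at most 2d.\<close>
  define d where "d = min (1/2) (\<epsilon> / 64)"
  have d: "0 < d" "d \<le> 1/2" "64 * d \<le> \<epsilon>" using \<epsilon> by (auto simp: d_def)
  have h': "0 < 1 - d" "1 - d < 1" using d by auto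
  have \<epsilon>2: "\<epsilon> / 2 > 0" using \<epsilon> by simp
  note less1 = eventually_tri_avg_form_factor_less_1[OF RH]
  show "eventually (\<lambda>T. \<forall>\<beta>. tri_avg h \<beta> (\<lambda>\<alpha>. form_factor \<alpha> T) \<le> h + h ^ 3 / 3 + \<epsilon>) at_top"
  proof (cases "h < 1")
    case True
    show ?thesis by (rule less1(1)[OF h(1) True \<epsilon>])
  next
    case False
    then have h1: "h = 1" using h by simp
    have "eventually (\<lambda>T. \<forall>\<beta>. tri_avg (3/4) \<beta> (\<lambda>\<alpha>. form_factor \<alpha> T) \<le> 3/4 + (3/4) ^ 3 / 3 + 1) at_top"
      by (rule less1(1)) auto
    then show ?thesis using less1(1)[OF h' \<epsilon>2] eventually_gt_at_top[of 1]
    proof eventually_elim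
      case (elim T)
      show ?case
      proof
        fix \<beta>
        have q: "4 * tri_avg (3/4) (\<beta> - 1/2) (\<lambda>\<alpha>. form_factor \<alpha> T) + 4 * tri_avg (3/4) (\<beta> + 1/2) (\<lambda>\<alpha>. form_factor \<alpha> T) \<le> 16"
        proof -
          have "tri_avg (3/4) \<gamma> (\<lambda>\<alpha>. form_factor \<alpha> T) \<le> 2" for \<gamma>
            using elim(1)[rule_format, of \<gamma>] by (simp add: power3_eq_cube)
          from this[of "\<beta> - 1/2"] this[of "\<beta> + 1/2"] show ?thesis by linarith
        qed
        have "tri_avg 1 \<beta> (\<lambda>\<alpha>. form_factor \<alpha> T) \<le> tri_avg (1 - d) \<beta> (\<lambda>\<alpha>. form_factor \<alpha> T) +
            (1 - (1 - d)) * (4 * tri_avg (3/4) (\<beta> - 1/2) (\<lambda>\<alpha>. form_factor \<alpha> T) + 4 * tri_avg (3/4) (\<beta> + 1/2) (\<lambda>\<alpha>. form_factor \<alpha> T))"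
          using h' elim(3) by (intro tri_avg_1_bounds(2) continuous_on_form_factor form_factor_nonneg) auto
        also have "\<dots> \<le> ((1 - d) + (1 - d) ^ 3 / 3 + \<epsilon> / 2) + (1 - (1 - d)) * 16"
          using elim(2) q d by (intro add_mono mult_left_mono) auto
        also have "\<dots> \<le> 1 + 1 / 3 + \<epsilon> / 2 + 16 * d"
        proof -
          have "(1 - d) ^ 3 \<le> 1" using h' by (intro power_le_one) auto
          then show ?thesis using d by simp
        qed
        also have "\<dots> \<le> 1 + 1 / 3 + \<epsilon>" using d \<epsilon> by linarith
        finally show "tri_avg h \<beta> (\<lambda>\<alpha>. form_factor \<alpha> T) \<le> h + h ^ 3 / 3 + \<epsilon>" by (simp add: h1)
      qed
    qed
  qed
  show "eventually (\<lambda>T. \<forall>\<beta>. h * (2 * h - 1 - h\<^sup>2 / 3) - \<epsilon> \<le> tri_avg h \<beta> (\<lambda>\<alpha>. form_factor \<alpha> T)) at_top"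
  proof (cases "h < 1")
    case True
    show ?thesis by (rule less1(2)[OF h(1) True \<epsilon>])
  next
    case False
    then have h1: "h = 1" using h by simp
    show ?thesis using less1(2)[OF h' \<epsilon>2] eventually_gt_at_top[of 1]
    proof eventually_elim
      case (elim T)
      show ?case
      proof
        fix \<beta>
        have "(1 - d) * (2 * (1 - d) - 1 - (1 - d)\<^sup>2 / 3) = 2/3 - 2 * d + d\<^sup>2 + d ^ 3 / 3"
          by (simp add: power2_eq_square power3_eq_cube field_simps)
        then have "2/3 - \<epsilon> \<le> (1 - d) * (2 * (1 - d) - 1 - (1 - d)\<^sup>2 / 3) - \<epsilon> / 2"
          using d \<epsilon> zero_le_power2[of d] zero_le_power[of d 3] by linarith
        also have "\<dots> \<le> tri_avg (1 - d) \<beta> (\<lambda>\<alpha>. form_factor \<alpha> T)" using elim(1) by blast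
        also have "\<dots> \<le> tri_avg 1 \<beta> (\<lambda>\<alpha>. form_factor \<alpha> T)"
          using h' elim(2) by (intro tri_avg_1_bounds(1) continuous_on_form_factor form_factor_nonneg) auto
        finally show "h * (2 * h - 1 - h\<^sup>2 / 3) - \<epsilon> \<le> tri_avg h \<beta> (\<lambda>\<alpha>. form_factor \<alpha> T)" by (simp add: h1)
      qed
    qed
  qed
qed

theorem theorem9:
  fixes b l :: real
  assumes "riemann_hypothesis" and "b \<ge> 1" and "l > 0"
  shows "ereal (C_minus l) \<le> Liminf at_top (\<lambda>T. ereal (integral {b..b + l} (\<lambda>\<alpha>. form_factor \<alpha> T)))
       \<and> Limsup at_top (\<lambda>T. ereal (integral {b..b + l} (\<lambda>\<alpha>. form_factor \<alpha> T))) \<le> ereal (C_plus l)"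
  using triangle_averages.Liminf_Limsup_bounds[OF triangle_averages_form_factor[OF assms(1)] assms(3)] by blast

end
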